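(* The satisfiability problem for $\mathcal{GC}^2\mathcal{D}$ is in $\textsc{ExpTime}$: there is a deterministic algorithm which, given a $\mathcal{GC}^2\mathcal{D}$-sentence $\psi$, decides in time bounded by an exponential function of $\|\psi\|$ whether $\psi$ has a (possibly infinite) model.
   Context: Signatures consist of individual constants and predicates of arity 1 or 2 (no function symbols). Unique names assumption: distinct individual constants denote distinct elements. Some binary predicates may be designated key predicates, which in every structure must be interpreted as graphs of total functions without fixed points. The logic $\mathcal{GC}^2$ uses only the variables $x,y$ and is the smallest set of formulas such that: unary or binary literals with all arguments in $\{x,y\}$ are formulas (equality allowed); formulas are closed under Boolean combinations; if $\phi$ has at most one free variable and $u\in\{x,y\}$, then $\forall u.\phi$ and $\exists u.\phi$ are formulas; if $\phi$ is a formula, $\alpha$ a guard (an atom $p(x,y)$ or $p(y,x)$), $u\in\{x,y\}$ and $C\ge0$ an integer written in binary, then $\exists_{\le C}u(\alpha\wedge\phi)$, $\exists_{\ge C}u(\alpha\wedge\phi)$, $\exists_{=C}u(\alpha\wedge\phi)$ are formulas (counting semantics). $\mathcal{GC}^2\mathcal{D}$ is defined likewise with the additional rule that ground (constant-only) unary or binary literals are formulas; atoms mixing variables and constants are not allowed. $\|\psi\|$ is the number of symbols of $\psi$. *)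

theory Defs
  imports "HOL-Computational_Algebra.Polynomial"
begin

section \<open>Deterministic Turing machines and exponential time\<close>

text \<open>
  Deterministic machines with finitely many two-way infinite tapes. Inputs are words over a
  finite alphabet \<open>'a\<close>; the tape alphabet consists of the blank, the input letters and
  finitely many further letters \<open>Work i\<close>.
\<close>

datatype 'a cell = Blank | Inp 'a | Work nat

datatype move = MoveL | Stay | MoveR

record 'a tm =
  num_tapes :: nat
  num_states :: nat
  num_work :: nat
  accept :: nat
  reject :: nat
  trans :: "nat \<Rightarrow> 'a cell list \<Rightarrow> nat \<times> ('a cell \<times> move) list"

definition tape_letters :: "'a tm \<Rightarrow> 'a cell set" where
  "tape_letters M = insert Blank (range Inp \<union> Work ` {..<num_work M})"

text \<open>
  Only the values of the transition function on the finitely many admissible arguments matter: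
  admissible configurations are closed under steps. The initial state is \<open>0\<close>.
\<close>

definition turing_machine :: "('a::finite) tm \<Rightarrow> bool" where
  "turing_machine M \<longleftrightarrow>
     0 < num_tapes M \<and> 0 < num_states M \<and>
     accept M < num_states M \<and> reject M < num_states M \<and> accept M \<noteq> reject M \<and>
     (\<forall>q < num_states M. \<forall>ss. length ss = num_tapes M \<longrightarrow> set ss \<subseteq> tape_letters M \<longrightarrow>
        (case trans M q ss of (q', acts) \<Rightarrow>
           q' < num_states M \<and> length acts = num_tapes M \<and> fst ` set acts \<subseteq> tape_letters M))"

text \<open>A tape is its contents together with the position of its head.\<close>

type_synonym 'a tape = "(int \<Rightarrow> 'a cell) \<times> int"

type_synonym 'a config = "nat \<times> 'a tape list"

fun read_tape :: "'a tape \<Rightarrow> 'a cell" where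
  "read_tape (f, h) = f h"

fun offset :: "move \<Rightarrow> int" where
  "offset MoveL = -1"
| "offset Stay = 0"
| "offset MoveR = 1"

fun act_tape :: "'a cell \<times> move \<Rightarrow> 'a tape \<Rightarrow> 'a tape" where
  "act_tape (s, d) (f, h) = (f(h := s), h + offset d)"

fun tm_step :: "'a tm \<Rightarrow> 'a config \<Rightarrow> 'a config" where
  "tm_step M (q, ts) =
     (if q = accept M \<or> q = reject M then (q, ts)
      else (case trans M q (map read_tape ts) of (q', acts) \<Rightarrow> (q', map2 act_tape acts ts)))"

definition input_tape :: "'a list \<Rightarrow> 'a tape" where
  "input_tape w =
     ((\<lambda>i. if 0 \<le> i \<and> i < int (length w) then Inp (w ! nat i) else Blank), 0)"

definition init_config :: "'a tm \<Rightarrow> 'a list \<Rightarrow> 'a config" where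
  "init_config M w = (0, input_tape w # replicate (num_tapes M - 1) (input_tape []))"

text \<open>Accepting and rejecting configurations are fixed points of \<^const>\<open>tm_step\<close>.\<close>

definition decides_in_time :: "('a::finite) tm \<Rightarrow> 'a list set \<Rightarrow> (nat \<Rightarrow> nat) \<Rightarrow> bool" where
  "decides_in_time M L T \<longleftrightarrow>
     (\<forall>w. \<exists>t \<le> T (length w).
        fst ((tm_step M ^^ t) (init_config M w)) = (if w \<in> L then accept M else reject M))"

definition EXPTIME :: "('a::finite) list set set" where
  "EXPTIME = {L. \<exists>M (p :: nat poly). turing_machine M \<and> decides_in_time M L (\<lambda>n. 2 ^ poly p n)}"


section \<open>Two-variable formulas with counting\<close>

datatype var = X | Y

text \<open>
  Individual constants and unary predicates are identified by numbers. Whether a binary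
  predicate is designated a key predicate is part of its name.
\<close>

datatype tm_arg = Var var | Const nat

datatype bpred = Plain nat | Key nat

datatype comparison = AtMost | AtLeast | Exactly

datatype form =
    Unary nat tm_arg
  | Binary bpred tm_arg tm_arg
  | Equal tm_arg tm_arg
  | Neg form
  | Conj form form
  | Disj form form
  | Impl form form
  | Iff form form
  | All var form
  | Ex var form
  | Count comparison nat var form

fun vars_arg :: "tm_arg \<Rightarrow> var set" where
  "vars_arg (Var v) = {v}"
| "vars_arg (Const c) = {}"

fun constants_arg :: "tm_arg \<Rightarrow> nat set" where
  "constants_arg (Var v) = {}"
| "constants_arg (Const c) = {c}"

primrec free_vars :: "form \<Rightarrow> var set" where
  "free_vars (Unary p s) = vars_arg s"
| "free_vars (Binary p s t) = vars_arg s \<union> vars_arg t"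
| "free_vars (Equal s t) = vars_arg s \<union> vars_arg t"
| "free_vars (Neg \<phi>) = free_vars \<phi>"
| "free_vars (Conj \<phi> \<psi>) = free_vars \<phi> \<union> free_vars \<psi>"
| "free_vars (Disj \<phi> \<psi>) = free_vars \<phi> \<union> free_vars \<psi>"
| "free_vars (Impl \<phi> \<psi>) = free_vars \<phi> \<union> free_vars \<psi>"
| "free_vars (Iff \<phi> \<psi>) = free_vars \<phi> \<union> free_vars \<psi>"
| "free_vars (All u \<phi>) = free_vars \<phi> - {u}"
| "free_vars (Ex u \<phi>) = free_vars \<phi> - {u}"
| "free_vars (Count k C u \<phi>) = free_vars \<phi> - {u}"

primrec constants :: "form \<Rightarrow> nat set" where
  "constants (Unary p s) = constants_arg s"
| "constants (Binary p s t) = constants_arg s \<union> constants_arg t"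
| "constants (Equal s t) = constants_arg s \<union> constants_arg t"
| "constants (Neg \<phi>) = constants \<phi>"
| "constants (Conj \<phi> \<psi>) = constants \<phi> \<union> constants \<psi>"
| "constants (Disj \<phi> \<psi>) = constants \<phi> \<union> constants \<psi>"
| "constants (Impl \<phi> \<psi>) = constants \<phi> \<union> constants \<psi>"
| "constants (Iff \<phi> \<psi>) = constants \<phi> \<union> constants \<psi>"
| "constants (All u \<phi>) = constants \<phi>"
| "constants (Ex u \<phi>) = constants \<phi>"
| "constants (Count k C u \<phi>) = constants \<phi>"

primrec bpreds :: "form \<Rightarrow> bpred set" where
  "bpreds (Unary p s) = {}"
| "bpreds (Binary p s t) = {p}"
| "bpreds (Equal s t) = {}"
| "bpreds (Neg \<phi>) = bpreds \<phi>"
| "bpreds (Conj \<phi> \<psi>) = bpreds \<phi> \<union> bpreds \<psi>"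
| "bpreds (Disj \<phi> \<psi>) = bpreds \<phi> \<union> bpreds \<psi>"
| "bpreds (Impl \<phi> \<psi>) = bpreds \<phi> \<union> bpreds \<psi>"
| "bpreds (Iff \<phi> \<psi>) = bpreds \<phi> \<union> bpreds \<psi>"
| "bpreds (All u \<phi>) = bpreds \<phi>"
| "bpreds (Ex u \<phi>) = bpreds \<phi>"
| "bpreds (Count k C u \<phi>) = bpreds \<phi>"

text \<open>
  The fragment \<open>GC\<^sup>2D\<close>; dropping the rules whose names start with \<open>ground\<close>
  gives \<open>GC\<^sup>2\<close>. Negative literals arise by rule \<open>neg\<close>. Equality is a literal
  but not a guard.
\<close>

inductive_set GC2D :: "form set" where
  un: "Unary p (Var u) \<in> GC2D"
| bin: "Binary p (Var u) (Var v) \<in> GC2D"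
| eq: "Equal (Var u) (Var v) \<in> GC2D"
| ground_un: "Unary p (Const c) \<in> GC2D"
| ground_bin: "Binary p (Const c) (Const d) \<in> GC2D"
| ground_eq: "Equal (Const c) (Const d) \<in> GC2D"
| neg: "\<phi> \<in> GC2D \<Longrightarrow> Neg \<phi> \<in> GC2D"
| conj: "\<phi> \<in> GC2D \<Longrightarrow> \<psi> \<in> GC2D \<Longrightarrow> Conj \<phi> \<psi> \<in> GC2D"
| disj: "\<phi> \<in> GC2D \<Longrightarrow> \<psi> \<in> GC2D \<Longrightarrow> Disj \<phi> \<psi> \<in> GC2D"
| impl: "\<phi> \<in> GC2D \<Longrightarrow> \<psi> \<in> GC2D \<Longrightarrow> Impl \<phi> \<psi> \<in> GC2D"
| iff: "\<phi> \<in> GC2D \<Longrightarrow> \<psi> \<in> GC2D \<Longrightarrow> Iff \<phi> \<psi> \<in> GC2D"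
| all: "\<phi> \<in> GC2D \<Longrightarrow> card (free_vars \<phi>) \<le> 1 \<Longrightarrow> All u \<phi> \<in> GC2D"
| ex: "\<phi> \<in> GC2D \<Longrightarrow> card (free_vars \<phi>) \<le> 1 \<Longrightarrow> Ex u \<phi> \<in> GC2D"
| count: "\<phi> \<in> GC2D \<Longrightarrow> v \<noteq> w \<Longrightarrow> Count k C u (Conj (Binary p (Var v) (Var w)) \<phi>) \<in> GC2D"

definition GC2D_sentences :: "form set" where
  "GC2D_sentences = {\<psi> \<in> GC2D. free_vars \<psi> = {}}"


section \<open>Models\<close>

record 'd struct =
  dom :: "'d set"
  unI :: "nat \<Rightarrow> 'd set"
  binI :: "bpred \<Rightarrow> ('d \<times> 'd) set"
  constI :: "nat \<Rightarrow> 'd"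

text \<open>
  Structures for the signature of \<open>\<psi>\<close>. The unique names assumption and the requirement on
  key predicates concern only the symbols occurring in \<open>\<psi>\<close>; imposing unique names on all
  numbers would exclude finite models.
\<close>

definition structure_for :: "form \<Rightarrow> 'd struct \<Rightarrow> bool" where
  "structure_for \<psi> S \<longleftrightarrow>
     dom S \<noteq> {} \<and>
     (\<forall>p. unI S p \<subseteq> dom S) \<and>
     (\<forall>p. binI S p \<subseteq> dom S \<times> dom S) \<and>
     constI S ` constants \<psi> \<subseteq> dom S \<and>
     inj_on (constI S) (constants \<psi>) \<and>
     (\<forall>n. Key n \<in> bpreds \<psi> \<longrightarrow>
        (\<forall>a \<in> dom S. (\<exists>!b. (a, b) \<in> binI S (Key n)) \<and> (a, a) \<notin> binI S (Key n)))"

fun val :: "'d struct \<Rightarrow> (var \<Rightarrow> 'd) \<Rightarrow> tm_arg \<Rightarrow> 'd" where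
  "val S e (Var v) = e v"
| "val S e (Const c) = constI S c"

fun counts :: "comparison \<Rightarrow> nat \<Rightarrow> 'd set \<Rightarrow> bool" where
  "counts AtMost C W \<longleftrightarrow> finite W \<and> card W \<le> C"
| "counts AtLeast C W \<longleftrightarrow> infinite W \<or> C \<le> card W"
| "counts Exactly C W \<longleftrightarrow> finite W \<and> card W = C"

primrec sat :: "'d struct \<Rightarrow> (var \<Rightarrow> 'd) \<Rightarrow> form \<Rightarrow> bool" where
  "sat S e (Unary p s) \<longleftrightarrow> val S e s \<in> unI S p"
| "sat S e (Binary p s t) \<longleftrightarrow> (val S e s, val S e t) \<in> binI S p"
| "sat S e (Equal s t) \<longleftrightarrow> val S e s = val S e t"
| "sat S e (Neg \<phi>) \<longleftrightarrow> \<not> sat S e \<phi>"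
| "sat S e (Conj \<phi> \<psi>) \<longleftrightarrow> sat S e \<phi> \<and> sat S e \<psi>"
| "sat S e (Disj \<phi> \<psi>) \<longleftrightarrow> sat S e \<phi> \<or> sat S e \<psi>"
| "sat S e (Impl \<phi> \<psi>) \<longleftrightarrow> (sat S e \<phi> \<longrightarrow> sat S e \<psi>)"
| "sat S e (Iff \<phi> \<psi>) \<longleftrightarrow> (sat S e \<phi> \<longleftrightarrow> sat S e \<psi>)"
| "sat S e (All u \<phi>) \<longleftrightarrow> (\<forall>a \<in> dom S. sat S (e(u := a)) \<phi>)"
| "sat S e (Ex u \<phi>) \<longleftrightarrow> (\<exists>a \<in> dom S. sat S (e(u := a)) \<phi>)"
| "sat S e (Count k C u \<phi>) \<longleftrightarrow> counts k C {a \<in> dom S. sat S (e(u := a)) \<phi>}"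

definition is_model :: "'d struct \<Rightarrow> form \<Rightarrow> bool" where
  "is_model S \<psi> \<longleftrightarrow> structure_for \<psi> S \<and> (\<forall>e. range e \<subseteq> dom S \<longrightarrow> sat S e \<psi>)"

text \<open>
  Having a (finite or infinite) model whose domain is a nonempty subset of the type \<open>'d\<close>.
  Since types cannot be quantified inside a formula, having a model of arbitrary cardinality is
  expressed by \<open>satisfiable_over TYPE(nat)\<close> together with the fact, to be stated for an
  arbitrary type \<open>'d\<close>, that a model over \<open>'d\<close> entails a model over the
  natural numbers.
\<close>

definition satisfiable_over :: "'d itself \<Rightarrow> form \<Rightarrow> bool" where
  "satisfiable_over _ \<psi> \<longleftrightarrow> (\<exists>S :: 'd struct. is_model S \<psi>)"


section \<open>Formulas as words\<close>

text \<open>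
  Formulas are written in prefix notation over a finite alphabet, with bounds \<open>C\<close> and the
  indices of names in binary, most significant digit first. The size of a formula is the
  length of this word.
\<close>

datatype token =
    TX | TY | TConst | TUn | TPlain | TKey | TEq
  | TNeg | TConj | TDisj | TImpl | TIff | TAll | TEx
  | TAtMost | TAtLeast | TExactly | T0 | T1

instance token :: finite
proof
  have "(UNIV :: token set) \<subseteq>
      {TX, TY, TConst, TUn, TPlain, TKey, TEq, TNeg, TConj, TDisj, TImpl, TIff, TAll, TEx,
       TAtMost, TAtLeast, TExactly, T0, T1}"
    using token.exhaust by blast
  then show "finite (UNIV :: token set)"
    by (rule finite_subset) simp
qed

fun binary :: "nat \<Rightarrow> token list" where
  "binary n = (if n < 2 then [] else binary (n div 2)) @ [if even n then T0 else T1]"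

declare binary.simps [simp del]

fun word_var :: "var \<Rightarrow> token" where
  "word_var X = TX"
| "word_var Y = TY"

fun word_arg :: "tm_arg \<Rightarrow> token list" where
  "word_arg (Var v) = [word_var v]"
| "word_arg (Const c) = TConst # binary c"

fun word_bpred :: "bpred \<Rightarrow> token list" where
  "word_bpred (Plain n) = TPlain # binary n"
| "word_bpred (Key n) = TKey # binary n"

fun word_comparison :: "comparison \<Rightarrow> token" where
  "word_comparison AtMost = TAtMost"
| "word_comparison AtLeast = TAtLeast"
| "word_comparison Exactly = TExactly"

primrec word :: "form \<Rightarrow> token list" where
  "word (Unary p s) = TUn # binary p @ word_arg s"
| "word (Binary p s t) = word_bpred p @ word_arg s @ word_arg t"
| "word (Equal s t) = TEq # word_arg s @ word_arg t"
| "word (Neg \<phi>) = TNeg # word \<phi>"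
| "word (Conj \<phi> \<psi>) = TConj # word \<phi> @ word \<psi>"
| "word (Disj \<phi> \<psi>) = TDisj # word \<phi> @ word \<psi>"
| "word (Impl \<phi> \<psi>) = TImpl # word \<phi> @ word \<psi>"
| "word (Iff \<phi> \<psi>) = TIff # word \<phi> @ word \<psi>"
| "word (All u \<phi>) = TAll # word_var u # word \<phi>"
| "word (Ex u \<phi>) = TEx # word_var u # word \<phi>"
| "word (Count k C u \<phi>) = word_comparison k # binary C @ word_var u # word \<phi>"

text \<open>Unique readability.\<close>

abbreviation no_digit :: "token list \<Rightarrow> bool" where
  "no_digit w \<equiv> w = [] \<or> hd w \<notin> {T0, T1}"

lemma binary_digits: "set (binary n) \<subseteq> {T0, T1}"
  by (induction n rule: binary.induct) (subst binary.simps, auto)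

lemma binary_inject: "binary m = binary n \<Longrightarrow> m = n"
proof -
  define digit where "digit = (\<lambda>t. if t = T1 then 1 else (0::nat))"
  have "foldl (\<lambda>a t. 2 * a + digit t) 0 (binary n) = n" for n
  proof (induction n rule: binary.induct)
    case (1 n)
    then show ?case
      by (subst binary.simps) (auto simp: digit_def less_2_cases_iff elim: oddE)
  qed
  then show "binary m = binary n \<Longrightarrow> m = n" by metis
qed

lemma binary_append:
  assumes "binary m @ w = binary n @ v" "no_digit w" "no_digit v"
  shows "m = n \<and> w = v"
proof -
  let ?P = "\<lambda>t. t \<in> {T0, T1}"
  have tw: "takeWhile ?P (binary n @ w) = binary n" if "no_digit w" for n w
  proof -
    have "takeWhile ?P (binary n @ w) = binary n @ takeWhile ?P w"
      using binary_digits[of n] by (intro takeWhile_append2) auto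
    also have "takeWhile ?P w = []"
      using that by (cases w) auto
    finally show ?thesis by simp
  qed
  have "binary m = binary n"
    using tw[of w m] tw[of v n] assms by simp
  then show ?thesis using assms binary_inject by auto
qed

lemma word_var_eq: "t = word_var u \<longleftrightarrow> u = X \<and> t = TX \<or> u = Y \<and> t = TY"
  by (cases u) auto

lemma word_comparison_eq:
  "t = word_comparison k \<longleftrightarrow>
     k = AtMost \<and> t = TAtMost \<or> k = AtLeast \<and> t = TAtLeast \<or> k = Exactly \<and> t = TExactly"
  by (cases k) auto

lemma word_bpred_eq:
  "t # z = word_bpred p @ w \<longleftrightarrow>
     (\<exists>n. p = Plain n \<and> t = TPlain \<and> z = binary n @ w) \<or>
     (\<exists>n. p = Key n \<and> t = TKey \<and> z = binary n @ w)"
  by (cases p) auto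

lemma word_var_inject: "word_var u = word_var v \<Longrightarrow> u = v"
  by (cases u; cases v) auto

lemma word_var_no_digit: "word_var u \<noteq> T0" "word_var u \<noteq> T1"
  by (cases u; simp)+

lemma word_comparison_inject: "word_comparison j = word_comparison k \<Longrightarrow> j = k"
  by (cases j; cases k) auto

lemma word_arg_no_digit: "no_digit (word_arg s @ w)"
  by (cases s) (auto simp: word_var_no_digit)

lemma word_no_digit: "no_digit (word \<phi> @ w)"
proof (cases \<phi>)
  case (Binary p s t)
  then show ?thesis by (cases p) auto
next
  case (Count k C u \<phi>')
  then show ?thesis by (cases k) auto
qed auto

lemma word_arg_append:
  assumes "word_arg s @ w = word_arg t @ v" "no_digit w" "no_digit v"
  shows "s = t \<and> w = v"
proof (cases s)
  case (Var x)
  then show ?thesis using assms by (cases t; cases x) (auto simp: word_var_eq)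
next
  case (Const c)
  show ?thesis
  proof (cases t)
    case (Var y)
    then show ?thesis using assms Const by (cases y) auto
  next
    case (Const d)
    then show ?thesis using assms \<open>s = tm_arg.Const c\<close> binary_append[of c w d v] by auto
  qed
qed

lemma word_bpred_append:
  assumes "word_bpred p @ w = word_bpred q @ v" "no_digit w" "no_digit v"
  shows "p = q \<and> w = v"
  using assms by (cases p; cases q) (auto dest: binary_append binary_inject)

lemma word_append:
  "word \<phi> @ w = word \<psi> @ v \<Longrightarrow> no_digit w \<Longrightarrow> no_digit v \<Longrightarrow> \<phi> = \<psi> \<and> w = v"
proof (induction \<phi> arbitrary: \<psi> w v)
  case (Unary p s)
  obtain q t where \<psi>: "\<psi> = Unary q t"
    using Unary.prems(1)
    by (cases \<psi>) (auto simp: word_bpred_eq word_comparison_eq)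
  have "binary p @ (word_arg s @ w) = binary q @ (word_arg t @ v)"
    using Unary.prems(1) \<psi> by simp
  then have "p = q \<and> word_arg s @ w = word_arg t @ v"
    by (rule binary_append) (rule word_arg_no_digit)+
  then show ?case using word_arg_append Unary.prems \<psi> by blast
next
  case (Binary p s t)
  obtain p' s' t' where \<psi>: "\<psi> = Binary p' s' t'"
    using Binary.prems(1)
    by (cases \<psi>; cases p) (auto simp: word_comparison_eq)
  have "word_bpred p @ (word_arg s @ word_arg t @ w) = word_bpred p' @ (word_arg s' @ word_arg t' @ v)"
    using Binary.prems(1) \<psi> by simp
  then have 1: "p = p' \<and> word_arg s @ (word_arg t @ w) = word_arg s' @ (word_arg t' @ v)"
    by (rule word_bpred_append) (rule word_arg_no_digit)+
  then have "s = s' \<and> word_arg t @ w = word_arg t' @ v"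
    using word_arg_append word_arg_no_digit by blast
  then show ?case using word_arg_append Binary.prems \<psi> 1 by blast
next
  case (Equal s t)
  obtain s' t' where \<psi>: "\<psi> = Equal s' t'"
    using Equal.prems(1)
    by (cases \<psi>) (auto simp: word_bpred_eq word_comparison_eq)
  have "word_arg s @ (word_arg t @ w) = word_arg s' @ (word_arg t' @ v)"
    using Equal.prems(1) \<psi> by simp
  then have "s = s' \<and> word_arg t @ w = word_arg t' @ v"
    using word_arg_append word_arg_no_digit by blast
  then show ?case using word_arg_append Equal.prems \<psi> by blast
next
  case (Neg \<phi>)
  obtain \<phi>' where \<psi>: "\<psi> = Neg \<phi>'"
    using Neg.prems(1)
    by (cases \<psi>) (auto simp: word_bpred_eq word_comparison_eq)
  then show ?case using Neg.IH[of w \<phi>' v] Neg.prems by simp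
next
  case (Conj \<phi>1 \<phi>2)
  obtain \<psi>1 \<psi>2 where \<psi>: "\<psi> = Conj \<psi>1 \<psi>2"
    using Conj.prems(1)
    by (cases \<psi>) (auto simp: word_bpred_eq word_comparison_eq)
  have "\<phi>1 = \<psi>1 \<and> word \<phi>2 @ w = word \<psi>2 @ v"
    using Conj.prems(1) \<psi> by (intro Conj.IH(1) word_no_digit) simp
  then show ?case using Conj.IH(2) Conj.prems \<psi> by blast
next
  case (Disj \<phi>1 \<phi>2)
  obtain \<psi>1 \<psi>2 where \<psi>: "\<psi> = Disj \<psi>1 \<psi>2"
    using Disj.prems(1)
    by (cases \<psi>) (auto simp: word_bpred_eq word_comparison_eq)
  have "\<phi>1 = \<psi>1 \<and> word \<phi>2 @ w = word \<psi>2 @ v"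
    using Disj.prems(1) \<psi> by (intro Disj.IH(1) word_no_digit) simp
  then show ?case using Disj.IH(2) Disj.prems \<psi> by blast
next
  case (Impl \<phi>1 \<phi>2)
  obtain \<psi>1 \<psi>2 where \<psi>: "\<psi> = Impl \<psi>1 \<psi>2"
    using Impl.prems(1)
    by (cases \<psi>) (auto simp: word_bpred_eq word_comparison_eq)
  have "\<phi>1 = \<psi>1 \<and> word \<phi>2 @ w = word \<psi>2 @ v"
    using Impl.prems(1) \<psi> by (intro Impl.IH(1) word_no_digit) simp
  then show ?case using Impl.IH(2) Impl.prems \<psi> by blast
next
  case (Iff \<phi>1 \<phi>2)
  obtain \<psi>1 \<psi>2 where \<psi>: "\<psi> = Iff \<psi>1 \<psi>2"
    using Iff.prems(1)
    by (cases \<psi>) (auto simp: word_bpred_eq word_comparison_eq)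
  have "\<phi>1 = \<psi>1 \<and> word \<phi>2 @ w = word \<psi>2 @ v"
    using Iff.prems(1) \<psi> by (intro Iff.IH(1) word_no_digit) simp
  then show ?case using Iff.IH(2) Iff.prems \<psi> by blast
next
  case (All u \<phi>)
  obtain u' \<phi>' where \<psi>: "\<psi> = All u' \<phi>'"
    using All.prems(1)
    by (cases \<psi>) (auto simp: word_bpred_eq word_comparison_eq)
  then show ?case using All.IH[of w \<phi>' v] All.prems word_var_inject by simp
next
  case (Ex u \<phi>)
  obtain u' \<phi>' where \<psi>: "\<psi> = Ex u' \<phi>'"
    using Ex.prems(1)
    by (cases \<psi>) (auto simp: word_bpred_eq word_comparison_eq)
  then show ?case using Ex.IH[of w \<phi>' v] Ex.prems word_var_inject by simp
next
  case (Count k C u \<phi>)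
  obtain k' C' u' \<phi>' where \<psi>: "\<psi> = Count k' C' u' \<phi>'"
    using Count.prems(1)
    by (cases \<psi>; cases k) (auto simp: word_bpred_eq)
  have "k = k'"
    using Count.prems(1) \<psi> word_comparison_inject by simp
  have "binary C @ (word_var u # word \<phi> @ w) = binary C' @ (word_var u' # word \<phi>' @ v)"
    using Count.prems(1) \<psi> by simp
  then have "C = C' \<and> word_var u # word \<phi> @ w = word_var u' # word \<phi>' @ v"
    by (rule binary_append) (simp_all add: word_var_no_digit)
  then show ?case
    using Count.IH[of w \<phi>' v] Count.prems(2,3) \<psi> word_var_inject \<open>k = k'\<close> by simp
qed

lemma inj_word: "inj word"
  by (rule injI) (metis word_append append_Nil2)


section \<open>The satisfiability problem\<close>

definition GC2D_SAT :: "'d itself \<Rightarrow> token list set" where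
  "GC2D_SAT D = word ` {\<psi> \<in> GC2D_sentences. satisfiable_over D \<psi>}"

end

theory Submission
  imports Defs "HOL-Library.Nat_Bijection"
begin

text \<open>
  A model of a guarded sentence can be unravelled into a forest whose roots include the named elements, because atoms never
  mix variables and constants. The type of a pair of elements records which subformulas hold of it;
  a forest model exists iff there are a parse of the input, types for all pairs of named elements, and
  witnesses for the global quantifiers such that each element can be given children. To find children
  one at a time, an element is paired with the vector of numbers of witnesses that its counters
  still lack; a state is impossible unless the vector is zero or some child reduces it and
  leaves two possible states. It suffices to treat vectors with entries of polynomially many
  bits, since finitely many chosen witnesses already fix the truth of every comparison. Types, vectors and
  parse tables are thus numbers below a bound \<open>B\<close> with polynomially many bits, and the impossible states
  are the least fixed point of a condition that is first-order over arithmetic with all quantifiers bounded by \<open>B\<close>.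

  Since \<open>B\<close> is a legitimate running time, numbers below \<open>B\<close> can be kept in unary, as
  head positions of a Turing machine. One further tape holds the bits of the fixed point.
\<close>

section \<open>Programs on unary counters\<close>

text \<open>Bounds are written in binary, so an element may need exponentially many children, and a
  whole list of them with their types cannot be named by polynomially many bits. The vector of
  remaining needs can, and adding one child changes only that vector. Global statements need little:
  the body of an unguarded quantifier has at most one free variable, so as soon as that variable is
  bound the formula is closed, and one type \<open>\<alpha>\<^sub>0\<close> fixes its truth value
  for all elements. All other quantifiers are guarded, so a pair of elements that are not neighbours
  in the forest is never evaluated beyond a failing guard. Parse tables are guessed by a bounded
  quantifier as well, but only after the fixed point has been computed. Hence each state carries its
  parse table, the array has \<open>Bd w ^ 3\<close> bits, and a single fixed point serves all
  candidate tables, right or wrong. The possible states form a greatest fixed point: branches of the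
  forest may go on for ever, which is what formulas with only infinite models require.\<close>

datatype act = NoAct | AInc nat | ADec nat | ASet

datatype test = TPos nat | TBit | TSym "token cell set"

datatype prog = Skip | Acc | Rej | Act act | Seq prog prog | If test prog prog | While test prog

text \<open>A small-step semantics split in two: the control sees the store only through the truth
  values of tests, and it emits a single action. This is the shape of a transition function, with
  programs as states.\<close>

primrec ctl :: "(test \<Rightarrow> bool) \<Rightarrow> prog \<Rightarrow> prog \<times> act" where
  "ctl b Skip = (Skip, NoAct)"
| "ctl b Acc = (Acc, NoAct)"
| "ctl b Rej = (Rej, NoAct)"
| "ctl b (Act a) = (Skip, a)"
| "ctl b (Seq p q) = (if p = Skip then (q, NoAct) else (Seq (fst (ctl b p)) q, snd (ctl b p)))"
| "ctl b (If c p q) = (if b c then p else q, NoAct)"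
| "ctl b (While c p) = (if b c then Seq p (While c p) else Skip, NoAct)"

text \<open>The continuations a program can reach: they become the states of the Turing machine.\<close>

primrec conts :: "prog \<Rightarrow> prog set" where
  "conts Skip = {Skip}"
| "conts Acc = {Acc}"
| "conts Rej = {Rej}"
| "conts (Act a) = {Act a, Skip}"
| "conts (Seq p q) = (\<lambda>x. Seq x q) ` conts p \<union> conts q"
| "conts (If c p q) = {If c p q} \<union> conts p \<union> conts q"
| "conts (While c p) = {While c p, Skip} \<union> (\<lambda>x. Seq x (While c p)) ` conts p"

lemma finite_conts: "finite (conts p)"
  by (induction p) auto

lemma self_conts: "p \<in> conts p"
  by (induction p) auto

lemma ctl_conts: "x \<in> conts p \<Longrightarrow> fst (ctl b x) \<in> conts p"
  by (induction p arbitrary: x) (force simp: self_conts)+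

text \<open>
  Register \<open>i\<close> is the position of head \<open>i\<close>. Tape \<open>0\<close> is the input, tape \<open>1\<close> holds an array of
  bits, and the other tapes are blank except for a mark in cell \<open>0\<close>, which makes the test for zero possible.
\<close>

type_synonym lstate = "(nat \<Rightarrow> int) \<times> (int \<Rightarrow> bool)"

fun holds :: "token list \<Rightarrow> lstate \<Rightarrow> test \<Rightarrow> bool" where
  "holds w (r, A) (TPos i) \<longleftrightarrow> r i \<noteq> 0"
| "holds w (r, A) TBit \<longleftrightarrow> A (r 1)"
| "holds w (r, A) (TSym c) \<longleftrightarrow> fst (input_tape w) (r 0) \<in> c"

fun perform :: "act \<Rightarrow> lstate \<Rightarrow> lstate" where
  "perform NoAct (r, A) = (r, A)"
| "perform (AInc i) (r, A) = (r(i := r i + 1), A)"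
| "perform (ADec i) (r, A) = (r(i := r i - 1), A)"
| "perform ASet (r, A) = (r, A(r 1 := True))"

definition lstep :: "token list \<Rightarrow> prog \<times> lstate \<Rightarrow> prog \<times> lstate" where
  "lstep w = (\<lambda>(p, \<sigma>). (fst (ctl (holds w \<sigma>) p), perform (snd (ctl (holds w \<sigma>) p)) \<sigma>))"

primrec act_bound :: "nat \<Rightarrow> act \<Rightarrow> bool" where
  "act_bound K NoAct = True"
| "act_bound K (AInc i) = (i < K)"
| "act_bound K (ADec i) = (i < K)"
| "act_bound K ASet = True"

text \<open>Only the tapes from 2 on carry a mark in cell 0, so the heads 0 and 1 have no test for
  zero.\<close>

primrec test_bound :: "nat \<Rightarrow> test \<Rightarrow> bool" where
  "test_bound K (TPos i) = (2 \<le> i \<and> i < K)"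
| "test_bound K TBit = True"
| "test_bound K (TSym c) = True"

primrec prog_bound :: "nat \<Rightarrow> prog \<Rightarrow> bool" where
  "prog_bound K Skip = True"
| "prog_bound K Acc = True"
| "prog_bound K Rej = True"
| "prog_bound K (Act a) = act_bound K a"
| "prog_bound K (Seq p q) = (prog_bound K p \<and> prog_bound K q)"
| "prog_bound K (If c p q) = (test_bound K c \<and> prog_bound K p \<and> prog_bound K q)"
| "prog_bound K (While c p) = (test_bound K c \<and> prog_bound K p)"

lemma prog_bound_mono: "prog_bound K p \<Longrightarrow> K \<le> K' \<Longrightarrow> prog_bound K' p"
proof -
  have a: "act_bound K a \<Longrightarrow> K \<le> K' \<Longrightarrow> act_bound K' a" for a by (cases a) auto
  have t: "test_bound K a \<Longrightarrow> K \<le> K' \<Longrightarrow> test_bound K' a" for a by (cases a) auto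
  show "prog_bound K p \<Longrightarrow> K \<le> K' \<Longrightarrow> prog_bound K' p"
    by (induction p) (auto intro: a t)
qed

lemma prog_bound_conts: "x \<in> conts p \<Longrightarrow> prog_bound K p \<Longrightarrow> prog_bound K x"
  by (induction p arbitrary: x) auto


section \<open>Simulation by a Turing machine\<close>

definition tape_contents :: "token list \<Rightarrow> (int \<Rightarrow> bool) \<Rightarrow> nat \<Rightarrow> int \<Rightarrow> token cell" where
  "tape_contents w A i = (if i = 0 then fst (input_tape w)
     else if i = 1 then (\<lambda>j. if A j then Work 1 else Blank)
     else (\<lambda>j. if j = 0 then Work 0 else Blank))"

definition tapes :: "nat \<Rightarrow> token list \<Rightarrow> lstate \<Rightarrow> token tape list" where
  "tapes K w \<sigma> = map (\<lambda>i. (tape_contents w (snd \<sigma>) i, fst \<sigma> i)) [0..<K]"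

fun seen :: "token cell list \<Rightarrow> test \<Rightarrow> bool" where
  "seen ss (TPos i) \<longleftrightarrow> ss ! i \<noteq> Work 0"
| "seen ss TBit \<longleftrightarrow> ss ! 1 = Work 1"
| "seen ss (TSym c) \<longleftrightarrow> ss ! 0 \<in> c"

definition moves :: "nat \<Rightarrow> token cell list \<Rightarrow> act \<Rightarrow> (token cell \<times> move) list" where
  "moves K ss a = map (\<lambda>i. (if a = ASet \<and> i = 1 then Work 1 else ss ! i,
     if a = AInc i then MoveR else if a = ADec i then MoveL else Stay)) [0..<K]"

lemma read_tapes: "i < K \<Longrightarrow> map read_tape (tapes K w (r, A)) ! i = tape_contents w A i (r i)"
  by (simp add: tapes_def)

lemma seen_holds:
  assumes "test_bound K c" "2 \<le> K"
  shows "seen (map read_tape (tapes K w \<sigma>)) c = holds w \<sigma> c"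
proof (cases \<sigma>)
  case (Pair r A)
  then show ?thesis
    using assms by (cases c) (auto simp: read_tapes tape_contents_def)
qed

lemma ctl_cong:
  "prog_bound K p \<Longrightarrow> (\<And>c. test_bound K c \<Longrightarrow> b c = b' c) \<Longrightarrow> ctl b p = ctl b' p"
  by (induction p) auto

lemma act_tapes:
  assumes "2 \<le> K"
  shows "map2 act_tape (moves K (map read_tape (tapes K w \<sigma>)) a) (tapes K w \<sigma>) =
    tapes K w (perform a \<sigma>)"
proof (cases \<sigma>)
  case (Pair r A)
  show ?thesis
  proof (rule nth_equalityI)
    fix i assume "i < length (map2 act_tape (moves K (map read_tape (tapes K w \<sigma>)) a) (tapes K w \<sigma>))"
    then have i: "i < K" by (simp add: moves_def tapes_def)
    show "map2 act_tape (moves K (map read_tape (tapes K w \<sigma>)) a) (tapes K w \<sigma>) ! i =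
        tapes K w (perform a \<sigma>) ! i"
      using i assms Pair
      by (cases a) (auto simp: moves_def tapes_def tape_contents_def fun_eq_iff)
  qed (simp add: moves_def tapes_def)
qed

definition index_of :: "'b list \<Rightarrow> 'b \<Rightarrow> nat" where
  "index_of ys y = (SOME i. i < length ys \<and> ys ! i = y)"

lemma index_of:
  assumes "y \<in> set ys"
  shows "index_of ys y < length ys" "ys ! index_of ys y = y"
  using someI_ex[of "\<lambda>i. i < length ys \<and> ys ! i = y"] assms
  by (auto simp: index_of_def in_set_conv_nth)

text \<open>The extra state \<open>None\<close> marks the cells \<open>0\<close> of the counter tapes.\<close>

definition machine :: "nat \<Rightarrow> prog option list \<Rightarrow> prog \<Rightarrow> token tm" where
  "machine K ys p = \<lparr>num_tapes = K, num_states = length ys, num_work = 2,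
     accept = index_of ys (Some Acc), reject = index_of ys (Some Rej),
     trans = (\<lambda>q ss. case ys ! q of
       None \<Rightarrow> (index_of ys (Some p), map (\<lambda>i. (if i < 2 then ss ! i else Work 0, Stay)) [0..<K])
     | Some x \<Rightarrow> (index_of ys (Some (fst (ctl (seen ss) x))), moves K ss (snd (ctl (seen ss) x))))\<rparr>"

text \<open>One extra first step writes the marks, and the strict bound on \<open>t\<close> pays for
  it. From then on each program step is exactly one machine step.\<close>

theorem EXPTIME_by_program:
  fixes L :: "token list set" and p :: "nat poly"
  assumes bound: "prog_bound K x" and K: "2 \<le> K"
    and runs: "\<And>w. \<exists>t < 2 ^ poly p (length w). \<exists>\<sigma>.
      (lstep w ^^ t) (x, (\<lambda>_. 0, \<lambda>_. False)) = (if w \<in> L then Acc else Rej, \<sigma>)"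
  shows "L \<in> EXPTIME"
proof -
  define C where "C = conts x \<union> {Acc, Rej}"
  have "finite C" by (simp add: C_def finite_conts)
  then obtain xs where xs: "set xs = C" "distinct xs" using finite_distinct_list by blast
  \<comment> \<open>Machines start in state 0, so the state that writes the marks has to come
    first.\<close>
  define ys where "ys = None # map Some xs"
  have set_ys: "Some c \<in> set ys \<longleftrightarrow> c \<in> C" for c by (auto simp: ys_def xs)
  have nth_ys: "i < length ys \<Longrightarrow> ys ! i = None \<longleftrightarrow> i = 0" for i
    by (cases i) (auto simp: ys_def)
  have in_C: "q < length ys \<Longrightarrow> ys ! q = Some c \<Longrightarrow> c \<in> C" for q c
    using set_ys nth_mem by metis
  have x: "x \<in> C" "Acc \<in> C" "Rej \<in> C" by (auto simp: C_def self_conts)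
  have ctlC: "c \<in> C \<Longrightarrow> fst (ctl b c) \<in> C" for b c
    by (auto simp: C_def ctl_conts)
  have boundC: "c \<in> C \<Longrightarrow> prog_bound K c" for c
    using prog_bound_conts[OF _ bound] by (auto simp: C_def)
  let ?M = "machine K ys x"
  let ?ix = "\<lambda>c. index_of ys (Some c)"
  have ix: "c \<in> C \<Longrightarrow> ?ix c < length ys \<and> ys ! ?ix c = Some c" for c
    using index_of[of "Some c" ys] set_ys by auto
  have ix_inj: "c \<in> C \<Longrightarrow> c' \<in> C \<Longrightarrow> ?ix c = ?ix c' \<Longrightarrow> c = c'" for c c'
    using ix by (metis option.inject)
  have ix0: "c \<in> C \<Longrightarrow> ?ix c \<noteq> 0" for c
    using ix[of c] nth_ys[of "?ix c"] by auto
  have y0: "ys ! 0 = None" "0 < length ys" by (auto simp: ys_def)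
  have tm: "turing_machine ?M"
    unfolding turing_machine_def
  proof (intro conjI allI impI)
    show "0 < num_tapes ?M" using K by (simp add: machine_def)
    show "0 < num_states ?M" using y0 by (simp add: machine_def)
    show "accept ?M < num_states ?M" "reject ?M < num_states ?M"
      using ix x by (auto simp: machine_def)
    show "accept ?M \<noteq> reject ?M" using ix_inj[OF x(2,3)] by (auto simp: machine_def)
  next
    fix q ss
    assume q: "q < num_states ?M" and len: "length ss = num_tapes ?M"
      and ss: "set ss \<subseteq> tape_letters ?M"
    have len: "length ss = K" using len by (simp add: machine_def)
    have W: "Work 0 \<in> tape_letters ?M" "Work 1 \<in> tape_letters ?M"
      by (auto simp: tape_letters_def machine_def)
    have nth: "i < K \<Longrightarrow> ss ! i \<in> tape_letters ?M" for i using ss len by auto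
    show "case trans ?M q ss of (q', acts) \<Rightarrow>
        q' < num_states ?M \<and> length acts = num_tapes ?M \<and> fst ` set acts \<subseteq> tape_letters ?M"
    proof (cases "ys ! q")
      case None
      have "trans ?M q ss = (?ix x, map (\<lambda>i. (if i < 2 then ss ! i else Work 0, Stay)) [0..<K])"
        using None by (simp add: machine_def)
      moreover have "num_states ?M = length ys" "num_tapes ?M = K" by (simp_all add: machine_def)
      ultimately show ?thesis using W ix[OF x(1)] nth by auto
    next
      case (Some c)
      then have c: "c \<in> C" using in_C q by (auto simp: machine_def)
      have "trans ?M q ss = (?ix (fst (ctl (seen ss) c)), moves K ss (snd (ctl (seen ss) c)))"
        using Some by (simp add: machine_def)
      moreover have "num_states ?M = length ys" "num_tapes ?M = K" by (simp_all add: machine_def)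
      ultimately show ?thesis using W ix[OF ctlC[OF c]] nth by (auto simp: moves_def)
    qed
  qed
  have acc: "accept ?M = ?ix Acc" "reject ?M = ?ix Rej" by (simp_all add: machine_def)
  define enc where "enc = (\<lambda>w (c, \<sigma>). (?ix c, tapes K w \<sigma>))"
  have step: "tm_step ?M (enc w (c, \<sigma>)) = enc w (lstep w (c, \<sigma>))" if c: "c \<in> C" for w c \<sigma>
  \<comment> \<open>Both semantics stop here: \<open>Acc\<close> and \<open>Rej\<close> are fixed
    points of \<open>lstep\<close>, just as halting configurations are of
    \<open>tm_step\<close>.\<close>
  proof (cases "c = Acc \<or> c = Rej")
    case True
    moreover have "perform NoAct \<sigma> = \<sigma>" by (cases \<sigma>) simp
    ultimately show ?thesis by (auto simp: enc_def lstep_def acc)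
  next
    case False
    have "ctl (seen (map read_tape (tapes K w \<sigma>))) c = ctl (holds w \<sigma>) c"
      by (rule ctl_cong[OF boundC[OF c]]) (rule seen_holds[OF _ K])
    moreover have "?ix c \<noteq> accept ?M" "?ix c \<noteq> reject ?M"
      using False ix_inj c x by (auto simp: acc)
    moreover have "trans ?M (?ix c) ss = (?ix (fst (ctl (seen ss) c)), moves K ss (snd (ctl (seen ss) c)))" for ss
      using ix[OF c] by (simp add: machine_def)
    ultimately show ?thesis
      by (simp add: enc_def lstep_def act_tapes K del: map_map)
  qed
  have steps: "(tm_step ?M ^^ t) (enc w (c, \<sigma>)) = enc w ((lstep w ^^ t) (c, \<sigma>)) \<and>
      fst ((lstep w ^^ t) (c, \<sigma>)) \<in> C" if c: "c \<in> C" for w c \<sigma> t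
  proof (induction t)
    case 0
    then show ?case using c by simp
  next
    case (Suc t)
    obtain c' \<sigma>' where eq: "(lstep w ^^ t) (c, \<sigma>) = (c', \<sigma>')"
      by (cases "(lstep w ^^ t) (c, \<sigma>)")
    then have c': "c' \<in> C" using Suc by simp
    then have "fst (lstep w (c', \<sigma>')) \<in> C" using ctlC by (simp add: lstep_def)
    then show ?case using Suc eq step[OF c'] by simp
  qed
  have init: "tm_step ?M (init_config ?M w) = enc w (x, (\<lambda>_. 0, \<lambda>_. False))" for w
  proof -
    define ts where "ts = input_tape w # replicate (K - 1) (input_tape [])"
    have "0 \<noteq> accept ?M" "0 \<noteq> reject ?M" using ix0[OF x(2)] ix0[OF x(3)] by (auto simp: acc)
    moreover have "trans ?M 0 ss = (?ix x, map (\<lambda>i. (if i < 2 then ss ! i else Work 0, Stay)) [0..<K])" for ss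
      using y0 by (simp add: machine_def)
    moreover have "map2 act_tape (map (\<lambda>i. (if i < 2 then map read_tape ts ! i else Work 0, Stay)) [0..<K]) ts =
        tapes K w (\<lambda>_. 0, \<lambda>_. False)" (is "?l = ?r")
    proof (rule nth_equalityI)
      show "length ?l = length ?r" using K by (simp add: tapes_def ts_def)
      fix i assume "i < length ?l"
      then have i: "i < K" using K by simp
      show "?l ! i = ?r ! i"
      proof (cases i)
        case 0
        then show ?thesis using i K
          by (simp add: tapes_def tape_contents_def input_tape_def fun_eq_iff ts_def)
      next
        case (Suc j)
        then show ?thesis using i K
          by (auto simp: tapes_def tape_contents_def input_tape_def fun_eq_iff ts_def)
      qed
    qed
    moreover have "init_config ?M w = (0, ts)"
      by (simp add: init_config_def ts_def machine_def)
    ultimately show ?thesis by (simp add: enc_def)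
  qed
  have "decides_in_time ?M L (\<lambda>n. 2 ^ poly p n)"
    unfolding decides_in_time_def
  proof
    fix w
    obtain t \<sigma> where t: "t < 2 ^ poly p (length w)"
      "(lstep w ^^ t) (x, (\<lambda>_. 0, \<lambda>_. False)) = (if w \<in> L then Acc else Rej, \<sigma>)"
      using runs by blast
    have "(tm_step ?M ^^ Suc t) (init_config ?M w) = (tm_step ?M ^^ t) (enc w (x, (\<lambda>_. 0, \<lambda>_. False)))"
      by (simp add: funpow_swap1 init)
    also have "\<dots> = enc w (if w \<in> L then Acc else Rej, \<sigma>)"
      using steps[OF x(1)] t(2) by simp
    finally have "fst ((tm_step ?M ^^ Suc t) (init_config ?M w)) = (if w \<in> L then accept ?M else reject ?M)"
      by (simp add: enc_def acc)
    then show "\<exists>t \<le> 2 ^ poly p (length w).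
        fst ((tm_step ?M ^^ t) (init_config ?M w)) = (if w \<in> L then accept ?M else reject ?M)"
      using t(1) by (metis Suc_leI)
  qed
  then show ?thesis using tm by (auto simp: EXPTIME_def)
qed

section \<open>Polynomially bounded computation\<close>

text \<open>Polynomial boundedness without coefficients: the base \<open>M + 2\<close> is at least
  2, so constants and sums are absorbed by a larger exponent.\<close>

definition pbd :: "(nat \<Rightarrow> nat) \<Rightarrow> bool" where
  "pbd T \<longleftrightarrow> (\<exists>c. \<forall>M. T M \<le> (M + 2) ^ c)"

lemma pbd_const: "pbd (\<lambda>_. k)"
proof -
  have "k \<le> (M + 2) ^ k" for M :: nat
    using less_exp[of k] power_mono[of 2 "M + 2" k] by linarith
  then show ?thesis unfolding pbd_def by blast
qed

lemma pbd_id: "pbd (\<lambda>M. M)"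
  unfolding pbd_def by (rule exI[of _ 1]) simp

lemma pbd_mult:
  assumes "pbd S" "pbd T"
  shows "pbd (\<lambda>M. S M * T M)"
proof -
  obtain c d where c: "S M \<le> (M + 2) ^ c" "T M \<le> (M + 2) ^ d" for M
    using assms unfolding pbd_def by blast
  have "S M * T M \<le> (M + 2) ^ (c + d)" for M
    using mult_mono[OF c(1)[of M] c(2)[of M]] by (simp add: power_add)
  then show ?thesis unfolding pbd_def by blast
qed

lemma pbd_add:
  assumes "pbd S" "pbd T"
  shows "pbd (\<lambda>M. S M + T M)"
proof -
  obtain c d where c: "S M \<le> (M + 2) ^ c" "T M \<le> (M + 2) ^ d" for M
    using assms unfolding pbd_def by blast
  have "S M + T M \<le> (M + 2) ^ (c + d + 1)" for M
  proof -
    have "(M + 2) ^ c \<le> (M + 2) ^ (c + d)" "(M + 2) ^ d \<le> (M + 2) ^ (c + d)"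
      by (auto intro!: power_increasing)
    then have "S M + T M \<le> 2 * (M + 2) ^ (c + d)" using c[of M] by linarith
    also have "\<dots> \<le> (M + 2) ^ (c + d + 1)" by simp
    finally show ?thesis .
  qed
  then show ?thesis unfolding pbd_def by blast
qed

lemma pbd_comp:
  assumes "pbd S" "pbd T"
  shows "pbd (\<lambda>M. S (T M))"
proof -
  obtain c d where c: "S M \<le> (M + 2) ^ c" "T M \<le> (M + 2) ^ d" for M
    using assms unfolding pbd_def by blast
  have "S (T M) \<le> (M + 2) ^ ((d + 2) * c)" for M
  proof -
    have "T M + 2 \<le> (M + 2) ^ (d + 2)"
    proof -
      have "1 \<le> (M + 2) ^ d" by simp
      then have "T M + 2 \<le> (M + 2) ^ d * 4" using c(2)[of M] by linarith
      also have "\<dots> \<le> (M + 2) ^ d * (M + 2) ^ 2"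
        by (intro mult_left_mono) (auto simp: power2_eq_square)
      finally show ?thesis unfolding power_add .
    qed
    then have "(T M + 2) ^ c \<le> ((M + 2) ^ (d + 2)) ^ c" by (rule power_mono) simp
    then show ?thesis using c(1)[of "T M"] unfolding power_mult by (rule order_trans[rotated])
  qed
  then show ?thesis unfolding pbd_def by blast
qed

lemma pbd_Suc: "pbd T \<Longrightarrow> pbd (\<lambda>M. Suc (T M))"
  using pbd_add[OF _ pbd_const[of 1], of T] by simp

lemma pbd_power: "pbd T \<Longrightarrow> pbd (\<lambda>M. T M ^ k)"
  by (induction k) (auto intro: pbd_const pbd_mult)

lemmas pbd_intros = pbd_const pbd_id pbd_mult pbd_add pbd_Suc pbd_power

section \<open>Timed runs of programs on natural-number registers\<close>

type_synonym st = "(nat \<Rightarrow> nat) \<times> (nat \<Rightarrow> bool)"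

fun emb :: "st \<Rightarrow> lstate" where
  "emb (r, A) = (\<lambda>i. int (r i), \<lambda>j. 0 \<le> j \<and> A (nat j))"

definition runs :: "token list \<Rightarrow> prog \<Rightarrow> st \<Rightarrow> st \<Rightarrow> nat \<Rightarrow> bool" where
  "runs w p \<sigma> \<sigma>' t \<longleftrightarrow> (\<exists>t' \<le> t. (lstep w ^^ t') (p, emb \<sigma>) = (Skip, emb \<sigma>'))"

lemma runs_mono: "runs w p \<sigma> \<sigma>' t \<Longrightarrow> t \<le> t' \<Longrightarrow> runs w p \<sigma> \<sigma>' t'"
  unfolding runs_def by (meson le_trans)

lemma runs_Skip: "runs w Skip \<sigma> \<sigma> t"
  unfolding runs_def by (rule exI[of _ 0]) simp

lemma perform_NoAct: "perform NoAct \<sigma> = \<sigma>"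
  by (cases \<sigma>) simp

lemma runs_Act: "perform a (emb \<sigma>) = emb \<sigma>' \<Longrightarrow> runs w (Act a) \<sigma> \<sigma>' 1"
  unfolding runs_def by (rule exI[of _ 1]) (simp add: lstep_def)

lemma runs_Inc: "runs w (Act (AInc i)) (r, A) (r(i := Suc (r i)), A) 1"
  by (rule runs_Act) (auto simp: fun_eq_iff)

lemma runs_Dec: "r i = Suc k \<Longrightarrow> runs w (Act (ADec i)) (r, A) (r(i := k), A) 1"
  by (rule runs_Act) (auto simp: fun_eq_iff)

lemma runs_Set: "runs w (Act ASet) (r, A) (r, A(r 1 := True)) 1"
  by (rule runs_Act) (auto simp: fun_eq_iff)

lemma lsteps_Seq:
  "(lstep w ^^ t) (p, \<sigma>) = (Skip, \<sigma>') \<Longrightarrow> \<exists>t' \<le> t + 1. (lstep w ^^ t') (Seq p q, \<sigma>) = (q, \<sigma>')"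
proof (induction t arbitrary: p \<sigma>)
  case 0
  then show ?case by (intro exI[of _ 1]) (simp add: lstep_def perform_NoAct)
next
  case (Suc t)
  show ?case
  proof (cases "p = Skip")
    case True
    have "(lstep w ^^ k) (Skip, \<sigma>) = (Skip, \<sigma>)" for k
      by (induction k) (auto simp: lstep_def perform_NoAct)
    then have "\<sigma>' = \<sigma>" using Suc.prems True by (metis prod.inject)
    then show ?thesis using True by (intro exI[of _ 1]) (simp add: lstep_def perform_NoAct)
  next
    case False
    obtain p1 \<sigma>1 where s: "lstep w (p, \<sigma>) = (p1, \<sigma>1)" by (cases "lstep w (p, \<sigma>)")
    then have "(lstep w ^^ t) (p1, \<sigma>1) = (Skip, \<sigma>')"
      using Suc.prems by (simp add: funpow_swap1)
    then obtain t' where t': "t' \<le> t + 1" "(lstep w ^^ t') (Seq p1 q, \<sigma>1) = (q, \<sigma>')"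
      using Suc.IH by blast
    have "lstep w (Seq p q, \<sigma>) = (Seq p1 q, \<sigma>1)"
      using s False by (auto simp: lstep_def)
    then have "(lstep w ^^ Suc t') (Seq p q, \<sigma>) = (q, \<sigma>')"
      using t' by (simp add: funpow_swap1)
    then show ?thesis using t'(1) by (intro exI[of _ "Suc t'"]) simp
  qed
qed

text \<open>The second program need not end in \<open>Skip\<close>; this form leads into the final
  \<open>Acc\<close> or \<open>Rej\<close>.\<close>

lemma runs_Seq_full:
  assumes "runs w p \<sigma> \<sigma>1 t1" "(lstep w ^^ t2) (q, emb \<sigma>1) = s"
  shows "\<exists>t \<le> t1 + t2 + 1. (lstep w ^^ t) (Seq p q, emb \<sigma>) = s"
proof -
  obtain t1' where "t1' \<le> t1" "(lstep w ^^ t1') (p, emb \<sigma>) = (Skip, emb \<sigma>1)"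
    using assms(1) unfolding runs_def by blast
  then obtain t' where t': "t' \<le> t1 + 1" "(lstep w ^^ t') (Seq p q, emb \<sigma>) = (q, emb \<sigma>1)"
    using lsteps_Seq[of t1' w p "emb \<sigma>" "emb \<sigma>1" q] by (auto intro: le_trans)
  have "(lstep w ^^ (t2 + t')) (Seq p q, emb \<sigma>) = s"
    using t' assms(2) by (simp add: funpow_add)
  then show ?thesis using t'(1) by (intro exI[of _ "t2 + t'"]) simp
qed

lemma runs_Seq:
  assumes "runs w p \<sigma> \<sigma>1 t1" "runs w q \<sigma>1 \<sigma>2 t2"
  shows "runs w (Seq p q) \<sigma> \<sigma>2 (t1 + t2 + 1)"
proof -
  obtain t2' where "t2' \<le> t2" "(lstep w ^^ t2') (q, emb \<sigma>1) = (Skip, emb \<sigma>2)"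
    using assms(2) unfolding runs_def by blast
  then obtain t where "t \<le> t1 + t2' + 1" "(lstep w ^^ t) (Seq p q, emb \<sigma>) = (Skip, emb \<sigma>2)"
    using runs_Seq_full[OF assms(1)] by blast
  then show ?thesis unfolding runs_def using \<open>t2' \<le> t2\<close> by (intro exI[of _ t]) simp
qed

lemma runs_step:
  assumes "lstep w (p, emb \<sigma>) = (q, emb \<sigma>)" "runs w q \<sigma> \<sigma>' t"
  shows "runs w p \<sigma> \<sigma>' (t + 1)"
proof -
  obtain t' where "t' \<le> t" "(lstep w ^^ t') (q, emb \<sigma>) = (Skip, emb \<sigma>')"
    using assms(2) unfolding runs_def by blast
  then show ?thesis unfolding runs_def using assms(1)
    by (intro exI[of _ "Suc t'"]) (simp add: funpow_swap1)
qed

lemma runs_If: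
  "runs w (if holds w (emb \<sigma>) c then p else q) \<sigma> \<sigma>' t \<Longrightarrow> runs w (If c p q) \<sigma> \<sigma>' (t + 1)"
  by (rule runs_step) (simp add: lstep_def perform_NoAct)

lemma runs_While:
  assumes "holds w (emb \<sigma>) c" "runs w p \<sigma> \<sigma>1 t1" "runs w (While c p) \<sigma>1 \<sigma>2 t2"
  shows "runs w (While c p) \<sigma> \<sigma>2 (t1 + t2 + 2)"
proof -
  have "runs w (While c p) \<sigma> \<sigma>2 (t1 + t2 + 1 + 1)"
    by (rule runs_step[OF _ runs_Seq[OF assms(2,3)]]) (simp add: lstep_def perform_NoAct assms(1))
  then show ?thesis by simp
qed

lemma runs_While_end:
  assumes "\<not> holds w (emb \<sigma>) c"
  shows "runs w (While c p) \<sigma> \<sigma> 1"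
proof -
  have "runs w (While c p) \<sigma> \<sigma> (0 + 1)"
    by (rule runs_step[OF _ runs_Skip]) (simp add: lstep_def perform_NoAct assms)
  then show ?thesis by simp
qed

abbreviation For :: "nat \<Rightarrow> prog \<Rightarrow> prog" where
  "For a p \<equiv> While (TPos a) (Seq (Act (ADec a)) p)"

text \<open>\<open>S k\<close> and \<open>A k\<close> describe the store after \<open>k\<close>
  rounds, except for the counter, which is overwritten because the loop owns it. The counter is
  decremented before the body, so round \<open>k\<close> sees \<open>N - Suc k\<close>. The
  induction is on the number of remaining rounds, since a loop unfolds at its head.\<close>

lemma runs_For:
  assumes body: "\<And>k. k < N \<Longrightarrow>
    runs w p ((S k)(a := N - Suc k), A k) ((S (Suc k))(a := N - Suc k), A (Suc k)) T"
  shows "runs w (For a p) ((S 0)(a := N), A 0) ((S N)(a := 0), A N) (N * (T + 5) + 1)"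
proof -
  have "runs w (For a p) ((S (N - j))(a := j), A (N - j)) ((S N)(a := 0), A N) (j * (T + 5) + 1)"
    if "j \<le> N" for j
    using that
  proof (induction j)
    case 0
    show ?case unfolding diff_zero mult_0 add_0 by (rule runs_While_end) simp
  next
    case (Suc j)
    define k where "k = N - Suc j"
    have k: "k < N" "N - Suc k = j" "Suc k = N - j" "N - Suc j = k" using Suc.prems by (auto simp: k_def)
    have 1: "runs w (Act (ADec a)) ((S k)(a := Suc j), A k) ((S k)(a := j), A k) 1"
      using runs_Dec[of "(S k)(a := Suc j)" a j] by simp
    have 2: "runs w p ((S k)(a := j), A k) ((S (N - j))(a := j), A (N - j)) T"
      using body[OF k(1)] k by simp
    have 3: "runs w (For a p) ((S (N - j))(a := j), A (N - j)) ((S N)(a := 0), A N) (j * (T + 5) + 1)"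
      by (rule Suc.IH[OF Suc_leD[OF Suc.prems]])
    have "runs w (For a p) ((S k)(a := Suc j), A k) ((S N)(a := 0), A N)
        (1 + T + 1 + (j * (T + 5) + 1) + 2)"
      by (rule runs_While[OF _ runs_Seq[OF 1 2] 3]) simp
    then show ?case unfolding k(4) by (rule runs_mono) simp
  qed
  from this[of N] show ?thesis by simp
qed

lemma runs_For':
  assumes "r = (S 0)(a := N)" "A = A' 0" "r' = (S N)(a := 0)" "B = A' N"
    "\<And>k. k < N \<Longrightarrow>
      runs w p ((S k)(a := N - Suc k), A' k) ((S (Suc k))(a := N - Suc k), A' (Suc k)) T"
    "N * (T + 5) + 1 \<le> t"
  shows "runs w (For a p) (r, A) (r', B) t"
  unfolding assms(1-4) by (rule runs_mono[OF runs_For assms(6)]) (rule assms(5))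

lemma runs_Seq':
  assumes "runs w p \<sigma> \<sigma>1 t1" "runs w q \<sigma>1 \<sigma>2 t2" "t1 + t2 + 1 \<le> t"
  shows "runs w (Seq p q) \<sigma> \<sigma>2 t"
  by (rule runs_mono[OF runs_Seq[OF assms(1,2)] assms(3)])

section \<open>Basic register operations\<close>

definition zero :: "nat \<Rightarrow> prog" where
  "zero a = For a Skip"

definition mv :: "nat \<Rightarrow> nat \<Rightarrow> prog" where
  "mv a b = For a (Act (AInc b))"

text \<open>A loop destroys its counter. So \<open>a\<close> is counted down into both
  \<open>b\<close> and an empty scratch register \<open>t\<close>, and then restored from
  \<open>t\<close>.\<close>

definition copy :: "nat \<Rightarrow> nat \<Rightarrow> nat \<Rightarrow> prog" where
  "copy a b t = Seq (For a (Seq (Act (AInc b)) (Act (AInc t)))) (mv t a)"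

lemma runs_zero: "runs w (zero a) (r, A) (r(a := 0), A) (r a * 5 + 1)"
  unfolding zero_def
  by (rule runs_For'[where S = "\<lambda>_. r" and A' = "\<lambda>_. A" and N = "r a" and T = 0])
    (auto intro: runs_Skip)

lemma runs_mv:
  assumes "a \<noteq> b"
  shows "runs w (mv a b) (r, A) (r(a := 0, b := r b + r a), A) (r a * 6 + 1)"
  unfolding mv_def
proof (rule runs_For'[where S = "\<lambda>k. r(b := r b + k)" and A' = "\<lambda>_. A" and N = "r a" and T = 1])
  fix k assume "k < r a"
  show "runs w (Act (AInc b)) ((r(b := r b + k))(a := r a - Suc k), A)
      ((r(b := r b + Suc k))(a := r a - Suc k), A) 1"
    using runs_Inc[of w b "(r(b := r b + k))(a := r a - Suc k)" A] assms
    by (simp add: fun_upd_twist)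
qed (use assms in \<open>auto simp: fun_eq_iff\<close>)

lemma runs_copy:
  assumes "a \<noteq> b" "a \<noteq> t" "b \<noteq> t" "r t = 0"
  shows "runs w (copy a b t) (r, A) (r(b := r b + r a), A) (r a * 14 + 3)"
  unfolding copy_def
proof (rule runs_Seq')
  show "runs w (For a (Seq (Act (AInc b)) (Act (AInc t)))) (r, A)
      (r(b := r b + r a, t := r a, a := 0), A) (r a * 8 + 1)"
  proof (rule runs_For'[where S = "\<lambda>k. r(b := r b + k, t := k)" and A' = "\<lambda>_. A" and N = "r a" and T = 3])
    fix k assume "k < r a"
    let ?r = "\<lambda>x y. r(b := r b + x, t := y, a := r a - Suc k)"
    have 1: "runs w (Act (AInc b)) (?r k k, A) (?r (Suc k) k, A) 1"
      using runs_Inc[of w b "?r k k" A] assms by (simp add: fun_upd_twist)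
    have 2: "runs w (Act (AInc t)) (?r (Suc k) k, A) (?r (Suc k) (Suc k), A) 1"
      using runs_Inc[of w t "?r (Suc k) k" A] assms by (simp add: fun_upd_twist)
    show "runs w (Seq (Act (AInc b)) (Act (AInc t))) (?r k k, A) (?r (Suc k) (Suc k), A) 3"
      by (rule runs_Seq'[OF 1 2]) simp
  qed (use assms in \<open>auto simp: fun_eq_iff\<close>)
  let ?r = "r(b := r b + r a, t := r a, a := 0)"
  have "?r(t := 0, a := ?r a + ?r t) = r(b := r b + r a)" using assms by (auto simp: fun_eq_iff)
  then show "runs w (mv t a) (?r, A) (r(b := r b + r a), A) (r a * 6 + 1)"
    using runs_mv[of t a w ?r A] assms by simp
qed simp

definition wf :: "prog \<Rightarrow> bool" where
  "wf p \<longleftrightarrow> (\<exists>K. prog_bound K p)"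

lemma wf_Seq: "wf p \<Longrightarrow> wf q \<Longrightarrow> wf (Seq p q)"
proof -
  assume "wf p" "wf q"
  then obtain K L where "prog_bound K p" "prog_bound L q" by (auto simp: wf_def)
  then have "prog_bound (max K L) (Seq p q)" using prog_bound_mono by auto
  then show ?thesis unfolding wf_def by blast
qed

lemma test_bound_mono: "test_bound K c \<Longrightarrow> K \<le> K' \<Longrightarrow> test_bound K' c"
  by (cases c) auto

lemma wf_If: "test_bound K c \<Longrightarrow> wf p \<Longrightarrow> wf q \<Longrightarrow> wf (If c p q)"
proof -
  assume "wf p" "wf q" "test_bound K c"
  then obtain K1 L where *: "prog_bound K1 p" "prog_bound L q" by (auto simp: wf_def)
  have "prog_bound (max K (max K1 L)) (If c p q)"
    using prog_bound_mono[OF *(1)] prog_bound_mono[OF *(2)] test_bound_mono[OF \<open>test_bound K c\<close>] by auto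
  then show ?thesis unfolding wf_def by blast
qed

lemma wf_While: "test_bound K c \<Longrightarrow> wf p \<Longrightarrow> wf (While c p)"
proof -
  assume "wf p" "test_bound K c"
  then obtain L where "prog_bound L p" by (auto simp: wf_def)
  then have "prog_bound (max K L) (While c p)"
    using prog_bound_mono[OF \<open>prog_bound L p\<close>] test_bound_mono[OF \<open>test_bound K c\<close>] by auto
  then show ?thesis unfolding wf_def by blast
qed

lemma wf_Act: "wf (Act a)"
proof -
  have "prog_bound (case a of AInc i \<Rightarrow> Suc i | ADec i \<Rightarrow> Suc i | _ \<Rightarrow> 0) (Act a)"
    by (cases a) auto
  then show ?thesis unfolding wf_def by blast
qed

lemma wf_Skip: "wf Skip" "wf Acc" "wf Rej"
  by (auto simp: wf_def)

lemma wf_For: "2 \<le> a \<Longrightarrow> wf p \<Longrightarrow> wf (For a p)"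
  by (rule wf_While[of "Suc a"]) (auto intro: wf_Seq wf_Act)

lemma wf_macros: "2 \<le> a \<Longrightarrow> wf (zero a)" "2 \<le> a \<Longrightarrow> wf (mv a b)"
  "2 \<le> a \<Longrightarrow> 2 \<le> t \<Longrightarrow> wf (copy a b t)"
  by (auto simp: zero_def mv_def copy_def intro!: wf_For wf_Skip wf_Act wf_Seq)

lemmas wf_intros = wf_Seq wf_Act wf_Skip wf_For wf_macros


section \<open>Functions computable in polynomial time on unary numbers\<close>

text \<open>The base must exceed everything stored in one digit: positions of the word, the powers
  of two up to 2^n, and the number of witnesses an element needs, which is at most n * 2^n for a
  word of length n.\<close>

definition Qd :: "token list \<Rightarrow> nat" where
  "Qd w = 4 ^ (length w + 1)"

text \<open>The exponent is the number of digits available. The longest sequences are the parse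
  tables, with 8 (n + 1) digits, and the types of all pairs of named elements, with (n + 1)^3. As a
  power of two the bound is 2^(16 (n + 1)^4), still a single exponential.\<close>

definition Bd :: "token list \<Rightarrow> nat" where
  "Bd w = Qd w ^ (8 * (length w + 1) ^ 3)"

text \<open>
  Registers \<open>0\<close> and \<open>1\<close> only move during accesses to the input and to the array; registers \<open>2\<close>, \<open>3\<close>, \<open>4\<close>
  permanently hold the bound \<open>Bd w\<close>, the base \<open>Qd w\<close> of digit sequences and the length of the input.
\<close>

definition pre :: "token list \<Rightarrow> (nat \<Rightarrow> nat) \<Rightarrow> nat \<Rightarrow> nat \<Rightarrow> bool" where
  "pre w r M d \<longleftrightarrow> r 0 = 0 \<and> r 1 = 0 \<and> r 2 = Bd w \<and> r 3 = Qd w \<and> r 4 = length w \<and>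
     (\<forall>j \<ge> d. r j = 0) \<and> (\<forall>j. r j \<le> M)"

type_synonym fn = "token list \<Rightarrow> (nat \<Rightarrow> bool) \<Rightarrow> (nat \<Rightarrow> nat) \<Rightarrow> nat"

text \<open>\<open>M\<close> bounds all registers, so time is measured in the stored values
  themselves, that is, in unary. Bounding the result by the same \<open>T M\<close> is what allows
  computations to be composed.\<close>

definition evaluates :: "prog \<Rightarrow> (nat \<Rightarrow> nat) \<Rightarrow> (nat \<Rightarrow> nat) \<Rightarrow> nat \<Rightarrow> fn \<Rightarrow> bool" where
  "evaluates p T \<rho> d f \<longleftrightarrow> (\<forall>w r A M. pre w r M d \<longrightarrow>
     runs w p (r, A) (r(d := f w A (\<lambda>i. r (\<rho> i))), A) (T M) \<and> f w A (\<lambda>i. r (\<rho> i)) \<le> T M)"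

text \<open>The environment is read from the registers \<open>\<rho> i\<close>; registers from \<open>d\<close> on are free.\<close>

definition pcomp :: "fn \<Rightarrow> bool" where
  "pcomp f \<longleftrightarrow> (\<forall>\<rho> d. (\<forall>i. 2 \<le> \<rho> i \<and> \<rho> i < d) \<longrightarrow> 5 \<le> d \<longrightarrow>
     (\<exists>p T. wf p \<and> pbd T \<and> evaluates p T \<rho> d f))"

lemma pcompE:
  assumes "pcomp f" "\<And>i. 2 \<le> \<rho> i \<and> \<rho> i < d" "5 \<le> d"
  obtains p T where "wf p" "pbd T" "evaluates p T \<rho> d f"
  using assms unfolding pcomp_def by blast

lemma evaluatesD:
  assumes "evaluates p T \<rho> d f" "pre w r M d"
  shows "runs w p (r, A) (r(d := f w A (\<lambda>i. r (\<rho> i))), A) (T M)" "f w A (\<lambda>i. r (\<rho> i)) \<le> T M"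
  using assms unfolding evaluates_def by blast+

lemma pre_upd:
  "pre w r M d \<Longrightarrow> 5 \<le> d \<Longrightarrow> x \<le> M' \<Longrightarrow> M \<le> M' \<Longrightarrow> pre w (r(d := x)) M' (Suc d)"
proof -
  assume a: "pre w r M d" "5 \<le> d" "x \<le> M'" "M \<le> M'"
  have "r j \<le> M'" for j using a le_trans[of "r j" M M'] by (simp add: pre_def)
  then show ?thesis using a by (simp add: pre_def)
qed

lemma pre_free: "pre w r M d \<Longrightarrow> d \<le> j \<Longrightarrow> r j = 0"
  by (simp add: pre_def)

lemma pre_le: "pre w r M d \<Longrightarrow> r j \<le> M"
  by (simp add: pre_def)

lemma pcomp_register:
  assumes "\<And>\<rho> d. (\<And>i. 2 \<le> \<rho> i \<and> \<rho> i < d) \<Longrightarrow> 5 \<le> d \<Longrightarrow> \<exists>a. 2 \<le> a \<and> a < d \<and>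
    (\<forall>w r A M. pre w r M d \<longrightarrow> f w A (\<lambda>i. r (\<rho> i)) = r a)"
  shows "pcomp f"
  unfolding pcomp_def
proof (intro allI impI)
  fix \<rho> :: "nat \<Rightarrow> nat" and d :: nat
  assume *: "\<forall>i. 2 \<le> \<rho> i \<and> \<rho> i < d" "5 \<le> d"
  obtain a where a: "2 \<le> a" "a < d" "\<And>w r A M. pre w r M d \<Longrightarrow> f w A (\<lambda>i. r (\<rho> i)) = r a"
    using assms[of \<rho> d] * by blast
  have "evaluates (copy a d (Suc d)) (\<lambda>M. M * 14 + 3) \<rho> d f"
    unfolding evaluates_def
  proof (intro allI impI conjI)
    fix w r A M assume p: "pre w r M d"
    have "runs w (copy a d (Suc d)) (r, A) (r(d := r d + r a), A) (r a * 14 + 3)"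
      by (rule runs_copy) (use a p in \<open>auto simp: pre_free\<close>)
    then show "runs w (copy a d (Suc d)) (r, A) (r(d := f w A (\<lambda>i. r (\<rho> i))), A) (M * 14 + 3)"
      using p pre_le[OF p, of a] a(3)[OF p] by (auto simp: pre_free intro: runs_mono)
    show "f w A (\<lambda>i. r (\<rho> i)) \<le> M * 14 + 3" using a(3)[OF p] pre_le[OF p, of a] by simp
  qed
  moreover have "wf (copy a d (Suc d))" using a * by (intro wf_intros) auto
  moreover have "pbd (\<lambda>M. M * 14 + 3)" by (intro pbd_intros)
  ultimately show "\<exists>p T. wf p \<and> pbd T \<and> evaluates p T \<rho> d f" by blast
qed

lemma pcomp_var: "pcomp (\<lambda>w A v. v i)"
proof (rule pcomp_register)
  fix \<rho> :: "nat \<Rightarrow> nat" and d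
  assume "\<And>i. 2 \<le> \<rho> i \<and> \<rho> i < d"
  then show "\<exists>a\<ge>2. a < d \<and> (\<forall>w r A M. pre w r M d \<longrightarrow> r (\<rho> i) = r a)"
    by (intro exI[of _ "\<rho> i"]) simp
qed

lemma pcomp_Bd: "pcomp (\<lambda>w A v. Bd w)"
  by (rule pcomp_register) (rule exI[of _ 2], auto simp: pre_def)

lemma pcomp_Qd: "pcomp (\<lambda>w A v. Qd w)"
  by (rule pcomp_register) (rule exI[of _ 3], auto simp: pre_def)

lemma pcomp_length: "pcomp (\<lambda>w A v. length w)"
  by (rule pcomp_register) (rule exI[of _ 4], auto simp: pre_def)

lemma runs_incs:
  "runs w (((Seq (Act (AInc a))) ^^ k) Skip) (r, A) (r(a := r a + k), A) (2 * k)"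
proof (induction k arbitrary: r)
  case 0
  then show ?case by (simp add: runs_Skip)
next
  case (Suc k)
  have "runs w (((Seq (Act (AInc a))) ^^ k) Skip) (r(a := Suc (r a)), A) (r(a := r a + Suc k), A) (2 * k)"
    using Suc[of "r(a := Suc (r a))"] by (simp only: fun_upd_same fun_upd_upd add_Suc_right add_Suc)
  then have "runs w (Seq (Act (AInc a)) (((Seq (Act (AInc a))) ^^ k) Skip)) (r, A)
      (r(a := r a + Suc k), A) (2 * Suc k)"
    by (rule runs_Seq'[OF runs_Inc]) simp
  then show ?case unfolding funpow.simps comp_apply .
qed

lemma wf_incs: "wf (((Seq (Act (AInc a))) ^^ k) Skip)"
  by (induction k) (auto intro: wf_intros)

lemma pcomp_const: "pcomp (\<lambda>w A v. k)"
  unfolding pcomp_def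
proof (intro allI impI)
  fix \<rho> :: "nat \<Rightarrow> nat" and d :: nat
  let ?p = "((Seq (Act (AInc d))) ^^ k) Skip"
  have "evaluates ?p (\<lambda>M. 2 * k) \<rho> d (\<lambda>w A v. k)"
    unfolding evaluates_def
  proof (intro allI impI conjI)
    fix w r A M assume "pre w r M d"
    then have "r d = 0" by (simp add: pre_free)
    then show "runs w ?p (r, A) (r(d := k), A) (2 * k)"
      using runs_incs[where a = d and k = k and r = r and A = A and w = w] by simp
  qed simp
  then show "\<exists>p T. wf p \<and> pbd T \<and> evaluates p T \<rho> d (\<lambda>w A v. k)"
    using wf_incs pbd_const by blast
qed

lemma pcomp_rename:
  assumes "pcomp f"
  shows "pcomp (\<lambda>w A v. f w A (\<lambda>j. v (\<pi> j)))"
  unfolding pcomp_def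
proof (intro allI impI)
  fix \<rho> :: "nat \<Rightarrow> nat" and d :: nat
  assume *: "\<forall>i. 2 \<le> \<rho> i \<and> \<rho> i < d" "5 \<le> d"
  obtain p T where "wf p" "pbd T" "evaluates p T (\<lambda>j. \<rho> (\<pi> j)) d f"
    by (rule pcompE[OF assms, of "\<lambda>j. \<rho> (\<pi> j)" d]) (use * in auto)
  then show "\<exists>p T. wf p \<and> pbd T \<and> evaluates p T \<rho> d (\<lambda>w A v. f w A (\<lambda>j. v (\<pi> j)))"
    unfolding evaluates_def by blast
qed

lemma pcomp_unary:
  assumes f: "pcomp f"
    and op: "\<And>d. 5 \<le> d \<Longrightarrow> \<exists>p T. wf p \<and> pbd T \<and> (\<forall>w r A M. pre w r M (Suc d) \<longrightarrow>
      runs w p (r, A) (r(d := op w A (r d)), A) (T M) \<and> op w A (r d) \<le> T M)"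
  shows "pcomp (\<lambda>w A v. op w A (f w A v))"
  unfolding pcomp_def
proof (intro allI impI)
  fix \<rho> :: "nat \<Rightarrow> nat" and d :: nat
  assume *: "\<forall>i. 2 \<le> \<rho> i \<and> \<rho> i < d" "5 \<le> d"
  obtain p T where p: "wf p" "pbd T" "evaluates p T \<rho> d f"
    by (rule pcompE[OF f, of \<rho> d]) (use * in auto)
  obtain q U where q: "wf q" "pbd U"
    "\<And>w r A M. pre w r M (Suc d) \<Longrightarrow> runs w q (r, A) (r(d := op w A (r d)), A) (U M) \<and> op w A (r d) \<le> U M"
    using op[OF *(2)] by blast
  have "evaluates (Seq p q) (\<lambda>M. T M + U (M + T M) + 1) \<rho> d (\<lambda>w A v. op w A (f w A v))"
    unfolding evaluates_def
  proof (intro allI impI)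
    fix w r A M assume pr: "pre w r M d"
    let ?x = "f w A (\<lambda>i. r (\<rho> i))"
    note e = evaluatesD[OF p(3) pr, of A]
    have "pre w (r(d := ?x)) (M + T M) (Suc d)"
      by (rule pre_upd[OF pr *(2)]) (use e in auto)
    note q' = q(3)[OF this, of A]
    show "runs w (Seq p q) (r, A) (r(d := op w A ?x), A) (T M + U (M + T M) + 1) \<and>
        op w A ?x \<le> T M + U (M + T M) + 1"
      using q' by (auto intro!: runs_Seq'[OF e(1)])
  qed
  moreover have "pbd (\<lambda>M. T M + U (M + T M) + 1)"
    by (intro pbd_add pbd_const p(2) pbd_comp[OF q(2)] pbd_id)
  ultimately show "\<exists>p T. wf p \<and> pbd T \<and> evaluates p T \<rho> d (\<lambda>w A v. op w A (f w A v))"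
    using p(1) q(1) wf_Seq by blast
qed

lemma pcomp_binary:
  assumes f: "pcomp f" and g: "pcomp g"
    and op: "\<And>d. 5 \<le> d \<Longrightarrow> \<exists>p T. wf p \<and> pbd T \<and> (\<forall>w r A M. pre w r M (d + 2) \<longrightarrow>
      runs w p (r, A) (r(d := op (r d) (r (Suc d)), Suc d := 0), A) (T M) \<and> op (r d) (r (Suc d)) \<le> T M)"
  shows "pcomp (\<lambda>w A v. op (f w A v) (g w A v))"
  unfolding pcomp_def
proof (intro allI impI)
  fix \<rho> :: "nat \<Rightarrow> nat" and d :: nat
  assume *: "\<forall>i. 2 \<le> \<rho> i \<and> \<rho> i < d" "5 \<le> d"
  obtain p T where p: "wf p" "pbd T" "evaluates p T \<rho> d f"
    by (rule pcompE[OF f, of \<rho> d]) (use * in auto)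
  obtain p' T' where p': "wf p'" "pbd T'" "evaluates p' T' \<rho> (Suc d) g"
    by (rule pcompE[OF g, of \<rho> "Suc d"]) (use * less_Suc_eq in auto)
  obtain q U where q: "wf q" "pbd U"
    "\<And>w r A M. pre w r M (d + 2) \<Longrightarrow>
      runs w q (r, A) (r(d := op (r d) (r (Suc d)), Suc d := 0), A) (U M) \<and> op (r d) (r (Suc d)) \<le> U M"
    using op[OF *(2)] by blast
  define M1 where "M1 = (\<lambda>M. M + T M)"
  define M2 where "M2 = (\<lambda>M. M1 M + T' (M1 M))"
  define V where "V = (\<lambda>M. T M + T' (M1 M) + U (M2 M) + 2)"
  have pb1: "pbd M1" unfolding M1_def using p by (intro pbd_intros)
  have pb2: "pbd M2" unfolding M2_def by (rule pbd_add[OF pb1 pbd_comp[OF p'(2) pb1]])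
  have pb: "pbd V" unfolding V_def
    by (intro pbd_add pbd_const p(2) pbd_comp[OF p'(2) pb1] pbd_comp[OF q(2) pb2])
  have "evaluates (Seq p (Seq p' q)) V \<rho> d (\<lambda>w A v. op (f w A v) (g w A v))"
    unfolding evaluates_def
  proof (intro allI impI)
    fix w r A M assume pr: "pre w r M d"
    let ?x = "f w A (\<lambda>i. r (\<rho> i))" and ?y = "g w A (\<lambda>i. r (\<rho> i))"
    note e = evaluatesD[OF p(3) pr, of A]
    have pr1: "pre w (r(d := ?x)) (M1 M) (Suc d)"
      by (rule pre_upd[OF pr *(2)]) (use e in \<open>auto simp: M1_def\<close>)
    have "(\<lambda>i. (r(d := ?x)) (\<rho> i)) = (\<lambda>i. r (\<rho> i))" using * by (auto simp: fun_eq_iff)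
    then have e': "runs w p' (r(d := ?x), A) (r(d := ?x, Suc d := ?y), A) (T' (M1 M))" "?y \<le> T' (M1 M)"
      using evaluatesD[OF p'(3) pr1, of A] by simp_all
    have pr2: "pre w (r(d := ?x, Suc d := ?y)) (M2 M) (d + 2)"
      using pre_upd[OF pr1, of ?y "M2 M"] * e' by (simp add: M2_def)
    define r' where "r' = r(d := ?x, Suc d := ?y)"
    have r': "r' d = ?x" "r' (Suc d) = ?y" by (simp_all add: r'_def)
    have z: "r'(d := op ?x ?y, Suc d := 0) = r(d := op ?x ?y)"
      using pre_free[OF pr, of "Suc d"] by (auto simp: fun_eq_iff r'_def)
    have "runs w q (r(d := ?x, Suc d := ?y), A) (r(d := op ?x ?y), A) (U (M2 M)) \<and> op ?x ?y \<le> U (M2 M)"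
      using q(3)[OF pr2, of A] unfolding r'_def[symmetric] r' z .
    then show "runs w (Seq p (Seq p' q)) (r, A) (r(d := op ?x ?y), A) (V M) \<and> op ?x ?y \<le> V M"
      by (intro conjI runs_Seq'[OF e(1)] runs_Seq'[OF e'(1)]) (auto simp: V_def)
  qed
  with p(1) p'(1) q(1) pb show "\<exists>p T. wf p \<and> pbd T \<and> evaluates p T \<rho> d (\<lambda>w A v. op (f w A v) (g w A v))"
    by (intro exI[of _ "Seq p (Seq p' q)"] exI[of _ V]) (simp add: wf_Seq)
qed

lemma pcomp_add:
  assumes "pcomp f" "pcomp g"
  shows "pcomp (\<lambda>w A v. f w A v + g w A v)"
proof (rule pcomp_binary[OF assms])
  fix d :: nat assume d: "5 \<le> d"
  have "runs w (mv (Suc d) d) (r, A) (r(d := r d + r (Suc d), Suc d := 0), A) (M * 6 + 1) \<and>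
      r d + r (Suc d) \<le> M * 6 + 1" if "pre w r M (d + 2)" for w r A M
  proof
    have "r(Suc d := 0, d := r d + r (Suc d)) = r(d := r d + r (Suc d), Suc d := 0)"
      by (rule fun_upd_twist) simp
    then have "runs w (mv (Suc d) d) (r, A) (r(d := r d + r (Suc d), Suc d := 0), A) (r (Suc d) * 6 + 1)"
      using runs_mv[of "Suc d" d w r A] by (metis n_not_Suc_n)
    then show "runs w (mv (Suc d) d) (r, A) (r(d := r d + r (Suc d), Suc d := 0), A) (M * 6 + 1)"
      by (rule runs_mono) (simp add: pre_le[OF that])
    show "r d + r (Suc d) \<le> M * 6 + 1"
      using pre_le[OF that, of "Suc d"] pre_le[OF that, of d] by linarith
  qed
  moreover have "pbd (\<lambda>M. M * 6 + 1)" by (intro pbd_intros)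
  ultimately show "\<exists>p T. wf p \<and> pbd T \<and> (\<forall>w r A M. pre w r M (d + 2) \<longrightarrow>
      runs w p (r, A) (r(d := r d + r (Suc d), Suc d := 0), A) (T M) \<and> r d + r (Suc d) \<le> T M)"
    using d wf_macros(2)[of "Suc d" d] by (intro exI[of _ "mv (Suc d) d"] exI[of _ "\<lambda>M. M * 6 + 1"]) simp
qed

lemma pcomp_sub:
  assumes "pcomp f" "pcomp g"
  shows "pcomp (\<lambda>w A v. f w A v - g w A v)"
proof (rule pcomp_binary[OF assms])
  fix d :: nat assume d: "5 \<le> d"
  let ?p = "For (Suc d) (If (TPos d) (Act (ADec d)) Skip)"
  have "runs w ?p (r, A) (r(d := r d - r (Suc d), Suc d := 0), A) (M * 7 + 1) \<and>
      r d - r (Suc d) \<le> M * 7 + 1" if "pre w r M (d + 2)" for w r A M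
  proof
    show "runs w ?p (r, A) (r(d := r d - r (Suc d), Suc d := 0), A) (M * 7 + 1)"
    proof (rule runs_For'[where S = "\<lambda>k. r(d := r d - k)" and A' = "\<lambda>_. A" and N = "r (Suc d)" and T = 2])
      fix k assume k: "k < r (Suc d)"
      let ?r = "\<lambda>x. r(d := x, Suc d := r (Suc d) - Suc k)"
      have 1: "runs w (If (TPos d) (Act (ADec d)) Skip) (?r (r d - k), A) (?r (r d - Suc k), A) (1 + 1)"
      proof (rule runs_If)
        show "runs w (if holds w (emb (?r (r d - k), A)) (TPos d) then Act (ADec d) else Skip)
            (?r (r d - k), A) (?r (r d - Suc k), A) 1"
        proof (cases "r d - k")
          case 0
          then show ?thesis by (simp add: runs_Skip)
        next
          case (Suc m)
          then have "r d - Suc k = m" by simp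
          moreover have "(?r (Suc m))(d := m) = ?r m" by (auto simp: fun_eq_iff)
          ultimately show ?thesis using Suc runs_Dec[of "?r (Suc m)" d m w A] by simp
        qed
      qed
      then show "runs w (If (TPos d) (Act (ADec d)) Skip) (?r (r d - k), A) (?r (r d - Suc k), A) 2"
        by (rule runs_mono) simp
    next
      show "r (Suc d) * (2 + 5) + 1 \<le> M * 7 + 1" using pre_le[OF that, of "Suc d"] by simp
    qed (auto simp: fun_eq_iff)
    show "r d - r (Suc d) \<le> M * 7 + 1" using pre_le[OF that, of d] by simp
  qed
  moreover have "pbd (\<lambda>M. M * 7 + 1)" by (intro pbd_intros)
  moreover have "wf ?p" using d by (intro wf_intros wf_If[of "Suc d"]) auto
  ultimately show "\<exists>p T. wf p \<and> pbd T \<and> (\<forall>w r A M. pre w r M (d + 2) \<longrightarrow>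
      runs w p (r, A) (r(d := r d - r (Suc d), Suc d := 0), A) (T M) \<and> r d - r (Suc d) \<le> T M)"
    by blast
qed

definition mulp :: "nat \<Rightarrow> nat \<Rightarrow> nat \<Rightarrow> nat \<Rightarrow> prog" where
  "mulp x y s t = Seq (For x (copy y s t)) (mv s x)"

lemma runs_mulp:
  assumes "distinct [x, y, s, t]" "r s = 0" "r t = 0" "r x \<le> M" "r y \<le> M"
  shows "runs w (mulp x y s t) (r, A) (r(x := r x * r y), A) (M * (14 * M + 8) + 6 * M * M + 3)"
  unfolding mulp_def
proof (rule runs_Seq')
  show "runs w (For x (copy y s t)) (r, A) (r(x := 0, s := r x * r y), A) (M * (14 * M + 8) + 1)"
  proof (rule runs_For'[where S = "\<lambda>k. r(s := k * r y)" and A' = "\<lambda>_. A" and N = "r x" and T = "14 * M + 3"])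
    fix k assume k: "k < r x"
    let ?r = "r(s := k * r y, x := r x - Suc k)"
    have "?r(s := ?r s + ?r y) = r(s := Suc k * r y, x := r x - Suc k)"
      using assms by (auto simp: fun_eq_iff)
    then show "runs w (copy y s t) (?r, A) (r(s := Suc k * r y, x := r x - Suc k), A) (14 * M + 3)"
      using runs_copy[of y s t ?r w A] assms by (auto intro: runs_mono)
  next
    have "r x * (14 * M + 8) \<le> M * (14 * M + 8)" using assms by (intro mult_right_mono) auto
    then show "r x * (14 * M + 3 + 5) + 1 \<le> M * (14 * M + 8) + 1" by (simp add: algebra_simps)
  qed (use assms in \<open>auto simp: fun_eq_iff\<close>)
  let ?r = "r(x := 0, s := r x * r y)"
  have "?r(s := 0, x := ?r x + ?r s) = r(x := r x * r y)" using assms by (auto simp: fun_eq_iff)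
  moreover have "r x * r y \<le> M * M" using assms by (intro mult_mono) auto
  ultimately show "runs w (mv s x) (?r, A) (r(x := r x * r y), A) (6 * M * M + 1)"
    using runs_mv[of s x w ?r A] assms by (auto intro: runs_mono)
qed simp

lemma wf_mulp: "2 \<le> x \<Longrightarrow> 2 \<le> y \<Longrightarrow> 2 \<le> s \<Longrightarrow> 2 \<le> t \<Longrightarrow> wf (mulp x y s t)"
  unfolding mulp_def by (intro wf_intros)

lemma pcomp_mult:
  assumes "pcomp f" "pcomp g"
  shows "pcomp (\<lambda>w A v. f w A v * g w A v)"
proof (rule pcomp_binary[OF assms])
  fix d :: nat assume d: "5 \<le> d"
  let ?p = "Seq (mulp d (Suc d) (d + 2) (d + 3)) (zero (Suc d))"
  let ?T = "\<lambda>M. M * (14 * M + 8) + 6 * M * M + 3 + (M * 5 + 1) + 1"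
  have "runs w ?p (r, A) (r(d := r d * r (Suc d), Suc d := 0), A) (?T M) \<and> r d * r (Suc d) \<le> ?T M"
    if pr: "pre w r M (d + 2)" for w r A M
  proof
    have 1: "runs w (mulp d (Suc d) (d + 2) (d + 3)) (r, A) (r(d := r d * r (Suc d)), A)
        (M * (14 * M + 8) + 6 * M * M + 3)"
      by (rule runs_mulp) (auto simp: pre_free[OF pr] pre_le[OF pr])
    have 2: "runs w (zero (Suc d)) (r(d := r d * r (Suc d)), A)
        (r(d := r d * r (Suc d), Suc d := 0), A) (M * 5 + 1)"
      using runs_zero[of w "Suc d" "r(d := r d * r (Suc d))" A] pre_le[OF pr, of "Suc d"]
      by (auto intro: runs_mono)
    show "runs w ?p (r, A) (r(d := r d * r (Suc d), Suc d := 0), A) (?T M)"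
      by (rule runs_Seq'[OF 1 2]) simp
    have "r d * r (Suc d) \<le> M * M" by (intro mult_mono pre_le[OF pr]) auto
    also have "M * M \<le> ?T M" by (simp add: algebra_simps)
    finally show "r d * r (Suc d) \<le> ?T M" .
  qed
  moreover have "pbd ?T" by (intro pbd_intros)
  moreover have "wf ?p" using d by (intro wf_intros wf_mulp) auto
  ultimately show "\<exists>p T. wf p \<and> pbd T \<and> (\<forall>w r A M. pre w r M (d + 2) \<longrightarrow>
      runs w p (r, A) (r(d := r d * r (Suc d), Suc d := 0), A) (T M) \<and> r d * r (Suc d) \<le> T M)"
    by blast
qed

text \<open>Binding by shifting: inside \<open>G\<close>, variable 0 holds the value of
  \<open>g\<close> and all older variables move up by one.\<close>

lemma pcomp_let:
  assumes g: "pcomp g" and G: "pcomp (\<lambda>w A v. G w A (v 0) (\<lambda>j. v (Suc j)))"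
  shows "pcomp (\<lambda>w A v. G w A (g w A v) v)"
  unfolding pcomp_def
proof (intro allI impI)
  fix \<rho> :: "nat \<Rightarrow> nat" and d :: nat
  assume *: "\<forall>i. 2 \<le> \<rho> i \<and> \<rho> i < d" "5 \<le> d"
  obtain p T where p: "wf p" "pbd T" "evaluates p T \<rho> d g"
    by (rule pcompE[OF g, of \<rho> d]) (use * in auto)
  let ?\<rho> = "case_nat d \<rho>"
  obtain q U where q: "wf q" "pbd U" "evaluates q U ?\<rho> (Suc d) (\<lambda>w A v. G w A (v 0) (\<lambda>j. v (Suc j)))"
    by (rule pcompE[OF G, of ?\<rho> "Suc d"]) (use * less_Suc_eq in \<open>auto split: nat.splits\<close>)
  define M1 where "M1 = (\<lambda>M. M + T M)"
  define V where "V = (\<lambda>M. T M + U (M1 M) + (M1 M * 5 + 1) + (U (M1 M) * 6 + 1) + 3)"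
  have pb1: "pbd M1" unfolding M1_def using p by (intro pbd_intros)
  have pb: "pbd V" unfolding V_def
    by (intro pbd_add pbd_mult pbd_const p(2) pb1 pbd_comp[OF q(2) pb1])
  let ?p = "Seq p (Seq q (Seq (zero d) (mv (Suc d) d)))"
  have "evaluates ?p V \<rho> d (\<lambda>w A v. G w A (g w A v) v)"
    unfolding evaluates_def
  proof (intro allI impI)
    fix w r A M assume pr: "pre w r M d"
    define v where "v = (\<lambda>i. r (\<rho> i))"
    define x where "x = g w A v"
    define y where "y = G w A x v"
    note e = evaluatesD[OF p(3) pr, of A, folded v_def, folded x_def]
    have pr1: "pre w (r(d := x)) (M1 M) (Suc d)"
      by (rule pre_upd[OF pr *(2)]) (use e in \<open>auto simp: M1_def\<close>)
    have env: "(\<lambda>j. (r(d := x)) (?\<rho> (Suc j))) = v" "(r(d := x)) (?\<rho> 0) = x"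
      using * by (auto simp: fun_eq_iff v_def)
    have e': "runs w q (r(d := x), A) (r(d := x, Suc d := y), A) (U (M1 M))" "y \<le> U (M1 M)"
      using evaluatesD[OF q(3) pr1, of A] unfolding env y_def by blast+
    have e2: "runs w (zero d) (r(d := x, Suc d := y), A) (r(d := 0, Suc d := y), A) (M1 M * 5 + 1)"
    proof -
      have "(r(d := x, Suc d := y))(d := 0) = r(d := 0, Suc d := y)" by (auto simp: fun_eq_iff)
      then have "runs w (zero d) (r(d := x, Suc d := y), A) (r(d := 0, Suc d := y), A) (x * 5 + 1)"
        using runs_zero[of w d "r(d := x, Suc d := y)" A] by simp
      then show ?thesis by (rule runs_mono) (use e in \<open>simp add: M1_def\<close>)
    qed
    have e3: "runs w (mv (Suc d) d) (r(d := 0, Suc d := y), A) (r(d := y), A) (U (M1 M) * 6 + 1)"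
    proof -
      have "(r(d := 0, Suc d := y))(Suc d := 0, d := 0 + y) = r(d := y)"
        using pre_free[OF pr, of "Suc d"] by (auto simp: fun_eq_iff)
      then have "runs w (mv (Suc d) d) (r(d := 0, Suc d := y), A) (r(d := y), A) (y * 6 + 1)"
        using runs_mv[of "Suc d" d w "r(d := 0, Suc d := y)" A] by simp
      then show ?thesis by (rule runs_mono) (use e' in simp)
    qed
    have "runs w ?p (r, A) (r(d := y), A) (V M)"
      by (rule runs_Seq'[OF e(1) runs_Seq[OF e'(1) runs_Seq[OF e2 e3]]]) (simp add: V_def)
    moreover have "y \<le> V M" using e'(2) by (simp add: V_def)
    ultimately show "runs w ?p (r, A) (r(d := G w A (g w A (\<lambda>i. r (\<rho> i))) (\<lambda>i. r (\<rho> i))), A) (V M) \<and>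
        G w A (g w A (\<lambda>i. r (\<rho> i))) (\<lambda>i. r (\<rho> i)) \<le> V M"
      by (simp add: y_def x_def v_def)
  qed
  moreover have "wf ?p" using p q * by (intro wf_intros) auto
  ultimately show "\<exists>p T. wf p \<and> pbd T \<and> evaluates p T \<rho> d (\<lambda>w A v. G w A (g w A v) v)"
    using pb by blast
qed

text \<open>A computable bound on all intermediate values is demanded because iterating even a
  squaring leaves every polynomial.\<close>

lemma pcomp_iter:
  assumes a: "pcomp a" and n: "pcomp n" and cap: "pcomp cap"
    and H: "pcomp (\<lambda>w A v. H w A (\<lambda>j. v (Suc (Suc j))) (v 0) (v (Suc 0)))"
    and bnd: "\<And>w A v k. k \<le> n w A v \<Longrightarrow> rec_nat (a w A v) (H w A v) k \<le> cap w A v"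
  shows "pcomp (\<lambda>w A v. rec_nat (a w A v) (H w A v) (n w A v))"
  unfolding pcomp_def
proof (intro allI impI)
  fix \<rho> :: "nat \<Rightarrow> nat" and d :: nat
  assume *: "\<forall>i. 2 \<le> \<rho> i \<and> \<rho> i < d" "5 \<le> d"
  obtain p1 T1 where p1: "wf p1" "pbd T1" "evaluates p1 T1 \<rho> d a"
    by (rule pcompE[OF a, of \<rho> d]) (use * in auto)
  obtain p2 T2 where p2: "wf p2" "pbd T2" "evaluates p2 T2 \<rho> (Suc d) n"
    by (rule pcompE[OF n, of \<rho> "Suc d"]) (use * less_Suc_eq in auto)
  \<comment> \<open>Of the computation of \<open>cap\<close> only the bound \<open>T3\<close>
    enters: it majorizes all iterates.\<close>
  obtain p3 T3 where p3: "wf p3" "pbd T3" "evaluates p3 T3 \<rho> d cap"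
    by (rule pcompE[OF cap, of \<rho> d]) (use * in auto)
  let ?\<rho> = "case_nat (d + 2) (case_nat d \<rho>)"
  obtain q U where q: "wf q" "pbd U"
    "evaluates q U ?\<rho> (d + 3) (\<lambda>w A v. H w A (\<lambda>j. v (Suc (Suc j))) (v 0) (v (Suc 0)))"
    by (rule pcompE[OF H, of ?\<rho> "d + 3"]) (use * in \<open>auto split: nat.splits simp: trans_less_add1\<close>)
  define M1 where "M1 = (\<lambda>M. M + T1 M)"
  define M2 where "M2 = (\<lambda>M. M1 M + T2 (M1 M) + T3 M)"
  define W where "W = (\<lambda>M. U (M2 M) + (M2 M * 5 + 1) + (U (M2 M) * 6 + 1) + 1 + 3)"
  define V where "V = (\<lambda>M. T1 M + T2 (M1 M) + (M2 M * (W M + 5) + 1) + (M2 M * 5 + 1) + M2 M + 3)"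
  have pb1: "pbd M1" unfolding M1_def using p1 by (intro pbd_intros)
  have pb2: "pbd M2" unfolding M2_def by (intro pbd_add pb1 pbd_comp[OF p2(2) pb1] p3(2))
  have pbW: "pbd W" unfolding W_def by (intro pbd_add pbd_mult pbd_const pb2 pbd_comp[OF q(2) pb2])
  have pb: "pbd V" unfolding V_def
    by (intro pbd_add pbd_mult pbd_const p1(2) pb2 pbW pbd_comp[OF p2(2) pb1])
  let ?b = "Seq q (Seq (zero d) (Seq (mv (d + 3) d) (Act (AInc (d + 2)))))"
  let ?p = "Seq p1 (Seq p2 (Seq (For (Suc d) ?b) (zero (d + 2))))"
  have "evaluates ?p V \<rho> d (\<lambda>w A v. rec_nat (a w A v) (H w A v) (n w A v))"
    unfolding evaluates_def
  proof (intro allI impI)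
    fix w r A M assume pr: "pre w r M d"
    define v where "v = (\<lambda>i. r (\<rho> i))"
    define N where "N = n w A v"
    define x where "x = rec_nat (a w A v) (H w A v)"
    note e1 = evaluatesD[OF p1(3) pr, of A, folded v_def]
    have x0: "a w A v = x 0" by (simp add: x_def)
    have pr1: "pre w (r(d := x 0)) (M1 M) (Suc d)"
      by (rule pre_upd[OF pr *(2)]) (use e1 x0 in \<open>auto simp: M1_def\<close>)
    have env: "(\<lambda>j. (r(d := x 0)) (\<rho> j)) = v" using * by (auto simp: fun_eq_iff v_def)
    have e2: "runs w p2 (r(d := x 0), A) (r(d := x 0, Suc d := N), A) (T2 (M1 M))" "N \<le> T2 (M1 M)"
      using evaluatesD[OF p2(3) pr1, of A] unfolding env N_def by blast+
    have x: "x k \<le> M2 M" if "k \<le> N" for k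
    proof -
      have "x k \<le> cap w A v" using bnd that by (simp add: x_def N_def)
      also have "\<dots> \<le> T3 M" using evaluatesD(2)[OF p3(3) pr, of A] by (simp add: v_def)
      finally show ?thesis by (simp add: M2_def)
    qed
    have NM: "N \<le> M2 M" using e2(2) by (simp add: M2_def)
    let ?S = "\<lambda>k. r(d := x k, d + 2 := k)"
    have e3: "runs w (For (Suc d) ?b) (r(d := x 0, Suc d := N), A) ((?S N)(Suc d := 0), A) (M2 M * (W M + 5) + 1)"
    proof (rule runs_For'[where S = ?S and A' = "\<lambda>_. A" and N = N and T = "W M"])
      show "r(d := x 0, Suc d := N) = (?S 0)(Suc d := N)"
        using pre_free[OF pr, of "d + 2"] by (auto simp: fun_eq_iff)
    next
      fix k assume k: "k < N"
      define R where "R = (\<lambda>a c b. r(d := a, d + 2 := c, Suc d := N - Suc k, d + 3 := b))"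
      have R0: "(?S k)(Suc d := N - Suc k) = R (x k) k 0" "(?S (Suc k))(Suc d := N - Suc k) = R (x (Suc k)) (Suc k) 0"
        using pre_free[OF pr, of "d + 3"] by (auto simp: R_def fun_eq_iff)
      have prk: "pre w (R (x k) k 0) (M2 M) (d + 3)"
        unfolding pre_def
      proof (intro conjI allI impI)
        fix j show "R (x k) k 0 j \<le> M2 M"
          using x[of k] k NM pre_le[OF pr, of j] by (auto simp: R_def M2_def M1_def)
      qed (use pr * in \<open>auto simp: R_def pre_def\<close>)
      have envk: "(\<lambda>j. R (x k) k 0 (?\<rho> (Suc (Suc j)))) = v" "R (x k) k 0 (?\<rho> 0) = k"
        "R (x k) k 0 (?\<rho> (Suc 0)) = x k"
      proof -
        have "\<rho> j \<noteq> d" "\<rho> j \<noteq> d + 2" "\<rho> j \<noteq> Suc d" "\<rho> j \<noteq> d + 3" for j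
          using *(1)[rule_format, of j] by auto
        then show "(\<lambda>j. R (x k) k 0 (?\<rho> (Suc (Suc j)))) = v"
          by (simp add: R_def v_def)
      qed (auto simp: R_def)
      have xS: "H w A v k (x k) = x (Suc k)" by (simp add: x_def)
      have "(R (x k) k 0)(d + 3 := y) = R (x k) k y" for y by (auto simp: R_def)
      then have b1: "runs w q (R (x k) k 0, A) (R (x k) k (x (Suc k)), A) (U (M2 M))" "x (Suc k) \<le> U (M2 M)"
        using evaluatesD[OF q(3) prk, of A] unfolding envk xS by simp_all
      have b2: "runs w (zero d) (R (x k) k (x (Suc k)), A) (R 0 k (x (Suc k)), A) (M2 M * 5 + 1)"
      proof -
        have "(R (x k) k (x (Suc k)))(d := 0) = R 0 k (x (Suc k))" "R (x k) k (x (Suc k)) d = x k"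
          by (auto simp: fun_eq_iff R_def)
        then have "runs w (zero d) (R (x k) k (x (Suc k)), A) (R 0 k (x (Suc k)), A) (x k * 5 + 1)"
          using runs_zero[of w d "R (x k) k (x (Suc k))" A] by simp
        then show ?thesis by (rule runs_mono) (use x[of k] k in simp)
      qed
      have b3: "runs w (mv (d + 3) d) (R 0 k (x (Suc k)), A) (R (x (Suc k)) k 0, A) (U (M2 M) * 6 + 1)"
      proof -
        have "(R 0 k (x (Suc k)))(d + 3 := 0, d := R 0 k (x (Suc k)) d + R 0 k (x (Suc k)) (d + 3)) = R (x (Suc k)) k 0"
          "R 0 k (x (Suc k)) (d + 3) = x (Suc k)"
          by (auto simp: fun_eq_iff R_def)
        then have "runs w (mv (d + 3) d) (R 0 k (x (Suc k)), A) (R (x (Suc k)) k 0, A) (x (Suc k) * 6 + 1)"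
          using runs_mv[of "d + 3" d w "R 0 k (x (Suc k))" A] by simp
        then show ?thesis by (rule runs_mono) (use b1 in simp)
      qed
      have b4: "runs w (Act (AInc (d + 2))) (R (x (Suc k)) k 0, A) (R (x (Suc k)) (Suc k) 0, A) 1"
      proof -
        have "(R (x (Suc k)) k 0)(d + 2 := Suc (R (x (Suc k)) k 0 (d + 2))) = R (x (Suc k)) (Suc k) 0"
          by (auto simp: fun_eq_iff R_def)
        then show ?thesis using runs_Inc[of w "d + 2" "R (x (Suc k)) k 0" A] by simp
      qed
      show "runs w ?b ((?S k)(Suc d := N - Suc k), A) ((?S (Suc k))(Suc d := N - Suc k), A) (W M)"
        unfolding R0
        by (rule runs_Seq'[OF b1(1) runs_Seq[OF b2 runs_Seq[OF b3 b4]]]) (simp add: W_def)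
    next
      have "N * (W M + 5) \<le> M2 M * (W M + 5)" using NM by (rule mult_right_mono) simp
      then show "N * (W M + 5) + 1 \<le> M2 M * (W M + 5) + 1" by simp
    qed auto
    have e4: "runs w (zero (d + 2)) ((?S N)(Suc d := 0), A) (r(d := x N), A) (M2 M * 5 + 1)"
    proof -
      have "(?S N)(Suc d := 0, d + 2 := 0) = r(d := x N)"
        using pre_free[OF pr, of "d + 2"] pre_free[OF pr, of "Suc d"] by (auto simp: fun_eq_iff)
      moreover have "((?S N)(Suc d := 0)) (d + 2) = N" by simp
      ultimately have "runs w (zero (d + 2)) ((?S N)(Suc d := 0), A) (r(d := x N), A) (N * 5 + 1)"
        using runs_zero[of w "d + 2" "(?S N)(Suc d := 0)" A] by metis
      then show ?thesis by (rule runs_mono) (use NM in simp)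
    qed
    have "runs w ?p (r, A) (r(d := x N), A) (V M)"
      by (rule runs_Seq'[OF e1(1)[unfolded x0] runs_Seq[OF e2(1) runs_Seq[OF e3 e4]]]) (simp add: V_def)
    moreover have "x N \<le> V M" using x[of N] by (simp add: V_def)
    ultimately show "runs w ?p (r, A) (r(d := rec_nat (a w A (\<lambda>i. r (\<rho> i))) (H w A (\<lambda>i. r (\<rho> i))) (n w A (\<lambda>i. r (\<rho> i)))), A) (V M) \<and>
        rec_nat (a w A (\<lambda>i. r (\<rho> i))) (H w A (\<lambda>i. r (\<rho> i))) (n w A (\<lambda>i. r (\<rho> i))) \<le> V M"
      by (simp add: x_def v_def N_def)
  qed
  moreover have "wf ?p" using p1 p2 q * by (intro wf_intros) auto
  ultimately show "\<exists>p T. wf p \<and> pbd T \<and> evaluates p T \<rho> d (\<lambda>w A v. rec_nat (a w A v) (H w A v) (n w A v))"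
    using pb by blast
qed

definition pdec :: "(token list \<Rightarrow> (nat \<Rightarrow> bool) \<Rightarrow> (nat \<Rightarrow> nat) \<Rightarrow> bool) \<Rightarrow> bool" where
  "pdec P \<longleftrightarrow> pcomp (\<lambda>w A v. of_bool (P w A v))"

section \<open>Access to the input and to the array\<close>

lemma runs_to_head:
  assumes "i < 2" "2 \<le> d" "r i = 0" "r (Suc d) = 0" "r d \<le> M"
  shows "runs w (For d (Seq (Act (AInc i)) (Act (AInc (Suc d))))) (r, A)
    (r(i := r d, Suc d := r d, d := 0), A) (M * 8 + 1)"
proof (rule runs_For'[where S = "\<lambda>k. r(i := k, Suc d := k)" and A' = "\<lambda>_. A" and N = "r d" and T = 3])
  fix k assume "k < r d"
  define R where "R = (\<lambda>x y. r(i := x, Suc d := y, d := r d - Suc k))"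
  have "(R k k)(i := Suc (R k k i)) = R (Suc k) k" "(R (Suc k) k)(Suc d := Suc (R (Suc k) k (Suc d))) = R (Suc k) (Suc k)"
    using assms by (auto simp: fun_eq_iff R_def)
  then have 1: "runs w (Act (AInc i)) (R k k, A) (R (Suc k) k, A) 1"
    and 2: "runs w (Act (AInc (Suc d))) (R (Suc k) k, A) (R (Suc k) (Suc k), A) 1"
    using runs_Inc[of w i "R k k" A] runs_Inc[of w "Suc d" "R (Suc k) k" A] by simp_all
  show "runs w (Seq (Act (AInc i)) (Act (AInc (Suc d)))) ((r(i := k, Suc d := k))(d := r d - Suc k), A)
      ((r(i := Suc k, Suc d := Suc k))(d := r d - Suc k), A) 3"
    by (rule runs_Seq'[OF 1[unfolded R_def] 2[unfolded R_def]]) simp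
qed (use assms in \<open>auto simp: fun_eq_iff\<close>)

lemma runs_from_head:
  assumes "i < 2" "2 \<le> d" "r i = r d" "r d \<le> M"
  shows "runs w (For d (Act (ADec i))) (r, A) (r(i := 0, d := 0), A) (M * 6 + 1)"
proof (rule runs_For'[where S = "\<lambda>k. r(i := r d - k)" and A' = "\<lambda>_. A" and N = "r d" and T = 1])
  fix k assume k: "k < r d"
  define R where "R = (\<lambda>x. r(i := x, d := r d - Suc k))"
  have "R (r d - k) i = Suc (r d - Suc k)" "(R (r d - k))(i := r d - Suc k) = R (r d - Suc k)"
    using assms k by (auto simp: fun_eq_iff R_def)
  then have rr: "runs w (Act (ADec i)) (R (r d - k), A) (R (r d - Suc k), A) 1"
    using runs_Dec[of "R (r d - k)" i "r d - Suc k" w A] by simp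
  show "runs w (Act (ADec i)) ((r(i := r d - k))(d := r d - Suc k), A) ((r(i := r d - Suc k))(d := r d - Suc k), A) 1"
    by (rule rr[unfolded R_def])
qed (use assms in \<open>auto simp: fun_eq_iff\<close>)

text \<open>The heads 0 and 1 cannot be tested for zero. So the head is counted out to the probed
  position while the count is saved in \<open>Suc d\<close>; after the test the saved count brings
  the head back to 0.\<close>

lemma pdec_probe:
  assumes f: "pcomp f" and i: "i < 2" and c: "test_bound 2 c"
    and P: "\<And>w r A. holds w (emb (r, A)) c \<longleftrightarrow> P w A (r i)"
  shows "pdec (\<lambda>w A v. P w A (f w A v))"
  unfolding pdec_def
proof (rule pcomp_unary[OF f])
  fix d :: nat assume d: "5 \<le> d"
  let ?p = "Seq (For d (Seq (Act (AInc i)) (Act (AInc (Suc d)))))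
    (Seq (If c (Act (AInc d)) Skip) (For (Suc d) (Act (ADec i))))"
  let ?T = "\<lambda>M. M * 8 + 1 + 2 + (M * 6 + 1) + 2"
  have "runs w ?p (r, A) (r(d := of_bool (P w A (r d))), A) (?T M) \<and> of_bool (P w A (r d)) \<le> ?T M"
    if pr: "pre w r M (Suc d)" for w r A M
  proof
    define b where "b = (of_bool (P w A (r d)) :: nat)"
    have ri: "r i = 0" using i pr by (cases "i = 0") (auto simp: pre_def less_2_cases_iff)
    have 1: "runs w (For d (Seq (Act (AInc i)) (Act (AInc (Suc d))))) (r, A)
        (r(i := r d, Suc d := r d, d := 0), A) (M * 8 + 1)"
      by (rule runs_to_head) (use i d ri pre_free[OF pr, of "Suc d"] pre_le[OF pr, of d] in auto)
    let ?r = "r(i := r d, Suc d := r d, d := 0)"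
    have 2: "runs w (If c (Act (AInc d)) Skip) (?r, A) (?r(d := b), A) (1 + 1)"
    proof (rule runs_If)
      have "holds w (emb (?r, A)) c \<longleftrightarrow> P w A (r d)" using P[of w ?r A] i d by simp
      then show "runs w (if holds w (emb (?r, A)) c then Act (AInc d) else Skip) (?r, A) (?r(d := b), A) 1"
        using runs_Inc[of w d ?r A] by (simp add: b_def runs_Skip)
    qed
    let ?r' = "r(i := r d, Suc d := r d, d := b)"
    have 3: "runs w (For (Suc d) (Act (ADec i))) (?r', A) (?r'(i := 0, Suc d := 0), A) (M * 6 + 1)"
      by (rule runs_from_head) (use i d pre_le[OF pr, of d] in auto)
    have "?r'(i := 0, Suc d := 0) = r(d := b)" "?r(d := b) = ?r'"
      using ri i d pre_free[OF pr, of "Suc d"] by (auto simp: fun_eq_iff)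
    with 2 3 have 2: "runs w (If c (Act (AInc d)) Skip) (?r, A) (?r', A) (1 + 1)"
      and 3: "runs w (For (Suc d) (Act (ADec i))) (?r', A) (r(d := b), A) (M * 6 + 1)"
      by metis+
    show "runs w ?p (r, A) (r(d := of_bool (P w A (r d))), A) (?T M)"
      unfolding b_def[symmetric] by (rule runs_Seq'[OF 1 runs_Seq[OF 2 3]]) simp
  qed simp
  moreover have "pbd ?T" by (intro pbd_intros)
  moreover have "wf ?p" using d by (intro wf_intros wf_If[OF c]) auto
  ultimately show "\<exists>p T. wf p \<and> pbd T \<and> (\<forall>w r A M. pre w r M (Suc d) \<longrightarrow>
      runs w p (r, A) (r(d := of_bool (P w A (r d))), A) (T M) \<and> of_bool (P w A (r d)) \<le> T M)"
    by blast
qed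

lemma pdec_array: "pcomp f \<Longrightarrow> pdec (\<lambda>w A v. A (f w A v))"
  by (rule pdec_probe[where i = 1 and c = TBit]) auto

definition istok :: "token list \<Rightarrow> nat \<Rightarrow> token \<Rightarrow> bool" where
  "istok w i t \<longleftrightarrow> i < length w \<and> w ! i = t"

lemma pdec_istok: "pcomp f \<Longrightarrow> pdec (\<lambda>w A v. istok w (f w A v) t)"
  by (rule pdec_probe[where i = 0 and c = "TSym {Inp t}"]) (auto simp: istok_def input_tape_def)

lemma pcomp_of_bool: "pdec P \<Longrightarrow> pcomp (\<lambda>w A v. of_bool (P w A v))"
  by (simp add: pdec_def)

lemma pdec_cong: "pcomp (\<lambda>w A v. f w A v) \<Longrightarrow> (\<And>w A v. f w A v = of_bool (P w A v)) \<Longrightarrow> pdec P"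
  unfolding pdec_def by simp

lemma pdec_less: "pcomp f \<Longrightarrow> pcomp g \<Longrightarrow> pdec (\<lambda>w A v. f w A v < g w A v)"
  by (rule pdec_cong[of "\<lambda>w A v. 1 - (1 - (g w A v - f w A v))"])
    (intro pcomp_sub pcomp_const, assumption+, auto)

lemma pdec_not: "pdec P \<Longrightarrow> pdec (\<lambda>w A v. \<not> P w A v)"
  by (rule pdec_cong[of "\<lambda>w A v. 1 - of_bool (P w A v)"]) (auto intro!: pcomp_sub pcomp_const pcomp_of_bool)

lemma pdec_conj: "pdec P \<Longrightarrow> pdec Q \<Longrightarrow> pdec (\<lambda>w A v. P w A v \<and> Q w A v)"
  by (rule pdec_cong[of "\<lambda>w A v. of_bool (P w A v) * of_bool (Q w A v)"])
    (auto intro!: pcomp_mult pcomp_const pcomp_of_bool)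

lemma pdec_disj: "pdec P \<Longrightarrow> pdec Q \<Longrightarrow> pdec (\<lambda>w A v. P w A v \<or> Q w A v)"
proof -
  assume "pdec P" "pdec Q"
  then have "pdec (\<lambda>w A v. \<not> (\<not> P w A v \<and> \<not> Q w A v))" by (intro pdec_not pdec_conj)
  then show ?thesis by simp
qed

lemma pdec_imp: "pdec P \<Longrightarrow> pdec Q \<Longrightarrow> pdec (\<lambda>w A v. P w A v \<longrightarrow> Q w A v)"
proof -
  assume "pdec P" "pdec Q"
  then have "pdec (\<lambda>w A v. \<not> P w A v \<or> Q w A v)" by (intro pdec_not pdec_disj)
  then show ?thesis by (simp only: imp_conv_disj)
qed

lemma pdec_iff: "pdec P \<Longrightarrow> pdec Q \<Longrightarrow> pdec (\<lambda>w A v. P w A v \<longleftrightarrow> Q w A v)"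
proof -
  assume "pdec P" "pdec Q"
  then have "pdec (\<lambda>w A v. (P w A v \<longrightarrow> Q w A v) \<and> (Q w A v \<longrightarrow> P w A v))" by (intro pdec_imp pdec_conj)
  then show ?thesis unfolding iff_conv_conj_imp .
qed

lemma pdec_le: "pcomp f \<Longrightarrow> pcomp g \<Longrightarrow> pdec (\<lambda>w A v. f w A v \<le> g w A v)"
proof -
  assume "pcomp f" "pcomp g"
  then have "pdec (\<lambda>w A v. \<not> (g w A v < f w A v))" by (intro pdec_not pdec_less)
  then show ?thesis by (simp only: not_less)
qed

lemma pdec_eq: "pcomp f \<Longrightarrow> pcomp g \<Longrightarrow> pdec (\<lambda>w A v. f w A v = g w A v)"
proof -
  assume "pcomp f" "pcomp g"
  then have "pdec (\<lambda>w A v. f w A v \<le> g w A v \<and> g w A v \<le> f w A v)" by (intro pdec_conj pdec_le)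
  then show ?thesis unfolding eq_iff .
qed

lemma pcomp_if: "pdec P \<Longrightarrow> pcomp f \<Longrightarrow> pcomp g \<Longrightarrow> pcomp (\<lambda>w A v. if P w A v then f w A v else g w A v)"
proof -
  assume "pdec P" "pcomp f" "pcomp g"
  then have "pcomp (\<lambda>w A v. of_bool (P w A v) * f w A v + of_bool (\<not> P w A v) * g w A v)"
    by (intro pcomp_add pcomp_mult pcomp_of_bool pdec_not)
  moreover have "of_bool (P w A v) * f w A v + of_bool (\<not> P w A v) * g w A v =
    (if P w A v then f w A v else g w A v)" for w A v by simp
  ultimately show ?thesis by simp
qed

lemma pdec_if: "pdec P \<Longrightarrow> pdec Q \<Longrightarrow> pdec R \<Longrightarrow> pdec (\<lambda>w A v. if P w A v then Q w A v else R w A v)"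
proof -
  assume "pdec P" "pdec Q" "pdec R"
  then have "pdec (\<lambda>w A v. (P w A v \<longrightarrow> Q w A v) \<and> (\<not> P w A v \<longrightarrow> R w A v))" by (intro pdec_conj pdec_imp pdec_not)
  then show ?thesis unfolding if_bool_eq_conj .
qed

lemma pdec_rename: "pdec P \<Longrightarrow> pdec (\<lambda>w A v. P w A (\<lambda>j. v (\<pi> j)))"
  unfolding pdec_def by (rule pcomp_rename)

section \<open>Bounded counting, quantifiers and substitution\<close>

lemma card_less_Suc:
  "card {i. i < Suc k \<and> P i} = card {i. i < k \<and> P i} + of_bool (P k)"
proof -
  have "{i. i < Suc k \<and> P i} = (if P k then insert k {i. i < k \<and> P i} else {i. i < k \<and> P i})"
    by (auto simp: less_Suc_eq)
  then show ?thesis by simp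
qed

text \<open>Counting is an iteration whose accumulator never exceeds the number of rounds. Bounded
  quantifiers and division are derived from it.\<close>

lemma pcomp_card:
  assumes n: "pcomp n" and P: "pdec (\<lambda>w A v. P w A (\<lambda>j. v (Suc j)) (v 0))"
  shows "pcomp (\<lambda>w A v. card {i. i < n w A v \<and> P w A v i})"
proof -
  let ?H = "\<lambda>w A v i acc. acc + of_bool (P w A v i)"
  have eq: "rec_nat 0 (?H w A v) k = card {i. i < k \<and> P w A v i}" for w A v k
    by (induction k) (auto simp: card_less_Suc)
  have le: "card {i. i < k \<and> P w A v i} \<le> k" for w A v k
    using card_mono[of "{..<k}" "{i. i < k \<and> P w A v i}"] by auto
  have "pdec (\<lambda>w A v. P w A (\<lambda>j. v (Suc (Suc j))) (v 0))"
    using pdec_rename[OF P, of "case_nat 0 (\<lambda>j. Suc (Suc j))"] by simp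
  then have "pcomp (\<lambda>w A v. rec_nat 0 (?H w A v) (n w A v))"
    by (intro pcomp_iter[OF pcomp_const n n] pcomp_add pcomp_var pcomp_of_bool)
      (assumption, unfold eq, rule le_trans[OF le])
  then show ?thesis by (simp add: eq)
qed

lemma pdec_bex:
  assumes n: "pcomp n" and P: "pdec (\<lambda>w A v. P w A (\<lambda>j. v (Suc j)) (v 0))"
  shows "pdec (\<lambda>w A v. \<exists>i < n w A v. P w A v i)"
proof -
  have "card {i. i < n w A v \<and> P w A v i} > 0 \<longleftrightarrow> (\<exists>i < n w A v. P w A v i)" for w A v
    by (subst card_gt_0_iff) auto
  then show ?thesis using pdec_less[OF pcomp_const[of 0] pcomp_card[OF assms]] by simp
qed

lemma pdec_ball:
  assumes n: "pcomp n" and P: "pdec (\<lambda>w A v. P w A (\<lambda>j. v (Suc j)) (v 0))"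
  shows "pdec (\<lambda>w A v. \<forall>i < n w A v. P w A v i)"
proof -
  have "pdec (\<lambda>w A v. \<not> (\<exists>i < n w A v. \<not> P w A v i))" by (intro pdec_not pdec_bex n P)
  then show ?thesis by simp
qed

text \<open>Substitution for the first \<open>k\<close> variables by \<open>k\<close> nested uses of
  \<open>pcomp_let\<close>. Each use shifts the environment, hence the renamings to
  \<open>v (Suc j)\<close>.\<close>

lemma pcomp_subst:
  assumes "pcomp F" "\<And>i. i < k \<Longrightarrow> pcomp (g i)"
  shows "pcomp (\<lambda>w A v. F w A (\<lambda>i. if i < k then g i w A v else v (i - k)))"
  using assms(2)
proof (induction k arbitrary: g)
  case 0
  then show ?case using assms(1) by simp
next
  case (Suc k)
  have "pcomp (\<lambda>w A v. g i w A (\<lambda>j. v (Suc j)))" if "i < k" for i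
    by (rule pcomp_rename[OF Suc.prems]) (use that in simp)
  from Suc.IH[of "\<lambda>i w A v. g i w A (\<lambda>j. v (Suc j))", OF this]
  have "pcomp (\<lambda>w A v. F w A (\<lambda>i. if i < k then g i w A (\<lambda>j. v (Suc j)) else v (i - k)))" .
  moreover have "(\<lambda>i. if i < k then g i w A (\<lambda>j. v (Suc j)) else v (i - k)) =
      (\<lambda>i. if i < k then g i w A (\<lambda>j. v (Suc j)) else case_nat (v 0) (\<lambda>j. v (Suc j)) (i - k))" for w A v
    by (auto simp: fun_eq_iff split: nat.splits intro!: arg_cong[of _ _ v])
  ultimately have "pcomp (\<lambda>w A v. F w A (\<lambda>i. if i < k then g i w A (\<lambda>j. v (Suc j)) else case_nat (v 0) (\<lambda>j. v (Suc j)) (i - k)))"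
    by simp
  from pcomp_let[OF Suc.prems[of k], where G = "\<lambda>w A x u. F w A (\<lambda>i. if i < k then g i w A u else case_nat x u (i - k))", OF _ this]
  have "pcomp (\<lambda>w A v. F w A (\<lambda>i. if i < k then g i w A v else case_nat (g k w A v) v (i - k)))" by simp
  moreover have "(\<lambda>i. if i < k then g i w A v else case_nat (g k w A v) v (i - k)) =
      (\<lambda>i. if i < Suc k then g i w A v else v (i - Suc k))" for w A v
    by (auto simp: fun_eq_iff less_Suc_eq split: nat.splits intro!: arg_cong[of _ _ v])
  ultimately show ?case by simp
qed

text \<open>The \<open>app\<close> rules reduce computability at computed arguments to computability
  at plain variables. They serve predicates with bounded quantifiers: under the binder the
  environment is shifted, which a variable survives by renaming but an arbitrary argument does
  not.\<close>

lemma pcomp_app1: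
  assumes "pcomp (\<lambda>w A v. G w A (v 0))" "pcomp g0"
  shows "pcomp (\<lambda>w A v. G w A (g0 w A v))"
  using pcomp_subst[OF assms(1), of 1 "\<lambda>_. g0"] assms by simp

lemma pcomp_app2:
  assumes "pcomp (\<lambda>w A v. G w A (v 0) (v 1))" "pcomp g0" "pcomp g1"
  shows "pcomp (\<lambda>w A v. G w A (g0 w A v) (g1 w A v))"
proof -
  have "pcomp ([g0, g1] ! i)" if "i < 2" for i
    using that assms(2-) by (auto simp: less_Suc_eq numeral_eq_Suc)
  from pcomp_subst[OF assms(1), of 2 "\<lambda>i. [g0, g1] ! i", OF this] show ?thesis by (simp add: numeral_eq_Suc)
qed

lemma pcomp_app3:
  assumes "pcomp (\<lambda>w A v. G w A (v 0) (v 1) (v 2))" "pcomp g0" "pcomp g1" "pcomp g2"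
  shows "pcomp (\<lambda>w A v. G w A (g0 w A v) (g1 w A v) (g2 w A v))"
proof -
  have "pcomp ([g0, g1, g2] ! i)" if "i < 3" for i
    using that assms(2-) by (auto simp: less_Suc_eq numeral_eq_Suc)
  from pcomp_subst[OF assms(1), of 3 "\<lambda>i. [g0, g1, g2] ! i", OF this] show ?thesis by (simp add: numeral_eq_Suc)
qed

lemma pcomp_app4:
  assumes "pcomp (\<lambda>w A v. G w A (v 0) (v 1) (v 2) (v 3))" "pcomp g0" "pcomp g1" "pcomp g2" "pcomp g3"
  shows "pcomp (\<lambda>w A v. G w A (g0 w A v) (g1 w A v) (g2 w A v) (g3 w A v))"
proof -
  have "pcomp ([g0, g1, g2, g3] ! i)" if "i < 4" for i
    using that assms(2-) by (auto simp: less_Suc_eq numeral_eq_Suc)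
  from pcomp_subst[OF assms(1), of 4 "\<lambda>i. [g0, g1, g2, g3] ! i", OF this] show ?thesis by (simp add: numeral_eq_Suc)
qed

lemma pcomp_app5:
  assumes "pcomp (\<lambda>w A v. G w A (v 0) (v 1) (v 2) (v 3) (v 4))" "pcomp g0" "pcomp g1" "pcomp g2" "pcomp g3" "pcomp g4"
  shows "pcomp (\<lambda>w A v. G w A (g0 w A v) (g1 w A v) (g2 w A v) (g3 w A v) (g4 w A v))"
proof -
  have "pcomp ([g0, g1, g2, g3, g4] ! i)" if "i < 5" for i
    using that assms(2-) by (auto simp: less_Suc_eq numeral_eq_Suc)
  from pcomp_subst[OF assms(1), of 5 "\<lambda>i. [g0, g1, g2, g3, g4] ! i", OF this] show ?thesis by (simp add: numeral_eq_Suc)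
qed

text \<open>The quotient is the number of positive multiples of the divisor up to the dividend,
  which is a bounded count. Division by 0 yields 0 and is a case of its own.\<close>

lemma pcomp_div:
  assumes "pcomp f" "pcomp g"
  shows "pcomp (\<lambda>w A v. f w A v div g w A v)"
proof -
  have eq: "(if b = 0 then 0 else card {i. i < a \<and> Suc i * b \<le> a}) = a div b" for a b :: nat
  proof (cases "b = 0")
    case False
    then have "Suc i * b \<le> a \<longleftrightarrow> i < a div b" for i
      by (metis Suc_le_eq bot_nat_0.not_eq_extremum less_eq_div_iff_mult_less_eq)
    then have "{i. i < a \<and> Suc i * b \<le> a} = {..<a div b}"
      using div_le_dividend[of a b] by (auto intro: less_le_trans)
    then show ?thesis using False by simp
  qed simp
  have "pcomp (\<lambda>w A v. if v 1 = 0 then 0 else card {i. i < v 0 \<and> Suc i * v 1 \<le> v 0})"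
    unfolding Suc_eq_plus1
    by (intro pcomp_if pdec_eq pcomp_card pdec_le pcomp_mult pcomp_add pcomp_var pcomp_const)
  from pcomp_app2[OF this[unfolded eq] assms] show ?thesis .
qed

lemma pcomp_mod: "pcomp f \<Longrightarrow> pcomp g \<Longrightarrow> pcomp (\<lambda>w A v. f w A v mod g w A v)"
  unfolding minus_mult_div_eq_mod[symmetric] by (intro pcomp_sub pcomp_mult pcomp_div)

definition shift :: "token list \<Rightarrow> nat \<Rightarrow> nat \<Rightarrow> nat" where
  "shift w a k = a div Qd w ^ k"

definition dig :: "token list \<Rightarrow> nat \<Rightarrow> nat \<Rightarrow> nat" where
  "dig w a i = shift w a i mod Qd w"

text \<open>The power \<open>Qd w ^ k\<close> may leave every polynomial bound, so it is never
  computed: dividing \<open>k\<close> times keeps all intermediate values below the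
  dividend.\<close>

lemma pcomp_shift:
  assumes "pcomp f" "pcomp g"
  shows "pcomp (\<lambda>w A v. shift w (f w A v) (g w A v))"
proof -
  have eq: "rec_nat a (\<lambda>i acc. acc div Qd w) k = shift w a k" for w a k
    by (induction k) (auto simp: shift_def div_mult2_eq[symmetric] mult.commute)
  have "pcomp (\<lambda>w A v. rec_nat (v 0) (\<lambda>i acc. acc div Qd w) (v 1))"
    by (rule pcomp_iter[where cap = "\<lambda>w A v. v 0"])
      (intro pcomp_var pcomp_div pcomp_Qd | simp add: eq shift_def)+
  from pcomp_app2[OF this[unfolded eq] assms] show ?thesis .
qed

lemma pcomp_dig: "pcomp f \<Longrightarrow> pcomp g \<Longrightarrow> pcomp (\<lambda>w A v. dig w (f w A v) (g w A v))"
  unfolding dig_def by (intro pcomp_mod pcomp_shift pcomp_Qd)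

lemma pcomp_Suc: "pcomp f \<Longrightarrow> pcomp (\<lambda>w A v. Suc (f w A v))"
  unfolding Suc_eq_plus1 by (intro pcomp_add pcomp_const)

lemmas pcomp_intros = pcomp_var pcomp_const pcomp_Bd pcomp_Qd pcomp_length pcomp_add pcomp_sub
  pcomp_mult pcomp_div pcomp_mod pcomp_if pcomp_dig pcomp_shift pcomp_card pcomp_Suc pcomp_of_bool
  pdec_array pdec_istok pdec_less pdec_le pdec_eq pdec_not pdec_conj pdec_disj pdec_imp pdec_iff
  pdec_if pdec_bex pdec_ball

lemma pdec_app1:
  assumes "pdec (\<lambda>w A v. G w A (v 0))" "pcomp g0"
  shows "pdec (\<lambda>w A v. G w A (g0 w A v))"
  using assms unfolding pdec_def by (rule pcomp_app1)

lemma pdec_app2: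
  assumes "pdec (\<lambda>w A v. G w A (v 0) (v 1))" "pcomp g0" "pcomp g1"
  shows "pdec (\<lambda>w A v. G w A (g0 w A v) (g1 w A v))"
  using assms unfolding pdec_def by (rule pcomp_app2)

lemma pdec_app3:
  assumes "pdec (\<lambda>w A v. G w A (v 0) (v 1) (v 2))" "pcomp g0" "pcomp g1" "pcomp g2"
  shows "pdec (\<lambda>w A v. G w A (g0 w A v) (g1 w A v) (g2 w A v))"
  using assms unfolding pdec_def by (rule pcomp_app3)

lemma pdec_app4:
  assumes "pdec (\<lambda>w A v. G w A (v 0) (v 1) (v 2) (v 3))" "pcomp g0" "pcomp g1" "pcomp g2" "pcomp g3"
  shows "pdec (\<lambda>w A v. G w A (g0 w A v) (g1 w A v) (g2 w A v) (g3 w A v))"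
  using assms unfolding pdec_def by (rule pcomp_app4)

lemma pdec_app5:
  assumes "pdec (\<lambda>w A v. G w A (v 0) (v 1) (v 2) (v 3) (v 4))" "pcomp g0" "pcomp g1" "pcomp g2" "pcomp g3" "pcomp g4"
  shows "pdec (\<lambda>w A v. G w A (g0 w A v) (g1 w A v) (g2 w A v) (g3 w A v) (g4 w A v))"
  using assms unfolding pdec_def by (rule pcomp_app5)

section \<open>Fixed points in exponential time\<close>

text \<open>One pass that already sees its own earlier updates. Bits are only ever set, so the pass
  can work in place on the single array tape, and no instruction to clear a bit is required.\<close>

primrec sweep :: "((nat \<Rightarrow> bool) \<Rightarrow> nat \<Rightarrow> bool) \<Rightarrow> nat \<Rightarrow> (nat \<Rightarrow> bool) \<Rightarrow> nat \<Rightarrow> bool" where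
  "sweep F 0 A = A"
| "sweep F (Suc k) A = (if F (sweep F k A) k then (sweep F k A)(k := True) else sweep F k A)"

definition fixpoint :: "((nat \<Rightarrow> bool) \<Rightarrow> nat \<Rightarrow> bool) \<Rightarrow> nat \<Rightarrow> nat \<Rightarrow> bool" where
  "fixpoint F N = (sweep F N ^^ N) (\<lambda>_. False)"

lemma sweep_inc: "A i \<Longrightarrow> sweep F k A i"
  by (induction k) auto

text \<open>Bits only grow, so a sweep without net effect changes nothing in between either; at
  every index \<open>F\<close> was therefore evaluated on \<open>A\<close> itself.\<close>

lemma sweep_stable: "sweep F k A = A \<Longrightarrow> i < k \<Longrightarrow> F A i \<Longrightarrow> A i"
proof (induction k)
  case (Suc k)
  have "sweep F k A = A"
  proof
    fix j
    have "sweep F k A j \<longrightarrow> sweep F (Suc k) A j" by simp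
    then show "sweep F k A j = A j" using Suc.prems(1) sweep_inc[of A j F k] by metis
  qed
  then show ?case using Suc by (auto simp: less_Suc_eq split: if_splits) (metis fun_upd_same)
qed simp

lemma sweep_outside: "k \<le> i \<Longrightarrow> sweep F k A i = A i"
  by (induction k) auto

text \<open>A sweep that changes the array sets at least one more of \<open>N\<close> bits, so one
  of the first \<open>N + 1\<close> sweeps changes nothing. From there on the array is stable, and
  stability means that \<open>F\<close> has nothing left to add.\<close>

lemma fixpoint_closed:
  assumes "i < N" "F (fixpoint F N) i"
  shows "fixpoint F N i"
proof -
  define A where "A = (\<lambda>t. (sweep F N ^^ t) (\<lambda>_. False))"
  have A0: "A 0 = (\<lambda>_. False)" and AS: "A (Suc t) = sweep F N (A t)" for t by (simp_all add: A_def)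
  have inc: "A t j \<Longrightarrow> A (Suc t) j" for t j by (simp add: AS sweep_inc)
  have out: "A t j \<Longrightarrow> j < N" for t j
    by (induction t) (auto simp: A0 AS, metis not_le sweep_outside)
  have fin: "finite {j. A t j}" for t
    by (rule finite_subset[of _ "{..<N}"]) (use out in auto)
  have "(\<exists>s \<le> t. A (Suc s) = A s) \<or> t + 1 \<le> card {j. A (Suc t) j}" for t
  proof (induction t)
    case 0
    show ?case
    proof (cases "A (Suc 0) = A 0")
      case False
      then obtain j where "A (Suc 0) j" by (auto simp: A0)
      then have "card {j. A (Suc 0) j} > 0" using fin by (auto simp: card_gt_0_iff)
      then show ?thesis by simp
    qed auto
  next
    case (Suc t)
    show ?case
    proof (cases "\<exists>s \<le> Suc t. A (Suc s) = A s")
      case False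
      then have "t + 1 \<le> card {j. A (Suc t) j}" "A (Suc (Suc t)) \<noteq> A (Suc t)"
        using Suc by (auto dest: le_SucI)
      moreover from this(2) have "{j. A (Suc t) j} \<subset> {j. A (Suc (Suc t)) j}"
        using inc[of "Suc t"] by (auto simp: fun_eq_iff)
      then have "card {j. A (Suc t) j} < card {j. A (Suc (Suc t)) j}" by (rule psubset_card_mono[OF fin])
      ultimately show ?thesis by simp
    qed auto
  qed
  moreover have "card {j. A (Suc N) j} \<le> N"
    using card_mono[of "{..<N}" "{j. A (Suc N) j}"] out by auto
  ultimately obtain s where s: "s \<le> N" "A (Suc s) = A s" by (metis Suc_eq_plus1 not_less_eq_eq)
  have "A (s + k) = A s" for k by (induction k) (use s(2) AS in auto)
  from this[of "N - s"] s have AN: "A N = A s" by simp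
  then have "sweep F N (A N) = A N" using s(2) AS by metis
  then show ?thesis using sweep_stable assms unfolding fixpoint_def A_def by blast
qed

text \<open>Leastness as an invariance principle. Closure is required for every array inside
  \<open>I\<close>, because \<open>F\<close> is evaluated on arrays in the middle of a
  sweep.\<close>

lemma fixpoint_least:
  assumes "\<And>A i. (\<And>j. A j \<Longrightarrow> j \<in> I) \<Longrightarrow> i < N \<Longrightarrow> F A i \<Longrightarrow> i \<in> I"
  shows "fixpoint F N i \<Longrightarrow> i \<in> I"
proof -
  have sw: "(\<And>j. A j \<Longrightarrow> j \<in> I) \<Longrightarrow> k \<le> N \<Longrightarrow> sweep F k A j \<Longrightarrow> j \<in> I" for A k j
  proof (induction k arbitrary: j)
    case (Suc k)
    have IH: "sweep F k A j \<Longrightarrow> j \<in> I" for j using Suc by simp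
    then show ?case using Suc.prems assms[of "sweep F k A" k] by (auto split: if_splits)
  qed simp
  have "(sweep F N ^^ t) (\<lambda>_. False) j \<Longrightarrow> j \<in> I" for t j
    by (induction t arbitrary: j) (use sw in auto)
  then show "fixpoint F N i \<Longrightarrow> i \<in> I" unfolding fixpoint_def by blast
qed

section \<open>Computing the bounds and the fixed point\<close>

lemma Qd_bounds: "length w < Qd w" "4 \<le> Qd w" "2 ^ length w < Qd w"
proof -
  show "4 \<le> Qd w" by (simp add: Qd_def)
  have "(2::nat) ^ length w < 2 ^ (length w + 1)" by simp
  also have "\<dots> \<le> Qd w" unfolding Qd_def by (rule power_mono) auto
  finally show *: "2 ^ length w < Qd w" .
  have "length w < 2 ^ length w" by (rule less_exp)
  then show "length w < Qd w" using * by linarith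
qed

lemma Qd_le_Bd: "Qd w \<le> Bd w"
  unfolding Bd_def using Qd_bounds(2)[of w] by (intro self_le_power) auto

lemma exponent_le_Bd: "8 * (length w + 1) ^ 3 \<le> Bd w"
proof -
  let ?e = "8 * (length w + 1) ^ 3"
  have "?e < 2 ^ ?e" by (rule less_exp)
  also have "\<dots> \<le> Qd w ^ ?e" using Qd_bounds(2)[of w] by (intro power_mono) auto
  finally show ?thesis by (simp add: Bd_def)
qed

text \<open>As \<open>r y\<close> is positive, the partial products increase, so the bound on the
  final power covers all of them.\<close>

lemma runs_pow:
  assumes "distinct [x, y, z, s, t]" "r s = 0" "r t = 0" "r y \<le> M" "r z \<le> M" "0 < r y"
    "r x * r y ^ r z \<le> M"
  shows "runs w (For z (mulp x y s t)) (r, A) (r(x := r x * r y ^ r z, z := 0), A)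
    (M * (M * (14 * M + 8) + 6 * M * M + 3 + 5) + 1)"
proof (rule runs_For'[where S = "\<lambda>k. r(x := r x * r y ^ k)" and A' = "\<lambda>_. A" and N = "r z" and
      T = "M * (14 * M + 8) + 6 * M * M + 3"])
  fix k assume k: "k < r z"
  let ?r = "r(x := r x * r y ^ k, z := r z - Suc k)"
  have "r x * r y ^ k \<le> r x * r y ^ r z"
    using k assms by (intro mult_left_mono power_increasing) auto
  then have "r x * r y ^ k \<le> M" using assms(7) by (rule le_trans)
  then have "?r x \<le> M" using assms(1) by simp
  moreover have "?r(x := ?r x * ?r y) = r(x := r x * r y ^ Suc k, z := r z - Suc k)"
    using assms by (auto simp: fun_eq_iff)
  moreover have "?r s = 0" "?r t = 0" "?r y \<le> M" using assms by auto
  ultimately show "runs w (mulp x y s t) (r(x := r x * r y ^ k, z := r z - Suc k), A)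
      (r(x := r x * r y ^ Suc k, z := r z - Suc k), A) (M * (14 * M + 8) + 6 * M * M + 3)"
    using runs_mulp[of x y s t ?r M w A] assms(1) by (metis distinct_length_2_or_more distinct_singleton)
next
  have "r z * (M * (14 * M + 8) + 6 * M * M + 3 + 5) \<le> M * (M * (14 * M + 8) + 6 * M * M + 3 + 5)"
    using assms by (intro mult_right_mono) auto
  then show "r z * (M * (14 * M + 8) + 6 * M * M + 3 + 5) + 1 \<le> M * (M * (14 * M + 8) + 6 * M * M + 3 + 5) + 1"
    by simp
qed (use assms in \<open>auto simp: fun_eq_iff\<close>)

text \<open>The length is counted twice: register 4 keeps it, and register 5 is spent on bringing
  the input head back.\<close>

lemma runs_scan:
  "runs w (While (TSym (- {Blank})) (Seq (Act (AInc 0)) (Seq (Act (AInc 4)) (Act (AInc 5))))) (\<lambda>_. 0, A)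
    ((\<lambda>_. 0)(0 := length w, 4 := length w, 5 := length w), A) (length w * 7 + 1)"
proof -
  let ?b = "Seq (Act (AInc 0)) (Seq (Act (AInc 4)) (Act (AInc 5)))"
  define R :: "nat \<Rightarrow> nat \<Rightarrow> nat \<Rightarrow> nat \<Rightarrow> nat" where
    "R = (\<lambda>a b c. (\<lambda>_. 0)(0 := a, 4 := b, 5 := c))"
  have "runs w (While (TSym (- {Blank})) ?b) (R (length w - j) (length w - j) (length w - j), A)
      (R (length w) (length w) (length w), A) (j * 7 + 1)" if "j \<le> length w" for j
    using that
  proof (induction j)
    case 0
    show ?case unfolding diff_zero mult_0 add_0
      by (rule runs_While_end) (simp add: R_def input_tape_def)
  next
    case (Suc j)
    define k where "k = length w - Suc j"
    have k: "length w - j = Suc k" "k < length w" "length w - Suc j = k" using Suc.prems by (auto simp: k_def)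
    have u: "(R k k k)(0 := Suc (R k k k 0)) = R (Suc k) k k"
      "(R (Suc k) k k)(4 := Suc (R (Suc k) k k 4)) = R (Suc k) (Suc k) k"
      "(R (Suc k) (Suc k) k)(5 := Suc (R (Suc k) (Suc k) k 5)) = R (Suc k) (Suc k) (Suc k)"
      by (auto simp: R_def fun_eq_iff)
    have 1: "runs w (Act (AInc 0)) (R k k k, A) (R (Suc k) k k, A) 1"
      using runs_Inc[of w 0 "R k k k" A] unfolding u .
    have 2: "runs w (Act (AInc 4)) (R (Suc k) k k, A) (R (Suc k) (Suc k) k, A) 1"
      using runs_Inc[of w 4 "R (Suc k) k k" A] unfolding u .
    have 3: "runs w (Act (AInc 5)) (R (Suc k) (Suc k) k, A) (R (Suc k) (Suc k) (Suc k), A) 1"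
      using runs_Inc[of w 5 "R (Suc k) (Suc k) k" A] unfolding u .
    have IH: "runs w (While (TSym (- {Blank})) ?b) (R (Suc k) (Suc k) (Suc k), A)
      (R (length w) (length w) (length w), A) (j * 7 + 1)"
      using Suc.IH[OF Suc_leD[OF Suc.prems]] unfolding k .
    have h: "holds w (emb (R k k k, A)) (TSym (- {Blank}))"
      using k by (simp add: R_def input_tape_def)
    show ?case unfolding k(3)
      by (rule runs_mono[OF runs_While[OF h runs_Seq[OF 1 runs_Seq[OF 2 3]] IH]]) simp
  qed
  from this[of "length w"] have "runs w (While (TSym (- {Blank})) ?b) (R 0 0 0, A)
      (R (length w) (length w) (length w), A) (length w * 7 + 1)" by simp
  moreover have "R 0 0 0 = (\<lambda>_. 0)" by (auto simp: R_def fun_eq_iff)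
  ultimately show ?thesis unfolding R_def by simp
qed

definition start :: "token list \<Rightarrow> nat \<Rightarrow> nat" where
  "start w = (\<lambda>_. 0)(2 := Bd w, 3 := Qd w, 4 := length w)"

lemma pre_start: "pre w (start w) (Bd w) 5"
  unfolding pre_def start_def using Qd_bounds(1)[of w] Qd_le_Bd[of w] by auto

lemma preparation:
  obtains p T where "wf p" "pbd T" "\<And>w A. runs w p (\<lambda>_. 0, A) (start w, A) (T (Bd w))"
proof -
  let ?inc = "\<lambda>a k. ((Seq (Act (AInc a))) ^^ k) Skip"
  let ?scan = "While (TSym (- {Blank})) (Seq (Act (AInc 0)) (Seq (Act (AInc 4)) (Act (AInc 5))))"
  \<comment> \<open>The list builds 4^(n + 1) in register 3, then 8 (n + 1)^3 in register 6 by three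
    multiplications with n + 1, and finally the power \<open>Bd w\<close> in register 2. Registers 8
    to 10 are scratch.\<close>
  let ?ps = "[?scan, For 5 (Act (ADec 0)), ?inc 6 4, ?inc 3 1, copy 4 7 8, ?inc 7 1,
     For 7 (mulp 3 6 9 10), zero 6, ?inc 6 8, copy 4 7 8, ?inc 7 1, ?inc 11 3,
     For 11 (mulp 6 7 9 10), zero 7, ?inc 2 1, For 6 (mulp 2 3 9 10)]"
  let ?p = "foldr Seq ?ps Skip"
  define P where "P = (\<lambda>M. M * (M * (14 * M + 8) + 6 * M * M + 3 + 5) + (1 :: nat))"
  define U where "U = (\<lambda>M. P M + 20 * M + 100)"
  have pbU: "pbd U" unfolding U_def P_def by (intro pbd_intros)
  have "wf (mulp 3 6 9 10)" "wf (mulp 6 7 9 10)" "wf (mulp 2 3 9 10)" by (auto intro!: wf_mulp)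
  moreover have "wf ?scan" by (rule wf_While[of 0]) (auto intro: wf_intros)
  ultimately have wfp: "wf ?p" unfolding foldr.simps comp_apply id_apply
    by (intro wf_intros wf_incs) auto
  have "runs w ?p (\<lambda>_. 0, A) (start w, A) (16 * (U (Bd w) + 1))" for w A
  proof -
    define n where "n = length w"
    define M where "M = Bd w"
    define R where "R = (\<lambda>a2 a3 a4 a5 a6 a7 a11 i :: nat. if i = 2 then a2 else if i = 3 then a3 else if i = 4 then a4
       else if i = 5 then a5 else if i = 6 then a6 else if i = 7 then a7 else if i = 11 then a11 else (0 :: nat))"
    have n: "n < M" "8 * (n + 1) ^ 3 \<le> M" "4 ^ (n + 1) \<le> M" "Bd w = (4 ^ (n + 1)) ^ (8 * (n + 1) ^ 3)"
      "Qd w = 4 ^ (n + 1)" "4 \<le> M"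
    proof -
      show "n < M" "4 \<le> M" using Qd_bounds(1,2)[of w] Qd_le_Bd[of w] by (simp_all add: M_def n_def)
      show "4 ^ (n + 1) \<le> M" "8 * (n + 1) ^ 3 \<le> M"
        using Qd_le_Bd[of w] exponent_le_Bd[of w] by (simp_all only: M_def n_def Qd_def)
    qed (simp_all only: n_def Qd_def Bd_def)
    have UM: "t \<le> U M" if "t \<le> P M + 20 * M + 100" for t using that by (simp add: U_def)
    have 1: "runs w ?scan (\<lambda>_. 0, A) ((\<lambda>_. 0)(0 := n, 4 := n, 5 := n), A) (U M)"
      by (rule runs_mono[OF runs_scan[of w A, folded n_def]]) (use n(1) in \<open>simp add: U_def\<close>)
    have 2: "runs w (For 5 (Act (ADec 0))) ((\<lambda>_. 0)(0 := n, 4 := n, 5 := n), A) (R 0 0 n 0 0 0 0, A) (U M)"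
    proof -
      have "((\<lambda>_. 0)(0 := n, 4 := n, 5 := n))(0 := 0, 5 := 0) = R 0 0 n 0 0 0 0"
        by (auto simp: R_def fun_eq_iff)
      then have "runs w (For 5 (Act (ADec 0))) ((\<lambda>_. 0)(0 := n, 4 := n, 5 := n), A) (R 0 0 n 0 0 0 0, A) (n * 6 + 1)"
        using runs_from_head[of 0 5 "(\<lambda>_. 0)(0 := n, 4 := n, 5 := n)" n w A] by simp
      then show ?thesis by (rule runs_mono) (use n in \<open>simp add: U_def\<close>)
    qed
    have incs: "runs w (?inc a k) (r, A) (r', A) (U M)" if "r(a := r a + k) = r'" "k \<le> 8" for a k r r'
      using runs_incs[where w = w and a = a and k = k and r = r and A = A] unfolding that(1)
      by (rule runs_mono) (use that(2) in \<open>simp add: U_def\<close>)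
    have 3: "runs w (?inc 6 4) (R 0 0 n 0 0 0 0, A) (R 0 0 n 0 4 0 0, A) (U M)"
      by (rule incs) (auto simp: R_def fun_eq_iff)
    have 4: "runs w (?inc 3 1) (R 0 0 n 0 4 0 0, A) (R 0 1 n 0 4 0 0, A) (U M)"
      by (rule incs) (auto simp: R_def fun_eq_iff)
    have cp: "runs w (copy 4 7 8) (r, A) (r', A) (U M)" if "r(7 := r 7 + r 4) = r'" "r 4 = n" "r 8 = 0" for r r'
    proof -
      have "runs w (copy 4 7 8) (r, A) (r', A) (n * 14 + 3)"
        using runs_copy[of 4 7 8 r w A] that(2,3) unfolding that(1) by simp
      then show ?thesis by (rule runs_mono) (use n in \<open>simp add: U_def\<close>)
    qed
    have 5: "runs w (copy 4 7 8) (R 0 1 n 0 4 0 0, A) (R 0 1 n 0 4 n 0, A) (U M)"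
      by (rule cp) (auto simp: R_def fun_eq_iff)
    have 6: "runs w (?inc 7 1) (R 0 1 n 0 4 n 0, A) (R 0 1 n 0 4 (n + 1) 0, A) (U M)"
      by (rule incs) (auto simp: R_def fun_eq_iff)
    have pw: "runs w (For z (mulp x y s t)) (r, A) (r', A) (U M)"
      if "r(x := r x * r y ^ r z, z := 0) = r'" "distinct [x, y, z, s, t]" "r s = 0" "r t = 0"
        "r y \<le> M" "r z \<le> M" "0 < r y" "r x * r y ^ r z \<le> M" for x y z s t r r'
      using runs_pow[OF that(2-8), of w A] unfolding that(1)
      by (rule runs_mono) (simp add: U_def P_def)
    have 7: "runs w (For 7 (mulp 3 6 9 10)) (R 0 1 n 0 4 (n + 1) 0, A) (R 0 (4 ^ (n + 1)) n 0 4 0 0, A) (U M)"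
      by (rule pw) (use n in \<open>auto simp: R_def fun_eq_iff\<close>)
    have zr: "runs w (zero a) (r, A) (r', A) (U M)" if "r(a := 0) = r'" "r a \<le> M" for a r r'
      using runs_zero[of w a r A] unfolding that(1)
      by (rule runs_mono) (use that(2) in \<open>simp add: U_def\<close>)
    have 8: "runs w (zero 6) (R 0 (4 ^ (n + 1)) n 0 4 0 0, A) (R 0 (4 ^ (n + 1)) n 0 0 0 0, A) (U M)"
      by (rule zr) (use n in \<open>auto simp: R_def fun_eq_iff\<close>)
    have 9: "runs w (?inc 6 8) (R 0 (4 ^ (n + 1)) n 0 0 0 0, A) (R 0 (4 ^ (n + 1)) n 0 8 0 0, A) (U M)"
      by (rule incs) (auto simp: R_def fun_eq_iff)
    have 10: "runs w (copy 4 7 8) (R 0 (4 ^ (n + 1)) n 0 8 0 0, A) (R 0 (4 ^ (n + 1)) n 0 8 n 0, A) (U M)"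
      by (rule cp) (auto simp: R_def fun_eq_iff)
    have 11: "runs w (?inc 7 1) (R 0 (4 ^ (n + 1)) n 0 8 n 0, A) (R 0 (4 ^ (n + 1)) n 0 8 (n + 1) 0, A) (U M)"
      by (rule incs) (auto simp: R_def fun_eq_iff)
    have 12: "runs w (?inc 11 3) (R 0 (4 ^ (n + 1)) n 0 8 (n + 1) 0, A) (R 0 (4 ^ (n + 1)) n 0 8 (n + 1) 3, A) (U M)"
      by (rule incs) (auto simp: R_def fun_eq_iff)
    have 13: "runs w (For 11 (mulp 6 7 9 10)) (R 0 (4 ^ (n + 1)) n 0 8 (n + 1) 3, A)
        (R 0 (4 ^ (n + 1)) n 0 (8 * (n + 1) ^ 3) (n + 1) 0, A) (U M)"
      by (rule pw) (use n in \<open>auto simp: R_def fun_eq_iff\<close>)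
    have 14: "runs w (zero 7) (R 0 (4 ^ (n + 1)) n 0 (8 * (n + 1) ^ 3) (n + 1) 0, A)
        (R 0 (4 ^ (n + 1)) n 0 (8 * (n + 1) ^ 3) 0 0, A) (U M)"
      by (rule zr) (use n in \<open>auto simp: R_def fun_eq_iff\<close>)
    have 15: "runs w (?inc 2 1) (R 0 (4 ^ (n + 1)) n 0 (8 * (n + 1) ^ 3) 0 0, A)
        (R 1 (4 ^ (n + 1)) n 0 (8 * (n + 1) ^ 3) 0 0, A) (U M)"
      by (rule incs) (auto simp: R_def fun_eq_iff)
    have S: "start w = R M (4 ^ (n + 1)) n 0 0 0 0"
      by (auto simp: R_def fun_eq_iff start_def M_def n n_def)
    have 16: "runs w (For 6 (mulp 2 3 9 10)) (R 1 (4 ^ (n + 1)) n 0 (8 * (n + 1) ^ 3) 0 0, A) (start w, A) (U M)"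
      unfolding S
    proof (rule pw)
      have eq: "(4 ^ (n + 1)) ^ (8 * (n + 1) ^ 3) = M" using n(4) by (simp only: M_def)
      let ?r = "R 1 (4 ^ (n + 1)) n 0 (8 * (n + 1) ^ 3) 0 0"
      have v: "?r 2 = 1" "?r 3 = 4 ^ (n + 1)" "?r 6 = 8 * (n + 1) ^ 3" by (simp_all add: R_def)
      show "?r(2 := ?r 2 * ?r 3 ^ ?r 6, 6 := 0) = R M (4 ^ (n + 1)) n 0 0 0 0"
        unfolding v eq mult_1 by (auto simp: R_def fun_eq_iff)
      show "?r 2 * ?r 3 ^ ?r 6 \<le> M" unfolding v eq mult_1 ..
      show "?r 3 \<le> M" "?r 6 \<le> M" "0 < ?r 3" unfolding v by (simp_all only: n) simp
    qed (auto simp: R_def)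
    have end_: "runs w Skip (start w, A) (start w, A) 0" by (rule runs_Skip)
    show ?thesis unfolding foldr.simps comp_apply id_apply M_def[symmetric]
      by (rule runs_mono, rule runs_Seq[OF 1 runs_Seq[OF 2 runs_Seq[OF 3 runs_Seq[OF 4 runs_Seq[OF 5
        runs_Seq[OF 6 runs_Seq[OF 7 runs_Seq[OF 8 runs_Seq[OF 9 runs_Seq[OF 10 runs_Seq[OF 11
        runs_Seq[OF 12 runs_Seq[OF 13 runs_Seq[OF 14 runs_Seq[OF 15 runs_Seq[OF 16 end_]]]]]]]]]]]]]]]]) simp
  qed
  moreover have "pbd (\<lambda>M. 16 * (U M + 1))" using pbU by (intro pbd_intros)
  ultimately show ?thesis using wfp that[of ?p "\<lambda>M. 16 * (U M + 1)"] by blast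
qed

definition put :: prog where
  "put = Seq (For 7 (Seq (Act (AInc 1)) (Act (AInc 8)))) (Seq (Act ASet)
     (Seq (For 8 (Seq (Act (ADec 1)) (Act (AInc 7)))) Skip))"

lemma runs_put:
  assumes "r 1 = 0" "r 8 = 0" "r 7 \<le> M"
  shows "runs w put (r, A) (r, A(r 7 := True)) (16 * M + 7)"
proof -
  have 1: "runs w (For 7 (Seq (Act (AInc 1)) (Act (AInc 8)))) (r, A) (r(1 := r 7, 8 := r 7, 7 := 0), A) (M * 8 + 1)"
    using runs_to_head[of 1 7 r M w A] assms by simp
  have 2: "runs w (Act ASet) (r(1 := r 7, 8 := r 7, 7 := 0), A) (r(1 := r 7, 8 := r 7, 7 := 0), A(r 7 := True)) 1"
    using runs_Set[of w "r(1 := r 7, 8 := r 7, 7 := 0)" A] by simp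
  have 3: "runs w (For 8 (Seq (Act (ADec 1)) (Act (AInc 7)))) (r(1 := r 7, 8 := r 7, 7 := 0), A(r 7 := True))
      (r, A(r 7 := True)) (M * 8 + 1)"
  proof (rule runs_For'[where S = "\<lambda>k. r(1 := r 7 - k, 7 := k)" and A' = "\<lambda>_. A(r 7 := True)" and N = "r 7" and T = 3])
    fix k assume k: "k < r 7"
    define R where "R = (\<lambda>x y. r(1 := x, 7 := y, 8 := r 7 - Suc k))"
    have R: "(R (r 7 - k) k)(1 := r 7 - Suc k) = R (r 7 - Suc k) k" "R (r 7 - k) k 1 = Suc (r 7 - Suc k)"
      "(R (r 7 - Suc k) k)(7 := Suc (R (r 7 - Suc k) k 7)) = R (r 7 - Suc k) (Suc k)"
      using k by (auto simp: R_def fun_eq_iff)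
    have 1: "runs w (Act (ADec 1)) (R (r 7 - k) k, A(r 7 := True)) (R (r 7 - Suc k) k, A(r 7 := True)) 1"
      using runs_Dec[of "R (r 7 - k) k" 1 "r 7 - Suc k", OF R(2), of w "A(r 7 := True)"] unfolding R(1) .
    have 2: "runs w (Act (AInc 7)) (R (r 7 - Suc k) k, A(r 7 := True)) (R (r 7 - Suc k) (Suc k), A(r 7 := True)) 1"
      using runs_Inc[of w 7 "R (r 7 - Suc k) k" "A(r 7 := True)"] unfolding R(3) .
    show "runs w (Seq (Act (ADec 1)) (Act (AInc 7))) ((r(1 := r 7 - k, 7 := k))(8 := r 7 - Suc k), A(r 7 := True))
        ((r(1 := r 7 - Suc k, 7 := Suc k))(8 := r 7 - Suc k), A(r 7 := True)) 3"
      by (rule runs_Seq'[OF 1[unfolded R_def] 2[unfolded R_def]]) simp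
  qed (use assms in \<open>auto simp: fun_eq_iff\<close>)
  show ?thesis unfolding put_def
    by (rule runs_mono[OF runs_Seq[OF 1 runs_Seq[OF 2 runs_Seq[OF 3 runs_Skip[of w _ 0]]]]]) simp
qed

lemma wf_put: "wf put"
  unfolding put_def by (intro wf_intros) auto

text \<open>Register 5 counts sweeps and register 6 counts positions within a sweep. Loops count
  down while a sweep ascends, so the current index has its own register 7; register 8 receives the
  value of \<open>F\<close> there.\<close>

lemma fixpoint_program:
  assumes F: "pdec (\<lambda>w A v. F w A (v 0))" and G: "pdec (\<lambda>w A v. G w A)"
  obtains p T where "wf p" "pbd T"
    "\<And>w. runs w p (start w, \<lambda>_. False) ((start w)(5 := of_bool (G w (fixpoint (F w) (Bd w ^ 3)))),
       fixpoint (F w) (Bd w ^ 3)) (T (Bd w))"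
proof -
  have cube: "pcomp (\<lambda>w A v. Bd w ^ 3)"
    unfolding power3_eq_cube by (intro pcomp_mult pcomp_Bd)
  obtain p1 T1 where p1: "wf p1" "pbd T1" "evaluates p1 T1 (\<lambda>_. 2) 5 (\<lambda>w A v. Bd w ^ 3)"
    by (rule pcompE[OF cube, of "\<lambda>_. 2" 5]) auto
  obtain p2 T2 where p2: "wf p2" "pbd T2" "evaluates p2 T2 (\<lambda>_. 2) 6 (\<lambda>w A v. Bd w ^ 3)"
    by (rule pcompE[OF cube, of "\<lambda>_. 2" 6]) auto
  obtain p3 T3 where p3: "wf p3" "pbd T3" "evaluates p3 T3 (\<lambda>_. 7) 8 (\<lambda>w A v. of_bool (F w A (v 0)))"
    by (rule pcompE[OF F[unfolded pdec_def], of "\<lambda>_. 7" 8]) auto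
  obtain p4 T4 where p4: "wf p4" "pbd T4" "evaluates p4 T4 (\<lambda>_. 2) 5 (\<lambda>w A v. of_bool (G w A))"
    by (rule pcompE[OF G[unfolded pdec_def], of "\<lambda>_. 2" 5]) auto
  let ?b = "Seq p3 (Seq (If (TPos 8) (Seq (Act (ADec 8)) put) Skip) (Act (AInc 7)))"
  let ?o = "Seq p2 (Seq (For 6 ?b) (zero 7))"
  let ?p = "Seq p1 (Seq (For 5 ?o) p4)"
  define M1 where "M1 = (\<lambda>M :: nat. M + M ^ 3)"
  define W where "W = (\<lambda>M. T3 (M1 M) + (16 * M1 M + 7 + 3) + 1 + 3)"
  define V where "V = (\<lambda>M. T2 (M1 M) + (M1 M * (W M + 5) + 1) + (5 * M1 M + 1) + 2)"
  define U where "U = (\<lambda>M. T1 M + (M1 M * (V M + 5) + 1) + T4 M + 2)"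
  have pb1: "pbd M1" unfolding M1_def by (intro pbd_intros)
  have pbW: "pbd W" unfolding W_def by (intro pbd_add pbd_mult pbd_const pb1 pbd_comp[OF p3(2) pb1])
  have pbV: "pbd V" unfolding V_def by (intro pbd_add pbd_mult pbd_const pb1 pbd_comp[OF p2(2) pb1] pbW)
  have pbU: "pbd U" unfolding U_def by (intro pbd_add pbd_mult pbd_const pb1 pbV p1(2) p4(2))
  have wfp: "wf ?p" using p1 p2 p3 p4 wf_put
    by (intro wf_intros wf_If[of 9]) auto
  have "runs w ?p (start w, \<lambda>_. False) ((start w)(5 := of_bool (G w (fixpoint (F w) (Bd w ^ 3)))),
       fixpoint (F w) (Bd w ^ 3)) (U (Bd w))" for w
  proof -
    define M where "M = Bd w"
    define N where "N = Bd w ^ 3"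
    define s where "s = start w"
    have NM: "N \<le> M1 M" "M \<le> M1 M" "N = M ^ 3" by (simp_all add: M1_def N_def M_def)
    have s: "pre w s M 5" using pre_start by (simp add: s_def M_def)
    have e1: "runs w p1 (s, A) (s(5 := N), A) (T1 M)" for A
      using evaluatesD(1)[OF p1(3) s, of A] by (simp add: N_def)
    have s0: "s j = 0" if "5 \<le> j" for j using pre_free[OF s that] .
    have inner: "runs w ?o (s(5 := k), A) (s(5 := k), sweep (F w) N A) (V M)" if k: "k \<le> N" for k A
    proof -
      have pr: "pre w (s(5 := k)) (M1 M) 6"
        using pre_upd[OF s, of k "M1 M"] k NM by simp
      have e2: "runs w p2 (s(5 := k), A) (s(5 := k, 6 := N), A) (T2 (M1 M))"
        using evaluatesD(1)[OF p2(3) pr, of A] by (simp add: N_def)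
      let ?A = "\<lambda>i. sweep (F w) i A"
      have e3: "runs w (For 6 ?b) (s(5 := k, 6 := N), A) (s(5 := k, 7 := N, 6 := 0), ?A N) (M1 M * (W M + 5) + 1)"
      proof (rule runs_For'[where S = "\<lambda>i. s(5 := k, 7 := i)" and A' = ?A and N = N and T = "W M"])
        fix i assume i: "i < N"
        define R where "R = (\<lambda>x y. s(5 := k, 7 := x, 6 := N - Suc i, 8 := y))"
        have R0: "s(5 := k, 7 := x, 6 := N - Suc i) = R x 0" for x
          using s0[of 8] by (auto simp: R_def fun_eq_iff)
        have prR: "pre w (R i 0) (M1 M) 8"
          unfolding pre_def
        proof (intro conjI allI impI)
          fix j show "R i 0 j \<le> M1 M"
            using i k NM pre_le[OF s, of j] by (auto simp: R_def)
        qed (use s in \<open>auto simp: R_def pre_def\<close>)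
        define f where "f = F w (?A i) i"
        have Rup: "(R i 0)(8 := y) = R i y" "R i 0 7 = i" for y by (auto simp: R_def fun_eq_iff)
        have b1: "runs w p3 (R i 0, ?A i) (R i (of_bool f), ?A i) (T3 (M1 M))"
          using evaluatesD(1)[OF p3(3) prR, of "?A i"] unfolding f_def Rup .
        have b2: "runs w (If (TPos 8) (Seq (Act (ADec 8)) put) Skip) (R i (of_bool f), ?A i) (R i 0, ?A (Suc i)) (16 * M1 M + 7 + 2 + 1)"
        proof (rule runs_If, cases f)
          case True
          have "R i 1 8 = Suc 0" "(R i 1)(8 := 0) = R i 0" by (auto simp: R_def fun_eq_iff)
          then have d: "runs w (Act (ADec 8)) (R i 1, ?A i) (R i 0, ?A i) 1"
            using runs_Dec[of "R i 1" 8 0 w "?A i"] by simp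
          have "R i 0 1 = 0" "R i 0 8 = 0" "R i 0 7 \<le> M1 M" using prR by (auto simp: pre_def)
          from runs_put[OF this, of w "?A i"]
          have "runs w put (R i 0, ?A i) (R i 0, ?A (Suc i)) (16 * M1 M + 7)"
            using True by (simp add: f_def Rup)
          from runs_Seq[OF d this]
          have "runs w (Seq (Act (ADec 8)) put) (R i 1, ?A i) (R i 0, ?A (Suc i)) (16 * M1 M + 7 + 2)"
            by (rule runs_mono) simp
          moreover have "holds w (emb (R i 1, ?A i)) (TPos 8)" by (simp add: R_def)
          ultimately show "runs w (if holds w (emb (R i (of_bool f), ?A i)) (TPos 8) then Seq (Act (ADec 8)) put else Skip)
              (R i (of_bool f), ?A i) (R i 0, ?A (Suc i)) (16 * M1 M + 7 + 2)"
            using True by simp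
        next
          case False
          moreover have "\<not> holds w (emb (R i 0, ?A i)) (TPos 8)" by (simp add: R_def)
          moreover have "?A (Suc i) = ?A i" using False by (simp add: f_def)
          ultimately show "runs w (if holds w (emb (R i (of_bool f), ?A i)) (TPos 8) then Seq (Act (ADec 8)) put else Skip)
              (R i (of_bool f), ?A i) (R i 0, ?A (Suc i)) (16 * M1 M + 7 + 2)"
            by (simp add: runs_Skip)
        qed
        have "(R i 0)(7 := Suc (R i 0 7)) = R (Suc i) 0" by (auto simp: R_def fun_eq_iff)
        then have b3: "runs w (Act (AInc 7)) (R i 0, ?A (Suc i)) (R (Suc i) 0, ?A (Suc i)) 1"
          using runs_Inc[of w 7 "R i 0" "?A (Suc i)"] by simp
        show "runs w ?b ((s(5 := k, 7 := i))(6 := N - Suc i), ?A i) ((s(5 := k, 7 := Suc i))(6 := N - Suc i), ?A (Suc i)) (W M)"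
          unfolding R0 by (rule runs_mono[OF runs_Seq[OF b1 runs_Seq[OF b2 b3]]]) (simp add: W_def)
      next
        have "N * (W M + 5) \<le> M1 M * (W M + 5)" using NM by (intro mult_right_mono) auto
        then show "N * (W M + 5) + 1 \<le> M1 M * (W M + 5) + 1" by simp
      qed (use s0[of 7] in \<open>auto simp: fun_eq_iff\<close>)
      have "s(5 := k, 7 := N, 6 := 0, 7 := 0) = s(5 := k)" using s0[of 7] s0[of 6] by (auto simp: fun_eq_iff)
      moreover have "(s(5 := k, 7 := N, 6 := 0)) 7 = N" by simp
      ultimately have "runs w (zero 7) (s(5 := k, 7 := N, 6 := 0), ?A N) (s(5 := k), ?A N) (N * 5 + 1)"
        using runs_zero[of w 7 "s(5 := k, 7 := N, 6 := 0)" "?A N"] by metis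
      then have e4: "runs w (zero 7) (s(5 := k, 7 := N, 6 := 0), ?A N) (s(5 := k), ?A N) (5 * M1 M + 1)"
        by (rule runs_mono) (use NM in simp)
      show ?thesis by (rule runs_mono[OF runs_Seq[OF e2 runs_Seq[OF e3 e4]]]) (simp add: V_def)
    qed
    let ?B = "\<lambda>t. (sweep (F w) N ^^ t) (\<lambda>_. False)"
    have e2: "runs w (For 5 ?o) (s(5 := N), \<lambda>_. False) (s, fixpoint (F w) N) (M1 M * (V M + 5) + 1)"
    proof (rule runs_For'[where S = "\<lambda>_. s" and A' = ?B and N = N and T = "V M"])
      fix t assume "t < N"
      then show "runs w ?o (s(5 := N - Suc t), ?B t) (s(5 := N - Suc t), ?B (Suc t)) (V M)"
        using inner[of "N - Suc t" "?B t"] by simp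
    next
      have "N * (V M + 5) \<le> M1 M * (V M + 5)" using NM by (intro mult_right_mono) auto
      then show "N * (V M + 5) + 1 \<le> M1 M * (V M + 5) + 1" by simp
    qed (use s0[of 5] in \<open>auto simp: fun_eq_iff fixpoint_def\<close>)
    have e3: "runs w p4 (s, fixpoint (F w) N) (s(5 := of_bool (G w (fixpoint (F w) N))), fixpoint (F w) N) (T4 M)"
      using evaluatesD(1)[OF p4(3) s] .
    show ?thesis
      unfolding s_def[symmetric] M_def[symmetric] NM(3)[symmetric]
      by (rule runs_mono[OF runs_Seq[OF e1 runs_Seq[OF e2 e3]]]) (simp add: U_def)
  qed
  then show ?thesis using that wfp pbU by blast
qed

text \<open>Time polynomial in \<open>Bd w\<close> is exponential in the length of the input. The
  array has \<open>Bd w ^ 3\<close> entries because its indices encode triples of numbers below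
  \<open>Bd w\<close>.\<close>

theorem EXPTIME_by_fixpoint:
  fixes L :: "token list set"
  assumes F: "pdec (\<lambda>w A v. F w A (v 0))" and G: "pdec (\<lambda>w A v. G w A)"
    and L: "\<And>w. w \<in> L \<longleftrightarrow> G w (fixpoint (F w) (Bd w ^ 3))"
  shows "L \<in> EXPTIME"
proof -
  obtain p1 T1 where p1: "wf p1" "pbd T1" "\<And>w A. runs w p1 (\<lambda>_. 0, A) (start w, A) (T1 (Bd w))"
    by (rule preparation) blast
  obtain p2 T2 where p2: "wf p2" "pbd T2"
    "\<And>w. runs w p2 (start w, \<lambda>_. False) ((start w)(5 := of_bool (G w (fixpoint (F w) (Bd w ^ 3)))),
       fixpoint (F w) (Bd w ^ 3)) (T2 (Bd w))"
    by (rule fixpoint_program[OF F G]) blast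
  let ?p = "Seq (Seq p1 p2) (If (TPos 5) Acc Rej)"
  have "wf ?p" using p1(1) p2(1) by (intro wf_intros wf_If[of 6]) auto
  then obtain K where K: "prog_bound K ?p" unfolding wf_def by blast
  then have K': "prog_bound (K + 2) ?p" by (rule prog_bound_mono) simp
  have "pbd (\<lambda>M. T1 M + T2 M + 3)" using p1(2) p2(2) by (intro pbd_intros)
  then obtain c where c: "\<And>M. T1 M + T2 M + 3 \<le> (M + 2) ^ c" unfolding pbd_def by blast
  \<comment> \<open>\<open>Bd w + 2\<close> is at most 2^(16 (n + 1)^4 + 3). The factor
    \<open>c + 1\<close> instead of \<open>c\<close> makes the final inequality strict.\<close>
  define q :: "nat poly" where "q = smult (c + 1) (smult 16 ([:1, 1:] ^ 4) + [:3:])"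
  have q: "poly q n = (c + 1) * (16 * (n + 1) ^ 4 + 3)" for n
    by (simp add: q_def poly_power)
  show ?thesis
  proof (rule EXPTIME_by_program[OF K', where p = q])
    fix w
    have 1: "runs w (Seq p1 p2) (\<lambda>_. 0, \<lambda>_. False)
        ((start w)(5 := of_bool (w \<in> L)), fixpoint (F w) (Bd w ^ 3)) (T1 (Bd w) + T2 (Bd w) + 1)"
      using runs_Seq[OF p1(3) p2(3)] unfolding L .
    have 2: "(lstep w ^^ 1) (If (TPos 5) Acc Rej, emb ((start w)(5 := of_bool (w \<in> L)), fixpoint (F w) (Bd w ^ 3))) =
        (if w \<in> L then Acc else Rej, emb ((start w)(5 := of_bool (w \<in> L)), fixpoint (F w) (Bd w ^ 3)))"
      by (simp add: lstep_def perform_NoAct)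
    obtain t where t: "t \<le> T1 (Bd w) + T2 (Bd w) + 1 + 1 + 1"
      "(lstep w ^^ t) (?p, emb (\<lambda>_. 0, \<lambda>_. False)) =
        (if w \<in> L then Acc else Rej, emb ((start w)(5 := of_bool (w \<in> L)), fixpoint (F w) (Bd w ^ 3)))"
      using runs_Seq_full[OF 1 2] by blast
    have e: "emb (\<lambda>_. 0, \<lambda>_. False) = (\<lambda>_. 0, \<lambda>_. False)" by (simp add: fun_eq_iff)
    have "t \<le> (Bd w + 2) ^ c" using t(1) c[of "Bd w"] by linarith
    also have "\<dots> \<le> (2 ^ (16 * (length w + 1) ^ 4 + 3)) ^ c"
    proof (rule power_mono)
      have pw: "x * (8 * x ^ 3) = 8 * x ^ 4" for x :: nat using power_Suc[of x 3] by simp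
      have "Bd w = 4 ^ ((length w + 1) * (8 * (length w + 1) ^ 3))"
        by (simp only: Bd_def Qd_def power_mult)
      also have "(length w + 1) * (8 * (length w + 1) ^ 3) = 8 * (length w + 1) ^ 4"
        by (rule pw)
      also have "(4 :: nat) ^ (8 * (length w + 1) ^ 4) = (2 ^ 2) ^ (8 * (length w + 1) ^ 4)" by simp
      also have "\<dots> = 2 ^ (16 * (length w + 1) ^ 4)"
        by (subst power_mult[symmetric]) (simp add: mult.assoc[symmetric])
      finally have "Bd w = 2 ^ (16 * (length w + 1) ^ 4)" .
      moreover have "Bd w + 2 \<le> Bd w * 2 ^ 3" using Qd_bounds(2)[of w] Qd_le_Bd[of w] by simp
      ultimately show "Bd w + 2 \<le> 2 ^ (16 * (length w + 1) ^ 4 + 3)"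
        by (simp only: power_add)
    qed simp
    also have "\<dots> < (2 ^ (16 * (length w + 1) ^ 4 + 3)) ^ (c + 1)"
      by (rule power_strict_increasing) (simp, rule one_less_power, simp_all)
    also have "\<dots> = 2 ^ poly q (length w)"
      by (subst power_mult[symmetric]) (simp only: q mult.commute)
    finally show "\<exists>t < 2 ^ poly q (length w). \<exists>\<sigma>.
        (lstep w ^^ t) (?p, (\<lambda>_. 0, \<lambda>_. False)) = (if w \<in> L then Acc else Rej, \<sigma>)"
      using t(2) unfolding e by blast
  qed simp
qed

section \<open>Sequences of digits\<close>

lemma digits_exist:
  fixes Q :: nat
  assumes "\<And>i. i < k \<Longrightarrow> f i < Q"
  shows "\<exists>a < Q ^ k. \<forall>i < k. a div Q ^ i mod Q = f i"
  using assms
proof (induction k)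
  case (Suc k)
  then obtain a where a: "a < Q ^ k" "\<And>i. i < k \<Longrightarrow> a div Q ^ i mod Q = f i"
    by (metis less_SucI)
  have fk: "f k < Q" using Suc.prems by simp
  let ?b = "a + f k * Q ^ k"
  have "?b < Q ^ Suc k"
  proof -
    have "?b < (f k + 1) * Q ^ k" using a(1) by simp
    also have "\<dots> \<le> Q * Q ^ k" using fk by (intro mult_right_mono) auto
    finally show ?thesis by simp
  qed
  moreover have "?b div Q ^ i mod Q = f i" if i: "i < Suc k" for i
  proof (cases "i = k")
    case True
    have "?b div Q ^ k = f k"
      using a(1) fk by (subst div_mult_self1) auto
    then show ?thesis using True fk by simp
  next
    case False
    then have ik: "i < k" using i by simp
    then have "f k * Q ^ k = (f k * Q ^ (k - Suc i)) * Q * Q ^ i"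
      by (metis (no_types, lifting) Suc_leI le_add_diff_inverse2 mult.assoc power_Suc power_add mult.commute add_Suc_right)
    then have "?b div Q ^ i = a div Q ^ i + f k * Q ^ (k - Suc i) * Q"
      using fk by (simp only:) (subst div_mult_self1, auto)
    then show ?thesis using a(2)[OF ik] by simp
  qed
  ultimately show ?case by blast
qed simp

lemma sequence_exists:
  assumes "\<And>i. i < k \<Longrightarrow> f i < Qd w" "k \<le> 8 * (length w + 1) ^ 3"
  obtains a where "a < Bd w" "\<And>i. i < k \<Longrightarrow> dig w a i = f i"
proof -
  obtain a where a: "a < Qd w ^ k" "\<And>i. i < k \<Longrightarrow> a div Qd w ^ i mod Qd w = f i"
    using digits_exist[of k f "Qd w"] assms(1) by blast
  have "Qd w ^ k \<le> Bd w"
    unfolding Bd_def using Qd_bounds(2)[of w] assms(2) by (intro power_increasing) auto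
  then show ?thesis using a that[of a] by (auto simp: dig_def shift_def)
qed

lemma dig_shift: "dig w (shift w a k) i = dig w a (k + i)"
  by (simp add: dig_def shift_def div_mult2_eq[symmetric] power_add)

lemma dig_0 [simp]: "dig w 0 i = 0"
  by (simp add: dig_def shift_def)

lemma shift_le: "shift w a k \<le> a"
  by (simp add: shift_def)


section \<open>Parse tables\<close>

text \<open>
  A single number \<open>P\<close> holds seven tables indexed by positions of the word \<open>w\<close>: the end of
  the maximal block of digits starting at a position (\<open>digits_end\<close>), the corresponding power of two
  and the value of the block, the end of the formula starting at a position (\<open>0\<close> if the position is not
  used as the start of a formula), its free variables, and the positions used as constants.
\<close>

context
  fixes w :: "token list" and P :: nat
begin

definition "digits_end i = dig w P (8 * i)"
definition "digits_pow i = dig w P (8 * i + 1)"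
definition "number i = dig w P (8 * i + 2)"
definition "fm_end i = dig w P (8 * i + 3)"
definition "freeX i \<longleftrightarrow> 0 < dig w P (8 * i + 4)"
definition "freeY i \<longleftrightarrow> 0 < dig w P (8 * i + 5)"
definition "marked i \<longleftrightarrow> 0 < dig w P (8 * i + 6)"

definition "digit i \<longleftrightarrow> istok w i T0 \<or> istok w i T1"
definition "node i \<longleftrightarrow> i < length w \<and> 0 < fm_end i"
text \<open>\<open>binary\<close> writes no leading zeros: a block of digits is some
  \<open>binary k\<close> iff it begins with 1 or is the single digit 0.\<close>

definition "canon i \<longleftrightarrow> istok w i T1 \<or> istok w i T0 \<and> digits_end i = Suc i"
definition "arg_end a = (if istok w a TConst then digits_end (Suc a) else Suc a)"
definition "isvar a \<longleftrightarrow> istok w a TX \<or> istok w a TY"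
definition "arg_ok a \<longleftrightarrow> isvar a \<or> istok w a TConst \<and> canon (Suc a) \<and> marked a"
definition "isbin i \<longleftrightarrow> istok w i TPlain \<or> istok w i TKey"
definition "isbool i \<longleftrightarrow> istok w i TConj \<or> istok w i TDisj \<or> istok w i TImpl \<or> istok w i TIff"
definition "isquant i \<longleftrightarrow> istok w i TAll \<or> istok w i TEx"
definition "iscount i \<longleftrightarrow> istok w i TAtMost \<or> istok w i TAtLeast \<or> istok w i TExactly"

text \<open>The positions of the arguments of an atom; for a counting quantifier, the first one is that of its variable.\<close>

definition "fst_pos i = (if istok w i TEq then Suc i else digits_end (Suc i))"
definition "snd_pos i = arg_end (fst_pos i)"

definition "args_ok i \<longleftrightarrow> arg_ok (fst_pos i) \<and> arg_ok (snd_pos i) \<and>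
  (isvar (fst_pos i) \<longleftrightarrow> isvar (snd_pos i)) \<and> fm_end i = arg_end (snd_pos i) \<and>
  (freeX i \<longleftrightarrow> istok w (fst_pos i) TX \<or> istok w (snd_pos i) TX) \<and>
  (freeY i \<longleftrightarrow> istok w (fst_pos i) TY \<or> istok w (snd_pos i) TY)"

text \<open>In prefix notation the second operand begins where the first one ends, so the table of
  ends replaces a stack.\<close>

definition "rpos i = fm_end (Suc i)"
definition "body i = Suc (fst_pos i)"

text \<open>The grammar of \<open>GC2D\<close> as a local condition on table entries, each referring
  only to later positions. A guard is recognised as a binary atom in which both variables are free,
  which expresses that they differ. It also follows that the only free variable of a counting
  formula is the one it does not bind.\<close>

definition "node_ok i \<longleftrightarrow>
  istok w i TUn \<and> canon (Suc i) \<and> arg_ok (fst_pos i) \<and> fm_end i = arg_end (fst_pos i) \<and>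
    (freeX i \<longleftrightarrow> istok w (fst_pos i) TX) \<and> (freeY i \<longleftrightarrow> istok w (fst_pos i) TY) \<or>
  isbin i \<and> canon (Suc i) \<and> args_ok i \<or>
  istok w i TEq \<and> args_ok i \<or>
  istok w i TNeg \<and> node (Suc i) \<and> fm_end i = fm_end (Suc i) \<and>
    (freeX i \<longleftrightarrow> freeX (Suc i)) \<and> (freeY i \<longleftrightarrow> freeY (Suc i)) \<or>
  isbool i \<and> node (Suc i) \<and> node (rpos i) \<and> fm_end i = fm_end (rpos i) \<and>
    (freeX i \<longleftrightarrow> freeX (Suc i) \<or> freeX (rpos i)) \<and> (freeY i \<longleftrightarrow> freeY (Suc i) \<or> freeY (rpos i)) \<or>
  isquant i \<and> isvar (Suc i) \<and> node (i + 2) \<and> fm_end i = fm_end (i + 2) \<and>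
    \<not> (freeX (i + 2) \<and> freeY (i + 2)) \<and>
    (freeX i \<longleftrightarrow> freeX (i + 2) \<and> istok w (Suc i) TY) \<and> (freeY i \<longleftrightarrow> freeY (i + 2) \<and> istok w (Suc i) TX) \<or>
  iscount i \<and> canon (Suc i) \<and> isvar (fst_pos i) \<and> node (body i) \<and> istok w (body i) TConj \<and>
    node (Suc (body i)) \<and> isbin (Suc (body i)) \<and> freeX (Suc (body i)) \<and> freeY (Suc (body i)) \<and>
    fm_end i = fm_end (body i) \<and>
    (freeX i \<longleftrightarrow> istok w (fst_pos i) TY) \<and> (freeY i \<longleftrightarrow> istok w (fst_pos i) TX)"

text \<open>A recursion from right to left. Position \<open>length w\<close> counts as a non-digit
  and starts it, which is why \<open>parsed\<close> checks \<open>length w + 1\<close>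
  positions.\<close>

definition "digits_ok i \<longleftrightarrow>
  (if digit i then digits_end i = digits_end (Suc i) \<and> digits_pow i = 2 * digits_pow (Suc i) \<and>
      number i = (if istok w i T1 then digits_pow (Suc i) else 0) + number (Suc i)
   else digits_end i = i \<and> digits_pow i = 1 \<and> number i = 0)"

definition "parsed \<longleftrightarrow> (\<forall>i < length w + 1. digits_ok i) \<and>
  (\<forall>i < length w. marked i \<longrightarrow> istok w i TConst \<and> canon (Suc i)) \<and>
  (\<forall>i < length w. 0 < fm_end i \<longrightarrow> node_ok i) \<and>
  0 < length w \<and> fm_end 0 = length w \<and> \<not> freeX 0 \<and> \<not> freeY 0"


section \<open>Types\<close>

text \<open>
  A type is a number whose digits are read as truth values. For a pair \<open>(a, b)\<close> of elements,
  the digit at the start of a formula tells whether it holds for \<open>x = a\<close>, \<open>y = b\<close>. The position after the start of an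
  atom \<open>p(\<dots>)\<close> is a digit of the name \<open>p\<close>; the truth value there tells
  whether \<open>a \<in> p\<close> or \<open>(a, b) \<in> p\<close>, whatever the arguments of the atom are.
\<close>

definition "tr \<alpha> i \<longleftrightarrow> 0 < dig w \<alpha> i"

definition "same_pred i j \<longleftrightarrow> number (Suc i) = number (Suc j) \<and>
  (istok w i TUn \<and> istok w j TUn \<or> istok w i TPlain \<and> istok w j TPlain \<or> istok w i TKey \<and> istok w j TKey)"

definition "bool_ok \<alpha> i \<longleftrightarrow>
  (istok w i TNeg \<longrightarrow> (tr \<alpha> i \<longleftrightarrow> \<not> tr \<alpha> (Suc i))) \<and>
  (istok w i TConj \<longrightarrow> (tr \<alpha> i \<longleftrightarrow> tr \<alpha> (Suc i) \<and> tr \<alpha> (rpos i))) \<and>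
  (istok w i TDisj \<longrightarrow> (tr \<alpha> i \<longleftrightarrow> tr \<alpha> (Suc i) \<or> tr \<alpha> (rpos i))) \<and>
  (istok w i TImpl \<longrightarrow> (tr \<alpha> i \<longleftrightarrow> (tr \<alpha> (Suc i) \<longrightarrow> tr \<alpha> (rpos i)))) \<and>
  (istok w i TIff \<longrightarrow> (tr \<alpha> i \<longleftrightarrow> (tr \<alpha> (Suc i) \<longleftrightarrow> tr \<alpha> (rpos i))))"

text \<open>What every typed pair must satisfy, equal or not: Boolean consistency, and a single
  truth value for a predicate that occurs at several positions.\<close>

definition "basic \<alpha> \<longleftrightarrow> (\<forall>i < length w. node i \<longrightarrow> bool_ok \<alpha> i \<and>
  (\<forall>j < length w. node j \<and> same_pred i j \<longrightarrow> (tr \<alpha> (Suc i) \<longleftrightarrow> tr \<alpha> (Suc j))))"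

text \<open>Quantifiers may be vacuous. One that binds its variable leaves none free, since its body
  has at most one, and is thus a global statement.\<close>

definition "binds i \<longleftrightarrow> istok w (Suc i) TX \<and> freeX (i + 2) \<or> istok w (Suc i) TY \<and> freeY (i + 2)"

text \<open>On the diagonal both variables denote the same element: an atom with variables repeats
  the value of its predicate, and equality holds. Equality of constants is equality of names, by the
  unique names assumption. For a binding quantifier only the instance at this element is local; the
  other direction is left to \<open>witnessed\<close>.\<close>

definition "diag_ok \<alpha> i \<longleftrightarrow>
  (istok w i TUn \<or> isbin i \<longrightarrow> isvar (fst_pos i) \<longrightarrow> (tr \<alpha> i \<longleftrightarrow> tr \<alpha> (Suc i))) \<and>
  (istok w i TKey \<longrightarrow> \<not> tr \<alpha> (Suc i)) \<and>
  (istok w i TEq \<longrightarrow> (tr \<alpha> i \<longleftrightarrow> isvar (fst_pos i) \<or> number (Suc (fst_pos i)) = number (Suc (snd_pos i)))) \<and>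
  (isquant i \<and> \<not> binds i \<longrightarrow> (tr \<alpha> i \<longleftrightarrow> tr \<alpha> (i + 2))) \<and>
  (istok w i TAll \<and> binds i \<longrightarrow> tr \<alpha> i \<longrightarrow> tr \<alpha> (i + 2)) \<and>
  (istok w i TEx \<and> binds i \<longrightarrow> tr \<alpha> (i + 2) \<longrightarrow> tr \<alpha> i)"

definition "diag \<alpha> \<longleftrightarrow> basic \<alpha> \<and> (\<forall>i < length w. node i \<longrightarrow> diag_ok \<alpha> i)"

text \<open>For distinct elements \<open>a\<close>, \<open>b\<close> with diagonal types \<alpha>,
  \<beta>: a formula without \<open>y\<close> has its value at \<open>(a, a)\<close>, one without
  \<open>x\<close> its value at \<open>(b, b)\<close>. An atom with arguments \<open>y\<close>,
  \<open>x\<close> is looked up in the type \<open>s'\<close> of the reversed pair.\<close>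

definition "pair_ok \<alpha> \<beta> s s' i \<longleftrightarrow>
  (\<not> freeY i \<longrightarrow> (tr s i \<longleftrightarrow> tr \<alpha> i)) \<and> (\<not> freeX i \<longrightarrow> (tr s i \<longleftrightarrow> tr \<beta> i)) \<and>
  (freeX i \<and> freeY i \<longrightarrow>
    (isbin i \<longrightarrow> (tr s i \<longleftrightarrow> (if istok w (fst_pos i) TX then tr s (Suc i) else tr s' (Suc i)))) \<and>
    (istok w i TEq \<longrightarrow> \<not> tr s i))"

definition "pair \<alpha> \<beta> s s' \<longleftrightarrow> basic s \<and> (\<forall>i < length w. node i \<longrightarrow> pair_ok \<alpha> \<beta> s s' i)"

definition "link \<alpha> \<beta> s s' \<longleftrightarrow> pair \<alpha> \<beta> s s' \<and> pair \<beta> \<alpha> s' s"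

text \<open>
  Counters are the counting quantifiers and the atoms with key predicates; \<open>con s s' i\<close> says that the second
  element of a pair with types \<open>s\<close>, \<open>s'\<close> contributes to the counter \<open>i\<close> of the first one.
\<close>

definition "counter i \<longleftrightarrow> node i \<and> (iscount i \<or> istok w i TKey)"

text \<open>A counter that binds \<open>y\<close> evaluates its body at the pair, one that binds
  \<open>x\<close> at the reversed pair; hence both types are needed.\<close>

definition "con s s' i \<longleftrightarrow> (if istok w i TKey then tr s (Suc i)
   else if istok w (fst_pos i) TY then tr s (body i) else tr s' (body i))"

definition "count_ok \<alpha> i k \<longleftrightarrow>
  (istok w i TKey \<longrightarrow> k = 1) \<and>
  (istok w i TAtMost \<longrightarrow> (tr \<alpha> i \<longleftrightarrow> k \<le> number (Suc i))) \<and>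
  (istok w i TAtLeast \<longrightarrow> (tr \<alpha> i \<longleftrightarrow> number (Suc i) \<le> k)) \<and>
  (istok w i TExactly \<longrightarrow> (tr \<alpha> i \<longleftrightarrow> k = number (Suc i)))"

text \<open>Closed formulas, among them ground atoms and binding quantifiers, must have one truth
  value throughout the structure.\<close>

definition "agree \<alpha> \<beta> \<longleftrightarrow> (\<forall>i < length w. node i \<and> \<not> freeX i \<and> \<not> freeY i \<longrightarrow> (tr \<alpha> i \<longleftrightarrow> tr \<beta> i))"

text \<open>
  A state \<open>(\<alpha>, v)\<close> stands for an element of type \<open>\<alpha>\<close> that still needs children contributing exactly
  the digits of \<open>v\<close> to its counters. The set \<open>A\<close> holds the states found to be impossible.
\<close>

definition "good A \<alpha> v \<longleftrightarrow> \<not> A ((P * Bd w + \<alpha>) * Bd w + v)"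

definition "finished v \<longleftrightarrow> (\<forall>i < length w. counter i \<longrightarrow> dig w v i = 0)"

text \<open>The child takes one unit from every counter it contributes to. It has to contribute
  somewhere, so that each child lowers the sum of the entries and the list of children is
  finite.\<close>

definition "splits v s s' u \<longleftrightarrow> (\<forall>i < length w. counter i \<longrightarrow> dig w v i = dig w u i + of_bool (con s s' i)) \<and>
  (\<exists>i < length w. counter i \<and> con s s' i)"

text \<open>The balance of a child: the only neighbours that can contribute to its counters are its
  own children, itself and its parent.\<close>

definition "serves \<beta> s s' v \<longleftrightarrow> (\<forall>i < length w. counter i \<longrightarrow>
  count_ok \<beta> i (dig w v i + of_bool (con \<beta> \<beta> i) + of_bool (con s' s i)))"

definition "kid A \<alpha> v \<beta> s s' u v' \<longleftrightarrow> diag \<beta> \<and> link \<alpha> \<beta> s s' \<and> splits v s s' u \<and> serves \<beta> s s' v' \<and>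
  good A \<alpha> u \<and> good A \<beta> v'"

text \<open>A child leaves two obligations, the reduced need of the parent and the need of the
  child, and both states must still be possible. The condition grows with \<open>A\<close>, so its
  least fixed point excludes exactly what fails after finitely many rounds.\<close>

definition "blocked A \<alpha> v \<longleftrightarrow> \<not> (finished v \<or>
  (\<exists>\<beta> < Bd w. \<exists>s < Bd w. \<exists>s' < Bd w. \<exists>u < Bd w. \<exists>v' < Bd w. kid A \<alpha> v \<beta> s s' u v'))"

definition "is_root A \<alpha> \<longleftrightarrow> diag \<alpha> \<and> (\<exists>v < Bd w. good A \<alpha> v \<and>
  (\<forall>i < length w. counter i \<longrightarrow> count_ok \<alpha> i (dig w v i + of_bool (con \<alpha> \<alpha> i))))"

text \<open>Two cases in one equivalence: a true existential statement needs an instance, a false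
  universal one a counterexample. The witness becomes the root of a tree of its own, attached to
  nothing.\<close>

definition "witnessed A \<alpha> \<longleftrightarrow> (\<forall>i < length w. node i \<and> isquant i \<and> binds i \<and> (tr \<alpha> i \<longleftrightarrow> istok w i TEx) \<longrightarrow>
  (\<exists>\<beta> < Bd w. is_root A \<beta> \<and> agree \<alpha> \<beta> \<and> (tr \<beta> (i + 2) \<longleftrightarrow> istok w i TEx)))"

text \<open>
  Named elements are represented by the first marked position of their name; \<open>D\<close> holds the types of all
  pairs of named elements and \<open>V\<close> the vectors of their remaining needs.
\<close>

definition "name c \<longleftrightarrow> marked c \<and> (\<forall>c' < c. marked c' \<longrightarrow> number (Suc c') \<noteq> number (Suc c))"

definition "core_type D c d = shift w D ((c * (length w + 1) + d) * (length w + 1))"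

definition "core_need V c = shift w V (c * (length w + 1))"

text \<open>Every two named elements are treated as neighbours, and their types are all listed in
  \<open>D\<close>. The cardinality therefore covers the contributions of all named elements,
  including that of \<open>c\<close> to itself.\<close>

definition "core_ok A \<alpha> D V c \<longleftrightarrow> diag (core_type D c c) \<and> agree \<alpha> (core_type D c c) \<and>
  good A (core_type D c c) (core_need V c) \<and>
  (\<forall>i < length w. counter i \<longrightarrow> count_ok (core_type D c c) i (dig w (core_need V c) i +
     card {d. d < length w \<and> name d \<and> con (core_type D c d) (core_type D d c) i})) \<and>
  (\<forall>d < length w. name d \<and> d \<noteq> c \<longrightarrow>
     link (core_type D c c) (core_type D d d) (core_type D c d) (core_type D d c))"

text \<open>A ground atom has its global value at its own position of \<alpha>. It must equal the
  value of the predicate, kept at the next position, in the types of the elements that its constants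
  denote.\<close>

definition "facts_ok \<alpha> D i \<longleftrightarrow>
  (istok w i TUn \<and> \<not> isvar (fst_pos i) \<longrightarrow> (\<forall>c < length w. name c \<and> number (Suc c) = number (Suc (fst_pos i)) \<longrightarrow>
     (tr \<alpha> i \<longleftrightarrow> tr (core_type D c c) (Suc i)))) \<and>
  (isbin i \<and> \<not> isvar (fst_pos i) \<longrightarrow> (\<forall>c < length w. \<forall>d < length w. name c \<and> name d \<and>
     number (Suc c) = number (Suc (fst_pos i)) \<and> number (Suc d) = number (Suc (snd_pos i)) \<longrightarrow>
     (tr \<alpha> i \<longleftrightarrow> tr (core_type D c d) (Suc i))))"

definition "core A \<alpha> D V \<longleftrightarrow> (\<forall>c < length w. name c \<longrightarrow> core_ok A \<alpha> D V c) \<and>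
  (\<forall>i < length w. node i \<longrightarrow> facts_ok \<alpha> D i)"

definition "final A \<longleftrightarrow> parsed \<and> (\<exists>\<alpha> < Bd w. tr \<alpha> 0 \<and> is_root A \<alpha> \<and> witnessed A \<alpha> \<and>
  (\<exists>D < Bd w. \<exists>V < Bd w. core A \<alpha> D V))"

end

definition "blocked_state w A x \<longleftrightarrow> blocked w (x div Bd w div Bd w) A (x div Bd w mod Bd w) (x mod Bd w)"

definition "accepted w A \<longleftrightarrow> (\<exists>P < Bd w. final w P A)"


section \<open>The conditions on types are computable\<close>

named_theorems pc

lemma pcomp_digits_end [pc]: "pcomp g0 \<Longrightarrow> pcomp g1 \<Longrightarrow> pcomp (\<lambda>w A v. digits_end w (g0 w A v) (g1 w A v))"
  unfolding digits_end_def by (intro pc pcomp_intros)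

lemma pcomp_digits_pow [pc]: "pcomp g0 \<Longrightarrow> pcomp g1 \<Longrightarrow> pcomp (\<lambda>w A v. digits_pow w (g0 w A v) (g1 w A v))"
  unfolding digits_pow_def by (intro pc pcomp_intros)

lemma pcomp_number [pc]: "pcomp g0 \<Longrightarrow> pcomp g1 \<Longrightarrow> pcomp (\<lambda>w A v. number w (g0 w A v) (g1 w A v))"
  unfolding number_def by (intro pc pcomp_intros)

lemma pcomp_fm_end [pc]: "pcomp g0 \<Longrightarrow> pcomp g1 \<Longrightarrow> pcomp (\<lambda>w A v. fm_end w (g0 w A v) (g1 w A v))"
  unfolding fm_end_def by (intro pc pcomp_intros)

lemma pdec_freeX [pc]: "pcomp g0 \<Longrightarrow> pcomp g1 \<Longrightarrow> pdec (\<lambda>w A v. freeX w (g0 w A v) (g1 w A v))"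
  unfolding freeX_def by (intro pc pcomp_intros)

lemma pdec_freeY [pc]: "pcomp g0 \<Longrightarrow> pcomp g1 \<Longrightarrow> pdec (\<lambda>w A v. freeY w (g0 w A v) (g1 w A v))"
  unfolding freeY_def by (intro pc pcomp_intros)

lemma pdec_marked [pc]: "pcomp g0 \<Longrightarrow> pcomp g1 \<Longrightarrow> pdec (\<lambda>w A v. marked w (g0 w A v) (g1 w A v))"
  unfolding marked_def by (intro pc pcomp_intros)

lemma pdec_digit [pc]: "pcomp g0 \<Longrightarrow> pdec (\<lambda>w A v. digit w (g0 w A v))"
  unfolding digit_def by (intro pc pcomp_intros)

lemma pdec_node [pc]: "pcomp g0 \<Longrightarrow> pcomp g1 \<Longrightarrow> pdec (\<lambda>w A v. node w (g0 w A v) (g1 w A v))"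
  unfolding node_def by (intro pc pcomp_intros)

lemma pdec_canon [pc]: "pcomp g0 \<Longrightarrow> pcomp g1 \<Longrightarrow> pdec (\<lambda>w A v. canon w (g0 w A v) (g1 w A v))"
  unfolding canon_def by (intro pc pcomp_intros)

lemma pcomp_arg_end [pc]: "pcomp g0 \<Longrightarrow> pcomp g1 \<Longrightarrow> pcomp (\<lambda>w A v. arg_end w (g0 w A v) (g1 w A v))"
  unfolding arg_end_def by (intro pc pcomp_intros)

lemma pdec_isvar [pc]: "pcomp g0 \<Longrightarrow> pdec (\<lambda>w A v. isvar w (g0 w A v))"
  unfolding isvar_def by (intro pc pcomp_intros)

lemma pdec_arg_ok [pc]: "pcomp g0 \<Longrightarrow> pcomp g1 \<Longrightarrow> pdec (\<lambda>w A v. arg_ok w (g0 w A v) (g1 w A v))"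
  unfolding arg_ok_def by (intro pc pcomp_intros)

lemma pdec_isbin [pc]: "pcomp g0 \<Longrightarrow> pdec (\<lambda>w A v. isbin w (g0 w A v))"
  unfolding isbin_def by (intro pc pcomp_intros)

lemma pdec_isbool [pc]: "pcomp g0 \<Longrightarrow> pdec (\<lambda>w A v. isbool w (g0 w A v))"
  unfolding isbool_def by (intro pc pcomp_intros)

lemma pdec_isquant [pc]: "pcomp g0 \<Longrightarrow> pdec (\<lambda>w A v. isquant w (g0 w A v))"
  unfolding isquant_def by (intro pc pcomp_intros)

lemma pdec_iscount [pc]: "pcomp g0 \<Longrightarrow> pdec (\<lambda>w A v. iscount w (g0 w A v))"
  unfolding iscount_def by (intro pc pcomp_intros)

lemma pcomp_fst_pos [pc]: "pcomp g0 \<Longrightarrow> pcomp g1 \<Longrightarrow> pcomp (\<lambda>w A v. fst_pos w (g0 w A v) (g1 w A v))"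
  unfolding fst_pos_def by (intro pc pcomp_intros)

lemma pcomp_snd_pos [pc]: "pcomp g0 \<Longrightarrow> pcomp g1 \<Longrightarrow> pcomp (\<lambda>w A v. snd_pos w (g0 w A v) (g1 w A v))"
  unfolding snd_pos_def by (intro pc pcomp_intros)

lemma pdec_args_ok [pc]: "pcomp g0 \<Longrightarrow> pcomp g1 \<Longrightarrow> pdec (\<lambda>w A v. args_ok w (g0 w A v) (g1 w A v))"
  unfolding args_ok_def by (intro pc pcomp_intros)

lemma pcomp_rpos [pc]: "pcomp g0 \<Longrightarrow> pcomp g1 \<Longrightarrow> pcomp (\<lambda>w A v. rpos w (g0 w A v) (g1 w A v))"
  unfolding rpos_def by (intro pc pcomp_intros)

lemma pcomp_body [pc]: "pcomp g0 \<Longrightarrow> pcomp g1 \<Longrightarrow> pcomp (\<lambda>w A v. body w (g0 w A v) (g1 w A v))"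
  unfolding body_def by (intro pc pcomp_intros)

lemma pdec_node_ok [pc]: "pcomp g0 \<Longrightarrow> pcomp g1 \<Longrightarrow> pdec (\<lambda>w A v. node_ok w (g0 w A v) (g1 w A v))"
  unfolding node_ok_def by (intro pc pcomp_intros)

lemma pdec_digits_ok [pc]: "pcomp g0 \<Longrightarrow> pcomp g1 \<Longrightarrow> pdec (\<lambda>w A v. digits_ok w (g0 w A v) (g1 w A v))"
  unfolding digits_ok_def by (intro pc pcomp_intros)

lemma pdec_parsed [pc]: "pcomp g0 \<Longrightarrow> pdec (\<lambda>w A v. parsed w (g0 w A v))"
  by (rule pdec_app1[where G = "\<lambda>w A x0. parsed w x0"])
    (unfold parsed_def, intro pc pcomp_intros)

lemma pdec_tr [pc]: "pcomp g0 \<Longrightarrow> pcomp g1 \<Longrightarrow> pdec (\<lambda>w A v. tr w (g0 w A v) (g1 w A v))"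
  unfolding tr_def by (intro pc pcomp_intros)

lemma pdec_same_pred [pc]: "pcomp g0 \<Longrightarrow> pcomp g1 \<Longrightarrow> pcomp g2 \<Longrightarrow> pdec (\<lambda>w A v. same_pred w (g0 w A v) (g1 w A v) (g2 w A v))"
  unfolding same_pred_def by (intro pc pcomp_intros)

lemma pdec_bool_ok [pc]: "pcomp g0 \<Longrightarrow> pcomp g1 \<Longrightarrow> pcomp g2 \<Longrightarrow> pdec (\<lambda>w A v. bool_ok w (g0 w A v) (g1 w A v) (g2 w A v))"
  unfolding bool_ok_def by (intro pc pcomp_intros)

lemma pdec_basic [pc]: "pcomp g0 \<Longrightarrow> pcomp g1 \<Longrightarrow> pdec (\<lambda>w A v. basic w (g0 w A v) (g1 w A v))"
  by (rule pdec_app2[where G = "\<lambda>w A x0 x1. basic w x0 x1"])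
    (unfold basic_def, intro pc pcomp_intros)

lemma pdec_binds [pc]: "pcomp g0 \<Longrightarrow> pcomp g1 \<Longrightarrow> pdec (\<lambda>w A v. binds w (g0 w A v) (g1 w A v))"
  unfolding binds_def by (intro pc pcomp_intros)

lemma pdec_diag_ok [pc]: "pcomp g0 \<Longrightarrow> pcomp g1 \<Longrightarrow> pcomp g2 \<Longrightarrow> pdec (\<lambda>w A v. diag_ok w (g0 w A v) (g1 w A v) (g2 w A v))"
  unfolding diag_ok_def by (intro pc pcomp_intros)

lemma pdec_diag [pc]: "pcomp g0 \<Longrightarrow> pcomp g1 \<Longrightarrow> pdec (\<lambda>w A v. diag w (g0 w A v) (g1 w A v))"
  by (rule pdec_app2[where G = "\<lambda>w A x0 x1. diag w x0 x1"])
    (unfold diag_def, intro pc pcomp_intros)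

lemma pdec_pair_ok [pc]: "pcomp g0 \<Longrightarrow> pcomp g1 \<Longrightarrow> pcomp g2 \<Longrightarrow> pcomp g3 \<Longrightarrow> pcomp g4 \<Longrightarrow> pcomp g5 \<Longrightarrow> pdec (\<lambda>w A v. pair_ok w (g0 w A v) (g1 w A v) (g2 w A v) (g3 w A v) (g4 w A v) (g5 w A v))"
  unfolding pair_ok_def by (intro pc pcomp_intros)

lemma pdec_pair [pc]: "pcomp g0 \<Longrightarrow> pcomp g1 \<Longrightarrow> pcomp g2 \<Longrightarrow> pcomp g3 \<Longrightarrow> pcomp g4 \<Longrightarrow> pdec (\<lambda>w A v. pair w (g0 w A v) (g1 w A v) (g2 w A v) (g3 w A v) (g4 w A v))"
  by (rule pdec_app5[where G = "\<lambda>w A x0 x1 x2 x3 x4. pair w x0 x1 x2 x3 x4"])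
    (unfold pair_def, intro pc pcomp_intros)

lemma pdec_link [pc]: "pcomp g0 \<Longrightarrow> pcomp g1 \<Longrightarrow> pcomp g2 \<Longrightarrow> pcomp g3 \<Longrightarrow> pcomp g4 \<Longrightarrow> pdec (\<lambda>w A v. link w (g0 w A v) (g1 w A v) (g2 w A v) (g3 w A v) (g4 w A v))"
  unfolding link_def by (intro pc pcomp_intros)

lemma pdec_counter [pc]: "pcomp g0 \<Longrightarrow> pcomp g1 \<Longrightarrow> pdec (\<lambda>w A v. counter w (g0 w A v) (g1 w A v))"
  unfolding counter_def by (intro pc pcomp_intros)

lemma pdec_con [pc]: "pcomp g0 \<Longrightarrow> pcomp g1 \<Longrightarrow> pcomp g2 \<Longrightarrow> pcomp g3 \<Longrightarrow> pdec (\<lambda>w A v. con w (g0 w A v) (g1 w A v) (g2 w A v) (g3 w A v))"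
  unfolding con_def by (intro pc pcomp_intros)

lemma pdec_count_ok [pc]: "pcomp g0 \<Longrightarrow> pcomp g1 \<Longrightarrow> pcomp g2 \<Longrightarrow> pcomp g3 \<Longrightarrow> pdec (\<lambda>w A v. count_ok w (g0 w A v) (g1 w A v) (g2 w A v) (g3 w A v))"
  unfolding count_ok_def by (intro pc pcomp_intros)

lemma pdec_agree [pc]: "pcomp g0 \<Longrightarrow> pcomp g1 \<Longrightarrow> pcomp g2 \<Longrightarrow> pdec (\<lambda>w A v. agree w (g0 w A v) (g1 w A v) (g2 w A v))"
  by (rule pdec_app3[where G = "\<lambda>w A x0 x1 x2. agree w x0 x1 x2"])
    (unfold agree_def, intro pc pcomp_intros)

lemma pdec_good [pc]: "pcomp g0 \<Longrightarrow> pcomp g1 \<Longrightarrow> pcomp g2 \<Longrightarrow> pdec (\<lambda>w A v. good w (g0 w A v) A (g1 w A v) (g2 w A v))"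
  unfolding good_def by (intro pc pcomp_intros)

lemma pdec_finished [pc]: "pcomp g0 \<Longrightarrow> pcomp g1 \<Longrightarrow> pdec (\<lambda>w A v. finished w (g0 w A v) (g1 w A v))"
  by (rule pdec_app2[where G = "\<lambda>w A x0 x1. finished w x0 x1"])
    (unfold finished_def, intro pc pcomp_intros)

lemma pdec_splits [pc]: "pcomp g0 \<Longrightarrow> pcomp g1 \<Longrightarrow> pcomp g2 \<Longrightarrow> pcomp g3 \<Longrightarrow> pcomp g4 \<Longrightarrow> pdec (\<lambda>w A v. splits w (g0 w A v) (g1 w A v) (g2 w A v) (g3 w A v) (g4 w A v))"
  by (rule pdec_app5[where G = "\<lambda>w A x0 x1 x2 x3 x4. splits w x0 x1 x2 x3 x4"])
    (unfold splits_def, intro pc pcomp_intros)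

lemma pdec_serves [pc]: "pcomp g0 \<Longrightarrow> pcomp g1 \<Longrightarrow> pcomp g2 \<Longrightarrow> pcomp g3 \<Longrightarrow> pcomp g4 \<Longrightarrow> pdec (\<lambda>w A v. serves w (g0 w A v) (g1 w A v) (g2 w A v) (g3 w A v) (g4 w A v))"
  by (rule pdec_app5[where G = "\<lambda>w A x0 x1 x2 x3 x4. serves w x0 x1 x2 x3 x4"])
    (unfold serves_def, intro pc pcomp_intros)


lemma pdec_blocked [pc]:
  "pcomp g0 \<Longrightarrow> pcomp g1 \<Longrightarrow> pcomp g2 \<Longrightarrow> pdec (\<lambda>w A v. blocked w (g0 w A v) A (g1 w A v) (g2 w A v))"
  by (rule pdec_app3[where G = "\<lambda>w A x y z. blocked w x A y z"])
    (unfold blocked_def kid_def, intro pc pcomp_intros)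

lemma pdec_blocked_state: "pdec (\<lambda>w A v. blocked_state w A (v 0))"
  unfolding blocked_state_def by (intro pc pcomp_intros)

lemma pdec_is_root [pc]:
  "pcomp g0 \<Longrightarrow> pcomp g1 \<Longrightarrow> pdec (\<lambda>w A v. is_root w (g0 w A v) A (g1 w A v))"
  by (rule pdec_app2[where G = "\<lambda>w A x y. is_root w x A y"]) (unfold is_root_def, intro pc pcomp_intros)

lemma pdec_witnessed [pc]:
  "pcomp g0 \<Longrightarrow> pcomp g1 \<Longrightarrow> pdec (\<lambda>w A v. witnessed w (g0 w A v) A (g1 w A v))"
  by (rule pdec_app2[where G = "\<lambda>w A x y. witnessed w x A y"]) (unfold witnessed_def, intro pc pcomp_intros)

lemma pdec_name [pc]: "pcomp g0 \<Longrightarrow> pcomp g1 \<Longrightarrow> pdec (\<lambda>w A v. name w (g0 w A v) (g1 w A v))"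
  by (rule pdec_app2[where G = "\<lambda>w A x y. name w x y"]) (unfold name_def, intro pc pcomp_intros)

lemma pcomp_core_type [pc]:
  "pcomp g0 \<Longrightarrow> pcomp g1 \<Longrightarrow> pcomp g2 \<Longrightarrow> pcomp (\<lambda>w A v. core_type w (g0 w A v) (g1 w A v) (g2 w A v))"
  unfolding core_type_def by (intro pcomp_intros)

lemma pcomp_core_need [pc]:
  "pcomp g0 \<Longrightarrow> pcomp g1 \<Longrightarrow> pcomp (\<lambda>w A v. core_need w (g0 w A v) (g1 w A v))"
  unfolding core_need_def by (intro pcomp_intros)

lemma pdec_core_ok [pc]:
  "pcomp g0 \<Longrightarrow> pcomp g1 \<Longrightarrow> pcomp g2 \<Longrightarrow> pcomp g3 \<Longrightarrow> pcomp g4 \<Longrightarrow>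
    pdec (\<lambda>w A v. core_ok w (g0 w A v) A (g1 w A v) (g2 w A v) (g3 w A v) (g4 w A v))"
  by (rule pdec_app5[where G = "\<lambda>w A x y z t u. core_ok w x A y z t u"]) (unfold core_ok_def, intro pc pcomp_intros)

lemma pdec_facts_ok [pc]:
  "pcomp g0 \<Longrightarrow> pcomp g1 \<Longrightarrow> pcomp g2 \<Longrightarrow> pcomp g3 \<Longrightarrow>
    pdec (\<lambda>w A v. facts_ok w (g0 w A v) (g1 w A v) (g2 w A v) (g3 w A v))"
  by (rule pdec_app4[where G = "\<lambda>w A x y z t. facts_ok w x y z t"]) (unfold facts_ok_def, intro pc pcomp_intros)

lemma pdec_core [pc]:
  "pcomp g0 \<Longrightarrow> pcomp g1 \<Longrightarrow> pcomp g2 \<Longrightarrow> pcomp g3 \<Longrightarrow>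
    pdec (\<lambda>w A v. core w (g0 w A v) A (g1 w A v) (g2 w A v) (g3 w A v))"
  by (rule pdec_app4[where G = "\<lambda>w A x y z t. core w x A y z t"]) (unfold core_def, intro pc pcomp_intros)

lemma pdec_accepted: "pdec (\<lambda>w A v. accepted w A)"
  unfolding accepted_def final_def by (intro pc pcomp_intros)

section \<open>Parsing\<close>

abbreviation is_digit :: "token \<Rightarrow> bool" where
  "is_digit t \<equiv> t \<in> {T0, T1}"

primrec digits_value :: "token list \<Rightarrow> nat" where
  "digits_value [] = 0"
| "digits_value (t # ts) = (if t = T1 then 2 ^ length ts else 0) + digits_value ts"

lemma digits_value_snoc: "digits_value (ts @ [t]) = 2 * digits_value ts + (if t = T1 then 1 else 0)"
  by (induction ts) auto

lemma digits_value_less: "digits_value ts < 2 ^ length ts"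
  by (induction ts) auto

lemma binary_small: "binary 0 = [T0]" "binary (Suc 0) = [T1]"
  by (subst binary.simps; simp)+

lemma binary_double:
  assumes "0 < n" "b < 2"
  shows "binary (2 * n + b) = binary n @ [if b = 0 then T0 else T1]"
proof -
  have "binary (2 * n + b) = binary ((2 * n + b) div 2) @ [if even (2 * n + b) then T0 else T1]"
    using assms by (subst binary.simps) auto
  moreover have "(2 * n + b) div 2 = n" using assms by simp
  moreover have "even (2 * n + b) \<longleftrightarrow> b = 0" using assms by (auto simp: less_2_cases_iff)
  ultimately show ?thesis by simp
qed

lemma digits_value_binary: "digits_value (binary n) = n"
proof (induction n rule: less_induct)
  case (less n)
  consider "n = 0" | "n = 1" | "2 \<le> n" by linarith
  then show ?case
  proof cases
    case 3
    then have "binary n = binary (n div 2) @ [if n mod 2 = 0 then T0 else T1]"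
      using binary_double[of "n div 2" "n mod 2"] by simp
    then have "digits_value (binary n) = 2 * (n div 2) + (if n mod 2 = 0 then 0 else 1)"
      using less[of "n div 2"] 3 by (simp add: digits_value_snoc)
    also have "\<dots> = n" by presburger
    finally show ?thesis .
  qed (simp_all add: binary_small)
qed

lemma digits_value_pos: "ts \<noteq> [] \<Longrightarrow> hd ts = T1 \<Longrightarrow> 0 < digits_value ts"
  by (cases ts) auto

lemma binary_digits_value:
  "ds \<noteq> [] \<Longrightarrow> set ds \<subseteq> {T0, T1} \<Longrightarrow> hd ds = T1 \<or> length ds = 1 \<Longrightarrow> binary (digits_value ds) = ds"
proof (induction ds rule: rev_induct)
  case (snoc t ds)
  show ?case
  proof (cases "ds = []")
    case True
    then show ?thesis using snoc.prems by (auto simp: binary_small)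
  next
    case False
    then have "hd ds = T1" using snoc.prems by auto
    then have "binary (digits_value ds) = ds" "0 < digits_value ds"
      using snoc False digits_value_pos by auto
    then show ?thesis
      using binary_double[of "digits_value ds" "if t = T1 then 1 else 0"] snoc.prems
      by (auto simp: digits_value_snoc)
  qed
qed simp

lemma binary_canonical: "binary n \<noteq> [] \<and> (hd (binary n) = T1 \<or> binary n = [T0])"
proof (induction n rule: less_induct)
  case (less n)
  consider "n = 0" | "n = 1" | "2 \<le> n" by linarith
  then show ?case
  proof cases
    case 3
    then have "binary n = binary (n div 2) @ [if n mod 2 = 0 then T0 else T1]"
      using binary_double[of "n div 2" "n mod 2"] by simp
    moreover have "binary (n div 2) \<noteq> [T0]"
      using digits_value_binary[of "n div 2"] 3 by auto
    ultimately show ?thesis using less[of "n div 2"] 3 by auto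
  qed (simp_all add: binary_small)
qed

lemma takeWhile_binary: "no_digit r \<Longrightarrow> takeWhile is_digit (binary n @ r) = binary n"
proof -
  assume "no_digit r"
  then have "takeWhile is_digit r = []" by (cases r) auto
  moreover have "takeWhile is_digit (binary n @ r) = binary n @ takeWhile is_digit r"
    using binary_digits[of n] by (intro takeWhile_append2) auto
  ultimately show ?thesis by simp
qed

lemma drop_ConsD: "drop i w = t # r \<Longrightarrow> istok w i t \<and> drop (Suc i) w = r"
  by (metis istok_def drop_Suc list.sel(3) nth_via_drop drop_eq_Nil linorder_not_le list.distinct(1) tl_drop)

lemma drop_appendD: "drop i w = u @ r \<Longrightarrow> drop (i + length u) w = r"
  by (metis add.commute append_eq_conv_conj drop_drop)

lemma istok_drop: "istok w i t \<Longrightarrow> drop i w = t # drop (Suc i) w"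
  by (auto simp: istok_def Cons_nth_drop_Suc)

lemma istok_less: "istok w i t \<Longrightarrow> i < length w"
  by (simp add: istok_def)

definition block :: "token list \<Rightarrow> nat \<Rightarrow> token list" where
  "block w i = takeWhile is_digit (drop i w)"

lemma block_digit: "istok w i t \<Longrightarrow> is_digit t \<Longrightarrow> block w i = t # block w (Suc i)"
  by (simp add: block_def istok_drop)

lemma block_no_digit: "\<not> digit w i \<Longrightarrow> block w i = []"
  by (cases "i < length w") (auto simp: block_def digit_def istok_def Cons_nth_drop_Suc[symmetric])

lemma block_append: "drop i w = block w i @ drop (i + length (block w i)) w"
  unfolding block_def using drop_appendD[of i w "takeWhile is_digit (drop i w)" "dropWhile is_digit (drop i w)"]
  by simp

definition the_arg :: "token list \<Rightarrow> nat \<Rightarrow> nat \<Rightarrow> tm_arg" where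
  "the_arg w P a = (if istok w a TX then Var X else if istok w a TY then Var Y else Const (number w P (Suc a)))"

definition the_var :: "token list \<Rightarrow> nat \<Rightarrow> var" where
  "the_var w a = (if istok w a TX then X else Y)"

definition the_bpred :: "token list \<Rightarrow> nat \<Rightarrow> nat \<Rightarrow> bpred" where
  "the_bpred w P i = (if istok w i TPlain then Plain (number w P (Suc i)) else Key (number w P (Suc i)))"

definition the_comparison :: "token list \<Rightarrow> nat \<Rightarrow> comparison" where
  "the_comparison w i = (if istok w i TAtMost then AtMost else if istok w i TAtLeast then AtLeast else Exactly)"

text \<open>The intended meaning of the table entries at \<open>i\<close>. As the end is part of
  them, uniqueness of the formula reduces to injectivity of \<open>word\<close>.\<close>

definition reads :: "token list \<Rightarrow> nat \<Rightarrow> nat \<Rightarrow> form \<Rightarrow> bool" where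
  "reads w P i \<phi> \<longleftrightarrow> \<phi> \<in> GC2D \<and> drop i w = word \<phi> @ drop (fm_end w P i) w \<and> i < fm_end w P i \<and>
     fm_end w P i \<le> length w \<and> (freeX w P i \<longleftrightarrow> X \<in> free_vars \<phi>) \<and> (freeY w P i \<longleftrightarrow> Y \<in> free_vars \<phi>)"

lemma reads_unique: "reads w P i \<phi> \<Longrightarrow> reads w P i \<psi> \<Longrightarrow> \<phi> = \<psi>"
  unfolding reads_def using inj_word by (metis append_same_eq injD)

definition fm :: "token list \<Rightarrow> nat \<Rightarrow> nat \<Rightarrow> form" where
  "fm w P i = (THE \<phi>. reads w P i \<phi>)"

lemma fm_eq: "reads w P i \<phi> \<Longrightarrow> fm w P i = \<phi>"
  unfolding fm_def using reads_unique by blast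

lemmas token_class_defs = isbin_def isbool_def isquant_def iscount_def istok_def

lemma token_exclusive:
  "isbool w i \<Longrightarrow> \<not> istok w i TUn \<and> \<not> isbin w i \<and> \<not> istok w i TEq \<and> \<not> istok w i TNeg \<and> \<not> isquant w i \<and> \<not> iscount w i"
  "isquant w i \<Longrightarrow> \<not> istok w i TUn \<and> \<not> isbin w i \<and> \<not> istok w i TEq \<and> \<not> istok w i TNeg \<and> \<not> isbool w i \<and> \<not> iscount w i"
  "iscount w i \<Longrightarrow> \<not> istok w i TUn \<and> \<not> isbin w i \<and> \<not> istok w i TEq \<and> \<not> istok w i TNeg \<and> \<not> isbool w i \<and> \<not> isquant w i"
  "isbin w i \<Longrightarrow> \<not> istok w i TUn \<and> \<not> istok w i TEq \<and> \<not> istok w i TNeg \<and> \<not> isbool w i \<and> \<not> isquant w i \<and> \<not> iscount w i"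
  "istok w i TUn \<Longrightarrow> \<not> isbin w i \<and> \<not> istok w i TEq \<and> \<not> istok w i TNeg \<and> \<not> isbool w i \<and> \<not> isquant w i \<and> \<not> iscount w i"
  "istok w i TEq \<Longrightarrow> \<not> istok w i TUn \<and> \<not> isbin w i \<and> \<not> istok w i TNeg \<and> \<not> isbool w i \<and> \<not> isquant w i \<and> \<not> iscount w i"
  "istok w i TNeg \<Longrightarrow> \<not> istok w i TUn \<and> \<not> isbin w i \<and> \<not> istok w i TEq \<and> \<not> isbool w i \<and> \<not> isquant w i \<and> \<not> iscount w i"
  by (auto simp: token_class_defs)

lemma GC2D_quantifier:
  "\<phi> \<in> GC2D \<Longrightarrow> \<not> (X \<in> free_vars \<phi> \<and> Y \<in> free_vars \<phi>) \<Longrightarrow> All u \<phi> \<in> GC2D \<and> Ex u \<phi> \<in> GC2D"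
proof -
  assume *: "\<phi> \<in> GC2D" "\<not> (X \<in> free_vars \<phi> \<and> Y \<in> free_vars \<phi>)"
  have "free_vars \<phi> \<subseteq> {X} \<or> free_vars \<phi> \<subseteq> {Y}" using *(2) by (metis insertI1 subsetI var.exhaust)
  then have "card (free_vars \<phi>) \<le> 1" using card_mono[of "{X}"] card_mono[of "{Y}"] by fastforce
  then show ?thesis using * GC2D.all GC2D.ex by blast
qed

section \<open>Correct tables describe formulas of the fragment\<close>

locale parse =
  fixes w :: "token list" and P :: nat
  assumes parsed: "parsed w P"
begin

lemma digits_table:
  assumes "i \<le> length w"
  shows "digits_end w P i = i + length (block w i) \<and> digits_pow w P i = 2 ^ length (block w i) \<and>
    number w P i = digits_value (block w i)"
  using assms
proof (induction "length w - i" arbitrary: i rule: less_induct)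
  case less
  have ok: "digits_ok w P i" using parsed less.prems by (simp add: parsed_def)
  show ?case
  proof (cases "digit w i")
    case False
    then show ?thesis using ok block_no_digit[OF False] by (simp add: digits_ok_def)
  next
    case True
    then obtain t where t: "istok w i t" "is_digit t" by (auto simp: digit_def)
    have "i < length w" using t istok_less by blast
    then show ?thesis using less.hyps[of "Suc i"] ok True block_digit[OF t] t
      by (auto simp: digits_ok_def istok_def)
  qed
qed

lemma canon_digits:
  assumes "canon w P i"
  shows "drop i w = binary (number w P i) @ drop (digits_end w P i) w"
    "i < digits_end w P i" "digits_end w P i \<le> length w"
proof -
  have "digit w i" using assms by (auto simp: canon_def digit_def)
  then obtain t where t: "istok w i t" "is_digit t" by (auto simp: digit_def)
  have i: "i < length w" using t istok_less by blast
  note b = block_digit[OF t]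
  note tb = digits_table[of i]
  have "set (block w i) \<subseteq> {T0, T1}"
    unfolding block_def using set_takeWhileD by fastforce
  moreover have "hd (block w i) = T1 \<or> length (block w i) = 1"
  proof (cases "t = T1")
    case False
    then have "digits_end w P i = Suc i" using assms t by (auto simp: canon_def istok_def)
    then show ?thesis using tb i by simp
  qed (simp add: b)
  ultimately have "binary (digits_value (block w i)) = block w i"
    using b by (intro binary_digits_value) auto
  then show "drop i w = binary (number w P i) @ drop (digits_end w P i) w"
    using block_append[of i w] tb i by simp
  show "i < digits_end w P i" using tb i b by simp
  have "length (block w i) \<le> length (drop i w)" unfolding block_def by (rule length_takeWhile_le)
  then show "digits_end w P i \<le> length w" using tb i by simp
qed

lemma arg_word:
  assumes "arg_ok w P a"
  shows "drop a w = word_arg (the_arg w P a) @ drop (arg_end w P a) w"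
    "a < arg_end w P a" "arg_end w P a \<le> length w"
    "vars_arg (the_arg w P a) = {v. v = X \<and> istok w a TX \<or> v = Y \<and> istok w a TY}"
    "constants_arg (the_arg w P a) = (if isvar w a then {} else {number w P (Suc a)})"
    "\<exists>v. the_arg w P a = (if isvar w a then Var v else Const (number w P (Suc a)))"
proof -
  consider "istok w a TX" | "istok w a TY" | "istok w a TConst" "canon w P (Suc a)"
    using assms by (auto simp: arg_ok_def isvar_def)
  then have "drop a w = word_arg (the_arg w P a) @ drop (arg_end w P a) w \<and>
    a < arg_end w P a \<and> arg_end w P a \<le> length w \<and>
    vars_arg (the_arg w P a) = {v. v = X \<and> istok w a TX \<or> v = Y \<and> istok w a TY} \<and>
    constants_arg (the_arg w P a) = (if isvar w a then {} else {number w P (Suc a)}) \<and>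
    (\<exists>v. the_arg w P a = (if isvar w a then Var v else Const (number w P (Suc a))))"
  proof cases
    case 3
    then show ?thesis using istok_drop[OF 3(1)] canon_digits[OF 3(2)]
      by (auto simp: istok_def arg_end_def the_arg_def isvar_def)
  qed (auto simp: arg_end_def the_arg_def isvar_def istok_def Cons_nth_drop_Suc[symmetric])
  then show "drop a w = word_arg (the_arg w P a) @ drop (arg_end w P a) w"
    "a < arg_end w P a" "arg_end w P a \<le> length w"
    "vars_arg (the_arg w P a) = {v. v = X \<and> istok w a TX \<or> v = Y \<and> istok w a TY}"
    "constants_arg (the_arg w P a) = (if isvar w a then {} else {number w P (Suc a)})"
    "\<exists>v. the_arg w P a = (if isvar w a then Var v else Const (number w P (Suc a)))" by blast+
qed

lemma node_ok: "node w P i \<Longrightarrow> node_ok w P i"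
  using parsed by (simp add: parsed_def node_def)

lemma args:
  assumes "node w P i" "isbin w i \<or> istok w i TEq"
  shows "args_ok w P i" "isbin w i \<Longrightarrow> canon w P (Suc i)"
proof -
  have "args_ok w P i \<and> (isbin w i \<longrightarrow> canon w P (Suc i))" using assms(2)
  proof
    assume "isbin w i"
    from this token_exclusive(4)[OF this] show ?thesis using node_ok[OF assms(1)] by (simp add: node_ok_def)
  next
    assume "istok w i TEq"
    from this token_exclusive(6)[OF this] show ?thesis using node_ok[OF assms(1)] by (simp add: node_ok_def)
  qed
  then show "args_ok w P i" "isbin w i \<Longrightarrow> canon w P (Suc i)" by blast+
qed

lemma node_cases [consumes 1, case_names unary binary equal neg bool quant count]:
  assumes "node w P i"
  obtains "istok w i TUn" | "isbin w i" | "istok w i TEq" | "istok w i TNeg" | "isbool w i" | "isquant w i" | "iscount w i"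
  using node_ok[OF assms] unfolding node_ok_def by blast

lemma unary_node:
  assumes "node w P i" "istok w i TUn"
  shows "reads w P i (Unary (number w P (Suc i)) (the_arg w P (fst_pos w P i)))"
    "arg_ok w P (fst_pos w P i)" "fst_pos w P i = digits_end w P (Suc i)"
proof -
  have *: "canon w P (Suc i)" "arg_ok w P (fst_pos w P i)" "fm_end w P i = arg_end w P (fst_pos w P i)"
    "freeX w P i \<longleftrightarrow> istok w (fst_pos w P i) TX" "freeY w P i \<longleftrightarrow> istok w (fst_pos w P i) TY"
    using node_ok[OF assms(1)] assms(2) token_exclusive(5)[OF assms(2)] by (simp_all add: node_ok_def)
  show f: "fst_pos w P i = digits_end w P (Suc i)" using assms by (simp add: fst_pos_def istok_def)
  show "arg_ok w P (fst_pos w P i)" by (rule *)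
  note a = arg_word[OF *(2)] and c = canon_digits[OF *(1)]
  have g: "Unary (number w P (Suc i)) (the_arg w P (fst_pos w P i)) \<in> GC2D"
    using a(6) by (auto intro: GC2D.un GC2D.ground_un split: if_splits)
  show "reads w P i (Unary (number w P (Suc i)) (the_arg w P (fst_pos w P i)))"
    unfolding reads_def using g istok_drop[OF assms(2)] a c *(3-5) f by simp
qed

lemma binary_node:
  assumes "node w P i" "isbin w i"
  shows "reads w P i (Binary (the_bpred w P i) (the_arg w P (fst_pos w P i)) (the_arg w P (snd_pos w P i)))"
proof -
  have *: "args_ok w P i" "canon w P (Suc i)" using args[OF assms(1)] assms(2) by blast+
  then have o: "arg_ok w P (fst_pos w P i)" "arg_ok w P (snd_pos w P i)"
    "isvar w (fst_pos w P i) \<longleftrightarrow> isvar w (snd_pos w P i)" "fm_end w P i = arg_end w P (snd_pos w P i)"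
    "freeX w P i \<longleftrightarrow> istok w (fst_pos w P i) TX \<or> istok w (snd_pos w P i) TX"
    "freeY w P i \<longleftrightarrow> istok w (fst_pos w P i) TY \<or> istok w (snd_pos w P i) TY"
    by (auto simp: args_ok_def)
  have f: "fst_pos w P i = digits_end w P (Suc i)" using assms by (auto simp: fst_pos_def token_class_defs)
  note a = arg_word[OF o(1)] and b = arg_word[OF o(2)] and c = canon_digits[OF *(2)]
  have g: "Binary (the_bpred w P i) (the_arg w P (fst_pos w P i)) (the_arg w P (snd_pos w P i)) \<in> GC2D"
    using a(6) b(6) o(3) by (auto intro: GC2D.bin GC2D.ground_bin GC2D.eq GC2D.ground_eq split: if_splits)
  have "drop i w = word_bpred (the_bpred w P i) @ drop (digits_end w P (Suc i)) w"
  proof (cases "istok w i TPlain")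
    case True
    then show ?thesis using istok_drop[OF True] c(1) by (simp add: the_bpred_def)
  next
    case False
    then have k: "istok w i TKey" using assms(2) by (auto simp: isbin_def)
    then show ?thesis using istok_drop[OF k] c(1) False by (simp add: the_bpred_def)
  qed
  then show ?thesis
    unfolding reads_def using g a b c o(4-6) f snd_pos_def[of w P i] by simp
qed

lemma equal_node:
  assumes "node w P i" "istok w i TEq"
  shows "reads w P i (Equal (the_arg w P (fst_pos w P i)) (the_arg w P (snd_pos w P i)))"
proof -
  have *: "args_ok w P i" using args[OF assms(1)] assms(2) by blast
  then have o: "arg_ok w P (fst_pos w P i)" "arg_ok w P (snd_pos w P i)"
    "isvar w (fst_pos w P i) \<longleftrightarrow> isvar w (snd_pos w P i)" "fm_end w P i = arg_end w P (snd_pos w P i)"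
    "freeX w P i \<longleftrightarrow> istok w (fst_pos w P i) TX \<or> istok w (snd_pos w P i) TX"
    "freeY w P i \<longleftrightarrow> istok w (fst_pos w P i) TY \<or> istok w (snd_pos w P i) TY"
    by (auto simp: args_ok_def)
  have f: "fst_pos w P i = Suc i" using assms by (auto simp: fst_pos_def)
  note a = arg_word[OF o(1)] and b = arg_word[OF o(2)]
  have g: "Equal (the_arg w P (fst_pos w P i)) (the_arg w P (snd_pos w P i)) \<in> GC2D"
    using a(6) b(6) o(3) by (auto intro: GC2D.bin GC2D.ground_bin GC2D.eq GC2D.ground_eq split: if_splits)
  show ?thesis
    unfolding reads_def using g istok_drop[OF assms(2)] a b o(4-6) f snd_pos_def[of w P i] by simp
qed

lemma neg_node:
  assumes "node w P i" "istok w i TNeg"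
  shows "node w P (Suc i)" "reads w P (Suc i) \<phi> \<Longrightarrow> reads w P i (Neg \<phi>)"
proof -
  have *: "node w P (Suc i)" "fm_end w P i = fm_end w P (Suc i)"
    "freeX w P i \<longleftrightarrow> freeX w P (Suc i)" "freeY w P i \<longleftrightarrow> freeY w P (Suc i)"
    using node_ok[OF assms(1)] assms(2) token_exclusive(7)[OF assms(2)] by (simp_all add: node_ok_def)
  show "node w P (Suc i)" by (rule *)
  show "reads w P i (Neg \<phi>)" if "reads w P (Suc i) \<phi>"
    using that * istok_drop[OF assms(2)] by (auto simp: reads_def intro: GC2D.neg)
qed

definition connective :: "nat \<Rightarrow> form \<Rightarrow> form \<Rightarrow> form" where
  "connective i = (if istok w i TConj then Conj else if istok w i TDisj then Disj else if istok w i TImpl then Impl else Iff)"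

lemma bool_node:
  assumes "node w P i" "isbool w i"
  shows "node w P (Suc i)" "node w P (rpos w P i)"
    "reads w P (Suc i) \<phi> \<Longrightarrow> reads w P (rpos w P i) \<psi> \<Longrightarrow> reads w P i (connective i \<phi> \<psi>)"
proof -
  have *: "node w P (Suc i)" "node w P (rpos w P i)" "fm_end w P i = fm_end w P (rpos w P i)"
    "freeX w P i \<longleftrightarrow> freeX w P (Suc i) \<or> freeX w P (rpos w P i)"
    "freeY w P i \<longleftrightarrow> freeY w P (Suc i) \<or> freeY w P (rpos w P i)"
    using node_ok[OF assms(1)] assms(2) token_exclusive(1)[OF assms(2)] by (simp_all add: node_ok_def)
  show "node w P (Suc i)" "node w P (rpos w P i)" by (rule *)+
  assume r: "reads w P (Suc i) \<phi>" "reads w P (rpos w P i) \<psi>"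
  have d: "drop (Suc i) w = word \<phi> @ word \<psi> @ drop (fm_end w P i) w"
    using r * by (simp add: reads_def rpos_def)
  have t: "istok w i TConj \<or> istok w i TDisj \<or> istok w i TImpl \<or> istok w i TIff"
    using assms(2) by (simp add: isbool_def)
  have "drop i w = word (connective i \<phi> \<psi>) @ drop (fm_end w P i) w"
    using t
  proof (elim disjE)
    assume "istok w i TConj" from istok_drop[OF this] this show ?thesis using d by (simp add: connective_def)
  next
    assume k: "istok w i TDisj" from istok_drop[OF this] show ?thesis using d k by (simp add: connective_def istok_def)
  next
    assume k: "istok w i TImpl" from istok_drop[OF this] show ?thesis using d k by (simp add: connective_def istok_def)
  next
    assume k: "istok w i TIff" from istok_drop[OF this] show ?thesis using d k by (simp add: connective_def istok_def)
  qed
  moreover have "connective i \<phi> \<psi> \<in> GC2D" "free_vars (connective i \<phi> \<psi>) = free_vars \<phi> \<union> free_vars \<psi>"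
    using r by (auto simp: connective_def reads_def intro: GC2D.conj GC2D.disj GC2D.impl GC2D.iff)
  ultimately show "reads w P i (connective i \<phi> \<psi>)" using r * by (auto simp: reads_def rpos_def)
qed

lemma isvar_drop: "isvar w a \<Longrightarrow> drop a w = word_var (the_var w a) # drop (Suc a) w"
  using istok_drop[of w a TX] istok_drop[of w a TY] by (auto simp: isvar_def the_var_def istok_def)

definition quantifier :: "nat \<Rightarrow> var \<Rightarrow> form \<Rightarrow> form" where
  "quantifier i = (if istok w i TAll then All else Ex)"

lemma quant_node:
  assumes "node w P i" "isquant w i"
  shows "node w P (i + 2)" "isvar w (Suc i)" "\<not> (freeX w P (i + 2) \<and> freeY w P (i + 2))"
    "reads w P (i + 2) \<phi> \<Longrightarrow> reads w P i (quantifier i (the_var w (Suc i)) \<phi>)"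
proof -
  have *: "node w P (i + 2)" "isvar w (Suc i)" "\<not> (freeX w P (i + 2) \<and> freeY w P (i + 2))"
    "fm_end w P i = fm_end w P (i + 2)"
    "freeX w P i \<longleftrightarrow> freeX w P (i + 2) \<and> istok w (Suc i) TY"
    "freeY w P i \<longleftrightarrow> freeY w P (i + 2) \<and> istok w (Suc i) TX"
    using node_ok[OF assms(1)] assms(2) token_exclusive(2)[OF assms(2)] by (simp_all add: node_ok_def)
  show "node w P (i + 2)" "isvar w (Suc i)" "\<not> (freeX w P (i + 2) \<and> freeY w P (i + 2))" by (rule *)+
  assume r: "reads w P (i + 2) \<phi>"
  have d: "drop (Suc i) w = word_var (the_var w (Suc i)) # word \<phi> @ drop (fm_end w P i) w"
    using r * isvar_drop[OF *(2)] by (simp add: reads_def)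
  have "drop i w = word (quantifier i (the_var w (Suc i)) \<phi>) @ drop (fm_end w P i) w"
  proof (cases "istok w i TAll")
    case True
    then show ?thesis using istok_drop[OF True] d by (simp add: quantifier_def)
  next
    case False
    then have "istok w i TEx" using assms(2) by (auto simp: isquant_def)
    then show ?thesis using istok_drop[of w i TEx] d False by (simp add: quantifier_def)
  qed
  moreover have "quantifier i (the_var w (Suc i)) \<phi> \<in> GC2D"
    using r *(3) GC2D_quantifier[of \<phi>] by (auto simp: quantifier_def reads_def)
  moreover have "free_vars (quantifier i (the_var w (Suc i)) \<phi>) = free_vars \<phi> - {the_var w (Suc i)}"
    by (simp add: quantifier_def)
  ultimately show "reads w P i (quantifier i (the_var w (Suc i)) \<phi>)"
    using r * by (auto simp: reads_def the_var_def isvar_def istok_def)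
qed

lemma count_node:
  assumes "node w P i" "iscount w i"
  shows "node w P (body w P i)" "istok w (body w P i) TConj" "node w P (Suc (body w P i))" "isbin w (Suc (body w P i))"
    "isvar w (fst_pos w P i)" "i < body w P i" "freeX w P (Suc (body w P i))" "freeY w P (Suc (body w P i))"
    "canon w P (Suc i)"
    "reads w P (body w P i) \<phi> \<Longrightarrow> reads w P i (Count (the_comparison w i) (number w P (Suc i)) (the_var w (fst_pos w P i)) \<phi>)"
proof -
  have *: "node w P (body w P i)" "istok w (body w P i) TConj" "node w P (Suc (body w P i))"
    "isbin w (Suc (body w P i))" "isvar w (fst_pos w P i)"
    "freeX w P (Suc (body w P i))" "freeY w P (Suc (body w P i))"
    "canon w P (Suc i)" "fm_end w P i = fm_end w P (body w P i)"
    "freeX w P i \<longleftrightarrow> istok w (fst_pos w P i) TY" "freeY w P i \<longleftrightarrow> istok w (fst_pos w P i) TX"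
    using node_ok[OF assms(1)] assms(2) token_exclusive(3)[OF assms(2)] by (simp_all add: node_ok_def)
  have f: "fst_pos w P i = digits_end w P (Suc i)" using assms by (auto simp: fst_pos_def token_class_defs)
  note c = canon_digits[OF *(8)]
  show "node w P (body w P i)" "istok w (body w P i) TConj" "node w P (Suc (body w P i))"
    "isbin w (Suc (body w P i))" "isvar w (fst_pos w P i)" "freeX w P (Suc (body w P i))" "freeY w P (Suc (body w P i))"
    "canon w P (Suc i)" by (rule *)+
  show "i < body w P i" using c f by (simp add: body_def)
  assume r: "reads w P (body w P i) \<phi>"
  have eb: "reads w P (Suc (body w P i)) (Binary (the_bpred w P (Suc (body w P i)))
      (the_arg w P (fst_pos w P (Suc (body w P i)))) (the_arg w P (snd_pos w P (Suc (body w P i)))))"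
    by (rule binary_node[OF *(3,4)])
  have ao: "args_ok w P (Suc (body w P i))" using args(1)[OF *(3)] *(4) by blast
  obtain v u where vu: "the_arg w P (fst_pos w P (Suc (body w P i))) = Var v"
    "the_arg w P (snd_pos w P (Suc (body w P i))) = Var u" "v \<noteq> u"
    using eb ao *(6,7) by (auto simp: reads_def args_ok_def the_arg_def isvar_def istok_def split: if_splits)
  define q where "q = the_bpred w P (Suc (body w P i))"
  have d: "word \<phi> @ drop (fm_end w P (body w P i)) w = TConj # word (Binary q (Var v) (Var u)) @
     drop (fm_end w P (Suc (body w P i))) w"
    using r eb istok_drop[OF *(2)] vu by (simp add: reads_def q_def)
  have phi: "\<phi> \<in> GC2D" using r by (simp add: reads_def)
  \<comment> \<open>The body begins with \<open>TConj\<close>, hence is a conjunction. What follows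
    that token can be read in two ways, as its left operand and as the guard found in the tables;
    unique readability identifies them.\<close>
  obtain \<chi> where \<chi>: "\<phi> = Conj (Binary q (Var v) (Var u)) \<chi>" "\<chi> \<in> GC2D"
  proof -
    have "\<exists>\<phi>1 \<phi>2. \<phi> = Conj \<phi>1 \<phi>2"
    proof (cases \<phi>)
      case (Binary p s t)
      then show ?thesis using d by (cases p) auto
    next
      case (Count k C u \<chi>)
      then show ?thesis using d by (cases k) auto
    qed (use d in auto)
    then obtain \<phi>1 \<phi>2 where e: "\<phi> = Conj \<phi>1 \<phi>2" by blast
    have fo: "istok w (Suc (body w P i)) TPlain \<or> istok w (Suc (body w P i)) TKey"
      using *(4) by (simp add: isbin_def)
    have "word \<phi>1 @ (word \<phi>2 @ drop (fm_end w P (body w P i)) w) = word (Binary q (Var v) (Var u)) @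
        drop (fm_end w P (Suc (body w P i))) w" using d e by simp
    \<comment> \<open>Another formula follows the guard, and no formula begins with a digit, so the
      last name in the guard cannot be read any longer.\<close>
    moreover have "no_digit (drop (fm_end w P (Suc (body w P i))) w)"
    proof -
      have "node w P (rpos w P (body w P i))"
        using bool_node(2)[OF *(1)] *(2) by (simp add: isbool_def)
      from node_cases[OF this] show ?thesis unfolding rpos_def
        by cases (auto dest: istok_drop simp: isbin_def isbool_def isquant_def iscount_def)
    qed
    ultimately have "\<phi>1 = Binary q (Var v) (Var u)"
      using word_append[of \<phi>1 _ "Binary q (Var v) (Var u)"] word_no_digit by blast
    moreover have "\<phi>2 \<in> GC2D" using phi unfolding e by (cases rule: GC2D.cases) auto
    ultimately show ?thesis using that e by blast
  qed
  define k where "k = the_comparison w i"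
  define C where "C = number w P (Suc i)"
  define z where "z = the_var w (fst_pos w P i)"
  have g: "Count k C z \<phi> \<in> GC2D" unfolding \<chi>(1) by (intro GC2D.count \<chi> vu(3))
  have fv: "free_vars \<phi> = {X, Y}"
    using vu(3) unfolding \<chi>(1) by (cases v; cases u) (auto, (metis var.exhaust)+)
  have tk: "drop i w = word_comparison k # drop (Suc i) w"
    using assms(2) istok_drop[of w i TAtMost] istok_drop[of w i TAtLeast] istok_drop[of w i TExactly]
    by (auto simp: iscount_def k_def the_comparison_def istok_def)
  have "drop i w = word (Count k C z \<phi>) @ drop (fm_end w P i) w"
    using tk c(1) isvar_drop[OF *(5)] r *(9) f by (simp add: C_def z_def reads_def body_def)
  moreover have "i < fm_end w P i" "fm_end w P i \<le> length w"
    using r *(9) c f by (auto simp: reads_def body_def)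
  ultimately show "reads w P i (Count (the_comparison w i) (number w P (Suc i)) (the_var w (fst_pos w P i)) \<phi>)"
    unfolding k_def[symmetric] C_def[symmetric] z_def[symmetric] reads_def
    using g *(5,10,11) fv by (auto simp: z_def the_var_def isvar_def istok_def)
qed

text \<open>Induction from right to left, since proper subformulas start at later positions.\<close>

lemma reads_fm: "node w P i \<Longrightarrow> reads w P i (fm w P i)"
proof -
  have "node w P i \<Longrightarrow> \<exists>\<phi>. reads w P i \<phi>"
  proof (induction "length w - i" arbitrary: i rule: less_induct)
    case less
    have il: "i < length w" using less.prems by (simp add: node_def)
    have IH: "\<exists>\<phi>. reads w P j \<phi>" if "i < j" "node w P j" for j
      using less.hyps[of j] that il by auto
    from less.prems show ?case
    proof (cases rule: node_cases)
      case unary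
      then show ?thesis using unary_node less.prems by blast
    next
      case binary
      then show ?thesis using binary_node less.prems by blast
    next
      case equal
      then show ?thesis using equal_node less.prems by blast
    next
      case neg
      then show ?thesis using neg_node[OF less.prems neg] IH[of "Suc i"] by blast
    next
      case bool
      note b = bool_node[OF less.prems bool]
      obtain \<phi> where \<phi>: "reads w P (Suc i) \<phi>" using IH[of "Suc i"] b by blast
      then have "i < rpos w P i" by (simp add: reads_def rpos_def)
      then show ?thesis using IH b \<phi> by blast
    next
      case quant
      then show ?thesis using quant_node[OF less.prems quant] IH[of "i + 2"] by fastforce
    next
      case count
      then show ?thesis using count_node[OF less.prems count] IH by blast
    qed
  qed
  then show "node w P i \<Longrightarrow> reads w P i (fm w P i)" using fm_eq by metis
qed

lemma fm_GC2D: "node w P i \<Longrightarrow> fm w P i \<in> GC2D"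
  using reads_fm by (simp add: reads_def)

lemma free_fm:
  "node w P i \<Longrightarrow> X \<in> free_vars (fm w P i) \<longleftrightarrow> freeX w P i"
  "node w P i \<Longrightarrow> Y \<in> free_vars (fm w P i) \<longleftrightarrow> freeY w P i"
  using reads_fm by (auto simp: reads_def)

lemma rpos_greater: "node w P i \<Longrightarrow> isbool w i \<Longrightarrow> i < rpos w P i"
  using reads_fm[OF bool_node(1), of i] by (simp add: reads_def rpos_def)

lemma fm_unary: "node w P i \<Longrightarrow> istok w i TUn \<Longrightarrow> fm w P i = Unary (number w P (Suc i)) (the_arg w P (fst_pos w P i))"
  by (rule fm_eq[OF unary_node(1)])

lemma fm_binary: "node w P i \<Longrightarrow> isbin w i \<Longrightarrow>
  fm w P i = Binary (the_bpred w P i) (the_arg w P (fst_pos w P i)) (the_arg w P (snd_pos w P i))"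
  by (rule fm_eq[OF binary_node])

lemma fm_equal: "node w P i \<Longrightarrow> istok w i TEq \<Longrightarrow>
  fm w P i = Equal (the_arg w P (fst_pos w P i)) (the_arg w P (snd_pos w P i))"
  by (rule fm_eq[OF equal_node])

lemma fm_neg: "node w P i \<Longrightarrow> istok w i TNeg \<Longrightarrow> fm w P i = Neg (fm w P (Suc i))"
  by (rule fm_eq[OF neg_node(2)]) (auto intro: reads_fm neg_node(1))

lemma fm_bool: "node w P i \<Longrightarrow> isbool w i \<Longrightarrow> fm w P i = connective i (fm w P (Suc i)) (fm w P (rpos w P i))"
  by (rule fm_eq[OF bool_node(3)]) (auto intro: reads_fm bool_node(1,2))

lemma fm_quant: "node w P i \<Longrightarrow> isquant w i \<Longrightarrow> fm w P i = quantifier i (the_var w (Suc i)) (fm w P (i + 2))"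
  by (rule fm_eq[OF quant_node(4)]) (auto intro: reads_fm quant_node(1)[simplified])

lemma fm_count: "node w P i \<Longrightarrow> iscount w i \<Longrightarrow>
  fm w P i = Count (the_comparison w i) (number w P (Suc i)) (the_var w (fst_pos w P i)) (fm w P (body w P i))"
  by (rule fm_eq[OF count_node(10)]) (auto intro: reads_fm count_node(1))

lemma root_node: "node w P 0" "fm w P 0 \<in> GC2D_sentences" "word (fm w P 0) = w"
proof -
  show n: "node w P 0" using parsed by (auto simp: parsed_def node_def)
  have e: "fm_end w P 0 = length w" "\<not> freeX w P 0" "\<not> freeY w P 0" using parsed by (auto simp: parsed_def)
  show "word (fm w P 0) = w" using reads_fm[OF n] e by (simp add: reads_def)
  have "free_vars (fm w P 0) = {}" using free_fm[OF n] e by (metis ex_in_conv var.exhaust)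
  then show "fm w P 0 \<in> GC2D_sentences" using fm_GC2D[OF n] by (simp add: GC2D_sentences_def)
qed

text \<open>Structures are constrained on the symbols that occur in the formula. Tracing each of
  them back to a position makes the conditions on types available for it.\<close>

lemma symbols_of_fm:
  "node w P i \<Longrightarrow> (\<forall>p \<in> bpreds (fm w P i). \<exists>j. node w P j \<and> isbin w j \<and> the_bpred w P j = p) \<and>
    (\<forall>c \<in> constants (fm w P i). \<exists>a < length w. marked w P a \<and> number w P (Suc a) = c)"
proof (induction "length w - i" arbitrary: i rule: less_induct)
  case less
  have il: "i < length w" using less.prems by (simp add: node_def)
  let ?P = "\<lambda>i. (\<forall>p \<in> bpreds (fm w P i). \<exists>j. node w P j \<and> isbin w j \<and> the_bpred w P j = p) \<and>
    (\<forall>c \<in> constants (fm w P i). \<exists>a < length w. marked w P a \<and> number w P (Suc a) = c)"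
  have IH: "?P j" if "i < j" "node w P j" for j
    using less.hyps[of j] that il by auto
  have arg: "\<exists>a < length w. marked w P a \<and> number w P (Suc a) = c" if "arg_ok w P b" "c \<in> constants_arg (the_arg w P b)" for b c
    using arg_word(5)[OF that(1)] that by (auto simp: arg_ok_def istok_def split: if_splits)
  from less.prems show ?case
  proof (cases rule: node_cases)
    case unary
    then show ?thesis using fm_unary[OF less.prems] arg[OF unary_node(2)[OF less.prems]] by auto
  next
    case binary
    then have "args_ok w P i" using args(1)[OF less.prems] by blast
    then show ?thesis using fm_binary[OF less.prems binary] arg less.prems binary by (auto simp: args_ok_def)
  next
    case equal
    then have "args_ok w P i" using args(1)[OF less.prems] by blast
    then show ?thesis using fm_equal[OF less.prems equal] arg by (auto simp: args_ok_def)
  next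
    case neg
    then show ?thesis using fm_neg[OF less.prems neg] IH[of "Suc i"] neg_node(1)[OF less.prems] by simp
  next
    case bool
    have "?P (Suc i)" "?P (rpos w P i)"
      using IH bool_node(1,2)[OF less.prems bool] rpos_greater[OF less.prems bool] by auto
    moreover have "bpreds (connective i a b) = bpreds a \<union> bpreds b"
      "constants (connective i a b) = constants a \<union> constants b" for a b by (auto simp: connective_def)
    ultimately show ?thesis unfolding fm_bool[OF less.prems bool] by auto
  next
    case quant
    then show ?thesis using fm_quant[OF less.prems quant] IH[of "i + 2"] quant_node(1)[OF less.prems]
      by (simp add: quantifier_def)
  next
    case count
    then show ?thesis using fm_count[OF less.prems count] IH[of "body w P i"] count_node(1,6)[OF less.prems count] by simp
  qed
qed

end

lemma word_not_Nil: "word \<phi> \<noteq> []"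
proof (cases \<phi>)
  case (Binary p s t)
  then show ?thesis by (cases p) auto
qed auto

text \<open>
  The tables of an actual formula \<open>\<psi>\<close>: a position counts as the start of a formula if a
  formula of the fragment over the symbols of \<open>\<psi>\<close> can be read there.
\<close>

locale tables =
  fixes \<psi> :: form and w :: "token list"
  assumes \<psi>: "\<psi> \<in> GC2D_sentences" and w: "w = word \<psi>"
begin

text \<open>Restricting the symbols replaces a proof that every readable formula is a subformula of
  \<psi>: the requirements on a model of \<psi> then cover every key predicate and constant that is
  met at some node.\<close>

definition "Sub = {\<phi> \<in> GC2D. bpreds \<phi> \<subseteq> bpreds \<psi> \<and> constants \<phi> \<subseteq> constants \<psi>}"

definition "rd i \<phi> \<longleftrightarrow> \<phi> \<in> Sub \<and> (\<exists>r. drop i w = word \<phi> @ r \<and> no_digit r)"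

lemma rd_unique: "rd i \<phi> \<Longrightarrow> rd i \<phi>' \<Longrightarrow> \<phi> = \<phi>'"
  unfolding rd_def using word_append by metis

definition "end_of i = (if \<exists>\<phi>. rd i \<phi> then i + length (word (THE \<phi>. rd i \<phi>)) else 0)"

lemma end_of: "rd i \<phi> \<Longrightarrow> end_of i = i + length (word \<phi>)"
proof -
  assume r: "rd i \<phi>"
  then have "(THE \<phi>. rd i \<phi>) = \<phi>" using rd_unique by blast
  then show ?thesis using r unfolding end_of_def by metis
qed

definition "mark a \<longleftrightarrow> istok w a TConst \<and>
  (\<exists>c \<in> constants \<psi>. \<exists>r. drop (Suc a) w = binary c @ r \<and> no_digit r)"

definition field :: "nat \<Rightarrow> nat \<Rightarrow> nat" where "field j i =
  (if j = 0 then i + length (block w i) else if j = 1 then 2 ^ length (block w i)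
   else if j = 2 then digits_value (block w i) else if j = 3 then end_of i
   else if j = 4 then of_bool (\<exists>\<phi>. rd i \<phi> \<and> X \<in> free_vars \<phi>)
   else if j = 5 then of_bool (\<exists>\<phi>. rd i \<phi> \<and> Y \<in> free_vars \<phi>)
   else of_bool (mark i))"

lemma block_le: "i \<le> length w \<Longrightarrow> i + length (block w i) \<le> length w"
proof -
  assume "i \<le> length w"
  moreover have "length (block w i) \<le> length (drop i w)" unfolding block_def by (rule length_takeWhile_le)
  ultimately show ?thesis by simp
qed

lemma end_of_le: "i \<le> length w \<Longrightarrow> end_of i \<le> length w"
proof (cases "\<exists>\<phi>. rd i \<phi>")
  case True
  then obtain \<phi> r where r: "rd i \<phi>" "drop i w = word \<phi> @ r" by (auto simp: rd_def)
  assume "i \<le> length w"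
  moreover have "length w - i = length (word \<phi>) + length r" using arg_cong[OF r(2), of length] by simp
  ultimately show ?thesis using end_of[OF r(1)] by simp
qed (simp add: end_of_def)

lemma field_less: "i \<le> length w \<Longrightarrow> field j i < Qd w"
proof -
  assume i: "i \<le> length w"
  have b: "length (block w i) \<le> length w" using block_le[OF i] by simp
  have p: "(2 :: nat) ^ length (block w i) \<le> 2 ^ length w" using b by (rule power_increasing) simp
  have q: "length w < Qd w" "4 \<le> Qd w" "2 ^ length w < Qd w" by (rule Qd_bounds)+
  have p': "2 ^ length (block w i) < Qd w" by (rule le_less_trans[OF p q(3)])
  then have "digits_value (block w i) < Qd w"
    using digits_value_less[of "block w i"] by (rule less_trans[rotated])
  with p' have "i + length (block w i) < Qd w" "end_of i < Qd w" "2 ^ length (block w i) < Qd w"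
    "digits_value (block w i) < Qd w" "of_bool b < Qd w" for b
    using block_le[OF i] end_of_le[OF i] q by (auto simp: of_bool_def)
  then show ?thesis by (simp add: field_def)
qed

lemma table_exists:
  obtains P where "P < Bd w" "\<And>i j. i \<le> length w \<Longrightarrow> j < 8 \<Longrightarrow> dig w P (8 * i + j) = field j i"
proof -
  have "field (k mod 8) (k div 8) < Qd w" if "k < 8 * (length w + 1)" for k
    using that by (intro field_less) (simp add: less_mult_imp_div_less)
  moreover have "8 * (length w + 1) \<le> 8 * (length w + 1) ^ 3"
    using self_le_power[of "length w + 1" 3] by simp
  ultimately obtain P where P: "P < Bd w" "\<And>k. k < 8 * (length w + 1) \<Longrightarrow> dig w P k = field (k mod 8) (k div 8)"
    using sequence_exists[of "8 * (length w + 1)" "\<lambda>k. field (k mod 8) (k div 8)" w] by blast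
  have "dig w P (8 * i + j) = field j i" if "i \<le> length w" "j < 8" for i j
    using P(2)[of "8 * i + j"] that by simp
  then show ?thesis using that P(1) by blast
qed

context
  fixes P
  assumes P: "\<And>i j. i \<le> length w \<Longrightarrow> j < 8 \<Longrightarrow> dig w P (8 * i + j) = field j i"
begin

lemma table:
  assumes "i \<le> length w"
  shows "digits_end w P i = i + length (block w i)" "digits_pow w P i = 2 ^ length (block w i)"
    "number w P i = digits_value (block w i)" "fm_end w P i = end_of i"
    "freeX w P i \<longleftrightarrow> (\<exists>\<phi>. rd i \<phi> \<and> X \<in> free_vars \<phi>)" "freeY w P i \<longleftrightarrow> (\<exists>\<phi>. rd i \<phi> \<and> Y \<in> free_vars \<phi>)"
    "marked w P i \<longleftrightarrow> mark i"
  using P[OF assms, of 0] P[OF assms, of 1] P[OF assms, of 2] P[OF assms, of 3]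
    P[OF assms, of 4] P[OF assms, of 5] P[OF assms, of 6]
  by (simp_all add: digits_end_def digits_pow_def number_def fm_end_def freeX_def freeY_def marked_def field_def)

lemma table_rd:
  assumes "rd i \<phi>"
  shows "node w P i" "fm_end w P i = i + length (word \<phi>)" "freeX w P i \<longleftrightarrow> X \<in> free_vars \<phi>" "freeY w P i \<longleftrightarrow> Y \<in> free_vars \<phi>"
proof -
  obtain r where "drop i w = word \<phi> @ r" using assms by (auto simp: rd_def)
  then have "drop i w \<noteq> []" using word_not_Nil[of \<phi>] by simp
  then have i: "i < length w" by simp
  show "fm_end w P i = i + length (word \<phi>)" using table(4)[of i] i end_of[OF assms] by simp
  then show "node w P i" using i word_not_Nil[of \<phi>] by (simp add: node_def)
  show "freeX w P i \<longleftrightarrow> X \<in> free_vars \<phi>" "freeY w P i \<longleftrightarrow> Y \<in> free_vars \<phi>"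
    using table(5,6)[of i] i assms rd_unique by auto
qed

lemma node_rd: "node w P i \<Longrightarrow> \<exists>\<phi>. rd i \<phi>"
  unfolding node_def using table(4)[of i] by (auto simp: end_of_def split: if_splits)

lemma number_rd:
  assumes "drop i w = binary k @ r" "no_digit r"
  shows "canon w P i" "number w P i = k" "digits_end w P i = i + length (binary k)" "drop (digits_end w P i) w = r"
proof -
  have "drop i w \<noteq> []" using assms binary_canonical[of k] by auto
  then have i: "i < length w" by simp
  have b: "block w i = binary k" using assms takeWhile_binary by (simp add: block_def)
  show "number w P i = k" using table(3)[of i] i b by (simp add: digits_value_binary)
  show e: "digits_end w P i = i + length (binary k)" using table(1)[of i] i b by simp
  show "drop (digits_end w P i) w = r" unfolding e by (rule drop_appendD[OF assms(1)])
  have "istok w i (hd (binary k))"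
    using drop_ConsD[of i w "hd (binary k)" "tl (binary k) @ r"] assms(1) binary_canonical[of k]
    by (metis append_Cons list.collapse)
  then show "canon w P i" using binary_canonical[of k] e by (auto simp: canon_def)
qed

lemma arg_rd:
  assumes "drop a w = word_arg s @ r" "no_digit r" "constants_arg s \<subseteq> constants \<psi>"
  shows "arg_ok w P a" "arg_end w P a = a + length (word_arg s)" "drop (arg_end w P a) w = r"
    "istok w a TX \<longleftrightarrow> s = Var X" "istok w a TY \<longleftrightarrow> s = Var Y" "isvar w a \<longleftrightarrow> vars_arg s \<noteq> {}"
proof -
  have *: "arg_ok w P a \<and> arg_end w P a = a + length (word_arg s) \<and>
    (istok w a TX \<longleftrightarrow> s = Var X) \<and> (istok w a TY \<longleftrightarrow> s = Var Y) \<and> (isvar w a \<longleftrightarrow> vars_arg s \<noteq> {})"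
  proof (cases s)
    case (Var v)
    then have "istok w a (word_var v)" using assms(1) drop_ConsD[of a w] by auto
    then show ?thesis using Var by (cases v) (auto simp: arg_ok_def isvar_def arg_end_def istok_def)
  next
    case (Const c)
    then have c: "istok w a TConst" "drop (Suc a) w = binary c @ r" using assms(1) drop_ConsD[of a w] by auto
    note n = number_rd[OF c(2) assms(2)]
    have "mark a" unfolding mark_def using c assms Const by auto
    then have "marked w P a" using table(7)[of a] c(1) istok_less[OF c(1)] by simp
    then show ?thesis using c n Const by (auto simp: arg_ok_def isvar_def arg_end_def istok_def)
  qed
  then show "arg_ok w P a" "arg_end w P a = a + length (word_arg s)"
    "istok w a TX \<longleftrightarrow> s = Var X" "istok w a TY \<longleftrightarrow> s = Var Y" "isvar w a \<longleftrightarrow> vars_arg s \<noteq> {}" by blast+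
  then show "drop (arg_end w P a) w = r" using drop_appendD[OF assms(1)] by simp
qed

lemma two_args_rd:
  assumes "drop (fst_pos w P i) w = word_arg s @ word_arg t @ r" "no_digit r"
    "constants_arg s \<subseteq> constants \<psi>" "constants_arg t \<subseteq> constants \<psi>" "vars_arg s = {} \<longleftrightarrow> vars_arg t = {}"
    "fm_end w P i = fst_pos w P i + length (word_arg s) + length (word_arg t)"
    "freeX w P i \<longleftrightarrow> X \<in> vars_arg s \<union> vars_arg t" "freeY w P i \<longleftrightarrow> Y \<in> vars_arg s \<union> vars_arg t"
  shows "args_ok w P i"
proof -
  note a = arg_rd[OF assms(1) word_arg_no_digit assms(3)]
  have "drop (snd_pos w P i) w = word_arg t @ r" unfolding snd_pos_def by (rule a(3))
  note b = arg_rd[OF this assms(2,4)]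
  have v: "z \<in> vars_arg u \<longleftrightarrow> u = Var z" for z u by (cases u) auto
  show ?thesis unfolding args_ok_def using a b assms(5-8) snd_pos_def[of w P i] by (auto simp: v)
qed

text \<open>Each grammar rule yields its disjunct of \<open>node_ok\<close>: the immediate
  subformulas are readable at the expected positions, so the tables have entries for them.\<close>

lemma node_ok_rd:
  assumes rd: "rd i \<phi>"
  shows "node_ok w P i"
proof -
  note t = table_rd[OF rd]
  have S: "\<phi> \<in> GC2D" "bpreds \<phi> \<subseteq> bpreds \<psi>" "constants \<phi> \<subseteq> constants \<psi>"
    using rd by (auto simp: rd_def Sub_def)
  obtain r where r: "drop i w = word \<phi> @ r" "no_digit r" using rd by (auto simp: rd_def)
  have subform: "rd j \<phi>'" if "\<phi>' \<in> GC2D" "bpreds \<phi>' \<subseteq> bpreds \<phi>" "constants \<phi>' \<subseteq> constants \<phi>"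
    "drop j w = word \<phi>' @ r'" "no_digit r'" for j \<phi>' r'
    using that S by (auto simp: rd_def Sub_def)
  have un: "node_ok w P i" if e: "\<phi> = Unary p s" for p s
  proof -
    have d: "istok w i TUn" "drop (Suc i) w = binary p @ word_arg s @ r" using r e drop_ConsD[of i w] by auto
    note n = number_rd[OF d(2) word_arg_no_digit]
    have f: "fst_pos w P i = digits_end w P (Suc i)" using d by (simp add: fst_pos_def istok_def)
    note a = arg_rd[OF n(4) r(2)]
    have v: "z \<in> vars_arg u \<longleftrightarrow> u = Var z" for z u by (cases u) auto
    show ?thesis using d(1) n(1,3) a t(2-4) S(3) unfolding node_ok_def f by (simp add: e v)
  qed
  have bin: "node_ok w P i" if e: "\<phi> = Binary p s u" "vars_arg s = {} \<longleftrightarrow> vars_arg u = {}" for p s u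
  proof -
    obtain k where k: "isbin w i" "drop (Suc i) w = binary k @ word_arg s @ word_arg u @ r"
      "word_bpred p = w ! i # binary k"
      using r e drop_ConsD[of i w] by (cases p) (auto simp: isbin_def istok_def)
    note n = number_rd[OF k(2) word_arg_no_digit]
    have f: "fst_pos w P i = digits_end w P (Suc i)" using k(1) by (auto simp: fst_pos_def istok_def isbin_def)
    have "args_ok w P i"
      by (rule two_args_rd[where s = s and t = u and r = r])
        (use n f t(2-4) S(3) r(2) k(3) e in auto)
    then show ?thesis using k(1) n(1) by (simp add: node_ok_def)
  qed
  have equal: "node_ok w P i" if e: "\<phi> = Equal s u" "vars_arg s = {} \<longleftrightarrow> vars_arg u = {}" for s u
  proof -
    have k: "istok w i TEq" "drop (Suc i) w = word_arg s @ word_arg u @ r"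
      using r e drop_ConsD[of i w] by auto
    have f: "fst_pos w P i = Suc i" using k(1) by (simp add: fst_pos_def)
    have "args_ok w P i"
      by (rule two_args_rd[where s = s and t = u and r = r])
        (use f t(2-4) S(3) r(2) k e in auto)
    then show ?thesis using k(1) by (simp add: node_ok_def)
  qed
  have bool: "node_ok w P i" if e: "word \<phi> = tk # word \<phi>1 @ word \<phi>2" "tk \<in> {TConj, TDisj, TImpl, TIff}"
    "\<phi>1 \<in> GC2D" "\<phi>2 \<in> GC2D" "bpreds \<phi> = bpreds \<phi>1 \<union> bpreds \<phi>2" "constants \<phi> = constants \<phi>1 \<union> constants \<phi>2"
    "free_vars \<phi> = free_vars \<phi>1 \<union> free_vars \<phi>2" for tk \<phi>1 \<phi>2
  proof -
    have d: "istok w i tk" "drop (Suc i) w = word \<phi>1 @ word \<phi>2 @ r" using r e(1) drop_ConsD[of i w] by auto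
    have 1: "rd (Suc i) \<phi>1" by (rule subform[OF _ _ _ d(2) word_no_digit]) (use e in auto)
    have "drop (rpos w P i) w = word \<phi>2 @ r"
      unfolding rpos_def table_rd(2)[OF 1] by (rule drop_appendD[OF d(2)])
    then have 2: "rd (rpos w P i) \<phi>2" by (rule subform[OF _ _ _ _ r(2), rotated 3]) (use e in auto)
    have "isbool w i" using d(1) e(2) by (auto simp: isbool_def)
    then show ?thesis using table_rd[OF 1] table_rd[OF 2] t e(1,7)
      by (auto simp: node_ok_def rpos_def)
  qed
  have quant: "node_ok w P i" if e: "word \<phi> = tk # word_var u # word \<phi>1" "tk \<in> {TAll, TEx}"
    "\<phi>1 \<in> GC2D" "bpreds \<phi> = bpreds \<phi>1" "constants \<phi> = constants \<phi>1"
    "free_vars \<phi> = free_vars \<phi>1 - {u}" "card (free_vars \<phi>1) \<le> 1" for tk u \<phi>1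
  proof -
    have d: "istok w i tk" "drop (Suc i) w = word_var u # word \<phi>1 @ r" using r e(1) drop_ConsD[of i w] by auto
    have d2: "istok w (Suc i) (word_var u)" "drop (i + 2) w = word \<phi>1 @ r" using d(2) drop_ConsD[of "Suc i" w] by auto
    have 1: "rd (i + 2) \<phi>1" by (rule subform[OF _ _ _ d2(2) r(2)]) (use e in auto)
    have "isquant w i" using d(1) e(2) by (auto simp: isquant_def)
    moreover have "\<not> (X \<in> free_vars \<phi>1 \<and> Y \<in> free_vars \<phi>1)"
    proof
      assume "X \<in> free_vars \<phi>1 \<and> Y \<in> free_vars \<phi>1"
      then have "free_vars \<phi>1 = {X, Y}" using var.exhaust by blast
      then show False using e(7) by simp
    qed
    moreover have "isvar w (Suc i)" "istok w (Suc i) TX \<longleftrightarrow> u = X" "istok w (Suc i) TY \<longleftrightarrow> u = Y"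
      using d2(1) by (cases u; auto simp: isvar_def istok_def)+
    ultimately show ?thesis using table_rd[OF 1] t e(1,6)
      by (cases u) (auto simp: node_ok_def)
  qed
  from S(1) show ?thesis
  proof (cases rule: GC2D.cases)
    case (neg \<phi>1)
    have d: "istok w i TNeg" "drop (Suc i) w = word \<phi>1 @ r" using r neg drop_ConsD[of i w] by auto
    have "rd (Suc i) \<phi>1" by (rule subform[OF _ _ _ d(2) r(2)]) (use neg in auto)
    from table_rd[OF this] show ?thesis using d(1) t neg by (auto simp: node_ok_def)
  next
    case (count \<phi>1 v u k C z p)
    let ?b = "Conj (Binary p (Var v) (Var u)) \<phi>1"
    have d: "istok w i (word_comparison k)" "drop (Suc i) w = binary C @ word_var z # word ?b @ r"
      using r count drop_ConsD[of i w] by auto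
    have nd: "no_digit (word_var z # word ?b @ r)" by (simp add: word_var_no_digit)
    note n = number_rd[OF d(2) nd]
    have ic: "iscount w i" using d(1) by (cases k) (auto simp: iscount_def)
    have f: "fst_pos w P i = digits_end w P (Suc i)" using ic by (auto simp: fst_pos_def istok_def iscount_def)
    have d2: "istok w (fst_pos w P i) (word_var z)" "drop (body w P i) w = word ?b @ r"
      using n(4) drop_ConsD[of "fst_pos w P i" w] f by (auto simp: body_def)
    have g: "?b \<in> GC2D" "Binary p (Var v) (Var u) \<in> GC2D" using count by (auto intro: GC2D.conj GC2D.bin)
    have 1: "rd (body w P i) ?b" by (rule subform[OF g(1) _ _ d2(2) r(2)]) (use count in auto)
    have d3: "istok w (body w P i) TConj" "drop (Suc (body w P i)) w = word (Binary p (Var v) (Var u)) @ word \<phi>1 @ r"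
      using d2(2) drop_ConsD[of "body w P i" w] by auto
    have 2: "rd (Suc (body w P i)) (Binary p (Var v) (Var u))"
      by (rule subform[OF g(2) _ _ d3(2) word_no_digit]) (use count in auto)
    have b: "isbin w (Suc (body w P i))"
      using d3(2) drop_ConsD[of "Suc (body w P i)" w] by (cases p) (auto simp: isbin_def)
    have fv: "free_vars \<phi> = {X, Y} - {z}" "X \<in> free_vars (Binary p (Var v) (Var u))" "Y \<in> free_vars (Binary p (Var v) (Var u))"
      using count by (cases v; cases u; auto; metis var.exhaust)+
    have z: "isvar w (fst_pos w P i)" "istok w (fst_pos w P i) TX \<longleftrightarrow> z = X" "istok w (fst_pos w P i) TY \<longleftrightarrow> z = Y"
      using d2(1) by (cases z; auto simp: isvar_def istok_def)+
    have "fm_end w P i = fm_end w P (body w P i)"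
      using table_rd(2)[OF 1] t(2) count n(3) f by (simp add: body_def)
    moreover have "freeX w P i \<longleftrightarrow> z = Y" "freeY w P i \<longleftrightarrow> z = X"
      using t(3,4) fv(1) by (cases z; auto)+
    ultimately show ?thesis
      using ic n(1) z table_rd(1)[OF 1] d3(1) table_rd(1,3,4)[OF 2] b fv(2,3) by (simp add: node_ok_def)
  qed (use un bin equal bool quant in auto)
qed

lemma parsed_tables: "parsed w P"
  unfolding parsed_def
proof (intro conjI allI impI)
  fix i assume i: "i < length w + 1"
  show "digits_ok w P i"
  proof (cases "digit w i")
    case True
    then obtain t where t: "istok w i t" "is_digit t" by (auto simp: digit_def)
    have "Suc i \<le> length w" using t istok_less by fastforce
    then show ?thesis using block_digit[OF t] t True table[of i] table[of "Suc i"]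
      by (auto simp: digits_ok_def istok_def)
  next
    case False
    then show ?thesis using block_no_digit[OF False] table[of i] i by (simp add: digits_ok_def)
  qed
next
  fix i assume i: "i < length w" "marked w P i"
  then have "mark i" using table(7)[of i] by simp
  then show "istok w i TConst" "canon w P (Suc i)"
    using number_rd(1) by (auto simp: mark_def)
next
  fix i assume "i < length w" "0 < fm_end w P i"
  then show "node_ok w P i" using node_rd node_ok_rd by (auto simp: node_def)
next
  have "rd 0 \<psi>" unfolding rd_def using \<psi> by (auto simp: Sub_def GC2D_sentences_def w)
  from table_rd[OF this] show "0 < length w" "fm_end w P 0 = length w" "\<not> freeX w P 0" "\<not> freeY w P 0"
    using w \<psi> by (auto simp: GC2D_sentences_def node_def)
qed

lemma fm_Sub:
  assumes "node w P i"
  shows "fm w P i \<in> Sub"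
proof -
  interpret parse w P by (rule parse.intro[OF parsed_tables])
  obtain \<phi> where \<phi>: "rd i \<phi>" using node_rd[OF assms] by blast
  then obtain r where r: "drop i w = word \<phi> @ r" by (auto simp: rd_def)
  have "drop i w = word (fm w P i) @ drop (fm_end w P i) w" using reads_fm[OF assms] by (simp add: reads_def)
  moreover have "drop (fm_end w P i) w = r" unfolding table_rd(2)[OF \<phi>] by (rule drop_appendD[OF r])
  ultimately have "word (fm w P i) = word \<phi>" using r by simp
  then have "fm w P i = \<phi>" using inj_word by (simp add: inj_def)
  then show ?thesis using \<phi> by (simp add: rd_def)
qed

lemma marked_constant:
  assumes "a < length w" "marked w P a"
  shows "number w P (Suc a) \<in> constants \<psi>"
proof -
  have "mark a" using assms table(7)[of a] by simp
  then show ?thesis using number_rd(2) by (auto simp: mark_def)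
qed

end

lemma parse_tables_exist:
  obtains P where "P < Bd w" "parsed w P" "fm w P 0 = \<psi>"
    "\<And>i. node w P i \<Longrightarrow> bpreds (fm w P i) \<subseteq> bpreds \<psi> \<and> constants (fm w P i) \<subseteq> constants \<psi>"
    "\<And>a. a < length w \<Longrightarrow> marked w P a \<Longrightarrow> number w P (Suc a) \<in> constants \<psi>"
proof -
  obtain P where P: "P < Bd w" "\<And>i j. i \<le> length w \<Longrightarrow> j < 8 \<Longrightarrow> dig w P (8 * i + j) = field j i"
    by (rule table_exists) blast
  note p = parsed_tables[OF P(2)]
  interpret parse w P by (rule parse.intro[OF p])
  have "word (fm w P 0) = word \<psi>" using root_node(3) w by simp
  then have "fm w P 0 = \<psi>" using inj_word by (simp add: inj_def)
  then show ?thesis using that[OF P(1) p] fm_Sub[OF P(2)] marked_constant[OF P(2)]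
    by (auto simp: Sub_def)
qed

end

section \<open>From models to types\<close>

definition env :: "'d \<Rightarrow> 'd \<Rightarrow> var \<Rightarrow> 'd" where
  "env a b = (\<lambda>v. case v of X \<Rightarrow> a | Y \<Rightarrow> b)"

lemma env_simps [simp]: "env a b X = a" "env a b Y = b" "(env a b)(X := c) = env c b" "(env a b)(Y := c) = env a c"
  by (auto simp: env_def fun_eq_iff split: var.splits)

lemma val_cong: "(\<And>v. v \<in> vars_arg s \<Longrightarrow> e v = e' v) \<Longrightarrow> val S e s = val S e' s"
  by (cases s) auto

lemma sat_cong: "(\<And>v. v \<in> free_vars \<phi> \<Longrightarrow> e v = e' v) \<Longrightarrow> sat S e \<phi> \<longleftrightarrow> sat S e' \<phi>"
proof (induction \<phi> arbitrary: e e')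
  case (Unary p s)
  then show ?case using val_cong[of s e e' S] by simp
next
  case (Binary p s t)
  then show ?case using val_cong[of s e e' S] val_cong[of t e e' S] by simp
next
  case (Equal s t)
  then show ?case using val_cong[of s e e' S] val_cong[of t e e' S] by simp
next
  case (Conj \<phi> \<psi>)
  show ?case using Conj.IH(1)[of e e'] Conj.IH(2)[of e e'] Conj.prems by simp
next
  case (Disj \<phi> \<psi>)
  show ?case using Disj.IH(1)[of e e'] Disj.IH(2)[of e e'] Disj.prems by simp
next
  case (Impl \<phi> \<psi>)
  show ?case using Impl.IH(1)[of e e'] Impl.IH(2)[of e e'] Impl.prems by simp
next
  case (Iff \<phi> \<psi>)
  show ?case using Iff.IH(1)[of e e'] Iff.IH(2)[of e e'] Iff.prems by simp
next
  case (All u \<phi>)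
  have "sat S (e(u := a)) \<phi> \<longleftrightarrow> sat S (e'(u := a)) \<phi>" for a
    by (rule All.IH) (use All.prems in auto)
  then show ?case by simp
next
  case (Ex u \<phi>)
  have "sat S (e(u := a)) \<phi> \<longleftrightarrow> sat S (e'(u := a)) \<phi>" for a
    by (rule Ex.IH) (use Ex.prems in auto)
  then show ?case by simp
next
  case (Count k C u \<phi>)
  have "sat S (e(u := a)) \<phi> \<longleftrightarrow> sat S (e'(u := a)) \<phi>" for a
    by (rule Count.IH) (use Count.prems in auto)
  then show ?case by simp
next
  case (Neg \<phi>)
  show ?case using Neg.IH[of e e'] Neg.prems by simp
qed

text \<open>Finitely many elements of \<open>R\<close> suffice to fix the truth of comparisons of its cardinality with \<open>C\<close>.\<close>

lemma selection_exists:
  "\<exists>Z \<subseteq> R. finite Z \<and> card Z \<le> C + 1 \<and>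
    (if finite R \<and> card R \<le> C then Z = R else C < card Z)"
proof (cases "finite R \<and> card R \<le> C")
  case False
  have "\<exists>Z. finite Z \<and> card Z = C + 1 \<and> Z \<subseteq> R"
  proof (cases "finite R")
    case True
    then have "C + 1 \<le> card R" using False by simp
    then obtain Z where "Z \<subseteq> R" "card Z = C + 1" "finite Z" by (rule obtain_subset_with_card_n)
    then show ?thesis by blast
  next
    case inf: False
    then show ?thesis using infinite_arbitrarily_large[of R "C + 1"] by blast
  qed
  then obtain Z where "finite Z" "card Z = C + 1" "Z \<subseteq> R" by blast
  then show ?thesis unfolding if_not_P[OF False] by (intro exI[of _ Z]) simp
next
  case True
  then show ?thesis unfolding if_P[OF True] by (intro exI[of _ R]) simp
qed

context parse
begin

lemma node_not_digit: "node w P i \<Longrightarrow> \<not> digit w i"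
  by (erule node_cases) (auto simp: digit_def token_class_defs)

lemma canon_digit: "canon w P i \<Longrightarrow> digit w i"
  by (auto simp: canon_def digit_def)

lemma unary_canon: "node w P i \<Longrightarrow> istok w i TUn \<Longrightarrow> canon w P (Suc i)"
  using node_ok[of i] token_exclusive(5)[of w i] by (simp add: node_ok_def)

lemma number_bound: "i \<le> length w \<Longrightarrow> number w P i < 2 ^ length w"
proof -
  assume i: "i \<le> length w"
  have "length (block w i) \<le> length (drop i w)" unfolding block_def by (rule length_takeWhile_le)
  then have "(2 :: nat) ^ length (block w i) \<le> 2 ^ length w" by (intro power_increasing) auto
  moreover have "number w P i < 2 ^ length (block w i)" using digits_table[OF i] digits_value_less by simp
  ultimately show ?thesis by (rule less_le_trans[rotated])
qed

lemma isvar_the_arg: "isvar w a \<Longrightarrow> the_arg w P a = Var (the_var w a)"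
  by (auto simp: isvar_def the_arg_def the_var_def)

lemma not_isvar_the_arg: "\<not> isvar w a \<Longrightarrow> the_arg w P a = Const (number w P (Suc a))"
  by (auto simp: isvar_def the_arg_def)

end

locale model_of_word = parse +
  fixes S :: "'d struct"
  assumes model: "is_model S (fm w P 0)"
    and symbols: "\<And>i. node w P i \<Longrightarrow> bpreds (fm w P i) \<subseteq> bpreds (fm w P 0) \<and> constants (fm w P i) \<subseteq> constants (fm w P 0)"
    and constants: "\<And>a. a < length w \<Longrightarrow> marked w P a \<Longrightarrow> number w P (Suc a) \<in> constants (fm w P 0)"
    and P_less: "P < Bd w"
begin

definition "sem a b i \<longleftrightarrow> sat S (env a b) (fm w P i)"

definition "typ a b k \<longleftrightarrow> (if digit w k then
    (if istok w (k - 1) TUn then a \<in> unI S (number w P k)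
     else (a, b) \<in> binI S (the_bpred w P (k - 1)))
  else sem a b k)"

definition "represents \<alpha> a b \<longleftrightarrow> (\<forall>i < length w. tr w \<alpha> i \<longleftrightarrow> typ a b i)"

lemma model_structure: "structure_for (fm w P 0) S"
  using model by (simp add: is_model_def)

lemma representative:
  obtains \<alpha> where "\<alpha> < Bd w" "represents \<alpha> a b"
proof -
  have "length w \<le> 8 * (length w + 1) ^ 3" using self_le_power[of "length w + 1" 3] by simp
  moreover have "of_bool (typ a b i) < Qd w" for i using Qd_bounds(2)[of w] by (simp add: of_bool_def)
  ultimately obtain \<alpha> where "\<alpha> < Bd w" "\<And>i. i < length w \<Longrightarrow> dig w \<alpha> i = of_bool (typ a b i)"
    using sequence_exists[of "length w" "\<lambda>i. of_bool (typ a b i)" w] by blast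
  then show ?thesis using that by (auto simp: represents_def tr_def)
qed

lemma typ_node: "node w P i \<Longrightarrow> typ a b i \<longleftrightarrow> sem a b i"
  using node_not_digit by (simp add: typ_def)

lemma tr_node: "represents \<alpha> a b \<Longrightarrow> node w P i \<Longrightarrow> tr w \<alpha> i \<longleftrightarrow> sem a b i"
  using typ_node by (simp add: represents_def node_def)

lemma tr_unary:
  assumes "represents \<alpha> a b" "node w P i" "istok w i TUn"
  shows "tr w \<alpha> (Suc i) \<longleftrightarrow> a \<in> unI S (number w P (Suc i))"
proof -
  have "digit w (Suc i)" using assms unary_canon canon_digit by blast
  then show ?thesis using assms by (auto simp: represents_def typ_def digit_def istok_def)
qed

lemma tr_binary:
  assumes "represents \<alpha> a b" "node w P i" "isbin w i"
  shows "tr w \<alpha> (Suc i) \<longleftrightarrow> (a, b) \<in> binI S (the_bpred w P i)"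
proof -
  have "digit w (Suc i)" using assms args(2) canon_digit by blast
  moreover have "\<not> istok w i TUn" using assms(3) token_exclusive(4) by blast
  ultimately show ?thesis using assms(1) by (auto simp: represents_def typ_def digit_def istok_def)
qed

lemma sem_free: 
  "node w P i \<Longrightarrow> \<not> freeY w P i \<Longrightarrow> sem a b i \<longleftrightarrow> sem a b' i"
  "node w P i \<Longrightarrow> \<not> freeX w P i \<Longrightarrow> sem a b i \<longleftrightarrow> sem a' b i"
  unfolding sem_def using free_fm[of i] by (auto intro!: sat_cong simp: env_def split: var.splits)

lemma sem_bool:
  assumes "node w P i" "isbool w i"
  shows "istok w i TConj \<Longrightarrow> sem a b i \<longleftrightarrow> sem a b (Suc i) \<and> sem a b (rpos w P i)"
    "istok w i TDisj \<Longrightarrow> sem a b i \<longleftrightarrow> sem a b (Suc i) \<or> sem a b (rpos w P i)"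
    "istok w i TImpl \<Longrightarrow> sem a b i \<longleftrightarrow> (sem a b (Suc i) \<longrightarrow> sem a b (rpos w P i))"
    "istok w i TIff \<Longrightarrow> sem a b i \<longleftrightarrow> (sem a b (Suc i) \<longleftrightarrow> sem a b (rpos w P i))"
  unfolding sem_def fm_bool[OF assms] by (auto simp: connective_def istok_def)

lemma basic_typ:
  assumes "represents \<alpha> a b"
  shows "basic w P \<alpha>"
  unfolding basic_def
proof (intro allI impI conjI)
  fix i assume i: "node w P i"
  note t = tr_node[OF assms]
  show "bool_ok w P \<alpha> i"
  proof (cases "isbool w i")
    case True
    note b = bool_node(1,2)[OF i True]
    show ?thesis
      using sem_bool[OF i True, of a b] t[OF i] t[OF b(1)] t[OF b(2)] token_exclusive(1)[OF True]
      by (simp add: bool_ok_def)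
  next
    case False
    then show ?thesis using t[OF i] t[OF neg_node(1)[OF i]] fm_neg[OF i]
      by (auto simp: bool_ok_def isbool_def sem_def)
  qed
next
  fix i j assume i: "node w P i" and j: "node w P j \<and> same_pred w P i j"
  then consider "istok w i TUn" "istok w j TUn" | "isbin w i" "isbin w j" "the_bpred w P i = the_bpred w P j"
    by (auto simp: same_pred_def isbin_def the_bpred_def istok_def)
  then show "tr w \<alpha> (Suc i) \<longleftrightarrow> tr w \<alpha> (Suc j)"
  proof cases
    case 1
    then show ?thesis using tr_unary[OF assms i] tr_unary[OF assms] j by (simp add: same_pred_def)
  next
    case 2
    then show ?thesis using tr_binary[OF assms i] tr_binary[OF assms] j by simp
  qed
qed

text \<open>A variable that is bound here is the only free one of the body, so the body can be
  evaluated at a diagonal pair \<open>(c, c)\<close>.\<close>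

lemma sem_quant:
  assumes "node w P i" "isquant w i"
  shows "\<not> binds w P i \<Longrightarrow> dom S \<noteq> {} \<Longrightarrow> sem a b i \<longleftrightarrow> sem a b (i + 2)"
    "binds w P i \<Longrightarrow> istok w i TAll \<Longrightarrow> sem a b i \<longleftrightarrow> (\<forall>c \<in> dom S. sem c c (i + 2))"
    "binds w P i \<Longrightarrow> istok w i TEx \<Longrightarrow> sem a b i \<longleftrightarrow> (\<exists>c \<in> dom S. sem c c (i + 2))"
proof -
  note q = quant_node(1-3)[OF assms]
  define u where "u = the_var w (Suc i)"
  have f: "fm w P i = quantifier i u (fm w P (i + 2))" using fm_quant[OF assms] by (simp add: u_def)
  have b: "binds w P i \<longleftrightarrow> u \<in> free_vars (fm w P (i + 2))"
    using q(2) free_fm[OF q(1)] by (auto simp: binds_def u_def the_var_def isvar_def istok_def)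
  have sub: "sat S ((env a b)(u := c)) (fm w P (i + 2)) \<longleftrightarrow> sem c c (i + 2)" if "binds w P i" for c
    unfolding sem_def
  proof (rule sat_cong)
    fix v assume "v \<in> free_vars (fm w P (i + 2))"
    moreover have "\<not> (X \<in> free_vars (fm w P (i + 2)) \<and> Y \<in> free_vars (fm w P (i + 2)))"
      using q(3) free_fm[OF q(1)] by simp
    ultimately have "v = u" using that b by (cases u; cases v) auto
    then show "((env a b)(u := c)) v = env c c v" by (cases v) (auto simp: env_def)
  qed
  have t: "istok w i TAll \<or> istok w i TEx" using assms(2) by (simp add: isquant_def)
  show "sem a b i \<longleftrightarrow> (\<forall>c \<in> dom S. sem c c (i + 2))" if "binds w P i" "istok w i TAll"
    unfolding sem_def[of a b i] f quantifier_def using sub[OF that(1)] that(2) by simp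
  show "sem a b i \<longleftrightarrow> (\<exists>c \<in> dom S. sem c c (i + 2))" if "binds w P i" "istok w i TEx"
    unfolding sem_def[of a b i] f quantifier_def using sub[OF that(1)] that(2) by (simp add: istok_def)
  assume nb: "\<not> binds w P i" and ne: "dom S \<noteq> {}"
  have "sat S ((env a b)(u := c)) (fm w P (i + 2)) \<longleftrightarrow> sem a b (i + 2)" for c
    unfolding sem_def by (rule sat_cong) (use nb b in auto)
  then show "sem a b i \<longleftrightarrow> sem a b (i + 2)"
    unfolding sem_def[of a b i] f quantifier_def using ne by auto
qed

lemma dom_nonempty: "dom S \<noteq> {}"
  using model_structure by (simp add: structure_for_def)

lemma key_function:
  assumes "node w P i" "istok w i TKey" "a \<in> dom S"
  shows "\<exists>!b. (a, b) \<in> binI S (the_bpred w P i)" "(a, a) \<notin> binI S (the_bpred w P i)"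
proof -
  have "isbin w i" using assms by (simp add: isbin_def)
  then have "the_bpred w P i \<in> bpreds (fm w P 0)"
    using fm_binary[OF assms(1)] symbols[OF assms(1)] by auto
  moreover have "the_bpred w P i = Key (number w P (Suc i))"
    using assms(2) by (auto simp: the_bpred_def istok_def)
  ultimately show "\<exists>!b. (a, b) \<in> binI S (the_bpred w P i)" "(a, a) \<notin> binI S (the_bpred w P i)"
    using model_structure assms(3) by (auto simp: structure_for_def)
qed

lemma bin_dom: "(a, b) \<in> binI S p \<Longrightarrow> a \<in> dom S \<and> b \<in> dom S"
  using model_structure unfolding structure_for_def by blast

lemma unique_names: "inj_on (constI S) (constants (fm w P 0))" "c \<in> constants (fm w P 0) \<Longrightarrow> constI S c \<in> dom S"
  using model_structure by (auto simp: structure_for_def)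

lemma diag_typ:
  assumes r: "represents \<alpha> a a" and a: "a \<in> dom S"
  shows "diag w P \<alpha>"
  unfolding diag_def
proof (intro conjI allI impI basic_typ[OF r])
  fix i assume i: "node w P i"
  note t = tr_node[OF r i]
  show "diag_ok w P \<alpha> i"
    unfolding diag_ok_def
  proof (intro conjI impI)
    assume v: "istok w i TUn \<or> isbin w i" "isvar w (fst_pos w P i)"
    have ea: "env a a z = a" for z by (cases z) auto
    from v(1) show "tr w \<alpha> i \<longleftrightarrow> tr w \<alpha> (Suc i)"
    proof
      assume u: "istok w i TUn"
      show ?thesis using t tr_unary[OF r i u] fm_unary[OF i u] v(2)
        by (simp add: sem_def isvar_the_arg ea)
    next
      assume u: "isbin w i"
      then have "isvar w (snd_pos w P i)" using args(1)[OF i] v(2) by (auto simp: args_ok_def)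
      then show ?thesis using t tr_binary[OF r i u] fm_binary[OF i u] v(2)
        by (simp add: sem_def isvar_the_arg ea)
    qed
  next
    assume k: "istok w i TKey"
    then show "\<not> tr w \<alpha> (Suc i)" using tr_binary[OF r i] key_function(2)[OF i k a] by (simp add: isbin_def)
  next
    assume e: "istok w i TEq"
    have ao: "args_ok w P i" using args(1)[OF i] e by blast
    show "tr w \<alpha> i \<longleftrightarrow> isvar w (fst_pos w P i) \<or> number w P (Suc (fst_pos w P i)) = number w P (Suc (snd_pos w P i))"
    proof (cases "isvar w (fst_pos w P i)")
      case True
      have ea: "env a a z = a" for z by (cases z) auto
      have "isvar w (snd_pos w P i)" using ao True by (simp add: args_ok_def)
      then show ?thesis using t True fm_equal[OF i e] by (simp add: sem_def isvar_the_arg ea)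
    next
      case False
      then have F: "\<not> isvar w (snd_pos w P i)" using ao by (simp add: args_ok_def)
      have "number w P (Suc (fst_pos w P i)) \<in> constants (fm w P 0)" "number w P (Suc (snd_pos w P i)) \<in> constants (fm w P 0)"
        using ao False F constants by (auto simp: args_ok_def arg_ok_def istok_def)
      then show ?thesis using t False F fm_equal[OF i e] unique_names(1)
        by (auto simp: sem_def not_isvar_the_arg inj_on_def)
    qed
  next
    assume q: "isquant w i \<and> \<not> binds w P i"
    then show "tr w \<alpha> i \<longleftrightarrow> tr w \<alpha> (i + 2)"
      using t tr_node[OF r quant_node(1)[OF i]] sem_quant(1)[OF i] dom_nonempty by blast
  next
    assume q: "istok w i TAll \<and> binds w P i" "tr w \<alpha> i"
    then have "isquant w i" by (simp add: isquant_def)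
    then show "tr w \<alpha> (i + 2)"
      using t tr_node[OF r quant_node(1)[OF i]] sem_quant(2)[OF i] a q by blast
  next
    assume q: "istok w i TEx \<and> binds w P i" "tr w \<alpha> (i + 2)"
    then have "isquant w i" by (simp add: isquant_def)
    then show "tr w \<alpha> i"
      using t tr_node[OF r quant_node(1)[OF i]] sem_quant(3)[OF i] a q by blast
  qed
qed

lemma pair_typ:
  assumes r: "represents \<alpha> a a" "represents \<beta> b b" "represents s a b" "represents s' b a" and ab: "a \<noteq> b"
  shows "pair w P \<alpha> \<beta> s s'"
  unfolding pair_def
proof (intro conjI allI impI basic_typ[OF r(3)])
  fix i assume i: "node w P i"
  note t = tr_node[OF _ i]
  show "pair_ok w P \<alpha> \<beta> s s' i"
    unfolding pair_ok_def
  proof (intro conjI impI)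
    show "tr w s i \<longleftrightarrow> tr w \<alpha> i" if "\<not> freeY w P i"
      using t[OF r(3)] t[OF r(1)] sem_free(1)[OF i that] by blast
    show "tr w s i \<longleftrightarrow> tr w \<beta> i" if "\<not> freeX w P i"
      using t[OF r(3)] t[OF r(2)] sem_free(2)[OF i that] by blast
  next
    assume f: "freeX w P i \<and> freeY w P i" and b: "isbin w i"
    have "args_ok w P i" using args(1)[OF i] b by blast
    then consider "istok w (fst_pos w P i) TX" "istok w (snd_pos w P i) TY" | "istok w (fst_pos w P i) TY" "istok w (snd_pos w P i) TX"
      using f by (auto simp: args_ok_def istok_def)
    then show "tr w s i \<longleftrightarrow> (if istok w (fst_pos w P i) TX then tr w s (Suc i) else tr w s' (Suc i))"
    proof cases
      case 1
      then show ?thesis using t[OF r(3)] tr_binary[OF r(3) i b] fm_binary[OF i b]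
        by (simp add: sem_def the_arg_def istok_def)
    next
      case 2
      then show ?thesis using t[OF r(3)] tr_binary[OF r(4) i b] fm_binary[OF i b]
        by (simp add: sem_def the_arg_def istok_def)
    qed
  next
    assume f: "freeX w P i \<and> freeY w P i" and b: "istok w i TEq"
    have "args_ok w P i" using args(1)[OF i] b by blast
    then consider "istok w (fst_pos w P i) TX" "istok w (snd_pos w P i) TY" | "istok w (fst_pos w P i) TY" "istok w (snd_pos w P i) TX"
      using f by (auto simp: args_ok_def istok_def)
    then show "\<not> tr w s i"
      using t[OF r(3)] fm_equal[OF i b] ab by cases (simp_all add: sem_def the_arg_def istok_def)
  qed
qed

lemma link_typ:
  assumes "represents \<alpha> a a" "represents \<beta> b b" "represents s a b" "represents s' b a" "a \<noteq> b"
  shows "link w P \<alpha> \<beta> s s'"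
  unfolding link_def using pair_typ[OF assms] pair_typ[OF assms(2,1,4,3)] assms(5) by simp

lemma agree_typ:
  assumes "represents \<alpha> a a" "represents \<beta> b b"
  shows "agree w P \<alpha> \<beta>"
  unfolding agree_def using tr_node[OF assms(1)] tr_node[OF assms(2)] sem_free by blast

section \<open>Witnesses selected in a model\<close>

definition "contrib a i = {b \<in> dom S. if istok w i TKey then (a, b) \<in> binI S (the_bpred w P i)
  else if istok w (fst_pos w P i) TY then sem a b (body w P i) else sem b a (body w P i)}"

lemma con_typ:
  assumes "represents s a b" "represents s' b a" "counter w P i" "b \<in> dom S"
  shows "con w P s s' i \<longleftrightarrow> b \<in> contrib a i"
proof (cases "istok w i TKey")
  case True
  then show ?thesis using assms tr_binary[OF assms(1), of i]
    by (simp add: con_def contrib_def counter_def isbin_def)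
next
  case False
  then have "node w P (body w P i)" using assms(3) count_node(1) by (auto simp: counter_def)
  then show ?thesis using assms False tr_node[OF assms(1)] tr_node[OF assms(2)]
    by (simp add: con_def contrib_def)
qed

definition "bound i = (if istok w i TKey then 1 else number w P (Suc i))"

definition "chosen a i = (SOME Z. Z \<subseteq> contrib a i \<and> finite Z \<and> card Z \<le> bound i + 1 \<and>
    (if finite (contrib a i) \<and> card (contrib a i) \<le> bound i then Z = contrib a i else bound i < card Z))"

lemma chosen:
  "chosen a i \<subseteq> contrib a i" "finite (chosen a i)" "card (chosen a i) \<le> bound i + 1"
  "if finite (contrib a i) \<and> card (contrib a i) \<le> bound i then chosen a i = contrib a i else bound i < card (chosen a i)"
  using someI_ex[OF selection_exists[of "contrib a i" "bound i", unfolded Bex_def[symmetric]]]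
    someI_ex[OF selection_exists[of "contrib a i" "bound i"]]
  unfolding chosen_def by blast+

text \<open>Selections for different counters are merged into one set, as the same neighbour may
  contribute to several counters.\<close>

definition "needed a = (\<Union>i \<in> {i. i < length w \<and> counter w P i}. chosen a i)"

lemma needed: "finite (needed a)" "needed a \<subseteq> dom S" "card (needed a) < Qd w"
  "b \<in> needed a \<Longrightarrow> \<exists>i < length w. counter w P i \<and> b \<in> contrib a i"
proof -
  show "finite (needed a)" unfolding needed_def using chosen(2) by auto
  show "needed a \<subseteq> dom S" unfolding needed_def using chosen(1) by (fastforce simp: contrib_def)
  show "b \<in> needed a \<Longrightarrow> \<exists>i < length w. counter w P i \<and> b \<in> contrib a i"
    unfolding needed_def using chosen(1) by blast
  let ?I = "{i. i < length w \<and> counter w P i}"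
  have n: "0 < length w" using parsed by (simp add: parsed_def)
  have b: "bound i + 1 \<le> 2 ^ length w" if "i < length w" for i
  proof (cases "istok w i TKey")
    case True
    have "(2 :: nat) ^ 1 \<le> 2 ^ length w" using n by (intro power_increasing) linarith+
    then show ?thesis using True by (simp add: bound_def)
  next
    case False
    then show ?thesis using number_bound[of "Suc i"] that by (simp add: bound_def)
  qed
  have "card (needed a) \<le> (\<Sum>i \<in> ?I. card (chosen a i))"
    unfolding needed_def by (rule card_UN_le) simp
  also have "\<dots> \<le> (\<Sum>i \<in> ?I. 2 ^ length w)"
    by (rule sum_mono) (use chosen(3) b le_trans in blast)
  also have "\<dots> = card ?I * 2 ^ length w" by simp
  also have "\<dots> \<le> length w * 2 ^ length w"
    using card_mono[of "{..<length w}" ?I] by (intro mult_right_mono) auto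
  \<comment> \<open>The product of n < 2^n and 2^n is the origin of the base 4 in
    \<open>Qd\<close>.\<close>
  also have "\<dots> < 2 ^ length w * 2 ^ length w" by (intro mult_strict_right_mono) auto
  also have "\<dots> = 4 ^ length w" by (simp add: power_mult_distrib[symmetric])
  also have "\<dots> \<le> Qd w" by (simp add: Qd_def)
  finally show "card (needed a) < Qd w" .
qed

lemma sem_count:
  assumes "node w P i" "iscount w i"
  shows "sem a a i \<longleftrightarrow> counts (the_comparison w i) (number w P (Suc i)) (contrib a i)"
proof -
  have v: "isvar w (fst_pos w P i)" using count_node(5)[OF assms] .
  have k: "\<not> istok w i TKey" using token_exclusive(3)[OF assms(2)] by (auto simp: isbin_def)
  have "{b \<in> dom S. sat S ((env a a)(the_var w (fst_pos w P i) := b)) (fm w P (body w P i))} = contrib a i"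
    using v k by (auto simp: contrib_def sem_def the_var_def isvar_def istok_def)
  then show ?thesis unfolding sem_def fm_count[OF assms] by simp
qed

text \<open>Any finite superset of the needed elements gives the verdict of the full, possibly
  infinite set of contributors: a small set lies inside \<open>U\<close>, and a large one exceeds
  the bound already by its selected part. The freedom in \<open>U\<close> makes room for the element
  itself, its parent or the named elements.\<close>

lemma count_typ:
  assumes a: "a \<in> dom S" "represents \<alpha> a a" and i: "i < length w" "counter w P i" and U: "finite U" "needed a \<subseteq> U"
  shows "count_ok w P \<alpha> i (card (U \<inter> contrib a i))"
proof -
  have n: "node w P i" using i by (simp add: counter_def)
  have sub: "chosen a i \<subseteq> U \<inter> contrib a i"
    using U(2) chosen(1)[of a i] i unfolding needed_def by blast
  define R where "R = contrib a i"
  define m where "m = card (U \<inter> R)"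
  have small: "m = card R" if "finite R" "card R \<le> bound i"
  proof -
    have "chosen a i = R" using chosen(4)[of a i] that by (simp add: R_def)
    then have "U \<inter> R = R" using sub by (auto simp: R_def)
    then show ?thesis by (simp add: m_def)
  qed
  have large: "bound i < m" if "\<not> (finite R \<and> card R \<le> bound i)"
  proof -
    have "bound i < card (chosen a i)" using chosen(4)[of a i] that by (auto simp: R_def)
    also have "\<dots> \<le> m" unfolding m_def R_def using sub U(1) by (intro card_mono) auto
    finally show ?thesis .
  qed
  show ?thesis
  proof (cases "istok w i TKey")
    case True
    obtain b where b: "\<And>c. (a, c) \<in> binI S (the_bpred w P i) \<longleftrightarrow> c = b"
      using key_function(1)[OF n True a(1)] by blast
    then have "R = {b}" using True bin_dom[of a b] by (auto simp: R_def contrib_def)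
    then have "m = 1" using small True by (simp add: bound_def)
    then show ?thesis using True by (auto simp: count_ok_def m_def R_def istok_def)
  next
    case False
    then have c: "iscount w i" using i by (simp add: counter_def)
    have bd: "bound i = number w P (Suc i)" using False by (simp add: bound_def)
    have "tr w \<alpha> i \<longleftrightarrow> counts (the_comparison w i) (bound i) R"
      using tr_node[OF a(2) n] sem_count[OF n c] by (simp add: R_def bd)
    moreover have "counts AtMost (bound i) R \<longleftrightarrow> m \<le> bound i" "counts AtLeast (bound i) R \<longleftrightarrow> bound i \<le> m"
      "counts Exactly (bound i) R \<longleftrightarrow> m = bound i"
      using small large by (cases "finite R"; cases "card R \<le> bound i"; auto)+
    ultimately show ?thesis using False c bd
      by (auto simp: count_ok_def the_comparison_def m_def R_def istok_def iscount_def)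
  qed
qed

lemma vector_exists:
  assumes "U \<subseteq> needed a"
  obtains v where "v < Bd w" "\<And>i. i < length w \<Longrightarrow> dig w v i = card (U \<inter> contrib a i)"
proof -
  have "length w \<le> 8 * (length w + 1) ^ 3" using self_le_power[of "length w + 1" 3] by simp
  moreover have "card (U \<inter> contrib a i) < Qd w" for i
    using card_mono[of "needed a" "U \<inter> contrib a i"] needed(1,3)[of a] assms by fastforce
  ultimately show ?thesis using sequence_exists[of "length w" "\<lambda>i. card (U \<inter> contrib a i)" w] that by blast
qed

text \<open>The states justified by the model: \<open>U\<close> is the set of needed neighbours that
  have not yet become children. The element itself is excluded, because its contribution to itself
  is added separately.\<close>

definition "realized \<alpha> v \<longleftrightarrow> (\<exists>a \<in> dom S. \<exists>U. U \<subseteq> needed a - {a} \<and> represents \<alpha> a a \<and>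
  (\<forall>i < length w. counter w P i \<longrightarrow> dig w v i = card (U \<inter> contrib a i)))"

lemma realizedI:
  "a \<in> dom S \<Longrightarrow> U \<subseteq> needed a - {a} \<Longrightarrow> represents \<alpha> a a \<Longrightarrow>
    (\<And>i. i < length w \<Longrightarrow> counter w P i \<Longrightarrow> dig w v i = card (U \<inter> contrib a i)) \<Longrightarrow> realized \<alpha> v"
  unfolding realized_def by blast

text \<open>The next child is any \<open>b\<close> in \<open>U\<close>; it contributes to some
  counter because it was selected for one. Its own children are to be the elements it needs other
  than itself and its parent, whose contributions \<open>serves\<close> adds. This is one step of
  the unravelling, in which an element of the model may reappear many times.\<close>

lemma realized_not_blocked:
  assumes real: "realized \<alpha> v" and good: "\<And>\<alpha> v. \<alpha> < Bd w \<Longrightarrow> v < Bd w \<Longrightarrow> realized \<alpha> v \<Longrightarrow> good w P A \<alpha> v"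
    and \<alpha>: "\<alpha> < Bd w"
  shows "\<not> blocked w P A \<alpha> v"
proof -
  obtain a U where a: "a \<in> dom S" "U \<subseteq> needed a - {a}" "represents \<alpha> a a"
    "\<And>i. i < length w \<Longrightarrow> counter w P i \<Longrightarrow> dig w v i = card (U \<inter> contrib a i)"
    using real unfolding realized_def by blast
  show ?thesis
  proof (cases "U = {}")
    case True
    then show ?thesis using a(4) by (simp add: blocked_def finished_def)
  next
    case False
    then obtain b where b: "b \<in> U" by blast
    then have ba: "b \<noteq> a" "b \<in> needed a" "b \<in> dom S" using a(2) needed(2) by auto
    obtain \<beta> where \<beta>: "\<beta> < Bd w" "represents \<beta> b b" by (rule representative)
    obtain s where s: "s < Bd w" "represents s a b" by (rule representative)
    obtain s' where s': "s' < Bd w" "represents s' b a" by (rule representative)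
    obtain u where u: "u < Bd w" "\<And>i. i < length w \<Longrightarrow> dig w u i = card ((U - {b}) \<inter> contrib a i)"
      by (rule vector_exists[of "U - {b}" a]) (use a in auto)
    define W where "W = needed b - {a, b}"
    obtain v' where v': "v' < Bd w" "\<And>i. i < length w \<Longrightarrow> dig w v' i = card (W \<inter> contrib b i)"
      by (rule vector_exists[of W b]) (auto simp: W_def)
    have fU: "finite U" using a(2) needed(1) finite_subset by (metis finite_Diff)
    have fW: "finite W" using needed(1) by (simp add: W_def)
    have "splits w P v s s' u"
      unfolding splits_def
    proof (intro conjI allI impI)
      fix i assume i: "i < length w" "counter w P i"
      have "card (U \<inter> contrib a i) = card ((U - {b}) \<inter> contrib a i) + of_bool (b \<in> contrib a i)"
      proof (cases "b \<in> contrib a i")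
        case True
        then have "U \<inter> contrib a i = insert b ((U - {b}) \<inter> contrib a i)" using b by blast
        then show ?thesis using True fU by simp
      next
        case False
        then have "U \<inter> contrib a i = (U - {b}) \<inter> contrib a i" by blast
        then show ?thesis using False by simp
      qed
      then show "dig w v i = dig w u i + of_bool (con w P s s' i)"
        using a(4)[OF i] u(2)[OF i(1)] con_typ[OF s(2) s'(2) i(2) ba(3)] by simp
    next
      show "\<exists>i<length w. counter w P i \<and> con w P s s' i"
        using needed(4)[OF ba(2)] con_typ[OF s(2) s'(2) _ ba(3)] by blast
    qed
    moreover have "serves w P \<beta> s s' v'"
      unfolding serves_def
    proof (intro allI impI)
      fix i assume i: "i < length w" "counter w P i"
      let ?R = "contrib b i"
      have "card (insert a (insert b W) \<inter> ?R) = card (W \<inter> ?R) + of_bool (b \<in> ?R) + of_bool (a \<in> ?R)"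
        using ba(1) fW by (cases "a \<in> ?R"; cases "b \<in> ?R") (auto simp: W_def)
      moreover have "needed b \<subseteq> insert a (insert b W)" by (auto simp: W_def)
      ultimately show "count_ok w P \<beta> i (dig w v' i + of_bool (con w P \<beta> \<beta> i) + of_bool (con w P s' s i))"
        using count_typ[OF ba(3) \<beta>(2) i, of "insert a (insert b W)"] fW v'(2)[OF i(1)]
          con_typ[OF \<beta>(2) \<beta>(2) i(2) ba(3)] con_typ[OF s'(2) s(2) i(2) a(1)] by simp
    qed
    moreover have "good w P A \<alpha> u"
      by (rule good[OF \<alpha> u(1) realizedI[of a "U - {b}"]]) (use a u in auto)
    moreover have "good w P A \<beta> v'"
      by (rule good[OF \<beta>(1) v'(1) realizedI[of b W]]) (use ba \<beta> v' in \<open>auto simp: W_def\<close>)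
    moreover have "diag w P \<beta>" by (rule diag_typ[OF \<beta>(2) ba(3)])
    moreover have "link w P \<alpha> \<beta> s s'" by (rule link_typ[OF a(3) \<beta>(2) s(2) s'(2) ba(1)[symmetric]])
    ultimately have "kid w P A \<alpha> v \<beta> s s' u v'" by (simp add: kid_def)
    then show ?thesis unfolding blocked_def using \<beta>(1) s(1) s'(1) u(1) v'(1) by blast
  qed
qed

abbreviation "A \<equiv> fixpoint (blocked_state w) (Bd w ^ 3)"

lemma state_decode:
  assumes "\<alpha> < Bd w" "v < Bd w"
  defines "x \<equiv> (P * Bd w + \<alpha>) * Bd w + v"
  shows "x div Bd w div Bd w = P" "x div Bd w mod Bd w = \<alpha>" "x mod Bd w = v"
  using assms by (simp_all add: x_def)

lemma realized_good:
  assumes "\<alpha> < Bd w" "v < Bd w" "realized \<alpha> v"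
  shows "good w P A \<alpha> v"
proof -
  \<comment> \<open>The invariant of \<open>fixpoint_least\<close>: no code of a realized state is
    ever marked.\<close>
  let ?I = "{x. \<forall>\<alpha> v. \<alpha> < Bd w \<longrightarrow> v < Bd w \<longrightarrow> x = (P * Bd w + \<alpha>) * Bd w + v \<longrightarrow> \<not> realized \<alpha> v}"
  have "A x \<Longrightarrow> x \<in> ?I" for x
  proof (rule fixpoint_least)
    fix A' x
    assume sub: "\<And>j. A' j \<Longrightarrow> j \<in> ?I" and F: "blocked_state w A' x"
    show "x \<in> ?I"
    proof (intro CollectI allI impI notI)
      fix \<alpha> v assume a: "\<alpha> < Bd w" "v < Bd w" and x: "x = (P * Bd w + \<alpha>) * Bd w + v" and r: "realized \<alpha> v"
      have "blocked w P A' \<alpha> v"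
        using F state_decode[OF a] unfolding blocked_state_def x by simp
      moreover have "good w P A' \<alpha>' v'" if "\<alpha>' < Bd w" "v' < Bd w" "realized \<alpha>' v'" for \<alpha>' v'
        unfolding good_def using sub that by blast
      ultimately show False using realized_not_blocked[OF r _ a(1)] by blast
    qed
  qed
  then show ?thesis unfolding good_def using assms by blast
qed

lemma root_typ:
  assumes a: "a \<in> dom S" and \<alpha>: "\<alpha> < Bd w" "represents \<alpha> a a"
  shows "is_root w P A \<alpha>"
proof -
  obtain v where v: "v < Bd w" "\<And>i. i < length w \<Longrightarrow> dig w v i = card ((needed a - {a}) \<inter> contrib a i)"
    by (rule vector_exists[of "needed a - {a}" a]) auto
  have "good w P A \<alpha> v"
    by (rule realized_good[OF \<alpha>(1) v(1) realizedI[OF a _ \<alpha>(2)]]) (use v in auto)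
  moreover have "count_ok w P \<alpha> i (dig w v i + of_bool (con w P \<alpha> \<alpha> i))" if i: "i < length w" "counter w P i" for i
  proof -
    have "card (insert a (needed a) \<inter> contrib a i) = card ((needed a - {a}) \<inter> contrib a i) + of_bool (a \<in> contrib a i)"
    proof (cases "a \<in> contrib a i")
      case True
      then have "insert a (needed a) \<inter> contrib a i = insert a ((needed a - {a}) \<inter> contrib a i)" by blast
      then show ?thesis using True needed(1) by simp
    next
      case False
      then have "insert a (needed a) \<inter> contrib a i = (needed a - {a}) \<inter> contrib a i" by blast
      then show ?thesis using False by simp
    qed
    then show ?thesis
      using count_typ[OF a \<alpha>(2) i, of "insert a (needed a)", OF _ subset_insertI] needed(1) v(2)[OF i(1)] con_typ[OF \<alpha>(2) \<alpha>(2) i(2) a] by auto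
  qed
  ultimately show ?thesis unfolding is_root_def using diag_typ[OF \<alpha>(2) a] v(1) by blast
qed

lemma witnessed_typ:
  assumes \<alpha>: "represents \<alpha> a a"
  shows "witnessed w P A \<alpha>"
  unfolding witnessed_def
proof (intro allI impI)
  fix i assume i: "i < length w" and h: "node w P i \<and> isquant w i \<and> binds w P i \<and> (tr w \<alpha> i \<longleftrightarrow> istok w i TEx)"
  have t: "istok w i TAll \<and> \<not> istok w i TEx \<or> istok w i TEx" using h by (auto simp: isquant_def istok_def)
  have "\<exists>c \<in> dom S. sem c c (i + 2) \<longleftrightarrow> istok w i TEx"
    using t sem_quant(2,3)[of i a a] h tr_node[OF \<alpha>, of i] by blast
  then obtain c where c: "c \<in> dom S" "sem c c (i + 2) \<longleftrightarrow> istok w i TEx" by blast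
  obtain \<beta> where \<beta>: "\<beta> < Bd w" "represents \<beta> c c" by (rule representative)
  have "tr w \<beta> (i + 2) \<longleftrightarrow> istok w i TEx"
    using tr_node[OF \<beta>(2) quant_node(1)] h c(2) by blast
  then show "\<exists>\<beta><Bd w. is_root w P A \<beta> \<and> agree w P \<alpha> \<beta> \<and> (tr w \<beta> (i + 2) \<longleftrightarrow> istok w i TEx)"
    using root_typ[OF c(1) \<beta>] agree_typ[OF \<alpha> \<beta>(2)] \<beta>(1) by blast
qed

section \<open>The named elements of a model\<close>

definition "elt c = constI S (number w P (Suc c))"

lemma elt_dom: "c < length w \<Longrightarrow> name w P c \<Longrightarrow> elt c \<in> dom S"
  using constants unique_names(2) by (simp add: elt_def name_def)

lemma elt_inj: "inj_on elt {c. c < length w \<and> name w P c}"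
proof (rule inj_onI)
  fix c d assume c: "c \<in> {c. c < length w \<and> name w P c}" and d: "d \<in> {c. c < length w \<and> name w P c}" and e: "elt c = elt d"
  have "number w P (Suc c) \<in> Defs.constants (fm w P 0)" "number w P (Suc d) \<in> Defs.constants (fm w P 0)"
    using c d constants by (auto simp: name_def)
  then have "number w P (Suc c) = number w P (Suc d)"
    using e unique_names(1) by (simp add: elt_def inj_on_def)
  then show "c = d" using c d unfolding name_def by (metis (mono_tags, lifting) linorder_neqE_nat mem_Collect_eq)
qed

lemma core_exists:
  assumes \<alpha>: "represents \<alpha> a a"
  shows "\<exists>D < Bd w. \<exists>V < Bd w. core w P A \<alpha> D V"
proof -
  define m where "m = length w + 1"
  define K where "K = elt ` {c. c < length w \<and> name w P c}"
  define f where "f = (\<lambda>k. of_bool (typ (elt (k div m div m)) (elt (k div m mod m)) (k mod m)) :: nat)"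
  \<comment> \<open>Named elements are joined to each other in the core, so those in
    \<open>K\<close> must not be generated again as children.\<close>
  define g where "g = (\<lambda>k. card ((needed (elt (k div m)) - K) \<inter> contrib (elt (k div m)) (k mod m)))"
  have fK: "finite K" by (simp add: K_def)
  have "f k < Qd w" for k using Qd_bounds(2)[of w] by (simp add: f_def of_bool_def)
  moreover have "m ^ 3 \<le> 8 * (length w + 1) ^ 3" by (simp add: m_def)
  ultimately obtain D where D: "D < Bd w" "\<And>k. k < m ^ 3 \<Longrightarrow> dig w D k = f k"
    using sequence_exists[of "m ^ 3" f w] by blast
  have "g k < Qd w" for k
    unfolding g_def using card_mono[of "needed (elt (k div m))" "(needed (elt (k div m)) - K) \<inter> contrib (elt (k div m)) (k mod m)"]
      needed(1,3)[of "elt (k div m)"] by fastforce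
  moreover have "m ^ 2 \<le> 8 * (length w + 1) ^ 3"
    using power_increasing[of 2 3 m] by (simp add: m_def)
  ultimately obtain V where V: "V < Bd w" "\<And>k. k < m ^ 2 \<Longrightarrow> dig w V k = g k"
    using sequence_exists[of "m ^ 2" g w] by blast
  have idx: "x * m + y < n * m" if "x < n" "y < m" for x y n
  proof -
    have "x * m + y < (x + 1) * m" using that by simp
    also have "\<dots> \<le> n * m" using that by (intro mult_right_mono) auto
    finally show ?thesis .
  qed
  have rep: "represents (core_type w D c d) (elt c) (elt d)" if c: "c < length w" "d < length w" for c d
    unfolding represents_def
  proof (intro allI impI)
    fix i assume i: "i < length w"
    have l: "c < m" "d < m" "i < m" using c i by (auto simp: m_def)
    let ?k = "(c * m + d) * m + i"
    have "?k < m ^ 3" using idx[OF idx[OF l(1,2)] l(3)] by (simp add: power3_eq_cube)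
    then have "dig w (core_type w D c d) i = f ?k" using D(2) by (simp add: core_type_def dig_shift m_def)
    also have "\<dots> = of_bool (typ (elt c) (elt d) i)" using l by (simp add: f_def)
    finally show "tr w (core_type w D c d) i \<longleftrightarrow> typ (elt c) (elt d) i" by (simp add: tr_def)
  qed
  have need: "dig w (core_need w V c) i = card ((needed (elt c) - K) \<inter> contrib (elt c) i)" if "c < length w" "i < length w" for c i
  proof -
    have l: "c < m" "i < m" using that by (auto simp: m_def)
    have "c * m + i < m ^ 2" using idx[OF l] by (simp add: power2_eq_square)
    then have "dig w (core_need w V c) i = g (c * m + i)" using V(2) by (simp add: core_need_def dig_shift m_def)
    then show ?thesis using l by (simp add: g_def)
  qed
  have "core_ok w P A \<alpha> D V c" if c: "c < length w" "name w P c" for c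
    unfolding core_ok_def
  proof (intro conjI allI impI)
    note ce = elt_dom[OF c] and cr = rep[OF c(1) c(1)]
    show "diag w P (core_type w D c c)" by (rule diag_typ[OF cr ce])
    show "agree w P \<alpha> (core_type w D c c)" by (rule agree_typ[OF \<alpha> cr])
    show "good w P A (core_type w D c c) (core_need w V c)"
    proof (rule realized_good)
      show "core_type w D c c < Bd w" "core_need w V c < Bd w"
        using shift_le D(1) V(1) unfolding core_type_def core_need_def by (meson le_less_trans)+
      have "elt c \<in> K" using c by (auto simp: K_def)
      then show "realized (core_type w D c c) (core_need w V c)"
        by (intro realizedI[OF ce _ cr, of "needed (elt c) - K"] need c) auto
    qed
  next
    fix i assume i: "i < length w" "counter w P i"
    note ce = elt_dom[OF c] and cr = rep[OF c(1) c(1)]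
    let ?R = "contrib (elt c) i"
    have "elt ` {d. d < length w \<and> name w P d \<and> con w P (core_type w D c d) (core_type w D d c) i} = K \<inter> ?R"
      using con_typ[OF rep rep i(2) elt_dom] c by (auto simp: K_def)
    moreover have "inj_on elt {d. d < length w \<and> name w P d \<and> con w P (core_type w D c d) (core_type w D d c) i}"
      by (rule inj_on_subset[OF elt_inj]) auto
    ultimately have k: "card {d. d < length w \<and> name w P d \<and> con w P (core_type w D c d) (core_type w D d c) i} = card (K \<inter> ?R)"
      using card_image by fastforce
    have "(needed (elt c) \<union> K) \<inter> ?R = ((needed (elt c) - K) \<inter> ?R) \<union> (K \<inter> ?R)" by blast
    then have "card ((needed (elt c) \<union> K) \<inter> ?R) = card ((needed (elt c) - K) \<inter> ?R) + card (K \<inter> ?R)"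
      using fK needed(1) by (simp only:) (rule card_Un_disjoint, auto)
    then show "count_ok w P (core_type w D c c) i (dig w (core_need w V c) i +
        card {d. d < length w \<and> name w P d \<and> con w P (core_type w D c d) (core_type w D d c) i})"
      using count_typ[OF ce cr i, of "needed (elt c) \<union> K"] fK needed(1) need[OF c(1) i(1)] k by simp
  next
    fix d assume d: "d < length w" "name w P d \<and> d \<noteq> c"
    then have "elt c \<noteq> elt d" using elt_inj c by (auto simp: inj_on_def)
    then show "link w P (core_type w D c c) (core_type w D d d) (core_type w D c d) (core_type w D d c)"
      using link_typ[OF rep rep rep rep] c d by blast
  qed
  moreover have "facts_ok w P \<alpha> D i" if i: "node w P i" for i
    unfolding facts_ok_def
  proof (intro conjI allI impI)
    fix c assume u: "istok w i TUn \<and> \<not> isvar w (fst_pos w P i)" and c: "c < length w"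
      "name w P c \<and> number w P (Suc c) = number w P (Suc (fst_pos w P i))"
    show "tr w \<alpha> i \<longleftrightarrow> tr w (core_type w D c c) (Suc i)"
      using tr_node[OF \<alpha> i] tr_unary[OF rep[OF c(1) c(1)] i] u c(2) fm_unary[OF i]
      by (simp add: sem_def not_isvar_the_arg elt_def)
  next
    fix c d assume u: "isbin w i \<and> \<not> isvar w (fst_pos w P i)" and c: "c < length w" and d: "d < length w"
      and e: "name w P c \<and> name w P d \<and> number w P (Suc c) = number w P (Suc (fst_pos w P i)) \<and>
        number w P (Suc d) = number w P (Suc (snd_pos w P i))"
    have "\<not> isvar w (snd_pos w P i)" using u args(1)[OF i] by (auto simp: args_ok_def)
    then show "tr w \<alpha> i \<longleftrightarrow> tr w (core_type w D c d) (Suc i)"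
      using tr_node[OF \<alpha> i] tr_binary[OF rep[OF c d] i] u e fm_binary[OF i]
      by (simp add: sem_def not_isvar_the_arg elt_def)
  qed
  ultimately have "core w P A \<alpha> D V" by (simp add: core_def)
  then show ?thesis using D(1) V(1) by blast
qed

theorem model_accepted: "accepted w A"
proof -
  obtain a where a: "a \<in> dom S" using dom_nonempty by blast
  obtain \<alpha> where \<alpha>: "\<alpha> < Bd w" "represents \<alpha> a a" by (rule representative)
  have "range (env a a) \<subseteq> dom S" using a by (auto simp: env_def split: var.splits)
  then have "sem a a 0" using model by (simp add: sem_def is_model_def)
  then have "tr w \<alpha> 0" using tr_node[OF \<alpha>(2) root_node(1)] by simp
  then show ?thesis
    unfolding accepted_def final_def
    using P_less parsed \<alpha>(1) root_typ[OF a \<alpha>] witnessed_typ[OF \<alpha>(2)] core_exists[OF \<alpha>(2)] by blast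
qed

end

section \<open>From types to models\<close>

lemma tr_0 [simp]: "\<not> tr w 0 i"
  by (simp add: tr_def)

locale accepted_word = parse +
  fixes A :: "nat \<Rightarrow> bool" and \<alpha>\<^sub>0 D V :: nat
  assumes closed: "\<And>\<alpha> v. \<alpha> < Bd w \<Longrightarrow> v < Bd w \<Longrightarrow> good w P A \<alpha> v \<Longrightarrow> \<not> blocked w P A \<alpha> v"
    and \<alpha>\<^sub>0: "\<alpha>\<^sub>0 < Bd w" "tr w \<alpha>\<^sub>0 0" "is_root w P A \<alpha>\<^sub>0" "witnessed w P A \<alpha>\<^sub>0"
    and core_holds: "core w P A \<alpha>\<^sub>0 D V" and DV: "D < Bd w" "V < Bd w"
begin

section \<open>Children of possible states and roots of the forest\<close>

definition kids_ok :: "nat \<Rightarrow> nat \<Rightarrow> (nat \<times> nat \<times> nat \<times> nat) list \<Rightarrow> bool" where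
  "kids_ok \<alpha> v ks \<longleftrightarrow>
     (\<forall>(\<beta>, s, s', v') \<in> set ks. \<beta> < Bd w \<and> v' < Bd w \<and> diag w P \<beta> \<and> link w P \<alpha> \<beta> s s' \<and>
        serves w P \<beta> s s' v' \<and> good w P A \<beta> v') \<and>
     (\<forall>i < length w. counter w P i \<longrightarrow> dig w v i = length (filter (\<lambda>(\<beta>, s, s', v'). con w P s s' i) ks))"

text \<open>Induction on the sum of the entries of the vector, which every child lowers. Only one
  generation is collected: the states of the children are merely known to be possible, and are
  expanded along the paths of the forest.\<close>

lemma kids_exist:
  assumes "\<alpha> < Bd w" "v < Bd w" "good w P A \<alpha> v"
  shows "\<exists>ks. kids_ok \<alpha> v ks"
  using assms(2,3)
proof (induction "\<Sum>i | i < length w \<and> counter w P i. dig w v i" arbitrary: v rule: less_induct)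
  case less
  have nb: "\<not> blocked w P A \<alpha> v" using closed assms(1) less.prems by blast
  show ?case
  proof (cases "finished w P v")
    case True
    then have "kids_ok \<alpha> v []" by (simp add: kids_ok_def finished_def)
    then show ?thesis by blast
  next
    case False
    then obtain \<beta> s s' u v' where k: "\<beta> < Bd w" "u < Bd w" "v' < Bd w" "kid w P A \<alpha> v \<beta> s s' u v'"
      using nb unfolding blocked_def by blast
    then have sp: "\<And>i. i < length w \<Longrightarrow> counter w P i \<Longrightarrow> dig w v i = dig w u i + of_bool (con w P s s' i)"
      "\<exists>i < length w. counter w P i \<and> con w P s s' i"
      by (auto simp: kid_def splits_def)
    have "(\<Sum>i | i < length w \<and> counter w P i. dig w u i) < (\<Sum>i | i < length w \<and> counter w P i. dig w v i)"
      by (rule sum_strict_mono_ex1) (use sp in auto)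
    moreover have "good w P A \<alpha> u" using k(4) by (simp add: kid_def)
    ultimately obtain ks where ks: "kids_ok \<alpha> u ks" using less.hyps k(2) by blast
    have "kids_ok \<alpha> v ((\<beta>, s, s', v') # ks)"
      using ks k sp(1) by (auto simp: kids_ok_def kid_def)
    then show ?thesis by blast
  qed
qed

definition "kids \<alpha> v = (SOME ks. kids_ok \<alpha> v ks)"

lemma kids: "\<alpha> < Bd w \<Longrightarrow> v < Bd w \<Longrightarrow> good w P A \<alpha> v \<Longrightarrow> kids_ok \<alpha> v (kids \<alpha> v)"
  unfolding kids_def using kids_exist by (metis someI_ex)

definition "names = {c. c < length w \<and> name w P c}"

definition "open_quant i \<longleftrightarrow> i < length w \<and> node w P i \<and> isquant w i \<and> binds w P i \<and> (tr w \<alpha>\<^sub>0 i \<longleftrightarrow> istok w i TEx)"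

definition "witness i = (SOME \<beta>. \<beta> < Bd w \<and> is_root w P A \<beta> \<and> agree w P \<alpha>\<^sub>0 \<beta> \<and> (tr w \<beta> (i + 2) \<longleftrightarrow> istok w i TEx))"

lemma witness:
  assumes "open_quant i"
  shows "witness i < Bd w" "is_root w P A (witness i)" "agree w P \<alpha>\<^sub>0 (witness i)"
    "tr w (witness i) (i + 2) \<longleftrightarrow> istok w i TEx"
proof -
  have "\<exists>\<beta>. \<beta> < Bd w \<and> is_root w P A \<beta> \<and> agree w P \<alpha>\<^sub>0 \<beta> \<and> (tr w \<beta> (i + 2) \<longleftrightarrow> istok w i TEx)"
    using \<alpha>\<^sub>0(4) assms unfolding witnessed_def open_quant_def by blast
  from someI_ex[OF this] show "witness i < Bd w" "is_root w P A (witness i)" "agree w P \<alpha>\<^sub>0 (witness i)"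
    "tr w (witness i) (i + 2) \<longleftrightarrow> istok w i TEx" unfolding witness_def by blast+
qed

text \<open>The roots of the forest: the named elements, a witness for each quantifier, and one further element.\<close>

definition "roots = names \<union> {length w + i | i. open_quant i} \<union> {2 * length w}"

text \<open>Roots are numbers in three disjoint ranges: a position below \<open>length w\<close> is
  a name, \<open>length w + i\<close> is the witness for the quantifier at \<open>i\<close>, and
  \<open>2 * length w\<close> carries \<open>\<alpha>\<^sub>0\<close> and keeps the domain
  nonempty.\<close>

definition "root_type r = (if r < length w then core_type w D r r
  else if r < 2 * length w then witness (r - length w) else \<alpha>\<^sub>0)"

definition "root_need r = (if r < length w then core_need w V r
  else SOME v. v < Bd w \<and> good w P A (root_type r) v \<and>
    (\<forall>i < length w. counter w P i \<longrightarrow>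
       count_ok w P (root_type r) i (dig w v i + of_bool (con w P (root_type r) (root_type r) i))))"

text \<open>Roots adjacent to \<open>r\<close>, including \<open>r\<close> itself, so that named and
  unnamed roots obey the same counting condition.\<close>

definition "peers r = (if r < length w then names else {r})"

definition "peer_type r d = (if r < length w then core_type w D r d else root_type r)"

lemma core_ok_names: "c \<in> names \<Longrightarrow> core_ok w P A \<alpha>\<^sub>0 D V c"
  using core_holds by (auto simp: core_def names_def)

lemma finite_names: "finite names"
  by (simp add: names_def)

lemma root:
  assumes "r \<in> roots"
  shows "root_type r < Bd w" "root_need r < Bd w" "good w P A (root_type r) (root_need r)" "diag w P (root_type r)"
    "agree w P \<alpha>\<^sub>0 (root_type r)" "peers r \<subseteq> roots" "finite (peers r)" "r \<in> peers r" "peer_type r r = root_type r"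
    "i < length w \<Longrightarrow> counter w P i \<Longrightarrow> count_ok w P (root_type r) i
       (dig w (root_need r) i + card {d \<in> peers r. con w P (peer_type r d) (peer_type d r) i})"
proof -
  have "root_type r < Bd w \<and> root_need r < Bd w \<and> good w P A (root_type r) (root_need r) \<and> diag w P (root_type r) \<and>
    agree w P \<alpha>\<^sub>0 (root_type r) \<and> peers r \<subseteq> roots \<and> finite (peers r) \<and> r \<in> peers r \<and> peer_type r r = root_type r \<and>
    (\<forall>i < length w. counter w P i \<longrightarrow> count_ok w P (root_type r) i
       (dig w (root_need r) i + card {d \<in> peers r. con w P (peer_type r d) (peer_type d r) i}))"
  proof (cases "r < length w")
    case True
    then have rn: "r \<in> names" using assms by (auto simp: roots_def)
    note c = core_ok_names[OF rn]
    have b: "core_type w D r r < Bd w" "core_need w V r < Bd w"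
      using shift_le DV unfolding core_type_def core_need_def by (meson le_less_trans)+
    have "{d \<in> names. con w P (core_type w D r d) (peer_type d r) i} =
        {d. d < length w \<and> name w P d \<and> con w P (core_type w D r d) (core_type w D d r) i}" for i
      by (auto simp: names_def peer_type_def)
    moreover have "names \<subseteq> roots" by (auto simp: roots_def)
    ultimately show ?thesis using b c rn True finite_names
      by (simp add: core_ok_def root_type_def root_need_def peers_def peer_type_def)
  next
    case False
    have R: "root_type r < Bd w \<and> is_root w P A (root_type r) \<and> agree w P \<alpha>\<^sub>0 (root_type r)"
    proof (cases "r < 2 * length w")
      case True
      then have "open_quant (r - length w)" using assms False by (auto simp: roots_def names_def)
      then show ?thesis using witness[of "r - length w"] True False by (simp add: root_type_def)
    next
      case F: False
      then show ?thesis using \<alpha>\<^sub>0 False by (simp add: root_type_def agree_def)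
    qed
    then have "\<exists>v. v < Bd w \<and> good w P A (root_type r) v \<and>
      (\<forall>i < length w. counter w P i \<longrightarrow>
       count_ok w P (root_type r) i (dig w v i + of_bool (con w P (root_type r) (root_type r) i)))"
      by (auto simp: is_root_def)
    from someI_ex[OF this] False
    have v: "root_need r < Bd w" "good w P A (root_type r) (root_need r)"
      "\<And>i. i < length w \<Longrightarrow> counter w P i \<Longrightarrow>
       count_ok w P (root_type r) i (dig w (root_need r) i + of_bool (con w P (root_type r) (root_type r) i))"
      by (auto simp: root_need_def)
    have "{d. d = r \<and> con w P (root_type r) (peer_type d r) i} =
        (if con w P (root_type r) (root_type r) i then {r} else {})" for i
      using False by (auto simp: peer_type_def)
    then have "card {d. d = r \<and> con w P (root_type r) (peer_type d r) i} = of_bool (con w P (root_type r) (root_type r) i)" for i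
      by simp
    then show ?thesis using R v assms False
      by (simp add: is_root_def peers_def peer_type_def)
  qed
  then show "root_type r < Bd w" "root_need r < Bd w" "good w P A (root_type r) (root_need r)" "diag w P (root_type r)"
    "agree w P \<alpha>\<^sub>0 (root_type r)" "peers r \<subseteq> roots" "finite (peers r)" "r \<in> peers r" "peer_type r r = root_type r"
    "i < length w \<Longrightarrow> counter w P i \<Longrightarrow> count_ok w P (root_type r) i
       (dig w (root_need r) i + card {d \<in> peers r. con w P (peer_type r d) (peer_type d r) i})" by blast+
qed

lemma peers_sym: "r \<in> roots \<Longrightarrow> d \<in> peers r \<Longrightarrow> r \<in> peers d"
  by (auto simp: peers_def roots_def names_def)

lemma peers_link:
  "r \<in> roots \<Longrightarrow> d \<in> peers r \<Longrightarrow> d \<noteq> r \<Longrightarrow> link w P (root_type r) (root_type d) (peer_type r d) (peer_type d r)"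
  using core_ok_names[of r] unfolding core_ok_def
  by (auto simp: peers_def roots_def names_def root_type_def peer_type_def split: if_splits)

text \<open>An element is the list of the numbers of the children on its path, last one first, ending in its root.\<close>

primrec element :: "nat list \<Rightarrow> nat \<times> nat \<times> nat \<times> nat" where
  "element [] = (0, 0, 0, 0)"
| "element (k # e) = (if e = [] then (root_type k, 0, 0, root_need k)
     else kids (fst (element e)) (snd (snd (snd (element e)))) ! k)"

definition "etype e = fst (element e)"
definition "eneed e = snd (snd (snd (element e)))"
definition "down e = fst (snd (element e))"
definition "upw e = fst (snd (snd (element e)))"

primrec valid :: "nat list \<Rightarrow> bool" where
  "valid [] = False"
| "valid (k # e) = (if e = [] then k \<in> roots else valid e \<and> k < length (kids (etype e) (eneed e)))"

lemma element_root: "etype [r] = root_type r" "eneed [r] = root_need r"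
  by (simp_all add: etype_def eneed_def)

lemma valid_element: "valid e \<Longrightarrow> etype e < Bd w \<and> eneed e < Bd w \<and> good w P A (etype e) (eneed e) \<and>
  diag w P (etype e) \<and> agree w P \<alpha>\<^sub>0 (etype e) \<and>
  (tl e \<noteq> [] \<longrightarrow> valid (tl e) \<and> link w P (etype (tl e)) (etype e) (down e) (upw e) \<and> serves w P (etype e) (down e) (upw e) (eneed e))"
proof (induction e)
  case (Cons k e)
  show ?case
  proof (cases "e = []")
    case True
    then show ?thesis using Cons.prems root[of k] by (simp add: element_root)
  next
    case False
    then have e: "valid e" "k < length (kids (etype e) (eneed e))" using Cons.prems by auto
    have IH: "etype e < Bd w" "eneed e < Bd w" "good w P A (etype e) (eneed e)" "agree w P \<alpha>\<^sub>0 (etype e)"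
      using Cons.IH e(1) by auto
    have el: "element (k # e) = kids (etype e) (eneed e) ! k" using False by (simp add: etype_def eneed_def)
    obtain \<beta> s s' v' where q: "kids (etype e) (eneed e) ! k = (\<beta>, s, s', v')"
      by (cases "kids (etype e) (eneed e) ! k")
    then have "(\<beta>, s, s', v') \<in> set (kids (etype e) (eneed e))" using e(2) nth_mem by metis
    then have k: "\<beta> < Bd w" "v' < Bd w" "diag w P \<beta>" "link w P (etype e) \<beta> s s'" "serves w P \<beta> s s' v'" "good w P A \<beta> v'"
      using kids[OF IH(1-3)] unfolding kids_ok_def by blast+
    have "agree w P (etype e) \<beta>" using k(4) unfolding agree_def link_def pair_def pair_ok_def by blast
    then have "agree w P \<alpha>\<^sub>0 \<beta>" using IH(4) unfolding agree_def by blast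
    then show ?thesis using k e False el q by (simp add: etype_def[of "k # e"] eneed_def[of "k # e"] down_def upw_def)
  qed
qed simp

text \<open>The default 0 makes every binary predicate empty on pairs that are not adjacent. On such
  pairs it does not claim the truth of compound formulas: type 0 satisfies neither a formula nor its
  negation.\<close>

definition "type_of e f = (if e = f then etype e
  else if e \<noteq> [] \<and> f \<noteq> [] \<and> tl f = e then down f
  else if e \<noteq> [] \<and> f \<noteq> [] \<and> tl e = f then upw e
  else if length e = 1 \<and> length f = 1 \<and> hd f \<in> peers (hd e) then peer_type (hd e) (hd f)
  else 0)"

definition "adjacent e f \<longleftrightarrow> e = f \<or> e \<noteq> [] \<and> f \<noteq> [] \<and> (tl f = e \<or> tl e = f) \<or>
  length e = 1 \<and> length f = 1 \<and> hd f \<in> peers (hd e)"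

lemma type_of_self: "type_of e e = etype e"
  by (simp add: type_of_def)

lemma tl_neq: "e \<noteq> [] \<Longrightarrow> tl e \<noteq> e"
  by (metis list.collapse not_Cons_self2)

lemma adjacent_link:
  assumes e: "valid e" "valid f" "e \<noteq> f" "adjacent e f"
  shows "link w P (etype e) (etype f) (type_of e f) (type_of f e)"
proof -
  have ne: "e \<noteq> []" "f \<noteq> []" using e by auto
  consider "tl f = e" | "tl e = f" | "length e = 1" "length f = 1" "hd f \<in> peers (hd e)"
    using e(3,4) by (auto simp: adjacent_def)
  then show ?thesis
  proof cases
    case 1
    have "tl e \<noteq> f"
    proof
      assume a: "tl e = f"
      have "length (tl f) < length f" "length (tl e) < length e" using ne by auto
      then show False using a 1 by simp
    qed
    then show ?thesis using valid_element[OF e(2)] 1 ne e(3) by (simp add: type_of_def)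
  next
    case 2
    have "tl f \<noteq> e"
    proof
      assume a: "tl f = e"
      have "length (tl f) < length f" "length (tl e) < length e" using ne by auto
      then show False using a 2 by simp
    qed
    then show ?thesis using valid_element[OF e(1)] 2 ne e(3) by (simp add: type_of_def link_def)
  next
    case 3
    obtain r d where rd: "e = [r]" "f = [d]" using 3 by (metis One_nat_def length_0_conv length_Suc_conv)
    then have "r \<in> roots" "d \<in> peers r" "d \<noteq> r" using e 3 by auto
    then show ?thesis using peers_link[of r d] peers_sym[of r d] rd by (simp add: type_of_def element_root)
  qed
qed

lemma not_adjacent: "\<not> adjacent e f \<Longrightarrow> type_of e f = 0"
  by (auto simp: adjacent_def type_of_def)

lemma adjacent_sym: "valid e \<Longrightarrow> valid f \<Longrightarrow> adjacent e f \<Longrightarrow> adjacent f e"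
proof -
  assume a: "valid e" "valid f" "adjacent e f"
  have "hd e \<in> roots" if "length e = 1" using a(1) that by (cases e) auto
  then show ?thesis using a peers_sym[of "hd e" "hd f"] by (auto simp: adjacent_def)
qed

lemma type_basic: "valid e \<Longrightarrow> valid f \<Longrightarrow> adjacent e f \<Longrightarrow> basic w P (type_of e f)"
  using adjacent_link[of e f] valid_element[of e]
  by (cases "e = f") (auto simp: type_of_self diag_def link_def pair_def)

text \<open>The contributors to \<open>e\<close> are its children, as many as its need vector says,
  and elements that are no longer lists than \<open>e\<close>: itself together with its parent or
  its peers. The two groups are disjoint, and their sum is what \<open>serves\<close> or the
  condition on roots has checked.\<close>

lemma count_neighbours:
  assumes e: "valid e" and i: "i < length w" "counter w P i"
  shows "finite {f. valid f \<and> con w P (type_of e f) (type_of f e) i}"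
    "count_ok w P (etype e) i (card {f. valid f \<and> con w P (type_of e f) (type_of f e) i})"
proof -
  let ?ks = "kids (etype e) (eneed e)"
  let ?K = "{f. \<exists>k < length ?ks. f = k # e \<and> con w P (down f) (upw f) i}"
  \<comment> \<open>The contributors that are not children: peers for a root, otherwise the element
    and its parent.\<close>
  define Up where "Up = (if tl e = [] then (\<lambda>d. [d]) ` {d \<in> peers (hd e). con w P (peer_type (hd e) d) (peer_type d (hd e)) i}
    else {f \<in> {e, tl e}. con w P (type_of e f) (type_of f e) i})"
  have ne: "e \<noteq> []" using e by auto
  note ve = valid_element[OF e]
  have no: "\<not> con w P 0 0 i" by (simp add: con_def)
  have child: "type_of e (k # e) = down (k # e)" "type_of (k # e) e = upw (k # e)" for k
  proof -
    have "tl e \<noteq> k # e"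
    proof
      assume "tl e = k # e"
      then have "length (tl e) = length (k # e)" by simp
      then show False by simp
    qed
    then show "type_of e (k # e) = down (k # e)" "type_of (k # e) e = upw (k # e)"
      using ne by (auto simp: type_of_def)
  qed
  have split: "{f. valid f \<and> con w P (type_of e f) (type_of f e) i} = Up \<union> ?K"
  proof (intro set_eqI iffI)
    fix f assume "f \<in> {f. valid f \<and> con w P (type_of e f) (type_of f e) i}"
    then have f: "valid f" "con w P (type_of e f) (type_of f e) i" by auto
    have "adjacent e f"
    proof (rule ccontr)
      assume na: "\<not> adjacent e f"
      then have "\<not> adjacent f e" using adjacent_sym e f by blast
      then show False using f(2) na no by (simp add: not_adjacent)
    qed
    then consider "f = e" | "tl f = e" "f \<noteq> e" | "tl e = f" "f \<noteq> e" | "length e = 1" "length f = 1" "hd f \<in> peers (hd e)" "f \<noteq> e"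
      by (auto simp: adjacent_def)
    then show "f \<in> Up \<union> ?K"
    proof cases
      case 1
      show ?thesis
      proof (cases "tl e = []")
        case True
        then obtain r where r: "e = [r]" using ne by (cases e) auto
        then have "r \<in> roots" using e by simp
        then show ?thesis using f(2) 1 r root(8,9)[of r]
          by (auto simp: Up_def type_of_self element_root)
      qed (use 1 f in \<open>auto simp: Up_def\<close>)
    next
      case 2
      then obtain k where "f = k # e" using f(1) by (cases f) auto
      then show ?thesis using f ne child by auto
    next
      case 3
      then show ?thesis using f by (auto simp: Up_def)
    next
      case 4
      then obtain r d where rd: "e = [r]" "f = [d]" by (metis One_nat_def length_0_conv length_Suc_conv)
      then have "type_of e f = peer_type r d" "type_of f e = peer_type d r"
        using 4 e f peers_sym[of r d] by (auto simp: type_of_def)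
      then show ?thesis using f rd 4 by (auto simp: Up_def)
    qed
  next
    fix f assume "f \<in> Up \<union> ?K"
    then show "f \<in> {f. valid f \<and> con w P (type_of e f) (type_of f e) i}"
    proof
      assume "f \<in> ?K"
      then show ?thesis using e ne child by auto
    next
      assume f: "f \<in> Up"
      show ?thesis
      proof (cases "tl e = []")
        case True
        then obtain r where r: "e = [r]" using ne by (cases e) auto
        then have rr: "r \<in> roots" using e by simp
        obtain d where d: "f = [d]" "d \<in> peers r" "con w P (peer_type r d) (peer_type d r) i"
          using f True r by (auto simp: Up_def)
        have "type_of e f = peer_type r d" "type_of f e = peer_type d r"
          using d r rr peers_sym[of r d] root(9)[OF rr] by (auto simp: type_of_def element_root)
        then show ?thesis using d root(6)[OF rr] by auto
      next
        case False
        then show ?thesis using f e ve by (auto simp: Up_def)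
      qed
    qed
  qed
  have K: "?K = (\<lambda>k. k # e) ` {k. k < length ?ks \<and> (case ?ks ! k of (\<beta>, s, s', v') \<Rightarrow> con w P s s' i)}"
  proof -
    have "con w P (down (k # e)) (upw (k # e)) i \<longleftrightarrow> (case ?ks ! k of (\<beta>, s, s', v') \<Rightarrow> con w P s s' i)" for k
      using ne by (auto simp: down_def upw_def etype_def eneed_def split: prod.splits)
    then show ?thesis by auto
  qed
  then have finK: "finite ?K" by simp
  have "card ?K = card {k. k < length ?ks \<and> (case ?ks ! k of (\<beta>, s, s', v') \<Rightarrow> con w P s s' i)}"
    unfolding K by (rule card_image) (simp add: inj_on_def)
  also have "\<dots> = length (filter (\<lambda>(\<beta>, s, s', v'). con w P s s' i) ?ks)"
    by (simp add: length_filter_conv_card)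
  also have "\<dots> = dig w (eneed e) i"
    using kids[of "etype e" "eneed e"] ve i by (simp add: kids_ok_def)
  finally have cK: "card ?K = dig w (eneed e) i" .
  have UK: "Up \<inter> ?K = {}"
  proof -
    have "length f \<le> length e" if "f \<in> Up" for f
      using that ne by (cases e) (auto simp: Up_def split: if_splits)
    then show ?thesis by fastforce
  qed
  have Up: "finite Up \<and> count_ok w P (etype e) i (dig w (eneed e) i + card Up)"
  proof (cases "tl e = []")
    case True
    then obtain r where r: "e = [r]" using ne by (cases e) auto
    then have rr: "r \<in> roots" using e by simp
    have "card Up = card {d \<in> peers r. con w P (peer_type r d) (peer_type d r) i}"
      using r by (simp add: Up_def card_image inj_on_def)
    then show ?thesis using root(7)[OF rr] root(10)[OF rr i] r by (simp add: Up_def element_root)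
  next
    case False
    have t: "type_of e (tl e) = upw e" "type_of (tl e) e = down e"
    proof -
      have "tl e \<noteq> e" using tl_neq ne by blast
      moreover have "tl (tl e) \<noteq> e" using ne False by (metis length_tl diff_less length_greater_0_conv less_asym zero_less_one)
      ultimately show "type_of e (tl e) = upw e" "type_of (tl e) e = down e"
        using ne False by (auto simp: type_of_def)
    qed
    have "Up = (if con w P (etype e) (etype e) i then {e} else {}) \<union> (if con w P (upw e) (down e) i then {tl e} else {})"
      using False t by (auto simp: Up_def type_of_self)
    then have "card Up = of_bool (con w P (etype e) (etype e) i) + of_bool (con w P (upw e) (down e) i)" "finite Up"
      using tl_neq[OF ne] by auto
    then show ?thesis using ve False i by (simp add: serves_def add.assoc)
  qed
  show "finite {f. valid f \<and> con w P (type_of e f) (type_of f e) i}"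
    unfolding split using Up finK by simp
  have "card (Up \<union> ?K) = card Up + card ?K" using Up finK UK by (intro card_Un_disjoint) auto
  then show "count_ok w P (etype e) i (card {f. valid f \<and> con w P (type_of e f) (type_of f e) i})"
    unfolding split using Up cK by (simp add: add.commute)
qed

section \<open>The forest as a structure\<close>

text \<open>A predicate is read off at some position where it occurs; by \<open>basic\<close> all
  its positions give the same answer. A predicate without occurrences is empty.\<close>

definition forest :: "nat list struct" where
  "forest = \<lparr>dom = {e. valid e},
     unI = (\<lambda>p. {e. valid e \<and> (\<exists>i. node w P i \<and> istok w i TUn \<and> number w P (Suc i) = p \<and> tr w (etype e) (Suc i))}),
     binI = (\<lambda>q. {(e, f). valid e \<and> valid f \<and> (\<exists>i. node w P i \<and> isbin w i \<and> the_bpred w P i = q \<and> tr w (type_of e f) (Suc i))}),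
     constI = (\<lambda>c. [SOME a. a \<in> names \<and> number w P (Suc a) = c])\<rparr>"

lemma dom_forest: "e \<in> dom forest \<longleftrightarrow> valid e"
  by (simp add: forest_def)

lemma node_less: "node w P i \<Longrightarrow> i < length w"
  by (simp add: node_def)

lemma unI_forest:
  assumes i: "node w P i" "istok w i TUn" and e: "valid e"
  shows "e \<in> unI forest (number w P (Suc i)) \<longleftrightarrow> tr w (etype e) (Suc i)"
proof
  assume "e \<in> unI forest (number w P (Suc i))"
  then obtain j where j: "node w P j" "istok w j TUn" "number w P (Suc j) = number w P (Suc i)" "tr w (etype e) (Suc j)"
    by (auto simp: forest_def)
  have "basic w P (etype e)" using valid_element[OF e] by (simp add: diag_def)
  moreover have "same_pred w P j i" using i j by (simp add: same_pred_def)
  ultimately show "tr w (etype e) (Suc i)" using i j node_less unfolding basic_def by blast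
qed (use i e in \<open>auto simp: forest_def\<close>)

lemma binI_forest:
  assumes i: "node w P i" "isbin w i" and e: "valid e" "valid f"
  shows "(e, f) \<in> binI forest (the_bpred w P i) \<longleftrightarrow> tr w (type_of e f) (Suc i)"
proof
  assume "(e, f) \<in> binI forest (the_bpred w P i)"
  then obtain j where j: "node w P j" "isbin w j" "the_bpred w P j = the_bpred w P i" "tr w (type_of e f) (Suc j)"
    by (auto simp: forest_def)
  then have "adjacent e f" using not_adjacent tr_0 by metis
  then have "basic w P (type_of e f)" using type_basic e by blast
  moreover have "same_pred w P j i" using i j
    by (auto simp: same_pred_def isbin_def the_bpred_def split: if_splits)
  ultimately show "tr w (type_of e f) (Suc i)" using i j node_less unfolding basic_def by blast
qed (use i e in \<open>auto simp: forest_def\<close>)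

lemma name_exists:
  assumes "a < length w" "marked w P a"
  shows "\<exists>c \<in> names. number w P (Suc c) = number w P (Suc a)"
proof -
  let ?Q = "\<lambda>c. marked w P c \<and> number w P (Suc c) = number w P (Suc a)"
  define c where "c = (LEAST c. ?Q c)"
  have c: "?Q c" unfolding c_def using assms by (intro LeastI[of ?Q a]) auto
  have "c \<le> a" unfolding c_def using assms by (intro Least_le) auto
  moreover have "\<not> ?Q c'" if "c' < c" for c' using that not_less_Least unfolding c_def by blast
  ultimately have "c \<in> names" using c assms(1) by (auto simp: names_def name_def)
  then show ?thesis using c by blast
qed

lemma names_unique: "c \<in> names \<Longrightarrow> d \<in> names \<Longrightarrow> number w P (Suc c) = number w P (Suc d) \<Longrightarrow> c = d"
  unfolding names_def name_def by (metis (mono_tags, lifting) linorder_neqE_nat mem_Collect_eq)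

lemma constI_forest: "c \<in> names \<Longrightarrow> constI forest (number w P (Suc c)) = [c]"
proof -
  assume c: "c \<in> names"
  then have "(SOME a. a \<in> names \<and> number w P (Suc a) = number w P (Suc c)) = c"
    using names_unique by (intro some_equality) auto
  then show ?thesis by (simp add: forest_def)
qed

lemma valid_name: "c \<in> names \<Longrightarrow> valid [c]"
  by (simp add: roots_def)

lemma arg_name:
  assumes "arg_ok w P a" "\<not> isvar w a"
  obtains c where "c \<in> names" "number w P (Suc c) = number w P (Suc a)" "val forest g (the_arg w P a) = [c]"
proof -
  have "a < length w" "marked w P a" using assms by (auto simp: arg_ok_def istok_def)
  then obtain c where c: "c \<in> names" "number w P (Suc c) = number w P (Suc a)" using name_exists by blast
  then show ?thesis using that not_isvar_the_arg[OF assms(2)] constI_forest[OF c(1)] by simp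
qed

lemma core_type_of: "c \<in> names \<Longrightarrow> d \<in> names \<Longrightarrow> type_of [c] [d] = core_type w D c d"
  by (auto simp: type_of_def peers_def peer_type_def names_def etype_def root_type_def)

lemma facts: "node w P i \<Longrightarrow> facts_ok w P \<alpha>\<^sub>0 D i"
  using core_holds node_less by (auto simp: core_def)

lemma agree_closed: "valid e \<Longrightarrow> node w P i \<Longrightarrow> \<not> freeX w P i \<Longrightarrow> \<not> freeY w P i \<Longrightarrow> tr w (etype e) i \<longleftrightarrow> tr w \<alpha>\<^sub>0 i"
  using valid_element[of e] node_less[of i] unfolding agree_def by blast

lemma diag_ok_etype: "valid e \<Longrightarrow> node w P i \<Longrightarrow> diag_ok w P (etype e) i"
  using valid_element[of e] node_less[of i] unfolding diag_def by blast

lemma env_self: "env a a v = a"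
  by (cases v) auto

section \<open>Agreement of types and truth in the forest\<close>

abbreviation "truth i e f \<equiv> (tr w (type_of e f) i \<longleftrightarrow> sat forest (env e f) (fm w P i))"

lemma truth_bool:
  assumes i: "node w P i" "isbool w i" and e: "valid e" "valid f" "adjacent e f"
    and IH: "truth (Suc i) e f" "truth (rpos w P i) e f"
  shows "truth i e f"
proof -
  have "bool_ok w P (type_of e f) i" using type_basic[OF e] i node_less[OF i(1)] unfolding basic_def by blast
  then show ?thesis using i(2) IH fm_bool[OF i]
    by (auto simp: bool_ok_def isbool_def connective_def istok_def)
qed

lemma truth_neg:
  assumes i: "node w P i" "istok w i TNeg" and e: "valid e" "valid f" "adjacent e f"
    and IH: "truth (Suc i) e f"
  shows "truth i e f"
proof -
  have "bool_ok w P (type_of e f) i" using type_basic[OF e] i node_less[OF i(1)] unfolding basic_def by blast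
  then show ?thesis using i(2) IH fm_neg[OF i] by (simp add: bool_ok_def)
qed

lemma truth_unary:
  assumes i: "node w P i" "istok w i TUn" and e: "valid e"
  shows "truth i e e"
proof (cases "isvar w (fst_pos w P i)")
  case True
  then show ?thesis using diag_ok_etype[OF e i(1)] unI_forest[OF i e] fm_unary[OF i] i(2)
    by (simp add: diag_ok_def type_of_self isvar_the_arg env_self)
next
  case False
  obtain c where c: "c \<in> names" "number w P (Suc c) = number w P (Suc (fst_pos w P i))"
    "\<And>g. val forest g (the_arg w P (fst_pos w P i)) = [c]"
    using arg_name[OF unary_node(2)[OF i] False] by (metis not_isvar_the_arg[OF False] val.simps(2))
  have "\<not> freeX w P i" "\<not> freeY w P i"
    using free_fm[OF i(1)] fm_unary[OF i] not_isvar_the_arg[OF False] by auto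
  then have "tr w (etype e) i \<longleftrightarrow> tr w \<alpha>\<^sub>0 i" using agree_closed e i by blast
  also have "\<dots> \<longleftrightarrow> tr w (core_type w D c c) (Suc i)"
    using facts[OF i(1)] i(2) False c(1,2) by (auto simp: facts_ok_def names_def)
  also have "\<dots> \<longleftrightarrow> sat forest (env e e) (fm w P i)"
    using unI_forest[OF i valid_name[OF c(1)]] core_type_of[OF c(1) c(1)] fm_unary[OF i] c(3)
    by (simp add: type_of_self)
  finally show ?thesis by (simp add: type_of_self)
qed

lemma truth_binary:
  assumes i: "node w P i" "isbin w i" and e: "valid e"
  shows "truth i e e"
proof (cases "isvar w (fst_pos w P i)")
  case True
  then have "isvar w (snd_pos w P i)" using args(1)[OF i(1)] i(2) by (auto simp: args_ok_def)
  then show ?thesis using True diag_ok_etype[OF e i(1)] binI_forest[OF i e e] fm_binary[OF i] i(2)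
    by (simp add: diag_ok_def type_of_self isvar_the_arg env_self)
next
  case False
  have ao: "args_ok w P i" using args(1)[OF i(1)] i(2) by blast
  then have ok: "arg_ok w P (fst_pos w P i)" "arg_ok w P (snd_pos w P i)" and F: "\<not> isvar w (snd_pos w P i)"
    using False by (auto simp: args_ok_def)
  obtain c where c: "c \<in> names" "number w P (Suc c) = number w P (Suc (fst_pos w P i))"
    "\<And>g. val forest g (the_arg w P (fst_pos w P i)) = [c]"
    using arg_name[OF ok(1) False] by (metis not_isvar_the_arg[OF False] val.simps(2))
  obtain d where d: "d \<in> names" "number w P (Suc d) = number w P (Suc (snd_pos w P i))"
    "\<And>g. val forest g (the_arg w P (snd_pos w P i)) = [d]"
    using arg_name[OF ok(2) F] by (metis not_isvar_the_arg[OF F] val.simps(2))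
  have "\<not> freeX w P i" "\<not> freeY w P i"
    using free_fm[OF i(1)] fm_binary[OF i] not_isvar_the_arg[OF False] not_isvar_the_arg[OF F] by auto
  then have "tr w (etype e) i \<longleftrightarrow> tr w \<alpha>\<^sub>0 i" using agree_closed e i by blast
  also have "\<dots> \<longleftrightarrow> tr w (core_type w D c d) (Suc i)"
    using facts[OF i(1)] i(2) False c(1,2) d(1,2) by (auto simp: facts_ok_def names_def)
  also have "\<dots> \<longleftrightarrow> sat forest (env e e) (fm w P i)"
    using binI_forest[OF i valid_name[OF c(1)] valid_name[OF d(1)]] core_type_of[OF c(1) d(1)] fm_binary[OF i] c(3) d(3)
    by simp
  finally show ?thesis by (simp add: type_of_self)
qed

lemma truth_equal:
  assumes i: "node w P i" "istok w i TEq" and e: "valid e"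
  shows "truth i e e"
proof (cases "isvar w (fst_pos w P i)")
  case True
  then have "isvar w (snd_pos w P i)" using args(1)[OF i(1)] i(2) by (auto simp: args_ok_def)
  then show ?thesis using True diag_ok_etype[OF e i(1)] fm_equal[OF i] i(2)
    by (simp add: diag_ok_def type_of_self isvar_the_arg env_self)
next
  case False
  have ao: "args_ok w P i" using args(1)[OF i(1)] i(2) by blast
  then have ok: "arg_ok w P (fst_pos w P i)" "arg_ok w P (snd_pos w P i)" and F: "\<not> isvar w (snd_pos w P i)"
    using False by (auto simp: args_ok_def)
  obtain c where c: "c \<in> names" "number w P (Suc c) = number w P (Suc (fst_pos w P i))"
    "val forest (env e e) (the_arg w P (fst_pos w P i)) = [c]" using arg_name[OF ok(1) False] by blast
  obtain d where d: "d \<in> names" "number w P (Suc d) = number w P (Suc (snd_pos w P i))"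
    "val forest (env e e) (the_arg w P (snd_pos w P i)) = [d]" using arg_name[OF ok(2) F] by blast
  have "sat forest (env e e) (fm w P i) \<longleftrightarrow> c = d" using c(3) d(3) fm_equal[OF i] by simp
  also have "\<dots> \<longleftrightarrow> number w P (Suc (fst_pos w P i)) = number w P (Suc (snd_pos w P i))"
    using c(1,2) d(1,2) names_unique by metis
  also have "\<dots> \<longleftrightarrow> tr w (etype e) i"
    using diag_ok_etype[OF e i(1)] i(2) False by (simp add: diag_ok_def)
  finally show ?thesis by (simp add: type_of_self)
qed

text \<open>A binding quantifier is closed, so by \<open>agree\<close> its value is that of
  \<open>\<alpha>\<^sub>0\<close> at every element. \<open>diag_ok\<close> gives the instances, and
  the witness among the roots gives the converse.\<close>

lemma truth_quant:
  assumes i: "node w P i" "isquant w i" and e: "valid e"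
    and IH: "\<And>f. valid f \<Longrightarrow> truth (i + 2) f f"
  shows "truth i e e"
proof -
  note q = quant_node(1-3)[OF i]
  define u where "u = the_var w (Suc i)"
  have f: "fm w P i = quantifier i u (fm w P (i + 2))" using fm_quant[OF i] by (simp add: u_def)
  have b: "binds w P i \<longleftrightarrow> u \<in> free_vars (fm w P (i + 2))"
    using q(2) free_fm[OF q(1)] by (auto simp: binds_def u_def the_var_def isvar_def istok_def)
  have t: "istok w i TAll \<or> istok w i TEx" using i(2) by (simp add: isquant_def)
  note dg = diag_ok_etype[OF e i(1)]
  show ?thesis
  proof (cases "binds w P i")
    case False
    have "sat forest ((env e e)(u := c)) (fm w P (i + 2)) \<longleftrightarrow> sat forest (env e e) (fm w P (i + 2))" for c
      by (rule sat_cong) (use False b in auto)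
    then have "sat forest (env e e) (fm w P i) \<longleftrightarrow> sat forest (env e e) (fm w P (i + 2))"
      unfolding f quantifier_def using e dom_forest by auto
    then show ?thesis using IH[OF e] dg False i(2) by (simp add: diag_ok_def type_of_self)
  next
    case True
    have sub: "sat forest ((env e e)(u := c)) (fm w P (i + 2)) \<longleftrightarrow> tr w (etype c) (i + 2)" if "valid c" for c
    proof -
      have "sat forest ((env e e)(u := c)) (fm w P (i + 2)) \<longleftrightarrow> sat forest (env c c) (fm w P (i + 2))"
      proof (rule sat_cong)
        fix v assume "v \<in> free_vars (fm w P (i + 2))"
        moreover have "\<not> (X \<in> free_vars (fm w P (i + 2)) \<and> Y \<in> free_vars (fm w P (i + 2)))"
          using q(3) free_fm[OF q(1)] by simp
        ultimately have "v = u" using True b by (cases u; cases v) auto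
        then show "((env e e)(u := c)) v = env c c v" by (simp add: env_self)
      qed
      then show ?thesis using IH[OF that] by (simp add: type_of_self)
    qed
    have cl: "\<not> freeX w P i" "\<not> freeY w P i"
    proof -
      have "free_vars (fm w P i) = free_vars (fm w P (i + 2)) - {u}" unfolding f quantifier_def by simp
      moreover have "\<not> (X \<in> free_vars (fm w P (i + 2)) \<and> Y \<in> free_vars (fm w P (i + 2)))"
        using q(3) free_fm[OF q(1)] by simp
      ultimately show "\<not> freeX w P i" "\<not> freeY w P i"
        using free_fm[OF i(1)] True b by (cases u; auto)+
    qed
    have ag: "tr w (etype c) i \<longleftrightarrow> tr w \<alpha>\<^sub>0 i" if "valid c" for c using agree_closed[OF that i(1) cl] .
    have wit: "\<exists>c. valid c \<and> (tr w (etype c) (i + 2) \<longleftrightarrow> istok w i TEx)" if "tr w \<alpha>\<^sub>0 i \<longleftrightarrow> istok w i TEx"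
    proof -
      have o: "open_quant i" using that i True node_less[OF i(1)] by (simp add: open_quant_def)
      then have "valid [length w + i]" "etype [length w + i] = witness i"
        using node_less[OF i(1)] by (auto simp: roots_def element_root root_type_def)
      then show ?thesis using witness(4)[OF o] by metis
    qed
    from t show ?thesis
    proof
      assume a: "istok w i TAll"
      then have nx: "\<not> istok w i TEx" by (simp add: istok_def)
      have "sat forest (env e e) (fm w P i) \<longleftrightarrow> (\<forall>c. valid c \<longrightarrow> tr w (etype c) (i + 2))"
        unfolding f quantifier_def using a sub by (simp add: dom_forest Ball_def)
      also have "\<dots> \<longleftrightarrow> tr w \<alpha>\<^sub>0 i"
      proof
        assume "\<forall>c. valid c \<longrightarrow> tr w (etype c) (i + 2)"
        then show "tr w \<alpha>\<^sub>0 i" using wit nx by blast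
      next
        assume h: "tr w \<alpha>\<^sub>0 i"
        show "\<forall>c. valid c \<longrightarrow> tr w (etype c) (i + 2)"
          using h ag diag_ok_etype[OF _ i(1)] a True unfolding diag_ok_def by blast
      qed
      finally show ?thesis using ag[OF e] by (simp add: type_of_self)
    next
      assume a: "istok w i TEx"
      then have nx: "\<not> istok w i TAll" by (simp add: istok_def)
      have "sat forest (env e e) (fm w P i) \<longleftrightarrow> (\<exists>c. valid c \<and> tr w (etype c) (i + 2))"
        unfolding f quantifier_def using nx sub by (auto simp: dom_forest)
      also have "\<dots> \<longleftrightarrow> tr w \<alpha>\<^sub>0 i"
      proof
        assume "tr w \<alpha>\<^sub>0 i"
        then show "\<exists>c. valid c \<and> tr w (etype c) (i + 2)" using wit a by blast
      next
        assume "\<exists>c. valid c \<and> tr w (etype c) (i + 2)"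
        then show "tr w \<alpha>\<^sub>0 i"
          using ag diag_ok_etype[OF _ i(1)] a True unfolding diag_ok_def by blast
      qed
      finally show ?thesis using ag[OF e] by (simp add: type_of_self)
    qed
  qed
qed

text \<open>Here guardedness enters: the body is a conjunction with a binary atom in both variables,
  and no such atom holds between elements that are not adjacent. So counting in the forest only sees
  neighbours.\<close>

lemma guard_fails:
  assumes i: "node w P i" "iscount w i" and e: "valid e" "valid f" "\<not> adjacent e f"
  shows "\<not> sat forest (env e f) (fm w P (body w P i))"
proof -
  note c = count_node(1-8)[OF i]
  let ?j = "Suc (body w P i)"
  have "isbool w (body w P i)" using c(2) by (simp add: isbool_def)
  then have f: "fm w P (body w P i) = Conj (fm w P ?j) (fm w P (rpos w P (body w P i)))"
    using fm_bool[OF c(1)] c(2) by (simp add: connective_def)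
  have "\<not> adjacent f e" using adjacent_sym e by blast
  then have no: "(e, f) \<notin> binI forest (the_bpred w P ?j)" "(f, e) \<notin> binI forest (the_bpred w P ?j)"
    using binI_forest[OF c(3,4)] e by (simp_all add: not_adjacent)
  have "args_ok w P ?j" using args(1)[OF c(3)] c(4) by blast
  then have "istok w (fst_pos w P ?j) TX \<and> istok w (snd_pos w P ?j) TY \<or> istok w (fst_pos w P ?j) TY \<and> istok w (snd_pos w P ?j) TX"
    using c(7,8) by (auto simp: args_ok_def istok_def)
  then show ?thesis unfolding f using fm_binary[OF c(3,4)] no
    by (auto simp: the_arg_def istok_def)
qed

lemma truth_count:
  assumes i: "node w P i" "iscount w i" and e: "valid e"
    and IH: "\<And>e f. valid e \<Longrightarrow> valid f \<Longrightarrow> adjacent e f \<Longrightarrow> truth (body w P i) e f"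
  shows "truth i e e"
proof -
  have cn: "counter w P i" using i by (simp add: counter_def)
  have nk: "\<not> istok w i TKey" using token_exclusive(3)[OF i(2)] by (auto simp: isbin_def)
  have v: "isvar w (fst_pos w P i)" using count_node(5)[OF i] .
  have sb: "sat forest (env e f) (fm w P (body w P i)) \<longleftrightarrow> tr w (type_of e f) (body w P i)" if "valid e" "valid f" for e f
    using IH[OF that] guard_fails[OF i that] not_adjacent tr_0 by (cases "adjacent e f") auto
  let ?W = "{f. valid f \<and> con w P (type_of e f) (type_of f e) i}"
  have "{f \<in> dom forest. sat forest ((env e e)(the_var w (fst_pos w P i) := f)) (fm w P (body w P i))} = ?W"
    using v sb e nk by (auto simp: dom_forest con_def the_var_def isvar_def istok_def)
  then have "sat forest (env e e) (fm w P i) \<longleftrightarrow> counts (the_comparison w i) (number w P (Suc i)) ?W"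
    using fm_count[OF i] by simp
  also have "\<dots> \<longleftrightarrow> tr w (etype e) i"
    using count_neighbours[OF e node_less[OF i(1)] cn] i(2)
    by (auto simp: count_ok_def the_comparison_def iscount_def istok_def)
  finally show ?thesis by (simp add: type_of_self)
qed

text \<open>Only adjacent pairs are claimed, since their types are consistent. The diagonal comes
  first. Off the diagonal, a formula with at most one free variable goes back to a diagonal pair,
  and one with both variables free is an atom or a Boolean combination, because no quantified
  formula has two free variables.\<close>

lemma truth_lemma: "node w P i \<Longrightarrow> valid e \<Longrightarrow> valid f \<Longrightarrow> adjacent e f \<Longrightarrow> truth i e f"
proof (induction "length w - i" arbitrary: i e f rule: less_induct)
  case less
  note i = less.prems(1)
  have IH: "truth j e f" if "i < j" "node w P j" "valid e" "valid f" "adjacent e f" for j e f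
    using less.hyps[of j e f] that node_less[OF that(2)] by simp
  have self: "adjacent e e" for e by (simp add: adjacent_def)
  have diag: "truth i e e" if e: "valid e" for e
    using i
  proof (cases rule: node_cases)
    case unary
    then show ?thesis using truth_unary i e by blast
  next
    case binary
    then show ?thesis using truth_binary i e by blast
  next
    case equal
    then show ?thesis using truth_equal i e by blast
  next
    case neg
    show ?thesis by (rule truth_neg[OF i neg e e self IH[OF _ neg_node(1)[OF i neg] e e self]]) simp
  next
    case bool
    show ?thesis
      by (rule truth_bool[OF i bool e e self IH[OF _ bool_node(1)[OF i bool] e e self]
          IH[OF rpos_greater[OF i bool] bool_node(2)[OF i bool] e e self]]) simp
  next
    case quant
    show ?thesis by (rule truth_quant[OF i quant e IH[OF _ quant_node(1)[OF i quant] _ _ self]]) simp_all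
  next
    case count
    show ?thesis by (rule truth_count[OF i count e IH[OF count_node(6)[OF i count] count_node(1)[OF i count]]])
  qed
  show ?case
  proof (cases "e = f")
    case True
    then show ?thesis using diag less.prems by blast
  next
    case ne: False
    have l: "pair w P (etype e) (etype f) (type_of e f) (type_of f e)"
      using adjacent_link[OF less.prems(2,3) ne less.prems(4)] by (simp add: link_def)
    have po: "pair_ok w P (etype e) (etype f) (type_of e f) (type_of f e) i"
      using l i node_less[OF i] unfolding pair_def by blast
    consider "\<not> freeY w P i" | "\<not> freeX w P i" | "freeX w P i" "freeY w P i" by blast
    then show ?thesis
    proof cases
      case 1
      have "sat forest (env e f) (fm w P i) \<longleftrightarrow> sat forest (env e e) (fm w P i)"
        by (rule sat_cong) (use 1 free_fm[OF i] in \<open>auto simp: env_def split: var.splits\<close>)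
      then show ?thesis using diag[OF less.prems(2)] po 1 by (simp add: pair_ok_def type_of_self)
    next
      case 2
      have "sat forest (env e f) (fm w P i) \<longleftrightarrow> sat forest (env f f) (fm w P i)"
        by (rule sat_cong) (use 2 free_fm[OF i] in \<open>auto simp: env_def split: var.splits\<close>)
      then show ?thesis using diag[OF less.prems(3)] po 2 by (simp add: pair_ok_def type_of_self)
    next
      case 3
      have fv: "X \<in> free_vars (fm w P i)" "Y \<in> free_vars (fm w P i)" using 3 free_fm[OF i] by auto
      from i show ?thesis
      proof (cases rule: node_cases)
        case unary
        then show ?thesis using fv fm_unary[OF i unary] by (cases "the_arg w P (fst_pos w P i)") auto
      next
        case binary
        have "args_ok w P i" using args(1)[OF i] binary by blast
        then consider "istok w (fst_pos w P i) TX" "istok w (snd_pos w P i) TY" | "istok w (fst_pos w P i) TY" "istok w (snd_pos w P i) TX"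
          using 3 by (auto simp: args_ok_def istok_def)
        then show ?thesis using po 3 binary fm_binary[OF i binary] binI_forest[OF i binary] less.prems(2,3)
          by cases (simp_all add: pair_ok_def the_arg_def istok_def)
      next
        case equal
        have "args_ok w P i" using args(1)[OF i] equal by blast
        then consider "istok w (fst_pos w P i) TX" "istok w (snd_pos w P i) TY" | "istok w (fst_pos w P i) TY" "istok w (snd_pos w P i) TX"
          using 3 by (auto simp: args_ok_def istok_def)
        then show ?thesis using po 3 equal fm_equal[OF i equal] ne
          by cases (simp_all add: pair_ok_def the_arg_def istok_def)
      next
        case neg
        show ?thesis by (rule truth_neg[OF i neg less.prems(2-4) IH[OF _ neg_node(1)[OF i neg] less.prems(2-4)]]) simp
      next
        case bool
        show ?thesis
          by (rule truth_bool[OF i bool less.prems(2-4) IH[OF _ bool_node(1)[OF i bool] less.prems(2-4)]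
              IH[OF rpos_greater[OF i bool] bool_node(2)[OF i bool] less.prems(2-4)]]) simp
      next
        case quant
        then show ?thesis using fv fm_quant[OF i quant] quant_node(3)[OF i quant] free_fm[OF quant_node(1)[OF i quant]]
          by (auto simp: quantifier_def split: if_splits)
      next
        case count
        then show ?thesis using fv fm_count[OF i count] by (cases "the_var w (fst_pos w P i)") auto
      qed
    qed
  qed
qed

theorem forest_model: "is_model forest (fm w P 0)"
  unfolding is_model_def
proof (intro conjI allI impI)
  have sy: "\<And>p. p \<in> bpreds (fm w P 0) \<Longrightarrow> \<exists>j. node w P j \<and> isbin w j \<and> the_bpred w P j = p"
    "\<And>c. c \<in> constants (fm w P 0) \<Longrightarrow> \<exists>a < length w. marked w P a \<and> number w P (Suc a) = c"
    using symbols_of_fm[OF root_node(1)] by blast+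
  have cn: "\<exists>a \<in> names. number w P (Suc a) = c \<and> constI forest c = [a]" if "c \<in> constants (fm w P 0)" for c
    using sy(2)[OF that] name_exists constI_forest by metis
  show "structure_for (fm w P 0) forest"
    unfolding structure_for_def
  proof (intro conjI allI impI ballI)
    have "valid [2 * length w]" by (simp add: roots_def)
    then show "dom forest \<noteq> {}" using dom_forest by blast
    show "unI forest p \<subseteq> dom forest" for p by (auto simp: forest_def)
    show "binI forest p \<subseteq> dom forest \<times> dom forest" for p by (auto simp: forest_def)
    show "constI forest ` constants (fm w P 0) \<subseteq> dom forest"
      using cn valid_name dom_forest by fastforce
    show "inj_on (constI forest) (constants (fm w P 0))"
      by (rule inj_onI) (metis cn list.inject)
  next
    fix n e assume "Key n \<in> bpreds (fm w P 0)" and "e \<in> dom forest"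
    then obtain j where j: "node w P j" "isbin w j" "the_bpred w P j = Key n" and e: "valid e"
      using sy(1) dom_forest by blast
    then have k: "istok w j TKey" by (auto simp: the_bpred_def isbin_def split: if_splits)
    then have c: "counter w P j" using j by (simp add: counter_def)
    \<comment> \<open>A key atom is a counter whose prescribed value is 1, so the count of
      contributors is exactly totality and uniqueness.\<close>
    have "{f. valid f \<and> con w P (type_of e f) (type_of f e) j} = {f. (e, f) \<in> binI forest (Key n)}"
      using binI_forest[OF j(1,2) e] j(3) k by (auto simp: con_def forest_def)
    then have "card {f. (e, f) \<in> binI forest (Key n)} = 1"
      using count_neighbours(2)[OF e node_less[OF j(1)] c] k by (simp add: count_ok_def)
    then obtain f where "{f. (e, f) \<in> binI forest (Key n)} = {f}" by (rule card_1_singletonE)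
    then have "(e, f') \<in> binI forest (Key n) \<longleftrightarrow> f' = f" for f'
      by (metis mem_Collect_eq singleton_iff)
    then show "\<exists>!f. (e, f) \<in> binI forest (Key n)" by simp
    show "(e, e) \<notin> binI forest (Key n)"
      using diag_ok_etype[OF e j(1)] binI_forest[OF j(1,2) e e] j(3) k by (simp add: diag_ok_def type_of_self)
  qed
next
  fix g :: "var \<Rightarrow> nat list"
  assume g: "range g \<subseteq> dom forest"
  then have e: "valid (g X)" using dom_forest by blast
  have "free_vars (fm w P 0) = {}" using root_node(2) by (simp add: GC2D_sentences_def)
  then have "sat forest g (fm w P 0) \<longleftrightarrow> sat forest (env (g X) (g X)) (fm w P 0)" by (intro sat_cong) auto
  also have "\<dots> \<longleftrightarrow> tr w (etype (g X)) 0"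
    using truth_lemma[OF root_node(1) e e] by (simp add: adjacent_def type_of_self)
  also have "\<dots> \<longleftrightarrow> tr w \<alpha>\<^sub>0 0"
    using agree_closed[OF e root_node(1)] parsed by (simp add: parsed_def)
  finally show "sat forest g (fm w P 0)" using \<alpha>\<^sub>0(2) by blast
qed

end

section \<open>Transfer of models along injections\<close>

definition rename_struct :: "('a \<Rightarrow> 'b) \<Rightarrow> 'a struct \<Rightarrow> 'b struct" where
  "rename_struct h S = \<lparr>dom = h ` dom S, unI = (\<lambda>p. h ` unI S p), binI = (\<lambda>p. map_prod h h ` binI S p),
     constI = h \<circ> constI S\<rparr>"

lemma rename_val: "val (rename_struct h S) (h \<circ> e) s = h (val S e s)"
  by (cases s) (simp_all add: rename_struct_def)

lemma rename_sat:
  assumes h: "inj h"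
  shows "sat (rename_struct h S) (h \<circ> e) \<phi> \<longleftrightarrow> sat S e \<phi>"
proof -
  have d: "dom (rename_struct h S) = h ` dom S" by (simp add: rename_struct_def)
  show ?thesis
  proof (induction \<phi> arbitrary: e)
    case (Unary p s)
    show ?case unfolding sat.simps rename_val using h by (simp add: rename_struct_def inj_image_mem_iff)
  next
    case (Binary p s t)
    have "(h a, h b) \<in> map_prod h h ` R \<longleftrightarrow> (a, b) \<in> R" for a b R
      using h by (auto simp: inj_eq)
    then show ?case unfolding sat.simps rename_val by (simp add: rename_struct_def)
  next
    case (Equal s t)
    show ?case unfolding sat.simps rename_val using h by (simp add: inj_eq)
  next
    case (All u \<phi>)
    have "(h \<circ> e)(u := h a) = h \<circ> e(u := a)" for a by auto
    then show ?case by (simp only: sat.simps d ball_simps All.IH)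
  next
    case (Ex u \<phi>)
    have "(h \<circ> e)(u := h a) = h \<circ> e(u := a)" for a by auto
    then show ?case by (simp only: sat.simps d bex_simps Ex.IH)
  next
    case (Count k C u \<phi>)
    have u: "(h \<circ> e)(u := h a) = h \<circ> e(u := a)" for a by auto
    let ?W = "{a \<in> dom S. sat S (e(u := a)) \<phi>}"
    have img: "{b \<in> h ` B. Q b} = h ` {a \<in> B. Q (h a)}" for B Q by auto
    have "{b \<in> dom (rename_struct h S). sat (rename_struct h S) ((h \<circ> e)(u := b)) \<phi>} = h ` ?W"
      unfolding d img u Count.IH ..
    moreover have "counts k C (h ` ?W) \<longleftrightarrow> counts k C ?W"
      using h inj_on_subset[OF h subset_UNIV, of ?W] by (cases k) (simp_all add: finite_image_iff card_image)
    ultimately show ?case unfolding sat.simps by (rule ssubst)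
  qed auto
qed

lemma rename_model:
  fixes h :: "'a \<Rightarrow> 'b"
  assumes h: "inj h" and S: "is_model S \<psi>"
  shows "is_model (rename_struct h S) \<psi>"
  unfolding is_model_def
proof (intro conjI allI impI)
  have s: "structure_for \<psi> S" using S by (simp add: is_model_def)
  have m: "(h a, h b) \<in> map_prod h h ` R \<longleftrightarrow> (a, b) \<in> R" for a b R
    using h by (auto simp: inj_eq)
  have k: "\<exists>!b. (h a, b) \<in> map_prod h h ` R" if "\<exists>!b. (a, b) \<in> R" for a R
  proof -
    obtain b where b: "\<And>c. (a, c) \<in> R \<longleftrightarrow> c = b" using \<open>\<exists>!b. (a, b) \<in> R\<close> by metis
    show ?thesis
    proof (rule ex1I[of _ "h b"])
      show "(h a, h b) \<in> map_prod h h ` R" using m b by blast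
      fix c assume "(h a, c) \<in> map_prod h h ` R"
      then obtain a' b' where "h a = h a'" "c = h b'" "(a', b') \<in> R" by auto
      then show "c = h b" using h b by (auto simp: inj_eq)
    qed
  qed
  show "structure_for \<psi> (rename_struct h S)"
    unfolding structure_for_def
  proof (intro conjI allI impI ballI)
    fix n b assume n: "Key n \<in> bpreds \<psi>" and b: "b \<in> dom (rename_struct h S)"
    then obtain a where a: "a \<in> dom S" "b = h a" by (auto simp: rename_struct_def)
    have key: "(\<exists>!c. (a, c) \<in> binI S (Key n)) \<and> (a, a) \<notin> binI S (Key n)"
      using s n a(1) by (simp add: structure_for_def)
    have r: "binI (rename_struct h S) (Key n) = map_prod h h ` binI S (Key n)" by (simp add: rename_struct_def)
    show "\<exists>!c. (b, c) \<in> binI (rename_struct h S) (Key n)" unfolding r a(2) by (rule k[OF conjunct1[OF key]])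
    show "(b, b) \<notin> binI (rename_struct h S) (Key n)" unfolding r a(2) m by (rule conjunct2[OF key])
  next
    have *: "dom S \<noteq> {}" "\<And>p. unI S p \<subseteq> dom S" "\<And>p. binI S p \<subseteq> dom S \<times> dom S"
      "constI S ` constants \<psi> \<subseteq> dom S" "inj_on (constI S) (constants \<psi>)"
      using s by (simp_all add: structure_for_def)
    show "dom (rename_struct h S) \<noteq> {}" using *(1) by (simp add: rename_struct_def)
    show "unI (rename_struct h S) p \<subseteq> dom (rename_struct h S)" for p
      using *(2) by (simp add: rename_struct_def image_mono)
    show "binI (rename_struct h S) p \<subseteq> dom (rename_struct h S) \<times> dom (rename_struct h S)" for p
      using *(3)[of p] by (auto simp: rename_struct_def)
    show "constI (rename_struct h S) ` constants \<psi> \<subseteq> dom (rename_struct h S)"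
      using *(4) by (auto simp: rename_struct_def)
    show "inj_on (constI (rename_struct h S)) (constants \<psi>)"
      unfolding rename_struct_def using *(5) inj_on_subset[OF h subset_UNIV] by (simp add: comp_inj_on)
  qed
next
  fix e :: "var \<Rightarrow> 'b"
  assume e: "range e \<subseteq> dom (rename_struct h S)"
  define e' where "e' = inv h \<circ> e"
  have "h (e' v) = e v \<and> e' v \<in> dom S" for v
  proof -
    obtain a where "a \<in> dom S" "e v = h a" using e by (auto simp: rename_struct_def)
    then show ?thesis using h by (simp add: e'_def)
  qed
  then have "e = h \<circ> e'" "range e' \<subseteq> dom S" by auto
  then show "sat (rename_struct h S) e \<psi>" using rename_sat[OF h, of S e' \<psi>] S by (simp add: is_model_def)
qed


section \<open>The satisfiability problem\<close>

abbreviation impossible :: "token list \<Rightarrow> nat \<Rightarrow> bool" where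
  "impossible w \<equiv> fixpoint (blocked_state w) (Bd w ^ 3)"

lemma satisfiable_accepted:
  fixes S :: "'d struct"
  assumes \<psi>: "\<psi> \<in> GC2D_sentences" and S: "is_model S \<psi>"
  shows "accepted (word \<psi>) (impossible (word \<psi>))"
proof -
  interpret tables \<psi> "word \<psi>" by unfold_locales (simp_all add: \<psi>)
  obtain P where P: "P < Bd (word \<psi>)" "parsed (word \<psi>) P" "fm (word \<psi>) P 0 = \<psi>"
    "\<And>i. node (word \<psi>) P i \<Longrightarrow> bpreds (fm (word \<psi>) P i) \<subseteq> bpreds \<psi> \<and> constants (fm (word \<psi>) P i) \<subseteq> constants \<psi>"
    "\<And>a. a < length (word \<psi>) \<Longrightarrow> marked (word \<psi>) P a \<Longrightarrow> number (word \<psi>) P (Suc a) \<in> constants \<psi>"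
    by (rule parse_tables_exist) blast
  interpret model_of_word "word \<psi>" P S
    by unfold_locales (use P S in auto)
  show ?thesis by (rule model_accepted)
qed

lemma accepted_satisfiable:
  assumes "accepted w (impossible w)"
  shows "\<exists>\<psi> \<in> GC2D_sentences. word \<psi> = w \<and> satisfiable_over TYPE(nat) \<psi>"
proof -
  let ?A = "impossible w"
  obtain P where P: "P < Bd w" "final w P ?A" using assms by (auto simp: accepted_def)
  obtain \<alpha> D V where \<alpha>: "\<alpha> < Bd w" "tr w \<alpha> 0" "is_root w P ?A \<alpha>" "witnessed w P ?A \<alpha>"
    "D < Bd w" "V < Bd w" "core w P ?A \<alpha> D V" and p: "parsed w P"
    using P(2) unfolding final_def by blast
  have cl: "\<not> blocked w P ?A \<alpha> v" if "\<alpha> < Bd w" "v < Bd w" "good w P ?A \<alpha> v" for \<alpha> v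
  proof
    assume b: "blocked w P ?A \<alpha> v"
    let ?x = "(P * Bd w + \<alpha>) * Bd w + v"
    have lt: "x * Bd w + y < z * Bd w" if "x < z" "y < Bd w" for x y z
    proof -
      have "x * Bd w + y < (x + 1) * Bd w" using that by simp
      also have "\<dots> \<le> z * Bd w" using that by (intro mult_right_mono) auto
      finally show ?thesis .
    qed
    \<comment> \<open>Closure of the fixed point is available only for indices inside the array; all
      three components are below \<open>Bd w\<close>.\<close>
    have "?x < Bd w ^ 3" using lt[OF lt[OF P(1) that(1)] that(2)] by (simp add: power3_eq_cube)
    moreover have "blocked_state w ?A ?x" using b that by (simp add: blocked_state_def)
    ultimately have "?A ?x" by (rule fixpoint_closed)
    then show False using that(3) by (simp add: good_def)
  qed
  interpret accepted_word w P ?A \<alpha> D V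
    by unfold_locales (use p cl \<alpha> in auto)
  have "is_model (rename_struct list_encode forest) (fm w P 0)"
    by (rule rename_model[OF _ forest_model]) (rule inj_list_encode)
  then show ?thesis using root_node(2,3) unfolding satisfiable_over_def by blast
qed

text \<open>Acceptance mediates between types: a model over any type leads to acceptance, and
  acceptance to a forest of number lists, encoded over \<open>nat\<close>. Both halves of the final
  result follow from these two implications.\<close>

lemma GC2D_SAT_accepted: "w \<in> GC2D_SAT TYPE('d) \<Longrightarrow> accepted w (impossible w)"
proof -
  assume "w \<in> GC2D_SAT TYPE('d)"
  then obtain \<psi> and S :: "'d struct" where "w = word \<psi>" "\<psi> \<in> GC2D_sentences" "is_model S \<psi>"
    unfolding GC2D_SAT_def satisfiable_over_def by blast
  then show ?thesis using satisfiable_accepted by simp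
qed

lemma accepted_GC2D_SAT: "accepted w (impossible w) \<Longrightarrow> w \<in> GC2D_SAT TYPE(nat)"
  unfolding GC2D_SAT_def by (drule accepted_satisfiable) blast

theorem theorem9p6:
  shows "GC2D_SAT TYPE(nat) \<in> EXPTIME \<and> GC2D_SAT TYPE('d) \<subseteq> GC2D_SAT TYPE(nat)"
proof
  show "GC2D_SAT TYPE(nat) \<in> EXPTIME"
    by (rule EXPTIME_by_fixpoint[OF pdec_blocked_state pdec_accepted])
      (use GC2D_SAT_accepted accepted_GC2D_SAT in blast)
  show "GC2D_SAT TYPE('d) \<subseteq> GC2D_SAT TYPE(nat)"
    using GC2D_SAT_accepted accepted_GC2D_SAT by blast
qed

end
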